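(* Let $v\in C^1(\mathbb{R}/\mathbb{Z},\mathbb{R})$ with $v(\mathbb{R}/\mathbb{Z})=[0,1]$ satisfy: (1) $v$ has finitely many critical points; (2) for each $t\in[0,1]$ outside of a finite set, $v'(x)$ takes different values for different $x\in v^{-1}(t)$. Fix an arbitrary $\epsilon>0$. Then for each Brjuno $\alpha$, $$\lim_{\lambda\to\infty}Leb\big([0,1]\cap\Delta_\epsilon(\lambda,\alpha)\big)=1,$$ and $$\lim_{\lambda\to\infty}Leb\big((\mathbb{R}/\mathbb{Z}\times[0,1])\cap\Gamma_\epsilon(\lambda)\big)=1.$$
   Context: $Leb$ denotes Lebesgue measure (one- or two-dimensional as appropriate). An irrational $\alpha$ with continued fraction approximants $p_n/q_n$ is Brjuno if $\sum_{n=1}^\infty\frac{\ln q_{n+1}}{q_n}<\infty$. The Schrödinger cocycle map is $A^{(E-\lambda v)}(x)=\begin{pmatrix}E-\lambda v(x)&-1\\1&0\end{pmatrix}$, and the parameter is $t=E/\lambda$, i.e. $E=\lambda t$. For $\alpha\in\mathbb{R}/\mathbb{Z}$ and continuous $A:\mathbb{R}/\mathbb{Z}\to SL(2,\mathbb{C})$, put $A_n(x)=A(x+(n-1)\alpha)\cdots A(x)$ and $A_{-n}(x)=A_n(x-n\alpha)^{-1}$ for $n\ge1$, and $L(\alpha,A)=\lim_{n\to\infty}\frac1n\int_{\mathbb{R}/\mathbb{Z}}\ln\|A_n(x)\|\,dx$. Let $SL(2,\mathbb{C})$ act on $\mathbb{CP}^1$, the space of lines in $\mathbb{C}^2$. The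 pair $(\alpha,A)$ is uniformly hyperbolic ($(\alpha,A)\in\mathcal{UH}$) if there are continuous $u,s:\mathbb{R}/\mathbb{Z}\to\mathbb{CP}^1$ with $A(x)\cdot u(x)=u(x+\alpha)$ and $A(x)\cdot s(x)=s(x+\alpha)$, and constants $C>0$, $\kappa>1$, such that $\|A_{-n}(x)w_1\|,\|A_n(x)w_2\|\le C\kappa^{-n}$ for all $x$, all $n\ge1$ and all unit vectors $w_1\in u(x)$, $w_2\in s(x)$. The pair $(\alpha,A)$ is nonuniformly hyperbolic ($(\alpha,A)\in\mathcal{NUH}$) if $L(\alpha,A)>0$ and $(\alpha,A)\notin\mathcal{UH}$. For $\epsilon>0$, $$\Delta_\epsilon(\lambda,\alpha)=\{t:(\alpha,A^{(\lambda t-\lambda v)})\in\mathcal{NUH}\text{ and }L(\alpha,A^{(\lambda t-\lambda v)})>(1-\epsilon)\ln\lambda\},$$ $$\Gamma_\epsilon(\lambda)=\{(\alpha,t):t\in\Delta_\epsilon(\lambda,\alpha)\}.$$ *)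

theory Defs
  imports "HOL-Analysis.Analysis"
begin

text \<open>
  The circle \<open>\<real>/\<int>\<close> is handled through representatives: functions on it are 1-periodic functions
  on the reals, a frequency \<open>\<alpha>\<close> is given by any real representative, and
  the interval \<open>{0..<1}\<close> is used as fundamental domain.
\<close>

definition periodic1 :: "(real \<Rightarrow> 'a) \<Rightarrow> bool" where
  "periodic1 f \<longleftrightarrow> (\<forall>x. f (x + 1) = f x)"

subsection \<open>Brjuno numbers\<close>

text \<open>\<open>cf_rem \<alpha> n\<close> is the n-th complete quotient of \<open>\<alpha>\<close>, so \<open>cf_coeff \<alpha> n\<close>
  is the n-th partial quotient; \<open>\<alpha>\<close> is meant to be irrational.\<close>

primrec cf_rem :: "real \<Rightarrow> nat \<Rightarrow> real" where
  "cf_rem \<alpha> 0 = \<alpha>"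
| "cf_rem \<alpha> (Suc n) = 1 / frac (cf_rem \<alpha> n)"

definition cf_coeff :: "real \<Rightarrow> nat \<Rightarrow> int" where
  "cf_coeff \<alpha> n = \<lfloor>cf_rem \<alpha> n\<rfloor>"

text \<open>The denominators of the convergents, indexed so that the 0-th convergent is \<open>\<lfloor>\<alpha>\<rfloor> / 1\<close>.\<close>

fun cf_denom :: "real \<Rightarrow> nat \<Rightarrow> int" where
  "cf_denom \<alpha> 0 = 1"
| "cf_denom \<alpha> (Suc 0) = cf_coeff \<alpha> 1"
| "cf_denom \<alpha> (Suc (Suc n)) =
     cf_coeff \<alpha> (Suc (Suc n)) * cf_denom \<alpha> (Suc n) + cf_denom \<alpha> n"

text \<open>The sum over \<open>n \<ge> 1\<close> is written with \<open>Suc n\<close>.\<close>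

definition brjuno :: "real \<Rightarrow> bool" where
  "brjuno \<alpha> \<longleftrightarrow> \<alpha> \<notin> \<rat> \<and>
     summable (\<lambda>n. ln (real_of_int (cf_denom \<alpha> (Suc (Suc n)))) / real_of_int (cf_denom \<alpha> (Suc n)))"

subsection \<open>The complex projective line\<close>

definition cline :: "complex ^ 2 \<Rightarrow> (complex ^ 2) set" where
  "cline w = range (\<lambda>c. c *s w)"

definition CP1 :: "(complex ^ 2) set set" where
  "CP1 = cline ` (UNIV - {0})"

text \<open>The quotient topology of the projection \<open>cline\<close> from the nonzero vectors.\<close>

definition CP1_topology :: "(complex ^ 2) set topology" where
  "CP1_topology = topology (\<lambda>U. U \<subseteq> CP1 \<and> open {w. w \<noteq> 0 \<and> cline w \<in> U})"

lemma openin_CP1_topology: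
  "openin CP1_topology U \<longleftrightarrow> U \<subseteq> CP1 \<and> open {w. w \<noteq> 0 \<and> cline w \<in> U}"
proof -
  have "istopology (\<lambda>U. U \<subseteq> CP1 \<and> open {w. w \<noteq> 0 \<and> cline w \<in> U})"
    unfolding istopology_def
  proof (intro conjI allI impI; (elim conjE)?)
    fix S T
    assume "open {w. w \<noteq> 0 \<and> cline w \<in> S}" "open {w. w \<noteq> 0 \<and> cline w \<in> T}"
    then have "open ({w. w \<noteq> 0 \<and> cline w \<in> S} \<inter> {w. w \<noteq> 0 \<and> cline w \<in> T})"
      by (rule open_Int)
    also have "{w. w \<noteq> 0 \<and> cline w \<in> S} \<inter> {w. w \<noteq> 0 \<and> cline w \<in> T}
      = {w. w \<noteq> 0 \<and> cline w \<in> S \<inter> T}"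
      by auto
    finally show "open {w. w \<noteq> 0 \<and> cline w \<in> S \<inter> T}" .
  next
    fix \<K>
    assume "\<forall>K\<in>\<K>. K \<subseteq> CP1 \<and> open {w. w \<noteq> 0 \<and> cline w \<in> K}"
    then have "open (\<Union>K\<in>\<K>. {w. w \<noteq> 0 \<and> cline w \<in> K})"
      by blast
    also have "(\<Union>K\<in>\<K>. {w. w \<noteq> 0 \<and> cline w \<in> K}) = {w. w \<noteq> 0 \<and> cline w \<in> \<Union>\<K>}"
      by auto
    finally show "open {w. w \<noteq> 0 \<and> cline w \<in> \<Union>\<K>}" .
  qed auto
  then show ?thesis
    unfolding CP1_topology_def by simp
qed

lemma topspace_CP1_topology: "topspace CP1_topology = CP1"
proof
  show "topspace CP1_topology \<subseteq> CP1"
    using openin_CP1_topology openin_topspace by blast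
  have "{w. w \<noteq> 0 \<and> cline w \<in> CP1} = - {0}"
    by (auto simp: CP1_def)
  then have "openin CP1_topology CP1"
    by (simp add: openin_CP1_topology open_Compl)
  then show "CP1 \<subseteq> topspace CP1_topology"
    by (rule openin_subset)
qed

lemma quotient_map_cline: "quotient_map (top_of_set (UNIV - {0})) CP1_topology cline"
proof -
  have "open (UNIV - {0 :: complex ^ 2})"
    by (simp add: open_delete)
  moreover have "{x \<in> UNIV - {0}. cline x \<in> U} = {w. w \<noteq> 0 \<and> cline w \<in> U}" for U
    by auto
  ultimately show ?thesis
    unfolding quotient_map_def topspace_CP1_topology openin_CP1_topology
    by (auto simp: CP1_def openin_open_eq)
qed

subsection \<open>Cocycles\<close>

definition opnorm :: "complex ^ 2 ^ 2 \<Rightarrow> real" where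
  "opnorm M = onorm (\<lambda>w. M *v w)"

primrec cocycle_iter :: "real \<Rightarrow> (real \<Rightarrow> complex ^ 2 ^ 2) \<Rightarrow> nat \<Rightarrow> real \<Rightarrow> complex ^ 2 ^ 2" where
  "cocycle_iter \<alpha> A 0 x = mat 1"
| "cocycle_iter \<alpha> A (Suc n) x = A (x + real n * \<alpha>) ** cocycle_iter \<alpha> A n x"

definition cocycle_iter_neg ::
    "real \<Rightarrow> (real \<Rightarrow> complex ^ 2 ^ 2) \<Rightarrow> nat \<Rightarrow> real \<Rightarrow> complex ^ 2 ^ 2" where
  "cocycle_iter_neg \<alpha> A n x = matrix_inv (cocycle_iter \<alpha> A n (x - real n * \<alpha>))"

definition lyapunov :: "real \<Rightarrow> (real \<Rightarrow> complex ^ 2 ^ 2) \<Rightarrow> real" where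
  "lyapunov \<alpha> A =
     lim (\<lambda>n. 1 / real n * integral {0..1} (\<lambda>x. ln (opnorm (cocycle_iter \<alpha> A n x))))"

text \<open>\<open>A\<close> is meant to be continuous and 1-periodic with \<open>det (A x) = 1\<close>.\<close>

definition uniformly_hyperbolic :: "real \<Rightarrow> (real \<Rightarrow> complex ^ 2 ^ 2) \<Rightarrow> bool" where
  "uniformly_hyperbolic \<alpha> A \<longleftrightarrow>
     (\<exists>u s C \<kappa>.
        periodic1 u \<and> continuous_map euclideanreal CP1_topology u \<and>
        periodic1 s \<and> continuous_map euclideanreal CP1_topology s \<and>
        (\<forall>x. (\<lambda>w. A x *v w) ` u x = u (x + \<alpha>)) \<and>
        (\<forall>x. (\<lambda>w. A x *v w) ` s x = s (x + \<alpha>)) \<and>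
        C > 0 \<and> \<kappa> > 1 \<and>
        (\<forall>x. \<forall>n\<ge>1.
           (\<forall>w\<in>u x. norm w = 1 \<longrightarrow>
              norm (cocycle_iter_neg \<alpha> A n x *v w) \<le> C * \<kappa> powi (- int n)) \<and>
           (\<forall>w\<in>s x. norm w = 1 \<longrightarrow>
              norm (cocycle_iter \<alpha> A n x *v w) \<le> C * \<kappa> powi (- int n))))"

definition nonuniformly_hyperbolic :: "real \<Rightarrow> (real \<Rightarrow> complex ^ 2 ^ 2) \<Rightarrow> bool" where
  "nonuniformly_hyperbolic \<alpha> A \<longleftrightarrow> lyapunov \<alpha> A > 0 \<and> \<not> uniformly_hyperbolic \<alpha> A"

subsection \<open>Schroedinger cocycles\<close>

definition schroedinger :: "(real \<Rightarrow> real) \<Rightarrow> real \<Rightarrow> complex ^ 2 ^ 2" where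
  "schroedinger f x = vector [vector [complex_of_real (f x), - 1], vector [1, 0]]"

definition Delta :: "(real \<Rightarrow> real) \<Rightarrow> real \<Rightarrow> real \<Rightarrow> real \<Rightarrow> real set" where
  "Delta v \<epsilon> lam \<alpha> =
     {t. nonuniformly_hyperbolic \<alpha> (schroedinger (\<lambda>x. lam * t - lam * v x)) \<and>
         lyapunov \<alpha> (schroedinger (\<lambda>x. lam * t - lam * v x)) > (1 - \<epsilon>) * ln lam}"

definition Gamma_set :: "(real \<Rightarrow> real) \<Rightarrow> real \<Rightarrow> real \<Rightarrow> (real \<times> real) set" where
  "Gamma_set v \<epsilon> lam = {(\<alpha>, t). t \<in> Delta v \<epsilon> lam \<alpha>}"

end

theory Submission
  imports Defs "HOL-Computational_Algebra.Fundamental_Theorem_Algebra" "HOL-Real_Asymp.Real_Asymp"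
begin

text \<open>
  Fix a Brjuno frequency \<open>\<alpha>\<close>. An energy \<open>t \<in> {0..1}\<close> can fail to belong to \<open>Delta\<close> for two reasons:
  its Lyapunov exponent is too small, or its cocycle is uniformly hyperbolic. Both kinds of energies
  are shown to have measure tending to 0 as \<open>lam\<close> tends to infinity.

  Small exponents are rare by an average over \<open>t\<close>. An entry of the \<open>n\<close>-step transfer matrix is a
  polynomial in \<open>t\<close> of degree \<open>n\<close> with leading coefficient \<open>lam ^ n\<close>, and the mean of \<open>ln \<bar>t - z\<bar>\<close>
  over \<open>{0..1}\<close> is at least \<open>-2\<close> for every \<open>z\<close>; so the mean over \<open>t\<close> of the logarithm of the matrix
  norm is at least \<open>n * (ln lam - 2)\<close>, whereas it never exceeds \<open>n * ln (lam + 1)\<close>. The measure of the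
  energies with exponent at most \<open>(1 - \<epsilon>) * ln lam\<close> is therefore at most
  \<open>3 / (\<epsilon> * ln lam)\<close> (\<open>lyap_exceptional_small\<close>).

  Uniform hyperbolicity means that the Schroedinger operators are bounded below on sequences over the
  integers, uniformly in the phase (\<open>uniformly_hyperbolic_iff\<close>), and the best lower bound is \<open>lam\<close> times the distance
  of \<open>t\<close> to the energies that are not uniformly hyperbolic (\<open>gapped_dist\<close>). The hyperbolic energies
  are sorted by the dyadic size \<open>g\<close> of this distance, and those of one size are counted by gap
  labelling. The stable directions form a section which turns \<open>k\<close> half turns along the circle, and \<open>k\<close>,
  together with the integer \<open>l\<close> that compares the lifted dynamics with the section, is constant on a
  gap; conversely two energies with equal labels have only hyperbolic energies between them
  (\<open>gapped_between_sections\<close>). Hence the energies of size \<open>g\<close> with a given label lie in two intervals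
  of length \<open>2 * g\<close>, and it remains to count labels. For given \<open>k\<close> there are at most three values of
  \<open>l\<close> (\<open>label_range\<close>). A label with large \<open>k\<close> is expensive: at \<open>\<bar>k\<bar>\<close> or more of the \<open>S\<close> points \<open>i / S\<close>,
  with \<open>S\<close> slightly larger than \<open>2 * V / g\<close> for a Lipschitz constant \<open>V\<close> of the sampling function, some
  energy within \<open>g / 2\<close> has a horizontal stable direction, that is, a square summable solution
  on the half line vanishing at the origin, called an edge state here (\<open>winding_le_crossings\<close>). At a given point
  the edge states of different energies are orthogonal, so if each of them has three quarters of its
  mass on the first \<open>len\<close> sites there are at most \<open>2 * len\<close> of them (\<open>edge_state_count\<close>).

  The localisation of edge states uses the large exponent. If \<open>P / q\<close> approximates \<open>\<alpha>\<close>, every \<open>q\<close>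
  consecutive points of an orbit come close to every point of the circle, so a block of about
  \<open>12 * ln q / ln lam\<close> sites on which the transfer matrix is expanding recurs in each window of \<open>q\<close> sites.
  A solution is small in the middle of such a block relative to its total mass; switching it on in
  many small steps at the middles of many blocks gives a nearly exact solution far from the origin,
  which the gap forbids to carry much mass (\<open>cutoff_estimate\<close>). For \<open>g \<le> 1 / q ^ 4\<close> this confines the
  energies of size \<open>g\<close> to a set of measure at most a constant divided by \<open>q\<close> (\<open>scale_cover\<close>).

  The size \<open>2 ^ (-j)\<close> is treated with the denominator \<open>q\<close> of the convergent for which
  \<open>q ^ 4 \<le> 2 ^ j < q' ^ 4\<close>, where \<open>q'\<close> is the next denominator. Each \<open>q\<close> serves for at most
  \<open>5 * log 2 q'\<close> sizes, so the total measure is at most a constant times a tail of the Brjuno series, and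
  the tail starts later and later because only sizes with \<open>lam * 2 ^ (-j) \<le> 2\<close> occur
  (\<open>uniformly_hyperbolic_cover\<close>).

  For the second limit, almost every \<open>\<alpha>\<close> is a Brjuno number by the Borel-Cantelli lemma
  (\<open>AE_brjuno\<close>), the set \<open>Gamma_set\<close> is a Borel set, and the first limit is integrated over \<open>\<alpha>\<close> by
  dominated convergence.
\<close>

section \<open>Schroedinger orbits\<close>

text \<open>
  The Schroedinger equation \<open>p (n + 1) + p (n - 1) = c n * p n\<close> is written as a first order recursion for
  the pair of consecutive values \<open>p (n + 1)\<close>, \<open>p n\<close>, which is stored as the real and imaginary part of a
  complex number; real matrices thus act on the plane \<open>complex\<close>.
\<close>

definition step :: "real \<Rightarrow> complex \<Rightarrow> complex" where
  "step c w = Complex (c * Re w - Im w) (Re w)"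

primrec orb :: "real \<Rightarrow> (real \<Rightarrow> real) \<Rightarrow> real \<Rightarrow> complex \<Rightarrow> nat \<Rightarrow> complex" where
  "orb \<alpha> c x w 0 = w"
| "orb \<alpha> c x w (Suc n) = step (c (x + real n * \<alpha>)) (orb \<alpha> c x w n)"

definition wedge :: "complex \<Rightarrow> complex \<Rightarrow> real" where
  "wedge w u = Re w * Im u - Im w * Re u"

lemma step_simps [simp]: "Re (step c w) = c * Re w - Im w" "Im (step c w) = Re w"
  by (simp_all add: step_def)

lemma wedge_step [simp]: "wedge (step c w) (step c u) = wedge w u"
  by (simp add: wedge_def algebra_simps)

lemma wedge_orb [simp]: "wedge (orb \<alpha> c x w n) (orb \<alpha> c x u n) = wedge w u"
  by (induction n) auto

lemma abs_wedge_le: "\<bar>wedge w u\<bar> \<le> cmod w * cmod u"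
proof -
  have "wedge w u = Im (cnj w * u)" by (simp add: wedge_def)
  also have "\<bar>\<dots>\<bar> \<le> cmod (cnj w * u)" by (rule abs_Im_le_cmod)
  finally show ?thesis by (simp add: norm_mult)
qed

lemma orb_add: "orb \<alpha> c x w (m + n) = orb \<alpha> c (x + real m * \<alpha>) (orb \<alpha> c x w m) n"
  by (induction n) (auto simp: algebra_simps)

lemma orb_Suc_shift: "orb \<alpha> c x w (Suc n) = orb \<alpha> c (x + \<alpha>) (step (c x) w) n"
  using orb_add[of \<alpha> c x w 1 n] by simp

lemma step_lin: "step c (of_real a * w + of_real b * u) = of_real a * step c w + of_real b * step c u"
  by (simp add: complex_eq_iff algebra_simps)

lemma orb_lin: "orb \<alpha> c x (of_real a * w + of_real b * u) n = of_real a * orb \<alpha> c x w n + of_real b * orb \<alpha> c x u n"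
  by (induction n) (simp_all add: step_lin)

lemma orb_scale: "orb \<alpha> c x (of_real a * w) n = of_real a * orb \<alpha> c x w n"
  using orb_lin[of \<alpha> c x a w 0 0 n] by simp

lemma orb_plus: "orb \<alpha> c x (w + u) n = orb \<alpha> c x w n + orb \<alpha> c x u n"
  using orb_lin[of \<alpha> c x 1 w 1 u n] by simp

lemma orb_zero [simp]: "orb \<alpha> c x 0 n = 0"
  using orb_scale[of \<alpha> c x 0 0 n] by simp

lemma orb_basis: "orb \<alpha> c x w n = of_real (Re w) * orb \<alpha> c x 1 n + of_real (Im w) * orb \<alpha> c x \<i> n"
  using orb_lin[of \<alpha> c x "Re w" 1 "Im w" \<i> n] complex_eq[of w]
  by (simp add: mult.commute)

lemma orb_eq_0 [simp]: "orb \<alpha> c x w n = 0 \<longleftrightarrow> w = 0"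
proof
  assume a: "orb \<alpha> c x w n = 0"
  have "wedge w 1 = 0" "wedge w \<i> = 0"
    using wedge_orb[of \<alpha> c x w n 1] wedge_orb[of \<alpha> c x w n \<i>] a by (auto simp: wedge_def)
  then show "w = 0" by (auto simp: wedge_def complex_eq_iff)
qed simp

lemma periodic1_add_nat: "periodic1 c \<Longrightarrow> c (x + real n) = c x"
proof (induction n)
  case (Suc n)
  have "c (x + real (Suc n)) = c ((x + real n) + 1)" by (simp add: algebra_simps)
  also have "\<dots> = c (x + real n)" using Suc.prems unfolding periodic1_def by blast
  finally show ?case using Suc by simp
qed simp

lemma periodic1_add_int: "periodic1 c \<Longrightarrow> c (x + real_of_int n) = c x"
proof (cases n)
  case (nonneg m)
  assume "periodic1 c" then show ?thesis using nonneg periodic1_add_nat by simp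
next
  case (neg m)
  assume p: "periodic1 c"
  have "c (x + real_of_int n + real (Suc m)) = c (x + real_of_int n)"
    using periodic1_add_nat[OF p] by blast
  then show ?thesis using neg by simp
qed

lemma orb_periodic: "periodic1 c \<Longrightarrow> orb \<alpha> c (x + 1) w n = orb \<alpha> c x w n"
proof (induction n)
  case (Suc n)
  have "c (x + 1 + real n * \<alpha>) = c ((x + real n * \<alpha>) + 1)" by (simp add: algebra_simps)
  then have "c (x + 1 + real n * \<alpha>) = c (x + real n * \<alpha>)"
    using Suc.prems unfolding periodic1_def by metis
  with Suc show ?case by simp
qed simp

lemma orb_periodic_int: "periodic1 c \<Longrightarrow> orb \<alpha> c (x + real_of_int m) w n = orb \<alpha> c x w n"
proof (induction n)
  case (Suc n)
  have "c (x + real_of_int m + real n * \<alpha>) = c ((x + real n * \<alpha>) + real_of_int m)" by (simp add: algebra_simps)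
  with Suc periodic1_add_int[of c] show ?case by simp
qed simp

lemma norm_step_le: "cmod (step c w) \<le> (\<bar>c\<bar> + 1) * cmod w"
proof -
  have "step c w = of_real (c * Re w) + \<i> * w" by (simp add: complex_eq_iff)
  also have "cmod \<dots> \<le> cmod (of_real (c * Re w)) + cmod (\<i> * w)" by (rule norm_triangle_ineq)
  also have "\<dots> \<le> \<bar>c\<bar> * cmod w + cmod w"
    using mult_left_mono[OF abs_Re_le_cmod[of w], of "\<bar>c\<bar>"] by (simp add: norm_mult abs_mult)
  finally show ?thesis by (simp add: algebra_simps)
qed

text \<open>
  Running the equation backwards exchanges the roles of the two consecutive values: the inverse of a
  step is conjugate to a step by \<open>swap\<close>. In this way every statement about forward orbits applies to
  backward orbits, with \<open>- \<alpha>\<close> in place of \<open>\<alpha>\<close>.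
\<close>

definition swap :: "complex \<Rightarrow> complex" where "swap w = Complex (Im w) (Re w)"

lemma swap_simps [simp]: "Re (swap w) = Im w" "Im (swap w) = Re w" "swap (swap w) = w"
  "cmod (swap w) = cmod w"
  by (simp_all add: swap_def cmod_def add.commute)

lemma step_swap_step [simp]: "step c (swap (step c w)) = swap w"
  by (simp add: complex_eq_iff)

lemma orb_reverse:
  "orb (-\<alpha>) c (x + real n * \<alpha> - \<alpha>) (swap (orb \<alpha> c x w n)) n = swap w"
proof (induction n arbitrary: x w)
  case (Suc n)
  have e: "x + real (Suc n) * \<alpha> - \<alpha> = x + real n * \<alpha>" by (simp add: algebra_simps)
  have "orb (-\<alpha>) c (x + real n * \<alpha>) (swap (orb \<alpha> c x w (Suc n))) (Suc n)
     = orb (-\<alpha>) c (x + real n * \<alpha> - \<alpha>) (step (c (x + real n * \<alpha>)) (swap (orb \<alpha> c x w (Suc n)))) n"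
    by (subst orb_Suc_shift) simp
  also have "\<dots> = orb (-\<alpha>) c (x + real n * \<alpha> - \<alpha>) (swap (orb \<alpha> c x w n)) n"
    by simp
  finally show ?case unfolding e by (simp only: Suc.IH)
qed simp

lemma norm_orb_le:
  assumes "\<And>x. \<bar>c x\<bar> + 1 \<le> B"
  shows "cmod (orb \<alpha> c x w n) \<le> B ^ n * cmod w"
proof (induction n)
  case (Suc n)
  have B: "0 \<le> B" using assms[of 0] by linarith
  have "cmod (orb \<alpha> c x w (Suc n)) \<le> (\<bar>c (x + real n * \<alpha>)\<bar> + 1) * cmod (orb \<alpha> c x w n)"
    by (simp add: norm_step_le)
  also have "\<dots> \<le> B * (B ^ n * cmod w)"
    using assms Suc B by (intro mult_mono) auto
  finally show ?case by (simp add: mult.assoc)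
qed simp

lemma norm_orb_ge:
  assumes "\<And>x. \<bar>c x\<bar> + 1 \<le> B"
  shows "cmod w \<le> B ^ n * cmod (orb \<alpha> c x w n)"
  using norm_orb_le[where c=c and B=B and \<alpha>="-\<alpha>" and x="x + real n * \<alpha> - \<alpha>" and w="swap (orb \<alpha> c x w n)" and n=n, OF assms]
  by (simp add: orb_reverse)

section \<open>Finitely supported sequences\<close>

text \<open>
  Finitely supported sequences are enough to express spectral gaps of bounded operators, and they spare
  all questions of convergence: \<open>zsum\<close>, \<open>ip\<close> and \<open>nn\<close> are the sum, the inner product and the norm of
  square summable sequences over the integers, restricted to finite supports.
\<close>

definition fsp :: "(int \<Rightarrow> real) \<Rightarrow> bool" where "fsp f \<longleftrightarrow> finite {n. f n \<noteq> 0}"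

definition zsum :: "(int \<Rightarrow> real) \<Rightarrow> real" where "zsum f = sum f {n. f n \<noteq> 0}"

definition ip :: "(int \<Rightarrow> real) \<Rightarrow> (int \<Rightarrow> real) \<Rightarrow> real" where "ip f g = zsum (\<lambda>n. f n * g n)"

lemma zsum_eq: "finite A \<Longrightarrow> (\<And>n. n \<notin> A \<Longrightarrow> f n = 0) \<Longrightarrow> zsum f = sum f A"
  unfolding zsum_def by (rule sum.mono_neutral_left) auto

lemma fspI: "finite A \<Longrightarrow> (\<And>n. n \<notin> A \<Longrightarrow> f n = 0) \<Longrightarrow> fsp f"
  unfolding fsp_def by (rule finite_subset[of _ A]) auto

lemma fsp_add [simp]: "fsp f \<Longrightarrow> fsp g \<Longrightarrow> fsp (\<lambda>n. f n + g n)"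
  by (rule fspI[of "{n. f n \<noteq> 0} \<union> {n. g n \<noteq> 0}"]) (auto simp: fsp_def)

lemma fsp_diff [simp]: "fsp f \<Longrightarrow> fsp g \<Longrightarrow> fsp (\<lambda>n. f n - g n)"
  by (rule fspI[of "{n. f n \<noteq> 0} \<union> {n. g n \<noteq> 0}"]) (auto simp: fsp_def)

lemma fsp_uminus [simp]: "fsp f \<Longrightarrow> fsp (\<lambda>n. - f n)"
  by (simp add: fsp_def)

lemma fsp_mult [simp]: "fsp f \<Longrightarrow> fsp (\<lambda>n. h n * f n)"
  by (rule fspI[of "{n. f n \<noteq> 0}"]) (auto simp: fsp_def)

lemma fsp_mult' [simp]: "fsp f \<Longrightarrow> fsp (\<lambda>n. f n * h n)"
  by (rule fspI[of "{n. f n \<noteq> 0}"]) (auto simp: fsp_def)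

lemma fsp_power [simp]: "fsp f \<Longrightarrow> fsp (\<lambda>n. (f n)\<^sup>2)"
  by (rule fspI[of "{n. f n \<noteq> 0}"]) (auto simp: fsp_def)

lemma fsp_shift [simp]: "fsp f \<Longrightarrow> fsp (\<lambda>n. f (n + k))"
  by (rule fspI[of "(\<lambda>n. n - k) ` {n. f n \<noteq> 0}"]) (force simp: fsp_def image_iff)+

lemma fsp_shift' [simp]: "fsp f \<Longrightarrow> fsp (\<lambda>n. f (n - k))"
  using fsp_shift[of f "-k"] by simp

lemma zsum_add: "fsp f \<Longrightarrow> fsp g \<Longrightarrow> zsum (\<lambda>n. f n + g n) = zsum f + zsum g"
proof -
  assume a: "fsp f" "fsp g"
  let ?A = "{n. f n \<noteq> 0} \<union> {n. g n \<noteq> 0}"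
  have f: "finite ?A" using a by (simp add: fsp_def)
  show ?thesis
    using zsum_eq[OF f, of f] zsum_eq[OF f, of g] zsum_eq[OF f, of "\<lambda>n. f n + g n"]
    by (auto simp: sum.distrib)
qed

lemma zsum_cmult: "zsum (\<lambda>n. a * f n) = a * zsum f"
proof (cases "a = 0")
  case False
  then have "{n. a * f n \<noteq> 0} = {n. f n \<noteq> 0}" by simp
  then show ?thesis by (simp add: zsum_def sum_distrib_left)
qed (simp add: zsum_def)

lemma zsum_diff: "fsp f \<Longrightarrow> fsp g \<Longrightarrow> zsum (\<lambda>n. f n - g n) = zsum f - zsum g"
  using zsum_add[of f "\<lambda>n. (-1) * g n"] zsum_cmult[of "-1" g] by simp

lemma zsum_shift: "zsum (\<lambda>n. f (n + k)) = zsum f"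
  unfolding zsum_def
  by (rule sum.reindex_bij_witness[of _ "\<lambda>n. n - k" "\<lambda>n. n + k"]) auto

lemma zsum_shift': "zsum (\<lambda>n. f (n - k)) = zsum f"
  using zsum_shift[of f "-k"] by simp

lemma zsum_nonneg: "(\<And>n. 0 \<le> f n) \<Longrightarrow> 0 \<le> zsum f"
  unfolding zsum_def by (rule sum_nonneg) auto

lemma zsum_mono: "fsp f \<Longrightarrow> fsp g \<Longrightarrow> (\<And>n. f n \<le> g n) \<Longrightarrow> zsum f \<le> zsum g"
  using zsum_nonneg[of "\<lambda>n. g n - f n"] zsum_diff[of g f] by simp

lemma zsum_sum: "finite J \<Longrightarrow> (\<And>j. j \<in> J \<Longrightarrow> fsp (f j)) \<Longrightarrow>
    fsp (\<lambda>n. \<Sum>j\<in>J. f j n) \<and> zsum (\<lambda>n. \<Sum>j\<in>J. f j n) = (\<Sum>j\<in>J. zsum (f j))"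
proof (induction J rule: finite_induct)
  case empty then show ?case by (simp add: zsum_def fsp_def)
next
  case (insert j J) then show ?case by (simp add: zsum_add)
qed

lemma ip_commute: "ip f g = ip g f" by (simp add: ip_def mult.commute)

lemma ip_self_nonneg [simp]: "0 \<le> ip f f" by (simp add: ip_def zsum_nonneg)

lemma ip_add_left: "fsp f \<Longrightarrow> fsp g \<Longrightarrow> ip (\<lambda>n. f n + g n) h = ip f h + ip g h"
  using zsum_add[of "\<lambda>n. f n * h n" "\<lambda>n. g n * h n"] by (simp add: ip_def algebra_simps)

lemma ip_diff_left: "fsp f \<Longrightarrow> fsp g \<Longrightarrow> ip (\<lambda>n. f n - g n) h = ip f h - ip g h"
  using zsum_diff[of "\<lambda>n. f n * h n" "\<lambda>n. g n * h n"] by (simp add: ip_def algebra_simps)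

lemma ip_cmult_left: "ip (\<lambda>n. a * f n) h = a * ip f h"
  using zsum_cmult[of a "\<lambda>n. f n * h n"] by (simp add: ip_def mult.assoc)

definition nn :: "(int \<Rightarrow> real) \<Rightarrow> real" where "nn f = sqrt (ip f f)"

lemma nn_nonneg [simp]: "0 \<le> nn f" by (simp add: nn_def)

lemma nn_power2: "(nn f)\<^sup>2 = ip f f" by (simp add: nn_def)

lemma nn_L2: "finite A \<Longrightarrow> (\<And>n. n \<notin> A \<Longrightarrow> f n = 0) \<Longrightarrow> nn f = L2_set f A"
  unfolding nn_def L2_set_def ip_def by (subst zsum_eq[of A]) (auto simp: power2_eq_square)

lemma nn_triangle: "fsp f \<Longrightarrow> fsp g \<Longrightarrow> nn (\<lambda>n. f n + g n) \<le> nn f + nn g"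
proof -
  assume a: "fsp f" "fsp g"
  let ?A = "{n. f n \<noteq> 0} \<union> {n. g n \<noteq> 0}"
  have f: "finite ?A" using a by (simp add: fsp_def)
  show ?thesis
    using nn_L2[OF f, of f] nn_L2[OF f, of g] nn_L2[OF f, of "\<lambda>n. f n + g n"] L2_set_triangle_ineq[of f g ?A]
    by auto
qed

lemma nn_cmult: "nn (\<lambda>n. a * f n) = \<bar>a\<bar> * nn f"
  unfolding nn_def using ip_cmult_left[of a f "\<lambda>n. a * f n"] ip_cmult_left[of a f f]
  by (simp add: ip_commute real_sqrt_mult mult.assoc[symmetric])

lemma nn_bounded_mult:
  assumes "fsp f" "\<And>n. \<bar>h n\<bar> \<le> M"
  shows "nn (\<lambda>n. h n * f n) \<le> M * nn f"
proof -
  have M: "0 \<le> M" using assms(2)[of 0] by linarith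
  have "(h n)\<^sup>2 \<le> M\<^sup>2" for n using assms(2)[of n] M by (simp add: abs_le_square_iff[symmetric])
  then have "ip (\<lambda>n. h n * f n) (\<lambda>n. h n * f n) \<le> ip (\<lambda>n. M * f n) (\<lambda>n. M * f n)"
    unfolding ip_def using assms(1)
    by (intro zsum_mono) (auto simp: power2_eq_square[symmetric] power_mult_distrib mult_right_mono)
  then have "nn (\<lambda>n. h n * f n) \<le> nn (\<lambda>n. M * f n)" by (simp add: nn_def)
  with M show ?thesis by (simp add: nn_cmult)
qed

lemma nn_shift: "nn (\<lambda>n. f (n + k)) = nn f"
  unfolding nn_def ip_def by (subst zsum_shift[of "\<lambda>n. f n * f n" k]) simp

lemma nn_shift': "nn (\<lambda>n. f (n - k)) = nn f"
  using nn_shift[of f "-k"] by simp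

lemma nn_diff_le: "fsp f \<Longrightarrow> fsp g \<Longrightarrow> nn (\<lambda>n. f n - g n) \<le> nn f + nn g"
  using nn_triangle[of f "\<lambda>n. (-1) * g n"] nn_cmult[of "-1" g] by simp

section \<open>The Schroedinger operator and its spectral gap\<close>

definition Top :: "real \<Rightarrow> (real \<Rightarrow> real) \<Rightarrow> real \<Rightarrow> (int \<Rightarrow> real) \<Rightarrow> int \<Rightarrow> real" where
  "Top \<alpha> c x f n = f (n + 1) + f (n - 1) - c (x + real_of_int n * \<alpha>) * f n"

text \<open>
  The operators of all phases \<open>x\<close> are bounded below by \<open>G\<close>. For \<open>G \<le> 0\<close> this is trivial, so an open gap
  is expressed by the existence of some admissible \<open>G > 0\<close>.
\<close>

definition gapped :: "real \<Rightarrow> (real \<Rightarrow> real) \<Rightarrow> real \<Rightarrow> bool" where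
  "gapped \<alpha> c G \<longleftrightarrow> (\<forall>x f. fsp f \<longrightarrow> G * nn f \<le> nn (Top \<alpha> c x f))"

lemma fsp_Top [simp]: "fsp f \<Longrightarrow> fsp (Top \<alpha> c x f)"
  unfolding Top_def[abs_def] by simp

lemma gappedD: "gapped \<alpha> c G \<Longrightarrow> fsp f \<Longrightarrow> G * nn f \<le> nn (Top \<alpha> c x f)"
  by (simp add: gapped_def)

lemma gapped_mono: "gapped \<alpha> c G \<Longrightarrow> G' \<le> G \<Longrightarrow> gapped \<alpha> c G'"
  unfolding gapped_def by (meson mult_right_mono nn_nonneg order_trans)

lemma nn_Top_le:
  assumes "fsp f" "\<And>x. \<bar>c x\<bar> \<le> M"
  shows "nn (Top \<alpha> c x f) \<le> (M + 2) * nn f"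
proof -
  have "nn (Top \<alpha> c x f) \<le> nn (\<lambda>n. f (n + 1) + f (n - 1)) + nn (\<lambda>n. c (x + real_of_int n * \<alpha>) * f n)"
    unfolding Top_def[abs_def] using assms(1) by (intro nn_diff_le) auto
  also have "nn (\<lambda>n. f (n + 1) + f (n - 1)) \<le> nn f + nn f"
    using nn_triangle[of "\<lambda>n. f (n+1)" "\<lambda>n. f (n - 1)"] assms(1) by (simp add: nn_shift nn_shift')
  also have "nn (\<lambda>n. c (x + real_of_int n * \<alpha>) * f n) \<le> M * nn f"
    using assms by (intro nn_bounded_mult) auto
  finally show ?thesis by (simp add: algebra_simps)
qed

lemma Top_sym: "fsp f \<Longrightarrow> fsp g \<Longrightarrow> ip (Top \<alpha> c x f) g = ip f (Top \<alpha> c x g)"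
proof -
  assume a: "fsp f" "fsp g"
  have 1: "zsum (\<lambda>n. f (n + 1) * g n) = zsum (\<lambda>n. f n * g (n - 1))"
    using zsum_shift[of "\<lambda>n. f n * g (n - 1)" 1] by simp
  have 2: "zsum (\<lambda>n. f (n - 1) * g n) = zsum (\<lambda>n. f n * g (n + 1))"
    using zsum_shift[of "\<lambda>n. f (n - 1) * g n" 1] by simp
  have "ip (Top \<alpha> c x f) g = zsum (\<lambda>n. (f (n+1) * g n + f (n-1) * g n) - c (x + real_of_int n * \<alpha>) * f n * g n)"
    by (simp add: ip_def Top_def algebra_simps)
  also have "\<dots> = zsum (\<lambda>n. f (n+1) * g n) + zsum (\<lambda>n. f (n-1) * g n) - zsum (\<lambda>n. c (x + real_of_int n * \<alpha>) * f n * g n)"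
    using a by (subst zsum_diff) (auto simp: zsum_add)
  also have "\<dots> = zsum (\<lambda>n. f n * g (n+1)) + zsum (\<lambda>n. f n * g (n-1)) - zsum (\<lambda>n. c (x + real_of_int n * \<alpha>) * f n * g n)"
    by (simp add: 1 2)
  also have "\<dots> = zsum (\<lambda>n. (f n * g (n+1) + f n * g (n-1)) - c (x + real_of_int n * \<alpha>) * f n * g n)"
    using a by (subst zsum_diff) (auto simp: zsum_add)
  finally show ?thesis by (simp add: ip_def Top_def algebra_simps)
qed

lemma gapped_perturb:
  assumes "gapped \<alpha> c G" "\<And>x. \<bar>c' x - c x\<bar> \<le> \<eta>"
  shows "gapped \<alpha> c' (G - \<eta>)"
  unfolding gapped_def
proof (intro allI impI)
  fix x f assume f: "fsp f"
  have "Top \<alpha> c x f = (\<lambda>n. Top \<alpha> c' x f n + (c' (x + real_of_int n * \<alpha>) - c (x + real_of_int n * \<alpha>)) * f n)"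
    by (simp add: fun_eq_iff Top_def algebra_simps)
  then have "nn (Top \<alpha> c x f) \<le> nn (Top \<alpha> c' x f) + nn (\<lambda>n. (c' (x + real_of_int n * \<alpha>) - c (x + real_of_int n * \<alpha>)) * f n)"
    using nn_triangle[of "Top \<alpha> c' x f" "\<lambda>n. (c' (x + real_of_int n * \<alpha>) - c (x + real_of_int n * \<alpha>)) * f n"] f by simp
  moreover have "nn (\<lambda>n. (c' (x + real_of_int n * \<alpha>) - c (x + real_of_int n * \<alpha>)) * f n) \<le> \<eta> * nn f"
    using assms(2) f by (intro nn_bounded_mult) auto
  moreover have "G * nn f \<le> nn (Top \<alpha> c x f)" using assms(1) f by (simp add: gapped_def)
  ultimately show "(G - \<eta>) * nn f \<le> nn (Top \<alpha> c' x f)" by (simp add: algebra_simps)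
qed

lemma gapped_sup:
  assumes "\<And>G'. G' < G \<Longrightarrow> gapped \<alpha> c G'"
  shows "gapped \<alpha> c G"
  unfolding gapped_def
proof (intro allI impI)
  fix x f assume f: "fsp f"
  show "G * nn f \<le> nn (Top \<alpha> c x f)"
  proof (rule field_le_epsilon)
    fix e :: real assume e: "0 < e"
    have "gapped \<alpha> c (G - e / (nn f + 1))" using e by (intro assms) (simp add: add_nonneg_pos)
    then have "(G - e / (nn f + 1)) * nn f \<le> nn (Top \<alpha> c x f)" using f by (simp add: gapped_def)
    moreover have "e / (nn f + 1) * nn f \<le> e"
    proof -
      have "0 < nn f + 1" by (simp add: add_nonneg_pos)
      then show ?thesis using e by (simp add: field_simps)
    qed
    ultimately show "G * nn f \<le> nn (Top \<alpha> c x f) + e" by (simp add: algebra_simps)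
  qed
qed

text \<open>
  Testing with a single site. At a phase where the potential vanishes this bounds every gap by 2.
\<close>

lemma gapped_upper:
  assumes "gapped \<alpha> c G" "0 \<le> G"
  shows "G\<^sup>2 \<le> 2 + (c x)\<^sup>2"
proof -
  define f :: "int \<Rightarrow> real" where "f n = (if n = 0 then 1 else 0)" for n
  have f: "fsp f" by (rule fspI[of "{0}"]) (auto simp: f_def)
  have 1: "nn f = 1" by (subst nn_L2[of "{0}"]) (auto simp: f_def L2_set_def)
  have "nn (Top \<alpha> c x f) = L2_set (Top \<alpha> c x f) {-1, 0, 1}"
    by (rule nn_L2) (auto simp: Top_def f_def)
  also have "\<dots> = sqrt (2 + (c x)\<^sup>2)" by (simp add: L2_set_def Top_def f_def)
  finally have "G \<le> sqrt (2 + (c x)\<^sup>2)" using gappedD[OF assms(1) f, of x] 1 by simp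
  then have "G\<^sup>2 \<le> (sqrt (2 + (c x)\<^sup>2))\<^sup>2" using assms(2) by (rule power_mono)
  then show ?thesis by simp
qed

text \<open>
  For a self-adjoint operator \<open>T\<close> the best lower bound is the distance of 0 to the spectrum. Without
  spectral theory: let \<open>D\<close> be the best bound for \<open>T\<close> and suppose that it is smaller than \<open>D'\<close>. Then
  \<open>P = T\<^sup>2 - D\<^sup>2\<close> is a nonnegative form, and it factors into the two shifts of \<open>T\<close> by \<open>D\<close>, both bounded below
  by assumption. The Cauchy-Schwarz inequality for the form \<open>P\<close> turns the lower bound of \<open>\<bar>P f\<bar>\<close> into a
  lower bound of \<open>P\<close> as a form, so \<open>D\<close> is not the best bound.
\<close>

lemma gapped_dist:
  assumes M: "\<And>x. \<bar>c x\<bar> \<le> M" and D': "0 \<le> D'"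
    and loc: "\<And>s. \<bar>s\<bar> \<le> D' \<Longrightarrow> \<exists>G>0. gapped \<alpha> (\<lambda>x. c x + s) G"
  shows "gapped \<alpha> c D'"
proof (rule ccontr)
  assume not: "\<not> gapped \<alpha> c D'"
  define X where "X = {g. 0 \<le> g \<and> gapped \<alpha> c g}"
  have bdd: "g \<le> D'" if "g \<in> X" for g
    using that not gapped_mono unfolding X_def by (metis linorder_le_cases mem_Collect_eq)
  have ne: "0 \<in> X" by (simp add: X_def gapped_def)
  define D where "D = Sup X"
  have bddX: "bdd_above X" using bdd by (auto simp: bdd_above_def)
  have D0: "0 \<le> D" unfolding D_def using ne bddX by (rule cSup_upper)
  have DD': "D \<le> D'" unfolding D_def using ne bdd by (intro cSup_least) auto
  have gD: "gapped \<alpha> c D"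
  proof (rule gapped_sup)
    fix G' assume "G' < D"
    then obtain g where "g \<in> X" "G' < g" unfolding D_def using ne bddX less_cSup_iff[of X G'] by auto
    then show "gapped \<alpha> c G'" using gapped_mono[of \<alpha> c g G'] by (auto simp: X_def)
  qed
  obtain G1 where G1: "G1 > 0" "gapped \<alpha> (\<lambda>x. c x + D) G1" using loc[of D] D0 DD' by auto
  obtain G2 where G2: "G2 > 0" "gapped \<alpha> (\<lambda>x. c x - D) G2" using loc[of "-D"] D0 DD' by auto
  have M0: "0 \<le> M" using M[of 0] by linarith
  define \<eta> where "\<eta> = (G1 * G2 / (M + 2))\<^sup>2"
  have \<eta>: "\<eta> > 0" using G1 G2 M0 by (simp add: \<eta>_def)
  have "gapped \<alpha> c (sqrt (D\<^sup>2 + \<eta>))"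
    unfolding gapped_def
  proof (intro allI impI)
    fix x f assume f: "fsp f"
    define P where "P h = (\<lambda>n. Top \<alpha> c x (Top \<alpha> c x h) n - D\<^sup>2 * h n)" for h :: "int \<Rightarrow> real"
    have Pfsp [simp]: "fsp (P h)" if "fsp h" for h unfolding P_def using that by simp
    have Pip: "ip (P h) k = ip (Top \<alpha> c x h) (Top \<alpha> c x k) - D\<^sup>2 * ip h k" if "fsp h" "fsp k" for h k
      unfolding P_def using that by (subst ip_diff_left) (auto simp: Top_sym ip_cmult_left)
    have Ppos: "0 \<le> ip (P h) h" if "fsp h" for h
    proof -
      have "D * nn h \<le> nn (Top \<alpha> c x h)" using gD that by (simp add: gapped_def)
      then have "(D * nn h)\<^sup>2 \<le> (nn (Top \<alpha> c x h))\<^sup>2" using D0 by (intro power_mono) auto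
      then show ?thesis using that by (simp add: Pip nn_power2 power_mult_distrib)
    qed
    have Psym: "ip (P h) k = ip (P k) h" if "fsp h" "fsp k" for h k
      using Pip[OF that] Pip[OF that(2,1)] ip_commute[of "Top \<alpha> c x h" "Top \<alpha> c x k"] ip_commute[of h k] by simp
    have CS: "(ip (P h) k)\<^sup>2 \<le> ip (P h) h * ip (P k) k" if hk: "fsp h" "fsp k" for h k
    proof -
      have q: "0 \<le> a\<^sup>2 * ip (P h) h + 2 * a * b * ip (P h) k + b\<^sup>2 * ip (P k) k" for a b :: real
      proof -
        define u where "u = (\<lambda>n. a * h n + b * k n)"
        have u: "fsp u" unfolding u_def using hk by simp
        have 1: "ip (P u) z = a * ip (P h) z + b * ip (P k) z" if z: "fsp z" for z
        proof -
          have "ip (P u) z = ip u (P z)" using u z by (metis Psym ip_commute)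
          also have "\<dots> = a * ip h (P z) + b * ip k (P z)"
            unfolding u_def using hk by (subst ip_add_left) (auto simp: ip_cmult_left)
          also have "\<dots> = a * ip (P h) z + b * ip (P k) z"
            using hk z by (metis Psym ip_commute)
          finally show ?thesis .
        qed
        have "ip (P u) u = a * ip (P u) h + b * ip (P u) k"
          using 1[OF u] hk u by (simp add: Psym)
        also have "\<dots> = a\<^sup>2 * ip (P h) h + 2 * a * b * ip (P h) k + b\<^sup>2 * ip (P k) k"
          using 1[OF hk(1)] 1[OF hk(2)] Psym[OF hk] by (simp add: algebra_simps power2_eq_square)
        finally show ?thesis using Ppos[OF u] by simp
      qed
      show ?thesis
      proof (cases "ip (P h) h = 0")
        case True
        have "ip (P h) k = 0"
        proof (rule ccontr)
          assume nz: "ip (P h) k \<noteq> 0"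
          show False
            using q[of "- (ip (P k) k + 1) / (2 * ip (P h) k)" 1] True nz
            by (simp add: field_simps)
        qed
        then show ?thesis using True by simp
      next
        case False
        then have pos: "0 < ip (P h) h" using Ppos[OF hk(1)] by simp
        from q[of "- ip (P h) k" "ip (P h) h"]
        have "0 \<le> ip (P h) h * (ip (P h) h * ip (P k) k - (ip (P h) k)\<^sup>2)"
          by (simp add: algebra_simps power2_eq_square)
        then show ?thesis using pos by (simp add: zero_le_mult_iff)
      qed
    qed
    have eqP: "P f = Top \<alpha> (\<lambda>x. c x + D) x (Top \<alpha> (\<lambda>x. c x - D) x f)"
      by (simp add: P_def fun_eq_iff Top_def algebra_simps power2_eq_square)
    have big: "G1 * G2 * nn f \<le> nn (P f)"
    proof -
      have "G2 * nn f \<le> nn (Top \<alpha> (\<lambda>x. c x - D) x f)" using gappedD[OF G2(2) f] .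
      then have "G1 * (G2 * nn f) \<le> G1 * nn (Top \<alpha> (\<lambda>x. c x - D) x f)" using G1(1) by simp
      also have "\<dots> \<le> nn (P f)" unfolding eqP using gappedD[OF G1(2)] f by simp
      finally show ?thesis by simp
    qed
    have le: "ip (P (P f)) (P f) \<le> (M + 2)\<^sup>2 * (nn (P f))\<^sup>2"
    proof -
      have "ip (P (P f)) (P f) \<le> (nn (Top \<alpha> c x (P f)))\<^sup>2"
        using Pip[of "P f" "P f"] f by (simp add: nn_power2)
      also have "\<dots> \<le> ((M + 2) * nn (P f))\<^sup>2"
        using nn_Top_le[OF Pfsp[OF f] M] by (intro power_mono) auto
      finally show ?thesis by (simp add: power_mult_distrib)
    qed
    \<comment> \<open>Cauchy-Schwarz for the form \<open>P\<close>, applied to \<open>f\<close> and \<open>P f\<close>.\<close>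
    have main: "\<eta> * (nn f)\<^sup>2 \<le> ip (P f) f"
    proof (cases "nn (P f) = 0")
      case True
      then have "nn f = 0" using big G1(1) G2(1) nn_nonneg[of f]
        by (metis mult_le_0_iff mult_pos_pos not_less order_antisym)
      then show ?thesis using Ppos[OF f] by simp
    next
      case False
      then have p: "0 < (nn (P f))\<^sup>2" by simp
      have "((nn (P f))\<^sup>2)\<^sup>2 \<le> ip (P f) f * ip (P (P f)) (P f)"
        using CS[OF f Pfsp[OF f]] by (simp add: nn_power2)
      also have "\<dots> \<le> ip (P f) f * ((M + 2)\<^sup>2 * (nn (P f))\<^sup>2)"
        using le Ppos[OF f] by (intro mult_left_mono) auto
      finally have "(nn (P f))\<^sup>2 * (nn (P f))\<^sup>2 \<le> (ip (P f) f * (M + 2)\<^sup>2) * (nn (P f))\<^sup>2"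
        by (simp add: power2_eq_square mult.assoc)
      then have 1: "(nn (P f))\<^sup>2 \<le> ip (P f) f * (M + 2)\<^sup>2" using p by (rule mult_right_le_imp_le)
      have "(G1 * G2 * nn f)\<^sup>2 \<le> (nn (P f))\<^sup>2" using big G1 G2 by (intro power_mono) auto
      with 1 have "(G1 * G2)\<^sup>2 * (nn f)\<^sup>2 \<le> ip (P f) f * (M + 2)\<^sup>2" by (simp add: power_mult_distrib)
      then show ?thesis using M0 by (simp add: \<eta>_def power_divide divide_simps mult.commute)
    qed
    have "(D\<^sup>2 + \<eta>) * (nn f)\<^sup>2 \<le> (nn (Top \<alpha> c x f))\<^sup>2"
      using main f by (simp add: Pip nn_power2 algebra_simps)
    then have "sqrt ((D\<^sup>2 + \<eta>) * (nn f)\<^sup>2) \<le> sqrt ((nn (Top \<alpha> c x f))\<^sup>2)" by (rule real_sqrt_le_mono)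
    then show "sqrt (D\<^sup>2 + \<eta>) * nn f \<le> nn (Top \<alpha> c x f)" by (simp add: real_sqrt_mult)
  qed
  then have "sqrt (D\<^sup>2 + \<eta>) \<in> X" using \<eta> by (simp add: X_def)
  then have "sqrt (D\<^sup>2 + \<eta>) \<le> D" unfolding D_def using bddX by (rule cSup_upper)
  moreover have "sqrt (D\<^sup>2) < sqrt (D\<^sup>2 + \<eta>)" using \<eta> by (intro real_sqrt_less_mono) simp
  ultimately show False using D0 by simp
qed

lemma nn_zsum: "(nn f)\<^sup>2 = zsum (\<lambda>n. (f n)\<^sup>2)"
  unfolding nn_power2 by (simp add: ip_def power2_eq_square)

text \<open>
  A quadratic form \<open>Q\<close> that increases along orbits plays the role of a Lyapunov function. For finitely
  supported \<open>f\<close> the pairs \<open>(f n, f (n - 1))\<close> follow the recursion up to an error controlled by the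
  operator applied to \<open>f\<close>; the sum of the increments of \<open>Q\<close> along them is 0, so the
  guaranteed increase must be compensated by the errors.
\<close>

lemma lyapunov_imp_gapped:
  fixes Q :: "real \<Rightarrow> complex \<Rightarrow> real"
  assumes M: "\<And>x. \<bar>c x\<bar> \<le> M" and \<kappa>: "\<kappa> > 0"
    and Q0: "\<And>x. Q x 0 = 0"
    and Qc: "\<And>x w f. \<bar>Q x (w + f) - Q x w\<bar> \<le> C * (cmod w * cmod f + (cmod f)\<^sup>2)"
    and inc: "\<And>x w. \<kappa> * (cmod w)\<^sup>2 \<le> Q (x + real N * \<alpha>) (orb \<alpha> c x w N) - Q x w"
  shows "\<exists>G>0. gapped \<alpha> c G"
proof -
  have M0: "0 \<le> M" using M[of 0] by linarith
  define B where "B = M + 1"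
  have B1: "1 \<le> B" using M0 by (simp add: B_def)
  have cB: "\<bar>c x\<bar> + 1 \<le> B" for x using M[of x] by (simp add: B_def)
  have C0: "0 \<le> C" using Qc[of 0 0 1] by simp
  define D where "D = (C * B ^ N)\<^sup>2 / (2 * \<kappa>) + C"
  have D0: "0 \<le> D" using C0 \<kappa> by (simp add: D_def)
  define H where "H = D * (B ^ N)\<^sup>2 * (real N)\<^sup>2 + 1"
  have H0: "0 < H" using D0 by (simp add: H_def add_nonneg_pos)
  have "gapped \<alpha> c (sqrt (\<kappa> / H))"
    unfolding gapped_def
  proof (intro allI impI)
    fix x f assume f: "fsp f"
    define r where "r = Top \<alpha> c x f"
    have rf: "fsp r" using f by (simp add: r_def)
    define w where "w n = Complex (f n) (f (n - 1))" for n :: int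
    have w_rec: "w (n + 1) = step (c (x + real_of_int n * \<alpha>)) (w n) + of_real (r n)" for n
      by (simp add: complex_eq_iff w_def r_def Top_def)
    define y where "y n = x + real_of_int n * \<alpha>" for n :: int
    define e where "e j n = w (n + int j) - orb \<alpha> c (y n) (w n) j" for j :: nat and n
    have e_rec: "e (Suc j) n = step (c (y (n + int j))) (e j n) + of_real (r (n + int j))" for j n
    proof -
      have "w (n + int (Suc j)) = step (c (y (n + int j))) (w (n + int j)) + of_real (r (n + int j))"
        using w_rec[of "n + int j"] by (simp add: algebra_simps y_def)
      moreover have "orb \<alpha> c (y n) (w n) (Suc j) = step (c (y (n + int j))) (orb \<alpha> c (y n) (w n) j)"
        by (simp add: y_def algebra_simps)
      moreover have "step k (a - b) = step k a - step k b" for k a b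
        by (simp add: complex_eq_iff algebra_simps)
      ultimately show ?thesis by (simp add: e_def)
    qed
    have e_bd: "cmod (e j n) \<le> B ^ j * (\<Sum>i<j. \<bar>r (n + int i)\<bar>)" for j n
    proof (induction j)
      case 0 then show ?case by (simp add: e_def)
    next
      case (Suc j)
      have "cmod (e (Suc j) n) \<le> cmod (step (c (y (n + int j))) (e j n)) + cmod (of_real (r (n + int j)) :: complex)"
        unfolding e_rec by (rule norm_triangle_ineq)
      also have "cmod (step (c (y (n + int j))) (e j n)) \<le> B * cmod (e j n)"
        using norm_step_le[of "c (y (n + int j))" "e j n"] cB[of "y (n + int j)"]
        by (meson mult_right_mono norm_ge_zero order_trans)
      also have "B * cmod (e j n) \<le> B * (B ^ j * (\<Sum>i<j. \<bar>r (n + int i)\<bar>))"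
        using Suc B1 by (intro mult_left_mono) auto
      also have "cmod (of_real (r (n + int j)) :: complex) \<le> B ^ Suc j * \<bar>r (n + int j)\<bar>"
        using one_le_power[OF B1, of "Suc j"] mult_right_mono[of 1 "B ^ Suc j" "\<bar>r (n + int j)\<bar>"] by simp
      finally show ?case by (simp add: algebra_simps)
    qed
    have e2: "(cmod (e N n))\<^sup>2 \<le> (B ^ N)\<^sup>2 * (real N * (\<Sum>i<N. (r (n + int i))\<^sup>2))" for n
    proof -
      have "(cmod (e N n))\<^sup>2 \<le> (B ^ N * (\<Sum>i<N. \<bar>r (n + int i)\<bar>))\<^sup>2"
        using e_bd by (intro power_mono) auto
      also have "\<dots> = (B ^ N)\<^sup>2 * (\<Sum>i<N. \<bar>r (n + int i)\<bar>)\<^sup>2" by (simp add: power_mult_distrib)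
      also have "\<dots> \<le> (B ^ N)\<^sup>2 * ((\<Sum>i<N. \<bar>r (n + int i)\<bar>\<^sup>2) * card {..<N})"
        by (intro mult_left_mono sum_squared_le_sum_of_squares) auto
      finally show ?thesis by (simp add: mult.commute)
    qed
    define a where "a n = Q (y n) (w n)" for n
    define A where "A = {n. f n \<noteq> 0} \<union> (\<lambda>n. n + 1) ` {n. f n \<noteq> 0}"
    have A: "finite A" using f by (simp add: A_def fsp_def)
    have w0: "w n = 0" if "n \<notin> A" for n
    proof -
      have "f n = 0" using that by (auto simp: A_def)
      moreover have "f (n - 1) = 0"
      proof (rule ccontr)
        assume "f (n - 1) \<noteq> 0"
        then have "(n - 1) + 1 \<in> A" unfolding A_def by blast
        then show False using that by simp
      qed
      ultimately show ?thesis by (simp add: w_def complex_eq_iff)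
    qed
    have af: "fsp a" by (rule fspI[OF A]) (simp add: a_def w0 Q0)
    have wf: "fsp (\<lambda>n. (cmod (w n))\<^sup>2)" by (rule fspI[OF A]) (simp add: w0)
    have pw: "\<kappa> / 2 * (cmod (w n))\<^sup>2 - D * (B ^ N)\<^sup>2 * real N * (\<Sum>i<N. (r (n + int i))\<^sup>2) \<le> a (n + int N) - a n" for n
    proof -
      define o' where "o' = orb \<alpha> c (y n) (w n) N"
      have yN: "y n + real N * \<alpha> = y (n + int N)" by (simp add: y_def algebra_simps)
      have wN: "w (n + int N) = o' + e N n" by (simp add: e_def o'_def)
      have 1: "\<kappa> * (cmod (w n))\<^sup>2 \<le> Q (y (n + int N)) o' - a n"
        using inc[of "w n" "y n"] by (simp add: o'_def a_def yN)
      have 2: "Q (y (n + int N)) o' - C * (cmod o' * cmod (e N n) + (cmod (e N n))\<^sup>2) \<le> a (n + int N)"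
        using Qc[of "y (n + int N)" o' "e N n"] by (simp add: a_def wN abs_le_iff)
      have 3: "cmod o' \<le> B ^ N * cmod (w n)"
        unfolding o'_def by (rule norm_orb_le) (rule cB)
      have "C * (cmod o' * cmod (e N n)) \<le> C * ((B ^ N * cmod (w n)) * cmod (e N n))"
        using 3 C0 by (intro mult_left_mono mult_right_mono) auto
      also have "\<dots> = (C * B ^ N * cmod (e N n)) * cmod (w n)" by simp
      \<comment> \<open>The mixed term is split so that half of the increase survives.\<close>
      also have "\<dots> \<le> \<kappa> / 2 * (cmod (w n))\<^sup>2 + (C * B ^ N)\<^sup>2 / (2 * \<kappa>) * (cmod (e N n))\<^sup>2"
      proof -
        let ?p = "C * B ^ N * cmod (e N n)" and ?q = "cmod (w n)"
        have "0 \<le> (\<kappa> * ?q - ?p)\<^sup>2 / (2 * \<kappa>)" using \<kappa> by simp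
        also have "\<dots> = \<kappa> / 2 * ?q\<^sup>2 + ?p\<^sup>2 / (2 * \<kappa>) - ?p * ?q"
          using \<kappa> by (simp add: field_simps power2_eq_square)
        finally show ?thesis by (simp add: power_mult_distrib)
      qed
      finally have 4: "C * (cmod o' * cmod (e N n)) \<le> \<kappa> / 2 * (cmod (w n))\<^sup>2 + (C * B ^ N)\<^sup>2 / (2 * \<kappa>) * (cmod (e N n))\<^sup>2" .
      have "D * (cmod (e N n))\<^sup>2 \<le> D * ((B ^ N)\<^sup>2 * (real N * (\<Sum>i<N. (r (n + int i))\<^sup>2)))"
        using e2 D0 by (intro mult_left_mono) auto
      then show ?thesis using 1 2 4 by (simp add: D_def algebra_simps)
    qed
    have rs: "fsp (\<lambda>n. \<Sum>i<N. (r (n + int i))\<^sup>2)" "zsum (\<lambda>n. \<Sum>i<N. (r (n + int i))\<^sup>2) = real N * (nn r)\<^sup>2"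
    proof -
      have "fsp (\<lambda>n. (r (n + int i))\<^sup>2)" for i using rf by simp
      moreover have "zsum (\<lambda>n. (r (n + int i))\<^sup>2) = (nn r)\<^sup>2" for i
        using zsum_shift[of "\<lambda>n. (r n)\<^sup>2" "int i"] by (simp add: nn_zsum)
      ultimately show "fsp (\<lambda>n. \<Sum>i<N. (r (n + int i))\<^sup>2)" "zsum (\<lambda>n. \<Sum>i<N. (r (n + int i))\<^sup>2) = real N * (nn r)\<^sup>2"
        using zsum_sum[of "{..<N}" "\<lambda>i n. (r (n + int i))\<^sup>2"] by simp_all
    qed
    have ws: "zsum (\<lambda>n. (cmod (w n))\<^sup>2) = 2 * (nn f)\<^sup>2"
    proof -
      have "zsum (\<lambda>n. (cmod (w n))\<^sup>2) = zsum (\<lambda>n. (f n)\<^sup>2 + (f (n - 1))\<^sup>2)"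
        by (simp add: w_def cmod_power2)
      also have "\<dots> = zsum (\<lambda>n. (f n)\<^sup>2) + zsum (\<lambda>n. (f (n - 1))\<^sup>2)"
        using f by (subst zsum_add) auto
      also have "zsum (\<lambda>n. (f (n - 1))\<^sup>2) = zsum (\<lambda>n. (f n)\<^sup>2)"
        by (rule zsum_shift')
      finally show ?thesis by (simp add: nn_zsum)
    qed
    have "zsum (\<lambda>n. \<kappa> / 2 * (cmod (w n))\<^sup>2 - D * (B ^ N)\<^sup>2 * real N * (\<Sum>i<N. (r (n + int i))\<^sup>2))
        \<le> zsum (\<lambda>n. a (n + int N) - a n)"
      using wf rs(1) af by (intro zsum_mono pw fsp_diff fsp_mult fsp_shift)
    also have "\<dots> = 0" using af by (simp add: zsum_diff zsum_shift)
    finally have "\<kappa> / 2 * zsum (\<lambda>n. (cmod (w n))\<^sup>2) - D * (B ^ N)\<^sup>2 * real N * zsum (\<lambda>n. \<Sum>i<N. (r (n + int i))\<^sup>2) \<le> 0"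
      by (simp only: zsum_diff[OF fsp_mult[OF wf] fsp_mult[OF rs(1)]] zsum_cmult)
    then have "\<kappa> * (nn f)\<^sup>2 \<le> D * (B ^ N)\<^sup>2 * (real N)\<^sup>2 * (nn r)\<^sup>2"
      by (simp only: rs(2) ws) (simp add: power2_eq_square[of "real N"] mult_ac)
    also have "\<dots> \<le> H * (nn r)\<^sup>2" by (simp add: H_def mult_right_mono)
    finally have "\<kappa> / H * (nn f)\<^sup>2 \<le> (nn r)\<^sup>2" using H0 by (simp add: field_simps)
    then have "sqrt (\<kappa> / H * (nn f)\<^sup>2) \<le> sqrt ((nn r)\<^sup>2)" by (rule real_sqrt_le_mono)
    then show "sqrt (\<kappa> / H) * nn f \<le> nn (Top \<alpha> c x f)"
      by (subst (asm) real_sqrt_mult) (simp add: r_def)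
  qed
  moreover have "sqrt (\<kappa> / H) > 0" using \<kappa> H0 by simp
  ultimately show ?thesis by blast
qed

text \<open>
  An orbit restricted to a window solves the equation except at the two ends, where the operator leaves
  only the first and the last pair of values.
\<close>

lemma gapped_orbit_window:
  assumes g: "gapped \<alpha> c G" and G: "G > 0"
  shows "(\<Sum>n=1..<N. (cmod (orb \<alpha> c x w n))\<^sup>2) \<le> 4 / G\<^sup>2 * ((cmod w)\<^sup>2 + (cmod (orb \<alpha> c x w N))\<^sup>2)"
proof (cases "N \<ge> 1")
  case True
  define p where "p n = Im (orb \<alpha> c x w n)" for n
  have re: "Re (orb \<alpha> c x w n) = p (Suc n)" for n by (simp add: p_def)
  have rec: "p (Suc (Suc n)) = c (x + real n * \<alpha>) * p (Suc n) - p n" for n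
    by (simp add: p_def)
  define f where "f m = (if 1 \<le> m \<and> m \<le> int N then p (nat m) else 0)" for m :: int
  define I where "I = {0..int N + 1}"
  have f0: "f m = 0" if "m \<notin> {1..int N}" for m using that by (auto simp: f_def)
  have f: "fsp f" by (rule fspI[of "{1..int N}"]) (auto simp: f0)
  define u1 where "u1 m = (if m = 0 then p 1 else if m = 1 then - p 0 else 0)" for m :: int
  define u2 where "u2 m = (if m = int N then - p (Suc N) else if m = int N + 1 then p N else 0)" for m :: int
  have T: "Top \<alpha> c (x - \<alpha>) f m = u1 m + u2 m" for m
  proof -
    consider "m < 0" | "m > int N + 1" | "m = 0" | "m = int N + 1" | "1 \<le> m" "m \<le> int N" by linarith
    then show ?thesis
    proof cases
      case 5
      then obtain j where j: "m = int (Suc j)" "Suc j \<le> N"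
        by (metis Suc_le_mono nat_0_le nat_int not_less_eq_eq of_nat_le_iff zero_le_one int_one_le_iff_zero_less old.nat.exhaust order_trans gr_implies_not0 le_0_eq of_nat_0 of_nat_1 zless_nat_eq_int_zless)
      have a1: "x - \<alpha> + real_of_int m * \<alpha> = x + real j * \<alpha>" using j by (simp add: algebra_simps)
      have a2: "f (m - 1) = (if j = 0 then 0 else p j)" using j by (auto simp: f_def)
      have a3: "f (m + 1) = (if Suc j = N then 0 else p (Suc (Suc j)))" using j by (auto simp: f_def nat_add_distrib)
      have a4: "f m = p (Suc j)" using j(2) by (simp add: f_def j(1) del: of_nat_Suc)
      have b1: "u1 m = (if j = 0 then - p 0 else 0)" using j by (auto simp: u1_def)
      have b2: "u2 m = (if Suc j = N then - p (Suc (Suc j)) else 0)" using j by (auto simp: u2_def)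
      show ?thesis unfolding Top_def a1 a2 a3 a4 b1 b2 using rec[of j] by auto
    next
      case 3 then show ?thesis using True by (auto simp: Top_def f_def u1_def u2_def)
    next
      case 4 then show ?thesis using True by (auto simp: Top_def f_def u1_def u2_def)
    qed (use True in \<open>auto simp: Top_def f_def u1_def u2_def\<close>)
  qed
  have "(nn (Top \<alpha> c (x - \<alpha>) f))\<^sup>2 = (\<Sum>m\<in>I. (u1 m + u2 m)\<^sup>2)"
    unfolding nn_zsum T using True
    by (subst zsum_eq[of I]) (auto simp: I_def u1_def u2_def)
  also have "\<dots> \<le> (\<Sum>m\<in>I. 2 * (u1 m)\<^sup>2 + 2 * (u2 m)\<^sup>2)"
  proof (rule sum_mono)
    fix m show "(u1 m + u2 m)\<^sup>2 \<le> 2 * (u1 m)\<^sup>2 + 2 * (u2 m)\<^sup>2"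
      using zero_le_power2[of "u1 m - u2 m"] by (simp add: power2_sum power2_diff)
  qed
  also have "\<dots> = 2 * (\<Sum>m\<in>I. (u1 m)\<^sup>2) + 2 * (\<Sum>m\<in>I. (u2 m)\<^sup>2)"
    by (simp add: sum.distrib sum_distrib_left)
  also have "(\<Sum>m\<in>I. (u1 m)\<^sup>2) = (\<Sum>m\<in>{0,1}. (u1 m)\<^sup>2)"
    using True by (intro sum.mono_neutral_right) (auto simp: I_def u1_def)
  also have "\<dots> = (cmod w)\<^sup>2" using re[of 0] by (simp add: u1_def cmod_power2 p_def)
  also have "(\<Sum>m\<in>I. (u2 m)\<^sup>2) = (\<Sum>m\<in>{int N, int N + 1}. (u2 m)\<^sup>2)"
    using True by (intro sum.mono_neutral_right) (auto simp: I_def u2_def)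
  also have "\<dots> = (cmod (orb \<alpha> c x w N))\<^sup>2" using re[of N] by (simp add: u2_def cmod_power2 p_def)
  finally have 1: "(nn (Top \<alpha> c (x - \<alpha>) f))\<^sup>2 \<le> 2 * ((cmod w)\<^sup>2 + (cmod (orb \<alpha> c x w N))\<^sup>2)"
    by (simp add: algebra_simps)
  have "(nn f)\<^sup>2 = (\<Sum>m\<in>{1..int N}. (f m)\<^sup>2)"
    unfolding nn_zsum by (subst zsum_eq[of "{1..int N}"]) (auto simp: f0)
  also have "\<dots> = (\<Sum>n\<in>{1..N}. (p n)\<^sup>2)"
    by (rule sum.reindex_bij_witness[of _ int nat]) (auto simp: f_def)
  finally have nf: "(nn f)\<^sup>2 = (\<Sum>n\<in>{1..N}. (p n)\<^sup>2)" .
  have "(\<Sum>n=1..<N. (cmod (orb \<alpha> c x w n))\<^sup>2) = (\<Sum>n=1..<N. (p (Suc n))\<^sup>2) + (\<Sum>n=1..<N. (p n)\<^sup>2)"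
    by (simp add: cmod_power2 re p_def[symmetric] sum.distrib)
  also have "(\<Sum>n=1..<N. (p (Suc n))\<^sup>2) = (\<Sum>n\<in>{Suc 1..<Suc N}. (p n)\<^sup>2)"
    by (rule sum.shift_bounds_Suc_ivl[symmetric])
  also have "\<dots> \<le> (\<Sum>n\<in>{1..N}. (p n)\<^sup>2)" by (rule sum_mono2) auto
  also have "(\<Sum>n=1..<N. (p n)\<^sup>2) \<le> (\<Sum>n\<in>{1..N}. (p n)\<^sup>2)" by (rule sum_mono2) auto
  finally have 2: "(\<Sum>n=1..<N. (cmod (orb \<alpha> c x w n))\<^sup>2) \<le> 2 * (nn f)\<^sup>2" using nf by simp
  have "(G * nn f)\<^sup>2 \<le> (nn (Top \<alpha> c (x - \<alpha>) f))\<^sup>2"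
    using gappedD[OF g f] G by (intro power_mono) auto
  with 1 have "G\<^sup>2 * (nn f)\<^sup>2 \<le> 2 * ((cmod w)\<^sup>2 + (cmod (orb \<alpha> c x w N))\<^sup>2)"
    by (simp add: power_mult_distrib)
  then have "2 * (nn f)\<^sup>2 \<le> 4 / G\<^sup>2 * ((cmod w)\<^sup>2 + (cmod (orb \<alpha> c x w N))\<^sup>2)"
    using G by (simp add: field_simps)
  with 2 show ?thesis by linarith
qed simp

section \<open>Stable vectors\<close>

text \<open>
  Over an open gap boundedness is equivalent to exponential decay, so this is the stable direction.
\<close>

definition stab :: "real \<Rightarrow> (real \<Rightarrow> real) \<Rightarrow> real \<Rightarrow> complex \<Rightarrow> bool" where
  "stab \<alpha> c x w \<longleftrightarrow> bounded (range (orb \<alpha> c x w))"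

text \<open>
  The window estimate bounds the tail sum after time \<open>a\<close> by a multiple of the single term at \<open>a\<close>; such
  tails decrease geometrically.
\<close>

lemma stabD_decay:
  assumes g: "gapped \<alpha> c G" and G: "G > 0" and s: "stab \<alpha> c x w"
  defines "K \<equiv> 4 / G\<^sup>2"
  shows "(cmod (orb \<alpha> c x w n))\<^sup>2 \<le> (1 + K) * (K / (1 + K)) ^ n * (cmod w)\<^sup>2"
    and "summable (\<lambda>n. (cmod (orb \<alpha> c x w n))\<^sup>2)"
proof -
  have K: "K > 0" using G by (simp add: K_def)
  define b where "b n = (cmod (orb \<alpha> c x w n))\<^sup>2" for n
  have b0 [simp]: "0 \<le> b n" for n by (simp add: b_def)
  obtain L where L: "cmod (orb \<alpha> c x w n) \<le> L" for n
    using s unfolding stab_def bounded_iff by auto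
  have bL: "b n \<le> L\<^sup>2" for n unfolding b_def by (intro power_mono L) simp
  have win: "(\<Sum>n=1..<N. b (a + n)) \<le> K * (b a + b (a + N))" for a N
    using gapped_orbit_window[OF g G, of "x + real a * \<alpha>" "orb \<alpha> c x w a" N]
    by (simp add: b_def K_def orb_add)
  have "(\<Sum>n<N. b n) \<le> b 0 + K * (b 0 + L\<^sup>2)" for N
  proof (cases N)
    case (Suc m)
    have "(\<Sum>n<N. b n) = b 0 + (\<Sum>n=1..<N. b (0 + n))"
      using Suc by (simp add: lessThan_atLeast0 sum.atLeast_Suc_lessThan)
    also have "\<dots> \<le> b 0 + K * (b 0 + b (0 + N))" using win[where a=0 and N=N] by linarith
    also have "\<dots> \<le> b 0 + K * (b 0 + L\<^sup>2)" using bL[of "0 + N"] K by simp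
    finally show ?thesis .
  qed (use K in simp)
  then have sm: "summable b" by (intro summableI_nonneg_bounded) auto
  then show "summable (\<lambda>n. (cmod (orb \<alpha> c x w n))\<^sup>2)" by (simp add: b_def[abs_def])
  define S where "S a = (\<Sum>n. b (a + n))" for a
  have sma: "summable (\<lambda>n. b (a + n))" for a
    using sm summable_iff_shift[of b a] by (simp add: add.commute)
  have Ssplit: "S a = b a + S (Suc a)" for a
    using suminf_split_head[OF sma[of a]] by (simp add: S_def)
  have SK: "S (Suc a) \<le> K * b a" for a
  proof -
    have l1: "(\<lambda>N. K * (b a + b (a + N))) \<longlonglongrightarrow> K * (b a + 0)"
      by (intro tendsto_intros summable_LIMSEQ_zero sma)
    have l2: "(\<lambda>N. \<Sum>n=1..<Suc N. b (a + n)) \<longlonglongrightarrow> S (Suc a)"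
    proof -
      have "(\<Sum>n=1..<Suc N. b (a + n)) = (\<Sum>n<N. b (Suc a + n))" for N
        using sum.shift_bounds_Suc_ivl[of "\<lambda>n. b (a + n)" 0 N] by (simp add: lessThan_atLeast0)
      then show ?thesis unfolding S_def using summable_LIMSEQ[OF sma[of "Suc a"]] by simp
    qed
    have l3: "(\<lambda>N. K * (b a + b (a + Suc N))) \<longlonglongrightarrow> K * (b a + 0)"
      using l1 by (rule LIMSEQ_Suc)
    have "S (Suc a) \<le> K * (b a + 0)"
      by (rule tendsto_le[OF _ l3 l2]) (simp, rule always_eventually, intro allI win)
    then show ?thesis by simp
  qed
  have S0: "0 \<le> S a" for a unfolding S_def by (rule suminf_nonneg[OF sma]) simp
  have dec: "S (Suc a) \<le> K / (1 + K) * S a" for a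
    using SK[of a] Ssplit[of a] K by (simp add: field_simps)
  have "S a \<le> (K / (1 + K)) ^ a * S 0" for a
  proof (induction a)
    case (Suc a)
    have "S (Suc a) \<le> K / (1 + K) * S a" by (rule dec)
    also have "\<dots> \<le> K / (1 + K) * ((K / (1 + K)) ^ a * S 0)"
      using Suc K by (intro mult_left_mono) auto
    finally show ?case by (simp add: mult.assoc)
  qed simp
  moreover have "b n \<le> S n" using Ssplit[of n] S0[of "Suc n"] by linarith
  moreover have "S 0 \<le> (1 + K) * b 0" using SK[of 0] Ssplit[of 0] by (simp add: algebra_simps)
  ultimately have "b n \<le> (K / (1 + K)) ^ n * ((1 + K) * b 0)"
    using K by (meson mult_left_mono order_trans zero_le_power divide_nonneg_nonneg add_nonneg_nonneg zero_le_one less_imp_le)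
  then show "(cmod (orb \<alpha> c x w n))\<^sup>2 \<le> (1 + K) * (K / (1 + K)) ^ n * (cmod w)\<^sup>2"
    by (simp add: b_def algebra_simps)
qed

lemma stab_tendsto_0:
  assumes g: "gapped \<alpha> c G" and G: "G > 0" and s: "stab \<alpha> c x w"
  shows "(\<lambda>n. orb \<alpha> c x w n) \<longlonglongrightarrow> 0"
proof -
  have "(\<lambda>n. sqrt ((cmod (orb \<alpha> c x w n))\<^sup>2)) \<longlonglongrightarrow> sqrt 0"
    by (intro tendsto_real_sqrt summable_LIMSEQ_zero stabD_decay(2)[OF g G s])
  then show ?thesis by (simp add: tendsto_norm_zero_iff)
qed

lemma stab_bound:
  assumes g: "gapped \<alpha> c G" and G: "G > 0" and s: "stab \<alpha> c x w"
  shows "(cmod (orb \<alpha> c x w n))\<^sup>2 \<le> (1 + 4 / G\<^sup>2) * (cmod w)\<^sup>2"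
proof -
  define K where "K = 4 / G\<^sup>2"
  have K: "K > 0" using G by (simp add: K_def)
  have "(K / (1 + K)) ^ n \<le> 1" using K by (intro power_le_one) auto
  then have "(1 + K) * (K / (1 + K)) ^ n * (cmod w)\<^sup>2 \<le> (1 + K) * 1 * (cmod w)\<^sup>2"
    using K by (intro mult_right_mono mult_left_mono) auto
  then show ?thesis using stabD_decay(1)[OF g G s, of n] by (simp add: K_def)
qed

text \<open>
  The wedge product of two orbits is constant, and it tends to 0 for decaying ones.
\<close>

lemma stab_parallel:
  assumes g: "gapped \<alpha> c G" and G: "G > 0" and s: "stab \<alpha> c x w" "stab \<alpha> c x u"
  shows "wedge w u = 0"
proof -
  have t: "(\<lambda>n. cmod (orb \<alpha> c x w n) * cmod (orb \<alpha> c x u n)) \<longlonglongrightarrow> 0 * 0"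
    by (intro tendsto_mult tendsto_norm_zero stab_tendsto_0[OF g G] s)
  have "\<bar>wedge w u\<bar> \<le> cmod (orb \<alpha> c x w n) * cmod (orb \<alpha> c x u n)" for n
    using abs_wedge_le[of "orb \<alpha> c x w n" "orb \<alpha> c x u n"] by simp
  then have "\<bar>wedge w u\<bar> \<le> 0"
    using t by (intro LIMSEQ_le_const[of _ 0]) auto
  then show ?thesis by simp
qed

lemma wedge_0_imp:
  assumes "wedge w u = 0" "w \<noteq> 0"
  shows "\<exists>a. u = of_real a * w"
proof -
  have n: "(Re w)\<^sup>2 + (Im w)\<^sup>2 \<noteq> 0"
    using assms(2) by (simp add: complex_eq_iff sum_power2_eq_zero_iff)
  have e: "Re w * Im u = Im w * Re u" using assms(1) by (simp add: wedge_def)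
  define a where "a = (Re u * Re w + Im u * Im w) / ((Re w)\<^sup>2 + (Im w)\<^sup>2)"
  have "Re u * ((Re w)\<^sup>2 + (Im w)\<^sup>2) = (Re u * Re w + Im u * Im w) * Re w"
    using e by algebra 
  moreover have "Im u * ((Re w)\<^sup>2 + (Im w)\<^sup>2) = (Re u * Re w + Im u * Im w) * Im w"
    using e by algebra
  ultimately have "u = of_real a * w"
    using n by (simp add: complex_eq_iff a_def field_simps)
  then show ?thesis by blast
qed

text \<open>
  The companion \<open>r\<close> of \<open>v\<close> is chosen at the final time, as the unit vector orthogonal to the orbit of \<open>v\<close>,
  and transported back.
\<close>

lemma transverse_orbit:
  assumes v: "v \<noteq> 0"
  shows "\<exists>r. cmod (orb \<alpha> c x r n) = 1 \<and> wedge v r = cmod (orb \<alpha> c x v n)"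
proof -
  define vn where "vn = orb \<alpha> c x v n"
  have vn: "0 < cmod vn" using v by (simp add: vn_def)
  define r where "r = swap (orb (-\<alpha>) c (x + real n * \<alpha> - \<alpha>) (swap (\<i> * vn / of_real (cmod vn))) n)"
  have e: "orb \<alpha> c x r n = \<i> * vn / of_real (cmod vn)"
  proof -
    have eq: "(x + real n * \<alpha> - \<alpha>) + real n * (-\<alpha>) - (-\<alpha>) = x" by (simp add: algebra_simps)
    have "orb (- (-\<alpha>)) c x r n = swap (swap (\<i> * vn / of_real (cmod vn)))"
      using orb_reverse[of "-\<alpha>" c "x + real n * \<alpha> - \<alpha>" n "swap (\<i> * vn / of_real (cmod vn))"]
      unfolding eq r_def[symmetric] .
    then show ?thesis by simp
  qed
  have "wedge vn (\<i> * vn / of_real (cmod vn)) = ((Re vn)\<^sup>2 + (Im vn)\<^sup>2) / cmod vn"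
    by (simp add: wedge_def power2_eq_square add_divide_distrib)
  also have "\<dots> = cmod vn" using vn by (simp only: cmod_power2[symmetric]) (simp add: power2_eq_square)
  finally have "wedge (orb \<alpha> c x v n) (orb \<alpha> c x r n) = cmod vn" by (simp add: e vn_def)
  moreover have "cmod (orb \<alpha> c x r n) = 1" using vn by (simp add: e norm_mult norm_divide)
  ultimately show ?thesis by (auto simp: vn_def)
qed

text \<open>
  Either the basis vector 1 is not expanded, or a transverse vector of final norm 1 has initial norm at least 1,
  by the invariance of the wedge product.
\<close>

lemma contracted_vector:
  "\<exists>w. cmod w = 1 \<and> cmod (orb \<alpha> c x w n) \<le> 1"
proof (cases "cmod (orb \<alpha> c x 1 n) \<le> 1")
  case False
  obtain r where r: "cmod (orb \<alpha> c x r n) = 1" "wedge 1 r = cmod (orb \<alpha> c x 1 n)"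
    using transverse_orbit[of 1 \<alpha> c x n] by auto
  have r1: "1 < cmod r" using abs_wedge_le[of 1 r] r(2) False by simp
  have "cmod (orb \<alpha> c x (of_real (1 / cmod r) * r) n) \<le> 1"
    using r1 r(1) by (simp only: orb_scale norm_mult norm_of_real) (auto simp: divide_le_eq)
  moreover have "cmod (of_real (1 / cmod r) * r) = 1"
    using r1 by (simp only: norm_mult norm_of_real) auto
  ultimately show ?thesis by blast
qed (auto intro: exI[of _ 1])

lemma continuous_orb [continuous_intros]: "continuous_on A (\<lambda>w. orb \<alpha> c x w n)"
proof -
  have "continuous_on A (\<lambda>w. of_real (Re w) * orb \<alpha> c x 1 n + of_real (Im w) * orb \<alpha> c x \<i> n)"
    by (intro continuous_intros)
  then show ?thesis by (subst orb_basis)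
qed

text \<open>
  A limit point of vectors contracted over longer and longer times: the window estimate bounds their
  orbits uniformly.
\<close>

lemma stab_exists:
  assumes g: "gapped \<alpha> c G" and G: "G > 0"
  shows "\<exists>w. cmod w = 1 \<and> stab \<alpha> c x w"
proof -
  obtain w where w: "\<And>N. cmod (w N) = 1" "\<And>N. cmod (orb \<alpha> c x (w N) N) \<le> 1"
    using contracted_vector by metis
  have "compact (sphere 0 1 :: complex set)" by simp
  moreover have "\<forall>N. w N \<in> sphere 0 1" using w by simp
  ultimately obtain l \<rho> where l: "l \<in> sphere 0 1" "strict_mono \<rho>" "(w \<circ> \<rho>) \<longlonglongrightarrow> l"
    unfolding compact_def by meson
  define L where "L = sqrt (8 / G\<^sup>2) + 1"
  have bd: "cmod (orb \<alpha> c x (w N) n) \<le> L" if "n < N" for n N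
  proof (cases "n = 0")
    case True then show ?thesis using w(1)[of N] G by (simp add: L_def)
  next
    case False
    have "(cmod (orb \<alpha> c x (w N) n))\<^sup>2 \<le> (\<Sum>n=1..<N. (cmod (orb \<alpha> c x (w N) n))\<^sup>2)"
      using False that by (intro member_le_sum) auto
    also have "\<dots> \<le> 4 / G\<^sup>2 * ((cmod (w N))\<^sup>2 + (cmod (orb \<alpha> c x (w N) N))\<^sup>2)"
      by (rule gapped_orbit_window[OF g G])
    also have "\<dots> \<le> 4 / G\<^sup>2 * (1 + 1)"
      using w(2)[of N] by (intro mult_left_mono add_mono) (auto simp: w(1) power_le_one)
    finally have "cmod (orb \<alpha> c x (w N) n) \<le> sqrt (8 / G\<^sup>2)" by (intro real_le_rsqrt) simp
    then show ?thesis by (simp add: L_def)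
  qed
  have "cmod (orb \<alpha> c x l n) \<le> L" for n
  proof -
    have "isCont (\<lambda>w. orb \<alpha> c x w n) l"
      using continuous_orb[of UNIV \<alpha> c x n] by (simp add: continuous_on_eq_continuous_at)
    then have "(\<lambda>j. orb \<alpha> c x (w (\<rho> j)) n) \<longlonglongrightarrow> orb \<alpha> c x l n"
      using l(3) isCont_tendsto_compose[of l "\<lambda>w. orb \<alpha> c x w n" "w \<circ> \<rho>" sequentially] by (simp add: o_def)
    then have t: "(\<lambda>j. cmod (orb \<alpha> c x (w (\<rho> j)) n)) \<longlonglongrightarrow> cmod (orb \<alpha> c x l n)"
      by (rule tendsto_norm)
    show ?thesis
    proof (rule LIMSEQ_le_const2[OF t], intro exI allI impI)
      fix j assume "Suc n \<le> j"
      then have "n < \<rho> j" using seq_suble[OF l(2), of j] by linarith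
      then show "cmod (orb \<alpha> c x (w (\<rho> j)) n) \<le> L" by (rule bd)
    qed
  qed
  then have "stab \<alpha> c x l" unfolding stab_def bounded_iff by auto
  with l(1) show ?thesis by auto
qed

lemma stab_scale: "stab \<alpha> c x w \<Longrightarrow> stab \<alpha> c x (of_real a * w)"
proof -
  assume "stab \<alpha> c x w"
  then obtain L where L: "cmod (orb \<alpha> c x w n) \<le> L" for n
    unfolding stab_def bounded_iff by auto
  have "cmod (orb \<alpha> c x (of_real a * w) n) \<le> \<bar>a\<bar> * L" for n
    using L[of n] by (simp add: orb_scale norm_mult mult_left_mono)
  then show ?thesis unfolding stab_def bounded_iff by auto
qed

lemma stab_step: "stab \<alpha> c x w \<Longrightarrow> stab \<alpha> c (x + \<alpha>) (step (c x) w)"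
proof -
  assume "stab \<alpha> c x w"
  then obtain L where L: "cmod (orb \<alpha> c x w n) \<le> L" for n
    unfolding stab_def bounded_iff by auto
  have "cmod (orb \<alpha> c (x + \<alpha>) (step (c x) w) n) \<le> L" for n
    using L[of "Suc n"] by (simp only: orb_Suc_shift)
  then show ?thesis unfolding stab_def bounded_iff by auto
qed

lemma stab_periodic: "periodic1 c \<Longrightarrow> stab \<alpha> c (x + 1) w \<longleftrightarrow> stab \<alpha> c x w"
  by (simp add: stab_def orb_periodic)

section \<open>The action on directions\<close>

text \<open>
  The action of a step on angles, lifted to the line. The branch of the argument is single valued
  because the complex number in question never meets the nonpositive real axis; hence the lift is jointly
  continuous in \<open>c\<close> and the angle.
\<close>

definition lift :: "real \<Rightarrow> real \<Rightarrow> real" where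
  "lift c \<phi> = \<phi> + pi / 2 + Arg (1 - \<i> * of_real (c * cos \<phi>) * cis (- \<phi>))"

lemma lift_arg_not_nonpos: "1 - \<i> * of_real (c * cos \<phi>) * cis (- \<phi>) \<notin> \<real>\<^sub>\<le>\<^sub>0"
  by (auto simp: complex_nonpos_Reals_iff)

lemma step_cis: "\<exists>r>0. step c (cis \<phi>) = of_real r * cis (lift c \<phi>)"
proof -
  define z where "z = 1 - \<i> * of_real (c * cos \<phi>) * cis (- \<phi>)"
  have z0: "z \<noteq> 0" using lift_arg_not_nonpos[of c \<phi>] by (auto simp: z_def)
  have "step c (cis \<phi>) = \<i> * cis \<phi> * z"
  proof -
    have "cis \<phi> * cis (-\<phi>) = 1" by (simp add: cis_mult)
    then have "\<i> * cis \<phi> * z = \<i> * cis \<phi> + of_real (c * cos \<phi>) * (cis \<phi> * cis (- \<phi>))"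
      unfolding z_def by (simp add: algebra_simps)
    also have "\<dots> = \<i> * cis \<phi> + of_real (c * cos \<phi>)" using \<open>cis \<phi> * cis (-\<phi>) = 1\<close> by simp
    also have "\<dots> = step c (cis \<phi>)" by (simp add: complex_eq_iff)
    finally show ?thesis by simp
  qed
  also have "z = of_real (cmod z) * cis (Arg z)" using rcis_cmod_Arg[of z] by (simp add: rcis_def)
  also have "\<i> * cis \<phi> * (of_real (cmod z) * cis (Arg z)) = of_real (cmod z) * cis (lift c \<phi>)"
  proof -
    have "lift c \<phi> = \<phi> + pi / 2 + Arg z" unfolding lift_def z_def by (rule refl)
    then show ?thesis
      using cis_mult[of "\<phi> + pi/2" "Arg z"] cis_mult[of \<phi> "pi/2"] by (simp add: mult_ac)
  qed
  finally show ?thesis using z0 by (intro exI[of _ "cmod z"]) simp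
qed

lemma lift_add_pi: "lift c (\<phi> + of_int m * pi) = lift c \<phi> + of_int m * pi"
proof -
  have s: "sin (of_int m * pi) = 0" by (simp add: sin_zero_iff_int2)
  then have "(cos (of_int m * pi))\<^sup>2 = 1" by (simp add: cos_squared_eq)
  then have "cos (of_int m * pi) * cos (of_int m * pi) = 1" by (simp add: power2_eq_square)
  define \<sigma> where "\<sigma> = cos (of_int m * pi)"
  define y where "y = \<phi> + of_int m * pi"
  have y: "cos y = \<sigma> * cos \<phi>" "sin y = \<sigma> * sin \<phi>"
    using s by (simp_all add: y_def \<sigma>_def cos_add sin_add)
  have \<sigma>: "\<sigma> * \<sigma> = 1" using \<open>cos (of_int m * pi) * cos (of_int m * pi) = 1\<close> by (simp add: \<sigma>_def)
  have "cis (- y) = of_real \<sigma> * cis (- \<phi>)" by (simp add: complex_eq_iff y)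
  then have "of_real (c * cos y) * cis (- y) = of_real (\<sigma> * \<sigma>) * (of_real (c * cos \<phi>) * cis (- \<phi>))"
    by (simp add: y mult_ac)
  then have "of_real (c * cos (\<phi> + of_int m * pi)) * cis (- (\<phi> + of_int m * pi)) = of_real (c * cos \<phi>) * cis (- \<phi>)"
    by (simp only: \<sigma> y_def[symmetric] of_real_1 mult_1)
  then have "1 - \<i> * of_real (c * cos (\<phi> + of_int m * pi)) * cis (- (\<phi> + of_int m * pi))
     = 1 - \<i> * of_real (c * cos \<phi>) * cis (- \<phi>)" by (simp only: mult.assoc)
  then show ?thesis by (simp only: lift_def)
qed

lemma continuous_lift:
  fixes f g :: "'a::t2_space \<Rightarrow> real"
  assumes "continuous_on A f" "continuous_on A g"
  shows "continuous_on A (\<lambda>x. lift (f x) (g x))"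
proof -
  have 1: "continuous_on A (\<lambda>x. 1 - \<i> * of_real (f x * cos (g x)) * cis (- g x))"
    by (intro continuous_intros assms)
  have "continuous_on (- \<real>\<^sub>\<le>\<^sub>0) Arg"
    by (intro continuous_at_imp_continuous_on ballI continuous_at_Arg) auto
  moreover have "(\<lambda>x. 1 - \<i> * of_real (f x * cos (g x)) * cis (- g x)) ` A \<subseteq> - \<real>\<^sub>\<le>\<^sub>0"
  proof (rule image_subsetI)
    fix x show "1 - \<i> * of_real (f x * cos (g x)) * cis (- g x) \<in> - \<real>\<^sub>\<le>\<^sub>0"
      using lift_arg_not_nonpos[of "f x" "g x"] by blast
  qed
  ultimately have "continuous_on A (\<lambda>x. Arg (1 - \<i> * of_real (f x * cos (g x)) * cis (- g x)))"
    using continuous_on_compose2[OF _ 1] by blast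
  then show ?thesis unfolding lift_def by (intro continuous_on_add continuous_on_const assms)
qed

lemma wedge_cis: "wedge (cis a) (cis b) = sin (b - a)"
  by (simp add: wedge_def sin_diff)

lemma wedge_scale: "wedge (of_real a * w) (of_real b * u) = a * b * wedge w u"
  by (simp add: wedge_def algebra_simps)

lemma parallel_cis: "wedge (cis a) (cis b) = 0 \<Longrightarrow> \<exists>m::int. b = a + of_int m * pi"
  unfolding wedge_cis sin_zero_iff_int2 by (metis add.commute diff_add_cancel)

lemma lift_inj: "lift c a = lift c b \<Longrightarrow> a = b"
proof -
  assume e: "lift c a = lift c b"
  obtain r where r: "r > 0" "step c (cis a) = of_real r * cis (lift c a)" using step_cis by blast
  obtain s where s: "s > 0" "step c (cis b) = of_real s * cis (lift c b)" using step_cis by blast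
  have "wedge (step c (cis a)) (step c (cis b)) = 0"
    unfolding r(2) s(2) wedge_scale e by (simp add: wedge_cis)
  then have "wedge (cis a) (cis b) = 0" by simp
  then obtain m :: int where m: "b = a + of_int m * pi" using parallel_cis by blast
  then show ?thesis using e lift_add_pi[of c a m] by simp
qed

text \<open>
  The lift is continuous and injective, hence monotone, and it commutes with translation by \<open>pi\<close>.
\<close>

lemma lift_strict_mono:
  assumes "a < b" shows "lift c a < lift c b"
proof -
  obtain m :: nat where m: "(b - a) / pi < real m" using reals_Archimedean2 by blast
  define d where "d = a + of_int (int m) * pi"
  have bd: "b < d" using m by (simp add: d_def divide_less_eq)
  have "(lift c a < lift c b \<and> lift c b < lift c d) \<or> (lift c d < lift c b \<and> lift c b < lift c a)"
  proof (rule continuous_inj_imp_mono[OF assms bd])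
    show "continuous_on {a..d} (lift c)"
      using continuous_lift[of "{a..d}" "\<lambda>_. c" "\<lambda>x. x"] by (simp add: continuous_intros)
    show "inj_on (lift c) {a..d}" by (rule inj_onI) (rule lift_inj)
  qed
  moreover have "lift c a < lift c d"
    using lift_add_pi[of c a "int m"] bd assms by (simp add: d_def)
  ultimately show ?thesis by linarith
qed

lemma lift_mono: "a \<le> b \<Longrightarrow> lift c a \<le> lift c b"
  using lift_strict_mono[of a b c] by (cases "a = b") auto

lemma lift_vertical: "cos \<phi> = 0 \<Longrightarrow> lift c \<phi> = \<phi> + pi / 2"
  by (simp add: lift_def)

text \<open>
  Increasing the potential turns all directions clockwise except the vertical one. The orientation is read off
  from one negative and one positive value of \<open>c\<close>, on which the argument has opposite signs.
\<close>

lemma lift_antimono_strict: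
  assumes "c1 < c2" "cos \<phi> \<noteq> 0"
  shows "lift c2 \<phi> < lift c1 \<phi>"
proof -
  have inj: "inj (\<lambda>c. lift c \<phi>)"
  proof (rule injI)
    fix a b assume e: "lift a \<phi> = lift b \<phi>"
    obtain r where r: "r > 0" "step a (cis \<phi>) = of_real r * cis (lift a \<phi>)" using step_cis by blast
    obtain s where s: "s > 0" "step b (cis \<phi>) = of_real s * cis (lift b \<phi>)" using step_cis by blast
    have "wedge (step a (cis \<phi>)) (step b (cis \<phi>)) = 0"
      unfolding r(2) s(2) wedge_scale e by (simp add: wedge_cis)
    then have "(a - b) * (cos \<phi> * cos \<phi>) = 0" by (simp add: wedge_def algebra_simps)
    then show "a = b" using assms(2) by simp
  qed
  have im: "Im (1 - \<i> * of_real (c * cos \<phi>) * cis (- \<phi>)) = - c * (cos \<phi>)\<^sup>2" for c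
    by (simp add: power2_eq_square)
  have p: "0 < (cos \<phi>)\<^sup>2" using assms(2) by simp
  have neg: "lift c \<phi> < \<phi> + pi / 2" if "c > 0" for c
  proof -
    have "Im (1 - \<i> * of_real (c * cos \<phi>) * cis (- \<phi>)) < 0" unfolding im using that p by simp
    then show ?thesis unfolding lift_def by (simp add: Arg_neg_iff)
  qed
  have pos: "lift c \<phi> > \<phi> + pi / 2" if "c < 0" for c
  proof -
    have "Im (1 - \<i> * of_real (c * cos \<phi>) * cis (- \<phi>)) > 0" unfolding im using that p by (simp add: mult_neg_pos)
    then have "Arg (1 - \<i> * of_real (c * cos \<phi>) * cis (- \<phi>)) > 0"
      using Arg_lt_pi by blast
    then show ?thesis unfolding lift_def by linarith
  qed
  define a where "a = min c1 0 - 1"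
  define b where "b = max c2 0 + 1"
  have ab: "a < c1" "a < 0" "c2 < b" "0 < b" by (auto simp: a_def b_def)
  have ba: "lift b \<phi> < lift a \<phi>" using neg[OF ab(4)] pos[OF ab(2)] by linarith
  have 1: "(lift a \<phi> < lift c1 \<phi> \<and> lift c1 \<phi> < lift b \<phi>) \<or> (lift b \<phi> < lift c1 \<phi> \<and> lift c1 \<phi> < lift a \<phi>)"
    using ab assms(1) by (intro continuous_inj_imp_mono[where f="\<lambda>c. lift c \<phi>"])
      (auto intro!: continuous_lift continuous_intros inj_on_subset[OF inj])
  have 2: "(lift c1 \<phi> < lift c2 \<phi> \<and> lift c2 \<phi> < lift b \<phi>) \<or> (lift b \<phi> < lift c2 \<phi> \<and> lift c2 \<phi> < lift c1 \<phi>)"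
    using ab assms(1) by (intro continuous_inj_imp_mono[where f="\<lambda>c. lift c \<phi>"])
      (auto intro!: continuous_lift continuous_intros inj_on_subset[OF inj])
  show ?thesis using 1 2 ba by linarith
qed

lemma lift_antimono: "c1 \<le> c2 \<Longrightarrow> lift c2 \<phi> \<le> lift c1 \<phi>"
  using lift_antimono_strict[of c1 c2 \<phi>] lift_vertical[of \<phi>]
  by (cases "c1 = c2"; cases "cos \<phi> = 0") auto

lemma lift_bounds: "\<phi> - pi / 2 \<le> lift c \<phi>" "lift c \<phi> \<le> \<phi> + 3 * pi / 2"
  using Arg_bounded[of "1 - \<i> * of_real (c * cos \<phi>) * cis (- \<phi>)"] by (auto simp: lift_def)

section \<open>Invariant sections and their labels\<close>

text \<open>
  An invariant section of directions, described by a lifted angle. The pair \<open>(k, l)\<close> is the label: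
  \<open>k\<close> counts the half turns of the section along the circle and \<open>l\<close> compares the lifted dynamics with the
  section.
\<close>

definition sect :: "real \<Rightarrow> (real \<Rightarrow> real) \<Rightarrow> (real \<Rightarrow> real) \<Rightarrow> int \<Rightarrow> int \<Rightarrow> bool" where
  "sect \<alpha> c s k l \<longleftrightarrow> continuous_on UNIV s \<and> (\<forall>x. lift (c x) (s x) = s (x + \<alpha>) + of_int l * pi)
     \<and> (\<forall>x. s (x + 1) = s x + of_int k * pi)"

lemma periodic1_bounded:
  fixes r :: "real \<Rightarrow> real"
  assumes "continuous_on UNIV r" "periodic1 r"
  shows "\<exists>B. \<forall>x. \<bar>r x\<bar> \<le> B"
proof -
  have "compact (r ` {0..1})"
    using assms(1) by (intro compact_continuous_image) (auto intro: continuous_on_subset)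
  then have "bounded (r ` {0..1})" by (rule compact_imp_bounded)
  then obtain B where "\<forall>y\<in>r ` {0..1}. norm y \<le> B" unfolding bounded_iff by blast
  then have B: "\<bar>r x\<bar> \<le> B" if "x \<in> {0..1}" for x using that by auto
  have "\<bar>r x\<bar> \<le> B" for x
  proof -
    have "r x = r (frac x)" using periodic1_add_int[OF assms(2), of "frac x" "\<lfloor>x\<rfloor>"] by (simp add: frac_def)
    then show ?thesis using B[of "frac x"] frac_lt_1[of x] by simp
  qed
  then show ?thesis by blast
qed

lemma sect_shift_iter: "sect \<alpha> c s k l \<Longrightarrow>
   - (real n * pi / 2) \<le> s (x + real n * \<alpha>) + real n * of_int l * pi - s x
   \<and> s (x + real n * \<alpha>) + real n * of_int l * pi - s x \<le> 3 * (real n * pi / 2)"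
proof (induction n)
  case (Suc n)
  have "lift (c (x + real n * \<alpha>)) (s (x + real n * \<alpha>)) = s (x + real (Suc n) * \<alpha>) + of_int l * pi"
    using Suc.prems unfolding sect_def by (simp add: algebra_simps)
  moreover note lift_bounds[where \<phi>="s (x + real n * \<alpha>)" and c="c (x + real n * \<alpha>)"]
  moreover have "real (Suc n) * of_int l * pi = real n * of_int l * pi + of_int l * pi"
      "real (Suc n) * pi / 2 = real n * pi / 2 + pi / 2"
    by (simp_all add: field_simps)
  ultimately show ?case using Suc.IH[OF Suc.prems] by linarith
qed simp

text \<open>
  The number \<open>k * \<alpha> + l\<close> is the mean rotation per step in units of \<open>pi\<close>, and a lifted step rotates by
  between \<open>- pi / 2\<close> and \<open>3 * pi / 2\<close>.
\<close>

lemma label_range: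
  assumes s: "sect \<alpha> c s k l"
  shows "- 1/2 \<le> of_int k * \<alpha> + of_int l \<and> of_int k * \<alpha> + of_int l \<le> 3/2"
proof -
  define r where "r x = s x - of_int k * pi * x" for x
  have "continuous_on UNIV r" unfolding r_def using s by (auto simp: sect_def intro!: continuous_intros)
  moreover have "periodic1 r" using s by (simp add: sect_def periodic1_def r_def algebra_simps)
  ultimately obtain B where B: "\<And>x. \<bar>r x\<bar> \<le> B" using periodic1_bounded by blast
  define \<theta> where "\<theta> = of_int k * \<alpha> + of_int l"
  have key: "real n * (\<theta> - 3/2) * pi \<le> 2 * B \<and> real n * (- 1/2 - \<theta>) * pi \<le> 2 * B" for n
  proof -
    have e: "s (real n * \<alpha>) + real n * of_int l * pi - s 0 = real n * \<theta> * pi + r (real n * \<alpha>) - r 0"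
      by (simp add: r_def \<theta>_def algebra_simps)
    show ?thesis
      using sect_shift_iter[OF s, of n 0] B[of "real n * \<alpha>"] B[of 0] e
      by (simp add: algebra_simps abs_le_iff)
  qed
  have "\<not> a > 0" if "\<And>n::nat. real n * a * pi \<le> 2 * B" for a
  proof
    assume a: "a > 0"
    obtain n :: nat where "2 * B / (a * pi) < real n" using reals_Archimedean2 by blast
    then show False using that[of n] a by (simp add: field_simps not_less[symmetric])
  qed
  from this[of "\<theta> - 3/2"] this[of "- 1/2 - \<theta>"] key show ?thesis
    by (auto simp: \<theta>_def not_less)
qed

lemma irrational_invariant_closed:
  assumes irr: "\<alpha> \<notin> \<rat>" and cl: "closed A" and x: "x0 \<in> A"
    and inv: "\<And>x. x \<in> A \<Longrightarrow> x + \<alpha> \<in> A" and per: "\<And>x. x + 1 \<in> A \<longleftrightarrow> x \<in> A"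
  shows "A = (UNIV :: real set)"
proof -
  have inv': "x0 + real n * \<alpha> \<in> A" for n
  proof (induction n)
    case (Suc n) then show ?case using inv[OF Suc] by (simp add: algebra_simps)
  qed (use x in simp)
  have up: "y \<in> A \<Longrightarrow> y + real n \<in> A" for y n
  proof (induction n)
    case (Suc n) then show ?case using per[of "y + real n"] by (simp add: algebra_simps)
  qed simp
  have down: "y + real n \<in> A \<Longrightarrow> y \<in> A" for y n
  proof (induction n arbitrary: y)
    case (Suc n)
    then have "(y + 1) + real n \<in> A" by (simp add: algebra_simps)
    then have "y + 1 \<in> A" by (rule Suc.IH)
    then show ?case using per by blast
  qed simp
  have per': "y \<in> A \<Longrightarrow> y + of_int m \<in> A" for y m
  proof (cases m)
    case (neg n)
    assume "y \<in> A"
    then show ?thesis using neg down[of "y + of_int m" "Suc n"] by simp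
  qed (use up in auto)
  have "z \<in> closure A" for z
    unfolding closure_approachable
  proof (intro allI impI)
    fix e :: real assume e: "0 < e"
    obtain h k where k: "k > 0" "\<bar>of_int k * \<alpha> - of_int h - (z - x0)\<bar> < e"
      using sequence_of_fractional_parts_is_dense[OF irr e, of "z - x0"] by metis
    define n where "n = nat k"
    have n: "real n = of_int k" using k(1) by (simp add: n_def)
    have "x0 + real n * \<alpha> + of_int (- h) \<in> A" by (intro per' inv')
    moreover have "dist (x0 + real n * \<alpha> + of_int (- h)) z < e"
      using k(2) n by (simp add: dist_real_def abs_if split: if_splits)
    ultimately show "\<exists>y\<in>A. dist y z < e" by blast
  qed
  then show ?thesis using cl by auto
qed

text \<open>
  A vertical direction is sent to a horizontal one by every step.
\<close>

lemma vertical_not_twice: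
  assumes "sect \<alpha> c s k l" "cos (s y) = 0" shows "cos (s (y + \<alpha>)) \<noteq> 0"
proof -
  have l1: "lift (c y) (s y) = s (y + \<alpha>) + of_int l * pi" using assms(1) by (simp add: sect_def)
  have e: "s (y + \<alpha>) = s y + pi / 2 - of_int l * pi"
    using l1 lift_vertical[OF assms(2)] by simp
  have sl: "sin (of_int l * pi) = 0" by (simp add: sin_zero_iff_int2)
  then have cl: "cos (of_int l * pi) \<noteq> 0" using sin_cos_squared_add[of "of_int l * pi"] by auto
  have s1y: "sin (s y) \<noteq> 0" using assms(2) sin_cos_squared_add[of "s y"] by auto
  have "cos (s (y + \<alpha>)) = - sin (s y) * cos (of_int l * pi)"
    unfolding e using sl by (simp add: cos_diff cos_add)
  then show ?thesis using s1y cl by simp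
qed

text \<open>
  Equal labels make the difference of the two angles a function on the circle. By monotonicity the set where
  it is nonnegative is forward invariant, and a step moves it into the set where the difference is positive unless the
  direction is vertical, which does not happen twice in a row. If the sections met, then by density of the orbits
  the difference would be nonnegative everywhere, hence positive everywhere.
\<close>

lemma sections_never_meet:
  assumes irr: "\<alpha> \<notin> \<rat>" and s1: "sect \<alpha> c1 s1 k l" and s2: "sect \<alpha> c2 s2 k l"
    and less: "\<And>x. c1 x < c2 x"
  shows "s1 x \<noteq> s2 x + of_int m * pi"
proof
  assume eq: "s1 x = s2 x + of_int m * pi"
  define p where "p y = s1 y - s2 y - of_int m * pi" for y
  have contp: "continuous_on UNIV p" unfolding p_def using s1 s2 by (auto simp: sect_def intro!: continuous_intros)
  have perp: "p (y + 1) = p y" for y using s1 s2 by (simp add: sect_def p_def)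
  have l1: "lift (c1 y) (s1 y) = s1 (y + \<alpha>) + of_int l * pi" for y using s1 by (simp add: sect_def)
  have l2: "lift (c2 y) (s2 y + of_int m * pi) = s2 (y + \<alpha>) + of_int m * pi + of_int l * pi" for y
    using s2 lift_add_pi by (simp add: sect_def)
  have ge: "0 \<le> p (y + \<alpha>)" if "0 \<le> p y" for y
  proof -
    have "lift (c2 y) (s2 y + of_int m * pi) \<le> lift (c1 y) (s2 y + of_int m * pi)"
      using less[of y] by (intro lift_antimono) simp
    also have "\<dots> \<le> lift (c1 y) (s1 y)" using that by (intro lift_mono) (simp add: p_def)
    finally show ?thesis unfolding l1 l2 by (simp add: p_def)
  qed
  have gt: "0 < p (y + \<alpha>)" if "0 < p y" for y
  proof -
    have "lift (c2 y) (s2 y + of_int m * pi) \<le> lift (c1 y) (s2 y + of_int m * pi)"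
      using less[of y] by (intro lift_antimono) simp
    also have "\<dots> < lift (c1 y) (s1 y)" using that by (intro lift_strict_mono) (simp add: p_def)
    finally show ?thesis unfolding l1 l2 by (simp add: p_def)
  qed
  have gt': "0 < p (y + \<alpha>)" if "0 \<le> p y" "cos (s1 y) \<noteq> 0" for y
  proof -
    have "lift (c2 y) (s2 y + of_int m * pi) \<le> lift (c2 y) (s1 y)"
      using that by (intro lift_mono) (simp add: p_def)
    also have "\<dots> < lift (c1 y) (s1 y)" using that less by (intro lift_antimono_strict) auto
    finally show ?thesis unfolding l1 l2 by (simp add: p_def)
  qed
  have two: "0 < p (y + \<alpha> + \<alpha>)" if "0 \<le> p y" for y
  proof (cases "cos (s1 y) = 0")
    case True
    then show ?thesis using gt'[OF ge[OF that]] vertical_not_twice[OF s1] by blast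
  next
    case False
    then show ?thesis using gt[OF gt'[OF that False]] by blast
  qed
  have "{y. 0 \<le> p y} = UNIV"
  proof (rule irrational_invariant_closed[OF irr, of _ x])
    show "closed {y. 0 \<le> p y}" using contp by (intro closed_Collect_le continuous_intros)
  qed (use eq ge perp in \<open>auto simp: p_def\<close>)
  then have "0 \<le> p (x - \<alpha> - \<alpha>)" by auto
  from two[OF this] have "0 < p x" by simp
  then show False using eq by (simp add: p_def)
qed

section \<open>Stable sections over a spectral gap\<close>

lemma continuous_orb_param:
  assumes "continuous_on S (\<lambda>p. C (fst p) (snd p))" 
    and "\<And>p y. p \<in> S \<Longrightarrow> (fst p, y) \<in> S"
  shows "continuous_on S (\<lambda>p. orb \<alpha> (C (fst p)) (snd p) w n)"
proof (induction n)
  case (Suc n)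
  have "continuous_on S (\<lambda>p. C (fst p) (snd p + real n * \<alpha>))"
  proof -
    have "continuous_on S (\<lambda>p. (fst p, snd p + real n * \<alpha>))" by (intro continuous_intros)
    moreover have "(\<lambda>p. (fst p, snd p + real n * \<alpha>)) ` S \<subseteq> S" using assms(2) by blast
    ultimately show ?thesis using continuous_on_compose2[OF assms(1)] by fastforce
  qed
  then show ?case using Suc by (simp add: step_def Complex_eq) (intro continuous_intros)
qed simp

lemma orb_continuous:
  assumes "continuous_on UNIV c" and that: "continuous_on UNIV f"
  shows "continuous_on UNIV (\<lambda>q :: real \<times> complex. orb \<alpha> c (fst q + b) (f (snd q)) n)"
proof (induction n)
  case 0
  have "continuous_on UNIV (\<lambda>q :: real \<times> complex. f (snd q))"
    by (rule continuous_on_compose2[OF that]) (intro continuous_intros, auto)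
  then show ?case by simp
next
  case (Suc n)
  have "continuous_on UNIV (\<lambda>q :: real \<times> complex. c (fst q + b + real n * \<alpha>))"
    by (rule continuous_on_compose2[OF assms(1)]) (intro continuous_intros, auto)
  then show ?case using Suc by (simp add: step_def Complex_eq) (intro continuous_intros)
qed

text \<open>
  The stable direction is a line and not a vector, so it is described by the square \<open>w\<^sup>2\<close> of a unit vector.
  In terms of this variable the squared norms are affine, hence continuous.
\<close>

lemma orb_normsq_double_angle:
  assumes "cmod w = 1"
  shows "(cmod (orb \<alpha> c x w n))\<^sup>2 = (1 + Re (w\<^sup>2)) / 2 * (cmod (orb \<alpha> c x 1 n))\<^sup>2
     + (1 - Re (w\<^sup>2)) / 2 * (cmod (orb \<alpha> c x \<i> n))\<^sup>2
     + Im (w\<^sup>2) * (Re (orb \<alpha> c x 1 n) * Re (orb \<alpha> c x \<i> n) + Im (orb \<alpha> c x 1 n) * Im (orb \<alpha> c x \<i> n))"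
proof -
  define P where "P = orb \<alpha> c x 1 n"
  define R where "R = orb \<alpha> c x \<i> n"
  define a where "a = Re w"
  define b where "b = Im w"
  have ab: "a\<^sup>2 + b\<^sup>2 = 1" using assms by (simp add: a_def b_def cmod_power2[symmetric])
  have z: "Re (w\<^sup>2) = a\<^sup>2 - b\<^sup>2" "Im (w\<^sup>2) = 2 * a * b" by (simp_all add: a_def b_def power2_eq_square)
  have o: "orb \<alpha> c x w n = of_real a * P + of_real b * R" unfolding P_def R_def a_def b_def by (rule orb_basis)
  have h: "(1 + (a\<^sup>2 - b\<^sup>2)) / 2 = a\<^sup>2" "(1 - (a\<^sup>2 - b\<^sup>2)) / 2 = b\<^sup>2" using ab by auto
  have "(cmod (of_real a * P + of_real b * R))\<^sup>2 = a\<^sup>2 * (cmod P)\<^sup>2 + b\<^sup>2 * (cmod R)\<^sup>2 + (2 * a * b) * (Re P * Re R + Im P * Im R)"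
    by (simp add: cmod_power2) (simp add: power2_eq_square algebra_simps)
  then show ?thesis unfolding o z h P_def[symmetric] R_def[symmetric] .
qed

lemma integer_multiples_constant:
  fixes f :: "'a::topological_space \<Rightarrow> real"
  assumes "continuous_on S f" "connected S" "\<And>x. x \<in> S \<Longrightarrow> \<exists>m::int. f x = of_int m * pi"
  shows "\<exists>m::int. \<forall>x\<in>S. f x = of_int m * pi"
proof (cases "S = {}")
  case False
  have "f constant_on S"
  proof (rule continuous_discrete_range_constant[OF assms(2,1)])
    fix x assume x: "x \<in> S"
    obtain m :: int where m: "f x = of_int m * pi" using assms(3)[OF x] by blast
    have "pi \<le> norm (f y - f x)" if y: "y \<in> S" "f y \<noteq> f x" for y
    proof -
      obtain n :: int where n: "f y = of_int n * pi" using assms(3)[OF y(1)] by blast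
      have "n \<noteq> m" using m n y(2) by auto
      then have "1 \<le> \<bar>n - m\<bar>" by linarith
      then have "1 \<le> \<bar>real_of_int n - real_of_int m\<bar>" by linarith
      then have "1 * pi \<le> \<bar>real_of_int n - real_of_int m\<bar> * pi" by (rule mult_right_mono) simp
      then show ?thesis using m n by (simp add: left_diff_distrib[symmetric] abs_mult)
    qed
    then show "\<exists>e>0. \<forall>y. y \<in> S \<and> f y \<noteq> f x \<longrightarrow> e \<le> norm (f y - f x)"
      by (intro exI[of _ pi]) auto
  qed
  then show ?thesis using False assms(3) unfolding constant_on_def by (metis ex_in_conv)
qed simp

text \<open>
  The squares of the stable unit vectors form a function whose graph is closed, being cut out by the uniform bound
  for stable orbits, with values in the compact circle; so it is continuous, jointly in the
  parameter and the phase, and it has a continuous logarithm because the domain is contractible. The label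
  is a continuous function with values in a discrete set, hence the same for all parameters.
\<close>

lemma stab_section_family:
  fixes C :: "real \<Rightarrow> real \<Rightarrow> real"
  assumes ab: "a \<le> b"
    and cont: "continuous_on ({a..b} \<times> UNIV) (\<lambda>p. C (fst p) (snd p))"
    and per: "\<And>\<tau>. \<tau> \<in> {a..b} \<Longrightarrow> periodic1 (C \<tau>)"
    and G: "G > 0" and g: "\<And>\<tau>. \<tau> \<in> {a..b} \<Longrightarrow> gapped \<alpha> (C \<tau>) G"
  obtains s k l where "continuous_on ({a..b} \<times> UNIV) (\<lambda>p. s (fst p) (snd p))"
    "\<And>\<tau>. \<tau> \<in> {a..b} \<Longrightarrow> sect \<alpha> (C \<tau>) (s \<tau>) k l"
    "\<And>\<tau> x. \<tau> \<in> {a..b} \<Longrightarrow> stab \<alpha> (C \<tau>) x (cis (s \<tau> x))"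
proof -
  define S where "S = {a..b} \<times> (UNIV :: real set)"
  have S: "fst p \<in> {a..b}" if "p \<in> S" for p using that by (auto simp: S_def)
  define K where "K = 1 + 4 / G\<^sup>2"
  have "\<forall>p\<in>S. \<exists>w. cmod w = 1 \<and> stab \<alpha> (C (fst p)) (snd p) w"
    using stab_exists[OF g G] S by blast
  then obtain W where W: "\<And>p. p \<in> S \<Longrightarrow> cmod (W p) = 1" "\<And>p. p \<in> S \<Longrightarrow> stab \<alpha> (C (fst p)) (snd p) (W p)"
    by metis
  have uniq: "w\<^sup>2 = (W p)\<^sup>2" if p: "p \<in> S" and w: "cmod w = 1" "stab \<alpha> (C (fst p)) (snd p) w" for p w
  proof -
    have "wedge (W p) w = 0" using stab_parallel[OF g[OF S[OF p]] G W(2)[OF p] w(2)] .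
    moreover have "W p \<noteq> 0" using W(1)[OF p] by auto
    ultimately obtain r where r: "w = of_real r * W p" using wedge_0_imp by blast
    then have "\<bar>r\<bar> = 1" using w(1) W(1)[OF p] by (simp add: norm_mult)
    then have "r\<^sup>2 = 1" by (simp add: abs_square_eq_1)
    then show ?thesis by (simp add: r power_mult_distrib flip: of_real_power)
  qed
  have uniqW: "stab \<alpha> (C (fst p)) (snd p) w" if p: "p \<in> S" and w: "cmod w = 1" "w\<^sup>2 = (W p)\<^sup>2" for p w
  proof -
    have "w = W p \<or> w = - W p" using w(2) by (simp add: power2_eq_iff)
    then show ?thesis using W(2)[OF p] stab_scale[OF W(2)[OF p], of "-1"] by auto
  qed
  define f where "f p = (W p)\<^sup>2" for p
  define H where "H n p z = (1 + Re z) / 2 * (cmod (orb \<alpha> (C (fst p)) (snd p) 1 n))\<^sup>2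
     + (1 - Re z) / 2 * (cmod (orb \<alpha> (C (fst p)) (snd p) \<i> n))\<^sup>2
     + Im z * (Re (orb \<alpha> (C (fst p)) (snd p) 1 n) * Re (orb \<alpha> (C (fst p)) (snd p) \<i> n)
         + Im (orb \<alpha> (C (fst p)) (snd p) 1 n) * Im (orb \<alpha> (C (fst p)) (snd p) \<i> n))" for n p z
  have H: "H n p (w\<^sup>2) = (cmod (orb \<alpha> (C (fst p)) (snd p) w n))\<^sup>2" if "cmod w = 1" for n p w
    unfolding H_def by (rule orb_normsq_double_angle[OF that, symmetric])
  have Hc: "continuous_on (S \<times> UNIV) (\<lambda>(p, z). H n p z)" for n
  proof -
    have "continuous_on S (\<lambda>p. orb \<alpha> (C (fst p)) (snd p) w n)" for w
      using cont by (intro continuous_orb_param) (auto simp: S_def)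
    then have "continuous_on (S \<times> (UNIV::complex set)) (\<lambda>q. orb \<alpha> (C (fst (fst q))) (snd (fst q)) w n)" for w
      by (rule continuous_on_compose2[where f=fst and g="\<lambda>p. orb \<alpha> (C (fst p)) (snd p) w n"]) (auto intro: continuous_intros)
    then show ?thesis unfolding H_def case_prod_beta by (intro continuous_intros) auto
  qed
  have "continuous_on S f"
  proof (rule continuous_from_closed_graph[of "sphere 0 1"])
    show "f \<in> S \<rightarrow> sphere 0 1" using W(1) by (auto simp: f_def norm_power)
    have clS: "closed S" by (simp add: S_def closed_Times)
    have "(\<lambda>p. (p, f p)) ` S = (\<Inter>n. {q \<in> S \<times> UNIV. (\<lambda>(p, z). H n p z) q \<le> K}) \<inter> (UNIV \<times> sphere 0 1)"
    proof (intro equalityI subsetI)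
      fix q assume "q \<in> (\<lambda>p. (p, f p)) ` S"
      then obtain p where p: "p \<in> S" "q = (p, f p)" by blast
      have "H n p (f p) \<le> K" for n
        using stab_bound[OF g[OF S[OF p(1)]] G W(2)[OF p(1)], of n] W(1)[OF p(1)]
        by (simp add: f_def H K_def)
      then show "q \<in> (\<Inter>n. {q \<in> S \<times> UNIV. (\<lambda>(p, z). H n p z) q \<le> K}) \<inter> (UNIV \<times> sphere 0 1)"
        using p W(1)[OF p(1)] by (auto simp: f_def norm_power)
    next
      fix q assume q: "q \<in> (\<Inter>n. {q \<in> S \<times> UNIV. (\<lambda>(p, z). H n p z) q \<le> K}) \<inter> (UNIV \<times> sphere 0 1)"
      obtain p z where pz: "q = (p, z)" by (cases q)
      have p: "p \<in> S" and z: "cmod z = 1" and HK: "H n p z \<le> K" for n using q pz by auto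
      define w where "w = csqrt z"
      have w: "w\<^sup>2 = z" by (simp add: w_def)
      have w1: "cmod w = 1" using z by (simp add: w_def norm_csqrt)
      have "cmod (orb \<alpha> (C (fst p)) (snd p) w n) \<le> sqrt K" for n
        using HK[of n] H[OF w1, of n p] by (intro real_le_rsqrt) (simp add: w)
      then have "stab \<alpha> (C (fst p)) (snd p) w" unfolding stab_def bounded_iff by auto
      then have "z = f p" using uniq[OF p w1] by (simp add: w f_def)
      then show "q \<in> (\<lambda>p. (p, f p)) ` S" using p pz by blast
    qed
    moreover have "closed \<dots>"
      using clS by (intro closed_Int closed_INT ballI continuous_on_closed_Collect_le Hc closed_Times continuous_intros) auto
    ultimately show "closed ((\<lambda>p. (p, f p)) ` S)" by simp
  qed simp
  moreover have "contractible S" unfolding S_def by (intro convex_imp_contractible convex_Times) auto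
  moreover have "f p \<noteq> 0" if "p \<in> S" for p using W(1)[OF that] by (auto simp: f_def)
  ultimately obtain L where L: "continuous_on S L" "\<And>p. p \<in> S \<Longrightarrow> f p = exp (L p)"
    using continuous_logarithm_on_contractible by blast
  define s where "s \<tau> x = Im (L (\<tau>, x)) / 2" for \<tau> x
  have sc: "continuous_on S (\<lambda>p. s (fst p) (snd p))" unfolding s_def using L(1) by (simp add: continuous_intros)
  have cs: "(cis (s \<tau> x))\<^sup>2 = (W (\<tau>, x))\<^sup>2" if "\<tau> \<in> {a..b}" for \<tau> x
  proof -
    have p: "(\<tau>, x) \<in> S" using that by (simp add: S_def)
    have "cmod (exp (L (\<tau>, x))) = 1" using L(2)[OF p] W(1)[OF p] by (simp add: f_def norm_power flip: L(2)[OF p])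
    then have "Re (L (\<tau>, x)) = 0" by simp
    then have "exp (L (\<tau>, x)) = cis (Im (L (\<tau>, x)))" by (simp add: exp_eq_polar)
    then show ?thesis using L(2)[OF p] by (simp add: f_def s_def Complex.DeMoivre)
  qed
  have st: "stab \<alpha> (C \<tau>) x (cis (s \<tau> x))" if "\<tau> \<in> {a..b}" for \<tau> x
    using uniqW[of "(\<tau>, x)" "cis (s \<tau> x)"] cs[OF that] that by (simp add: S_def)
  have conS: "connected S" unfolding S_def by (intro convex_connected convex_Times) auto
  have "\<exists>k::int. \<forall>p\<in>S. s (fst p) (snd p + 1) - s (fst p) (snd p) = of_int k * pi"
  proof (rule integer_multiples_constant[OF _ conS])
    have "continuous_on S (\<lambda>p. (fst p, snd p + 1::real))" by (intro continuous_intros)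
    moreover have "(\<lambda>p. (fst p, snd p + 1::real)) ` S \<subseteq> S" by (auto simp: S_def)
    ultimately have "continuous_on S (\<lambda>p. s (fst p) (snd p + 1))"
      using continuous_on_compose2[OF sc] by fastforce
    with sc show "continuous_on S (\<lambda>p. s (fst p) (snd p + 1) - s (fst p) (snd p))" by (intro continuous_intros)
    fix p assume "p \<in> S"
    then have p: "fst p \<in> {a..b}" by (rule S)
    have "stab \<alpha> (C (fst p)) (snd p) (cis (s (fst p) (snd p + 1)))"
      using st[OF p, of "snd p + 1"] by (simp add: stab_periodic[OF per[OF p]])
    then have "wedge (cis (s (fst p) (snd p))) (cis (s (fst p) (snd p + 1))) = 0"
      using stab_parallel[OF g[OF p] G st[OF p]] by blast
    from parallel_cis[OF this] show "\<exists>m::int. s (fst p) (snd p + 1) - s (fst p) (snd p) = of_int m * pi"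
      by auto
  qed
  then obtain k :: int where k: "\<And>p. p \<in> S \<Longrightarrow> s (fst p) (snd p + 1) - s (fst p) (snd p) = of_int k * pi" by blast
  have "\<exists>l::int. \<forall>p\<in>S. lift (C (fst p) (snd p)) (s (fst p) (snd p)) - s (fst p) (snd p + \<alpha>) = of_int l * pi"
  proof (rule integer_multiples_constant[OF _ conS])
    have "continuous_on S (\<lambda>p. (fst p, snd p + \<alpha>))" by (intro continuous_intros)
    moreover have "(\<lambda>p. (fst p, snd p + \<alpha>)) ` S \<subseteq> S" by (auto simp: S_def)
    ultimately have "continuous_on S (\<lambda>p. s (fst p) (snd p + \<alpha>))"
      using continuous_on_compose2[OF sc] by fastforce
    with sc cont show "continuous_on S (\<lambda>p. lift (C (fst p) (snd p)) (s (fst p) (snd p)) - s (fst p) (snd p + \<alpha>))"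
      by (intro continuous_intros continuous_lift) (auto simp: S_def)
    fix p assume "p \<in> S"
    then have p: "fst p \<in> {a..b}" by (rule S)
    obtain r where r: "r > 0" "step (C (fst p) (snd p)) (cis (s (fst p) (snd p))) = of_real r * cis (lift (C (fst p) (snd p)) (s (fst p) (snd p)))"
      using step_cis by blast
    have "stab \<alpha> (C (fst p)) (snd p + \<alpha>) (of_real r * cis (lift (C (fst p) (snd p)) (s (fst p) (snd p))))"
      using stab_step[OF st[OF p, of "snd p"]] r(2) by simp
    then have "wedge (cis (s (fst p) (snd p + \<alpha>))) (of_real r * cis (lift (C (fst p) (snd p)) (s (fst p) (snd p)))) = 0"
      using stab_parallel[OF g[OF p] G st[OF p]] by blast
    then have "wedge (cis (s (fst p) (snd p + \<alpha>))) (cis (lift (C (fst p) (snd p)) (s (fst p) (snd p)))) = 0"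
      using wedge_scale[of 1 "cis (s (fst p) (snd p + \<alpha>))" r] r(1) by simp
    from parallel_cis[OF this] show "\<exists>m::int. lift (C (fst p) (snd p)) (s (fst p) (snd p)) - s (fst p) (snd p + \<alpha>) = of_int m * pi"
      by auto
  qed
  then obtain l :: int where l: "\<And>p. p \<in> S \<Longrightarrow> lift (C (fst p) (snd p)) (s (fst p) (snd p)) - s (fst p) (snd p + \<alpha>) = of_int l * pi" by blast
  have "sect \<alpha> (C \<tau>) (s \<tau>) k l" if t: "\<tau> \<in> {a..b}" for \<tau>
    unfolding sect_def
  proof (intro conjI allI)
    have "continuous_on UNIV (\<lambda>x. (\<tau>, x) :: real \<times> real)" by (intro continuous_intros)
    moreover have "range (\<lambda>x. (\<tau>, x)) \<subseteq> S" using t by (auto simp: S_def)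
    ultimately show "continuous_on UNIV (s \<tau>)" using continuous_on_compose2[OF sc] by fastforce
    show "lift (C \<tau> x) (s \<tau> x) = s \<tau> (x + \<alpha>) + of_int l * pi" for x
      using l[of "(\<tau>, x)"] t by (simp add: S_def)
    show "s \<tau> (x + 1) = s \<tau> x + of_int k * pi" for x
      using k[of "(\<tau>, x)"] t by (simp add: S_def)
  qed
  then show ?thesis using that[of s k l] sc[unfolded S_def] st by blast
qed

lemma stab_sect_label_unique:
  assumes G: "G > 0" "gapped \<alpha> c G"
    and s: "sect \<alpha> c s k l" "\<And>x. stab \<alpha> c x (cis (s x))"
    and s': "sect \<alpha> c s' k' l'" "\<And>x. stab \<alpha> c x (cis (s' x))"
  shows "k = k'" "l = l'"
proof -
  have "\<exists>m::int. \<forall>x\<in>UNIV. s' x - s x = of_int m * pi"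
  proof (rule integer_multiples_constant)
    show "continuous_on UNIV (\<lambda>x. s' x - s x)" using s(1) s'(1) by (auto simp: sect_def intro!: continuous_intros)
    fix x
    have "wedge (cis (s x)) (cis (s' x)) = 0" using stab_parallel[OF G(2,1) s(2) s'(2)] .
    from parallel_cis[OF this] show "\<exists>m::int. s' x - s x = of_int m * pi" by auto
  qed simp
  then obtain m :: int where m: "\<And>x. s' x = s x + of_int m * pi"
    by (metis UNIV_I add.commute diff_add_cancel)
  have u: "s (0 + 1) = s 0 + of_int k * pi" "s' (0 + 1) = s' 0 + of_int k' * pi"
    "lift (c 0) (s 0) = s (0 + \<alpha>) + of_int l * pi" "lift (c 0) (s' 0) = s' (0 + \<alpha>) + of_int l' * pi"
    using s(1) s'(1) unfolding sect_def by blast+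
  have "of_int k * pi = of_int k' * pi" using u(1,2) by (simp add: m)
  then show "k = k'" by simp
  have "of_int l * pi = of_int l' * pi" using u(3,4) by (simp add: m lift_add_pi)
  then show "l = l'" by simp
qed

section \<open>Equal labels lie in the same gap\<close>

text \<open>
  In the basis \<open>e1, e2\<close> of the first cone and \<open>E1, E2\<close> of the second one, the product of the two coordinates is a
  quadratic form. A linear map with positive matrix entries and positive determinant strictly increases
  this form, as is seen by completing a square.
\<close>

lemma cone_form_positive:
  assumes D: "wedge e1 e2 = D" "D > 0" and D': "wedge E1 E2 = D'" "D' > 0" and f: "wedge f1 f2 = D"
    and pos: "wedge f1 E2 > 0" "wedge f2 E2 > 0" "wedge E1 f1 > 0" "wedge E1 f2 > 0"
    and z: "z1 \<noteq> 0 \<or> z2 \<noteq> 0"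
  shows "z1 * z2 * D < (z1 * wedge f1 E2 + z2 * wedge f2 E2) * (z1 * wedge E1 f1 + z2 * wedge E1 f2) / D'"
proof -
  define a where "a = wedge f1 E2"
  define b where "b = wedge f2 E2"
  define c where "c = wedge E1 f1"
  define d where "d = wedge E1 f2"
  have p: "a > 0" "b > 0" "c > 0" "d > 0" using pos by (auto simp: a_def b_def c_def d_def)
  have pl: "a * d - b * c = D * D'"
    unfolding a_def b_def c_def d_def D'(1)[symmetric] f[symmetric]
    by (simp add: wedge_def algebra_simps)
  have "(a * c) * ((z1 * a + z2 * b) * (z1 * c + z2 * d) - z1 * z2 * (a * d - b * c))
      = (a * c * z1 + b * c * z2)\<^sup>2 + b * c * (a * d - b * c) * z2\<^sup>2"
    by (simp add: power2_eq_square algebra_simps)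
  also have "\<dots> > 0"
  proof (cases "z2 = 0")
    case True then show ?thesis using z p by simp
  next
    case False
    have "0 < b * c * (a * d - b * c) * z2\<^sup>2" using False p D(2) D'(2) pl by simp
    then show ?thesis by (simp add: add_nonneg_pos)
  qed
  finally have X: "0 < (a * c) * ((z1 * a + z2 * b) * (z1 * c + z2 * d) - z1 * z2 * (a * d - b * c))" .
  have "0 < a * c" using p by simp
  from zero_less_mult_pos[OF X this]
  have "0 < (z1 * a + z2 * b) * (z1 * c + z2 * d) - z1 * z2 * (D * D')" unfolding pl .
  then show ?thesis using D'(2) unfolding a_def b_def c_def d_def by (simp add: less_divide_eq mult_ac)
qed

lemma avoid_multiples_of_pi:
  fixes p :: "'a::topological_space \<Rightarrow> real"
  assumes cont: "continuous_on S p" and con: "connected S" and av: "\<And>x (m::int). x \<in> S \<Longrightarrow> p x \<noteq> of_int m * pi"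
    and x0: "x0 \<in> S" "of_int j * pi < p x0" "p x0 < (of_int j + 1) * pi"
    and x: "x \<in> S"
  shows "of_int j * pi < p x" "p x < (of_int j + 1) * pi"
proof -
  have conn: "connected (p ` S)" using cont con by (rule connected_continuous_image)
  have mem: "p x0 \<in> p ` S" "p x \<in> p ` S" using x0 x by auto
  show "of_int j * pi < p x"
  proof (rule ccontr)
    assume "\<not> ?thesis"
    then have "of_int j * pi \<in> p ` S" using connectedD_interval[OF conn mem(2,1)] x0(2) by simp
    then show False using av by (metis imageE)
  qed
  show "p x < (of_int j + 1) * pi"
  proof (rule ccontr)
    assume "\<not> ?thesis"
    then have "(of_int j + 1) * pi \<in> p ` S" using connectedD_interval[OF conn mem(1,2)] x0(3) by simp
    then show False using av[of _ "j + 1"] by (metis imageE of_int_add of_int_1)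
  qed
qed

lemma pi_floor: "of_int \<lfloor>y / pi\<rfloor> * pi \<le> y" "y < (of_int \<lfloor>y / pi\<rfloor> + 1) * pi"
  using of_int_floor_le[of "y / pi"] floor_correct[of "y / pi"]
  by (simp_all only: le_divide_eq divide_less_eq) auto

lemma sect_shift: "sect \<alpha> c s k l \<Longrightarrow> sect \<alpha> c (\<lambda>x. s x + of_int m * pi) k l"
  unfolding sect_def by (auto simp: lift_add_pi intro!: continuous_intros)

lemma sin_add_2pi_int: "sin (x + of_int (2 * m) * pi) = sin x"
  using sin_integer_2pi[of "of_int m"] cos_integer_2pi[of "of_int m"]
  by (simp add: sin_add mult_ac)

text \<open>
  The two sections bound a field of cones. For a potential between \<open>c1\<close> and \<open>c2\<close> both edges of the
  cone move strictly inwards within two steps; two, because a vertical direction does not feel the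
  potential. The product of the coordinates with respect to the edges is then a form that strictly increases along
  orbits, and by compactness it increases uniformly.
\<close>

lemma gapped_between_sections:
  assumes irr: "\<alpha> \<notin> \<rat>" and s1: "sect \<alpha> c1 s1 k l" and s2: "sect \<alpha> c2 s2 k l"
    and c1: "\<And>x. c1 x < c x" and c2: "\<And>x. c x < c2 x"
    and contc: "continuous_on UNIV c" and perc: "periodic1 c"
  shows "\<exists>G>0. gapped \<alpha> c G"
proof -
  define j where "j = \<lfloor>(s1 0 - s2 0) / pi\<rfloor>"
  define t2 where "t2 x = s2 x + of_int j * pi" for x
  have t2: "sect \<alpha> c2 t2 k l" unfolding t2_def by (rule sect_shift[OF s2])
  have c12: "c1 x < c2 x" for x using c1[of x] c2[of x] by linarith
  have cs1: "continuous_on UNIV s1" and ct2: "continuous_on UNIV t2" using s1 t2 by (auto simp: sect_def)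
  have av: "s1 x - s2 x \<noteq> of_int m * pi" for x and m :: int
    using sections_never_meet[OF irr s1 s2 c12, of x m] by (simp add: algebra_simps)
  have cont12: "continuous_on UNIV (\<lambda>x. s1 x - s2 x)" using s1 s2 by (auto simp: sect_def intro!: continuous_intros)
  have j0: "of_int j * pi < s1 0 - s2 0" "s1 0 - s2 0 < (of_int j + 1) * pi"
    using pi_floor[where y = "s1 0 - s2 0"] av[of 0 j] by (auto simp: j_def order_less_le)
  have r: "0 < s1 x - t2 x" "s1 x - t2 x < pi" for x
    using avoid_multiples_of_pi[OF cont12 connected_UNIV av UNIV_I j0 UNIV_I, of x]
    by (auto simp: t2_def algebra_simps)
  define D where "D x = wedge (cis (t2 x)) (cis (s1 x))" for x
  have D: "D x > 0" for x unfolding D_def wedge_cis by (rule sin_gt_zero[OF r])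
  \<comment> \<open>The product of the coordinates of \<open>w\<close> in the basis of the two edges, up to the factor \<open>D x\<close>.\<close>
  define Q where "Q x w = wedge w (cis (s1 x)) * wedge (cis (t2 x)) w / D x" for x w
  define F where "F x \<phi> = lift (c (x + \<alpha>)) (lift (c x) \<phi>)" for x \<phi>
  have l1: "lift (c1 y) (s1 y) = s1 (y + \<alpha>) + of_int l * pi" for y using s1 by (simp add: sect_def)
  have l2: "lift (c2 y) (t2 y) = t2 (y + \<alpha>) + of_int l * pi" for y using t2 by (simp add: sect_def)
  have up1: "lift (c y) (s1 y) \<le> s1 (y + \<alpha>) + of_int l * pi" for y
    using lift_antimono[of "c1 y" "c y" "s1 y"] c1[of y] l1[of y] by simp
  have up1': "lift (c y) (s1 y) < s1 (y + \<alpha>) + of_int l * pi" if "cos (s1 y) \<noteq> 0" for y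
    using lift_antimono_strict[OF c1[of y] that] l1[of y] by simp
  have lo1: "t2 (y + \<alpha>) + of_int l * pi \<le> lift (c y) (t2 y)" for y
    using lift_antimono[of "c y" "c2 y" "t2 y"] c2[of y] l2[of y] by simp
  have lo1': "t2 (y + \<alpha>) + of_int l * pi < lift (c y) (t2 y)" if "cos (t2 y) \<noteq> 0" for y
    using lift_antimono_strict[OF c2[of y] that] l2[of y] by simp
  have F1: "F x (s1 x) < s1 (x + \<alpha> + \<alpha>) + of_int (2 * l) * pi" for x
  proof (cases "cos (s1 x) = 0")
    case True
    have "F x (s1 x) \<le> lift (c (x + \<alpha>)) (s1 (x + \<alpha>) + of_int l * pi)"
      unfolding F_def by (rule lift_mono[OF up1])
    also have "\<dots> < s1 (x + \<alpha> + \<alpha>) + of_int l * pi + of_int l * pi"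
      using up1'[OF vertical_not_twice[OF s1 True]] unfolding lift_add_pi by linarith
    finally show ?thesis by (simp add: algebra_simps)
  next
    case False
    have "F x (s1 x) < lift (c (x + \<alpha>)) (s1 (x + \<alpha>) + of_int l * pi)"
      unfolding F_def by (rule lift_strict_mono[OF up1'[OF False]])
    also have "\<dots> \<le> s1 (x + \<alpha> + \<alpha>) + of_int l * pi + of_int l * pi"
      using up1[of "x + \<alpha>"] unfolding lift_add_pi by linarith
    finally show ?thesis by (simp add: algebra_simps)
  qed
  have F2: "t2 (x + \<alpha> + \<alpha>) + of_int (2 * l) * pi < F x (t2 x)" for x
  proof (cases "cos (t2 x) = 0")
    case True
    have "t2 (x + \<alpha> + \<alpha>) + of_int l * pi + of_int l * pi < lift (c (x + \<alpha>)) (t2 (x + \<alpha>) + of_int l * pi)"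
      using lo1'[OF vertical_not_twice[OF t2 True]] unfolding lift_add_pi by linarith
    also have "\<dots> \<le> F x (t2 x)" unfolding F_def by (rule lift_mono[OF lo1])
    finally show ?thesis by (simp add: algebra_simps)
  next
    case False
    have "t2 (x + \<alpha> + \<alpha>) + of_int l * pi + of_int l * pi \<le> lift (c (x + \<alpha>)) (t2 (x + \<alpha>) + of_int l * pi)"
      using lo1[of "x + \<alpha>"] unfolding lift_add_pi by linarith
    also have "\<dots> < F x (t2 x)" unfolding F_def by (rule lift_strict_mono[OF lo1'[OF False]])
    finally show ?thesis by (simp add: algebra_simps)
  qed
  have F12: "F x (t2 x) < F x (s1 x)" for x
    unfolding F_def using r(1)[of x] by (intro lift_strict_mono) simp
  have orbF: "\<exists>\<rho>>0. orb \<alpha> c x (cis \<phi>) 2 = of_real \<rho> * cis (F x \<phi>)" for x \<phi>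
  proof -
    obtain a where a: "a > 0" "step (c x) (cis \<phi>) = of_real a * cis (lift (c x) \<phi>)" using step_cis by blast
    obtain b where b: "b > 0" "step (c (x + \<alpha>)) (cis (lift (c x) \<phi>)) = of_real b * cis (F x \<phi>)"
      using step_cis unfolding F_def by blast
    have "orb \<alpha> c x (cis \<phi>) 2 = step (c (x + \<alpha>)) (step (c x) (cis \<phi>))"
      by (simp add: numeral_2_eq_2)
    also have "\<dots> = of_real a * step (c (x + \<alpha>)) (cis (lift (c x) \<phi>))"
      unfolding a(2) using step_lin[of _ a _ 0 0] by simp
    also have "\<dots> = of_real (a * b) * cis (F x \<phi>)" by (simp add: b(2))
    finally show ?thesis using a(1) b(1) by (intro exI[of _ "a * b"]) simp
  qed
  have Bpos: "Q x w < Q (x + \<alpha> + \<alpha>) (orb \<alpha> c x w 2)" if w: "w \<noteq> 0" for x w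
  proof -
    define e1 where "e1 = cis (t2 x)"
    define e2 where "e2 = cis (s1 x)"
    define x' where "x' = x + \<alpha> + \<alpha>"
    define z1 where "z1 = wedge w e2 / D x"
    define z2 where "z2 = wedge e1 w / D x"
    have Dx: "D x = wedge e1 e2" by (simp add: D_def e1_def e2_def)
    have wz: "w = of_real z1 * e1 + of_real z2 * e2"
    proof -
      have "wedge w e2 * Re e1 + wedge e1 w * Re e2 = D x * Re w"
           "wedge w e2 * Im e1 + wedge e1 w * Im e2 = D x * Im w"
        unfolding Dx wedge_def by (simp_all add: algebra_simps)
      then have "z1 * Re e1 + z2 * Re e2 = Re w" "z1 * Im e1 + z2 * Im e2 = Im w"
        using D[of x] by (simp_all add: z1_def z2_def add_divide_distrib[symmetric])
      then show ?thesis by (simp add: complex_eq_iff)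
    qed
    have z: "z1 \<noteq> 0 \<or> z2 \<noteq> 0" using w wz by auto
    define f1 where "f1 = orb \<alpha> c x e1 2"
    define f2 where "f2 = orb \<alpha> c x e2 2"
    have fz: "orb \<alpha> c x w 2 = of_real z1 * f1 + of_real z2 * f2"
      unfolding f1_def f2_def by (subst wz) (rule orb_lin)
    obtain \<rho>1 where \<rho>1: "\<rho>1 > 0" "f1 = of_real \<rho>1 * cis (F x (t2 x))" unfolding f1_def e1_def using orbF by blast
    obtain \<rho>2 where \<rho>2: "\<rho>2 > 0" "f2 = of_real \<rho>2 * cis (F x (s1 x))" unfolding f2_def e2_def using orbF by blast
    have wr: "wedge (of_real \<rho> * cis a) (cis b) = \<rho> * sin (b - a)" "wedge (cis b) (of_real \<rho> * cis a) = \<rho> * sin (a - b)" for \<rho> a b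
      using wedge_scale[of \<rho> "cis a" 1 "cis b"] wedge_scale[of 1 "cis b" \<rho> "cis a"] by (simp_all add: wedge_cis)
    have ang: "0 < sin (s1 x' - \<theta>)" "0 < sin (\<theta> - t2 x')"
      if "t2 x' + of_int (2 * l) * pi < \<theta>" "\<theta> < s1 x' + of_int (2 * l) * pi" for \<theta>
    proof -
      have "0 < sin ((s1 x' + of_int (2 * l) * pi) - \<theta>)" using that r(2)[of x'] by (intro sin_gt_zero) auto
      then show "0 < sin (s1 x' - \<theta>)" using sin_add_2pi_int[of "s1 x' - \<theta>" l] by (simp add: algebra_simps)
      have "0 < sin (\<theta> - (t2 x' + of_int (2 * l) * pi))" using that r(2)[of x'] by (intro sin_gt_zero) auto
      then show "0 < sin (\<theta> - t2 x')" using sin_add_2pi_int[of "\<theta> - t2 x'" "-l"] by (simp add: algebra_simps)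
    qed
    have a1: "t2 x' + of_int (2 * l) * pi < F x (t2 x)" "F x (t2 x) < s1 x' + of_int (2 * l) * pi"
      and a2: "t2 x' + of_int (2 * l) * pi < F x (s1 x)" "F x (s1 x) < s1 x' + of_int (2 * l) * pi"
      using F1[of x] F2[of x] F12[of x] by (auto simp: x'_def)
    have "z1 * z2 * D x < (z1 * wedge f1 (cis (s1 x')) + z2 * wedge f2 (cis (s1 x')))
        * (z1 * wedge (cis (t2 x')) f1 + z2 * wedge (cis (t2 x')) f2) / D x'"
    proof (rule cone_form_positive)
      show "wedge e1 e2 = D x" by (simp add: D_def e1_def e2_def)
      show "wedge f1 f2 = D x" by (simp add: D_def e1_def e2_def f1_def f2_def)
      show "wedge (cis (t2 x')) (cis (s1 x')) = D x'" by (simp add: D_def)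
      show "0 < wedge f1 (cis (s1 x'))" "0 < wedge (cis (t2 x')) f1" "0 < wedge f2 (cis (s1 x'))" "0 < wedge (cis (t2 x')) f2"
        using ang[OF a1] ang[OF a2] \<rho>1(1) \<rho>2(1) by (simp_all add: \<rho>1(2) \<rho>2(2) wr)
    qed (use D z in auto)
    moreover have "Q x w = z1 * z2 * D x" using D[of x] by (simp add: Q_def z1_def z2_def e1_def e2_def)
    moreover have "Q x' (orb \<alpha> c x w 2) = (z1 * wedge f1 (cis (s1 x')) + z2 * wedge f2 (cis (s1 x')))
        * (z1 * wedge (cis (t2 x')) f1 + z2 * wedge (cis (t2 x')) f2) / D x'"
      unfolding Q_def fz by (simp add: wedge_def algebra_simps)
    ultimately show ?thesis by (simp add: x'_def)
  qed
  have cwedge: "continuous_on UNIV (\<lambda>q :: real \<times> complex. wedge (f q) (g q))"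
    if "continuous_on UNIV f" "continuous_on UNIV g" for f g
    unfolding wedge_def using that by (intro continuous_intros)
  have ccis: "continuous_on UNIV (\<lambda>q :: real \<times> complex. cis (s (fst q + b)))" if "continuous_on UNIV s" for s b
  proof -
    have "continuous_on UNIV (\<lambda>q :: real \<times> complex. s (fst q + b))"
      by (rule continuous_on_compose2[OF that]) (intro continuous_intros, auto)
    then show ?thesis by (intro continuous_intros)
  qed
  have cD: "continuous_on UNIV (\<lambda>q :: real \<times> complex. D (fst q + b))" for b
    unfolding D_def by (intro cwedge ccis cs1 ct2)
  have D0: "D y \<noteq> 0" for y using D[of y] by simp
  have Qcont: "continuous_on UNIV (\<lambda>q :: real \<times> complex. Q (fst q + b) (g q))" if "continuous_on UNIV g" for b g
    unfolding Q_def using D0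
    by (intro continuous_on_divide continuous_on_mult cwedge ccis cs1 ct2 that cD) auto
  have orbc: "continuous_on UNIV (\<lambda>q :: real \<times> complex. orb \<alpha> c (fst q) (snd q) n)" for n
    using orb_continuous[OF contc continuous_on_id, of \<alpha> 0] by simp
  \<comment> \<open>The increase of the form over two steps, to be minimised over a compact set.\<close>
  define B where "B q = Q (fst q + 2 * \<alpha>) (orb \<alpha> c (fst q) (snd q) 2) - Q (fst q + 0) (snd q)" for q
  have Bc: "continuous_on UNIV B"
    unfolding B_def by (intro continuous_on_diff Qcont orbc continuous_intros)
  have Bp: "0 < B (x, w)" if "w \<noteq> 0" for x w
    using Bpos[OF that, of x] by (simp add: B_def algebra_simps)
  have "compact ({0..1} \<times> sphere 0 1 :: (real \<times> complex) set)" by (intro compact_Times) auto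
  moreover have "{0..1} \<times> sphere 0 1 \<noteq> ({} :: (real \<times> complex) set)" by auto
  moreover have "continuous_on ({0..1} \<times> sphere 0 1) B" using Bc continuous_on_subset by blast
  ultimately obtain q0 where q0: "q0 \<in> {0..1} \<times> sphere 0 1" "\<And>q. q \<in> {0..1} \<times> sphere 0 1 \<Longrightarrow> B q0 \<le> B q"
    using continuous_attains_inf by meson
  define \<kappa> where "\<kappa> = B q0"
  have \<kappa>: "\<kappa> > 0" using q0(1) Bp[of "snd q0" "fst q0"] by (cases "snd q0 = 0") (auto simp: \<kappa>_def mem_Times_iff)
  have Qhom: "Q x (of_real a * w) = a\<^sup>2 * Q x w" for x a w
  proof -
    have "wedge (of_real a * w) u = a * wedge w u" "wedge u (of_real a * w) = a * wedge u w" for u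
      by (simp_all add: wedge_def algebra_simps)
    then show ?thesis by (simp add: Q_def power2_eq_square)
  qed
  have cisk: "cis (s + of_int k * pi) = of_real (cos (of_int k * pi)) * cis s" for s
  proof -
    have "sin (of_int k * pi) = 0" by (simp add: sin_zero_iff_int2)
    then show ?thesis by (simp add: complex_eq_iff cos_add sin_add)
  qed
  have ck: "cos (of_int k * pi) \<noteq> 0"
  proof -
    have "sin (of_int k * pi) = 0" by (simp add: sin_zero_iff_int2)
    then show ?thesis using sin_cos_squared_add[of "of_int k * pi"] by auto
  qed
  have Qper: "Q (x + 1) w = Q x w" for x w
  proof -
    have "s1 (x + 1) = s1 x + of_int k * pi" "t2 (x + 1) = t2 x + of_int k * pi"
      using s1 t2 by (auto simp: sect_def)
    moreover have "wedge w (of_real a * u) = a * wedge w u" "wedge (of_real a * u) w = a * wedge u w" for a u w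
      by (simp_all add: wedge_def algebra_simps)
    ultimately show ?thesis using ck by (simp add: Q_def D_def cisk)
  qed
  have Qp: "periodic1 (\<lambda>x. Q x w)" for w using Qper by (simp add: periodic1_def)
  have inc: "\<kappa> * (cmod w)\<^sup>2 \<le> Q (x + real 2 * \<alpha>) (orb \<alpha> c x w 2) - Q x w" for x w
  proof (cases "w = 0")
    case True then show ?thesis by (simp add: Q_def wedge_def)
  next
    case False
    define u where "u = of_real (1 / cmod w) * w"
    have u: "cmod u = 1" "of_real (cmod w) * u = w" using False by (auto simp: u_def norm_mult norm_divide)
    have x: "frac x + of_int \<lfloor>x\<rfloor> = x" by (simp add: frac_def)
    have "\<kappa> \<le> B (frac x, u)" unfolding \<kappa>_def using u frac_lt_1[of x] by (intro q0(2)) auto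
    also have "B (frac x, u) = Q (frac x + 2 * \<alpha>) (orb \<alpha> c (frac x) u 2) - Q (frac x) u" by (simp add: B_def)
    also have "orb \<alpha> c (frac x) u 2 = orb \<alpha> c x u 2"
      using orb_periodic_int[OF perc, of \<alpha> "frac x" "\<lfloor>x\<rfloor>" u 2] x by simp
    also have "Q (frac x) u = Q x u" using periodic1_add_int[OF Qp[of u], of "frac x" "\<lfloor>x\<rfloor>"] x by simp
    also have "Q (frac x + 2 * \<alpha>) (orb \<alpha> c x u 2) = Q (x + 2 * \<alpha>) (orb \<alpha> c x u 2)"
    proof -
      have e: "(frac x + 2 * \<alpha>) + of_int \<lfloor>x\<rfloor> = x + 2 * \<alpha>" by (simp add: frac_def)
      show ?thesis using periodic1_add_int[OF Qp[of "orb \<alpha> c x u 2"], of "frac x + 2 * \<alpha>" "\<lfloor>x\<rfloor>"] unfolding e by simp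
    qed
    finally have "\<kappa> * (cmod w)\<^sup>2 \<le> (Q (x + 2 * \<alpha>) (orb \<alpha> c x u 2) - Q x u) * (cmod w)\<^sup>2"
      by (rule mult_right_mono) simp
    also have "\<dots> = Q (x + real 2 * \<alpha>) (orb \<alpha> c x w 2) - Q x w"
    proof -
      have "orb \<alpha> c x w 2 = of_real (cmod w) * orb \<alpha> c x u 2" using orb_scale[of \<alpha> c x "cmod w" u 2] by (simp only: u(2))
      moreover have "Q x w = (cmod w)\<^sup>2 * Q x u" using Qhom[of x "cmod w" u] by (simp only: u(2))
      ultimately show ?thesis by (simp add: Qhom algebra_simps)
    qed
    finally show ?thesis .
  qed
  obtain M where M: "\<And>x. \<bar>c x\<bar> \<le> M" using periodic1_bounded[OF contc perc] by blast
  have "periodic1 D"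
  proof -
    have "s1 (x + 1) = s1 x + of_int k * pi" "t2 (x + 1) = t2 x + of_int k * pi" for x
      using s1 t2 by (auto simp: sect_def)
    then show ?thesis by (simp add: periodic1_def D_def wedge_cis)
  qed
  then have "periodic1 (\<lambda>x. 1 / D x)" by (simp add: periodic1_def)
  moreover have "continuous_on UNIV (\<lambda>x. 1 / D x)"
  proof -
    have "continuous_on UNIV D" unfolding D_def wedge_cis using cs1 ct2 by (intro continuous_intros)
    then show ?thesis using D0 by (intro continuous_intros) auto
  qed
  ultimately obtain K where K: "\<And>x. \<bar>1 / D x\<bar> \<le> K" using periodic1_bounded by blast
  have Qc: "\<bar>Q x (w + f) - Q x w\<bar> \<le> 2 * K * (cmod w * cmod f + (cmod f)\<^sup>2)" for x w f
  proof -
    have bil: "wedge (a + b) z = wedge a z + wedge b z" "wedge z (a + b) = wedge z a + wedge z b" for a b z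
      by (simp_all add: wedge_def algebra_simps)
    let ?a = "\<lambda>w. wedge w (cis (s1 x))" and ?b = "\<lambda>w. wedge (cis (t2 x)) w"
    have ab: "\<bar>?a w\<bar> \<le> cmod w" "\<bar>?b w\<bar> \<le> cmod w" for w
      using abs_wedge_le[of w "cis (s1 x)"] abs_wedge_le[of "cis (t2 x)" w] by simp_all
    have "Q x (w + f) - Q x w = (?a w * ?b f + ?a f * ?b w + ?a f * ?b f) * (1 / D x)"
      by (simp add: Q_def bil algebra_simps add_divide_distrib)
    also have "\<bar>\<dots>\<bar> = \<bar>?a w * ?b f + ?a f * ?b w + ?a f * ?b f\<bar> * \<bar>1 / D x\<bar>" by (rule abs_mult)
    also have "\<dots> \<le> (2 * (cmod w * cmod f + (cmod f)\<^sup>2)) * K"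
    proof (rule mult_mono[OF _ K])
      have "\<bar>?a w * ?b f\<bar> \<le> cmod w * cmod f" "\<bar>?a f * ?b w\<bar> \<le> cmod f * cmod w" "\<bar>?a f * ?b f\<bar> \<le> cmod f * cmod f"
        unfolding abs_mult by (intro mult_mono ab; simp)+
      then show "\<bar>?a w * ?b f + ?a f * ?b w + ?a f * ?b f\<bar> \<le> 2 * (cmod w * cmod f + (cmod f)\<^sup>2)"
        by (simp add: power2_eq_square abs_le_iff mult.commute)
    qed auto
    finally show ?thesis by (simp add: mult_ac)
  qed
  show ?thesis
    by (rule lyapunov_imp_gapped[OF M \<kappa> _ Qc inc]) (simp add: Q_def wedge_def)
qed

section \<open>Convexity of norms along orbits\<close>

text \<open>
  Uniform hyperbolicity amounts to this condition for some \<open>N\<close>. For given \<open>N\<close> the condition is closed in all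
  parameters, so the set of hyperbolic parameters is a countable union of closed sets.
\<close>

definition hyp :: "real \<Rightarrow> (real \<Rightarrow> real) \<Rightarrow> nat \<Rightarrow> bool" where
  "hyp \<alpha> c N \<longleftrightarrow> (\<forall>x w. 4 * (cmod (orb \<alpha> c x w N))\<^sup>2 \<le> (cmod (orb \<alpha> c x w (2 * N)))\<^sup>2 + (cmod w)\<^sup>2)"

text \<open>
  The growth of the squared norm over \<open>N\<close> steps is a Lyapunov function, because the hypothesis makes the second
  difference of the squared norm along orbits positive.
\<close>

lemma hyp_imp_gapped:
  assumes h: "hyp \<alpha> c N" and M: "\<And>x. \<bar>c x\<bar> \<le> M"
  shows "\<exists>G>0. gapped \<alpha> c G"
proof -
  define B where "B = M + 1"
  have cB: "\<bar>c x\<bar> + 1 \<le> B" for x using M[of x] by (simp add: B_def)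
  have B1: "1 \<le> B" using cB[of 0] by linarith
  define E where "E = B ^ N"
  have E1: "1 \<le> E" unfolding E_def using B1 by simp
  define Q where "Q x w = (cmod (orb \<alpha> c x w N))\<^sup>2 - (cmod w)\<^sup>2" for x w
  have sq: "\<bar>(cmod (a + b))\<^sup>2 - (cmod a)\<^sup>2\<bar> \<le> 2 * cmod a * cmod b + (cmod b)\<^sup>2" for a b :: complex
  proof -
    define r where "r = Re (a * cnj b)"
    have "(cmod (a + b))\<^sup>2 - (cmod a)\<^sup>2 = 2 * r + (cmod b)\<^sup>2"
      unfolding r_def by (simp add: cmod_power2) (simp add: power2_eq_square algebra_simps)
    moreover have "\<bar>r\<bar> \<le> cmod a * cmod b"
      unfolding r_def using abs_Re_le_cmod[of "a * cnj b"] by (simp add: norm_mult)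
    moreover have "0 \<le> (cmod b)\<^sup>2" by simp
    ultimately show ?thesis unfolding abs_le_iff mult.assoc by linarith
  qed
  show ?thesis
  proof (rule lyapunov_imp_gapped[where Q = Q and N = N and \<kappa> = "2 / E\<^sup>2" and C = "4 * E\<^sup>2", OF M])
    show "0 < 2 / E\<^sup>2" using E1 by simp
    show "Q x 0 = 0" for x by (simp add: Q_def)
    fix x w f
    have Ew: "cmod (orb \<alpha> c x u N) \<le> E * cmod u" for u unfolding E_def by (rule norm_orb_le[OF cB])
    have "\<bar>(cmod (orb \<alpha> c x (w + f) N))\<^sup>2 - (cmod (orb \<alpha> c x w N))\<^sup>2\<bar>
        \<le> 2 * cmod (orb \<alpha> c x w N) * cmod (orb \<alpha> c x f N) + (cmod (orb \<alpha> c x f N))\<^sup>2"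
      unfolding orb_plus by (rule sq)
    also have "\<dots> \<le> 2 * (E * cmod w) * (E * cmod f) + (E * cmod f)\<^sup>2"
      using Ew E1 by (intro add_mono mult_mono power_mono) auto
    also have "\<dots> = E\<^sup>2 * (2 * cmod w * cmod f + (cmod f)\<^sup>2)" by (simp add: power2_eq_square algebra_simps)
    finally have 1: "\<bar>(cmod (orb \<alpha> c x (w + f) N))\<^sup>2 - (cmod (orb \<alpha> c x w N))\<^sup>2\<bar> \<le> E\<^sup>2 * (2 * cmod w * cmod f + (cmod f)\<^sup>2)" .
    have 2: "\<bar>(cmod (w + f))\<^sup>2 - (cmod w)\<^sup>2\<bar> \<le> E\<^sup>2 * (2 * cmod w * cmod f + (cmod f)\<^sup>2)"
    proof -
      have "2 * cmod w * cmod f + (cmod f)\<^sup>2 \<le> E\<^sup>2 * (2 * cmod w * cmod f + (cmod f)\<^sup>2)"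
        using mult_right_mono[OF one_le_power[OF E1, of 2], of "2 * cmod w * cmod f + (cmod f)\<^sup>2"] by simp
      then show ?thesis using sq[of w f] by linarith
    qed
    have "\<bar>Q x (w + f) - Q x w\<bar> \<le> 2 * (E\<^sup>2 * (2 * cmod w * cmod f + (cmod f)\<^sup>2))"
      using 1 2 by (simp add: Q_def abs_le_iff)
    also have "\<dots> \<le> 4 * E\<^sup>2 * (cmod w * cmod f + (cmod f)\<^sup>2)" by (simp add: algebra_simps)
    finally show "\<bar>Q x (w + f) - Q x w\<bar> \<le> 4 * E\<^sup>2 * (cmod w * cmod f + (cmod f)\<^sup>2)" .
    have "cmod w \<le> E * cmod (orb \<alpha> c x w N)" unfolding E_def by (rule norm_orb_ge[OF cB])
    then have "(cmod w)\<^sup>2 \<le> (E * cmod (orb \<alpha> c x w N))\<^sup>2" by (intro power_mono) auto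
    then have "2 / E\<^sup>2 * (cmod w)\<^sup>2 \<le> 2 * (cmod (orb \<alpha> c x w N))\<^sup>2"
      using E1 by (simp add: field_simps power_mult_distrib)
    also have "\<dots> \<le> (cmod (orb \<alpha> c x w (2 * N)))\<^sup>2 + (cmod w)\<^sup>2 - 2 * (cmod (orb \<alpha> c x w N))\<^sup>2"
      using h[unfolded hyp_def, rule_format, of x w] by simp
    also have "\<dots> = Q (x + real N * \<alpha>) (orb \<alpha> c x w N) - Q x w"
    proof -
      have "orb \<alpha> c (x + real N * \<alpha>) (orb \<alpha> c x w N) N = orb \<alpha> c x w (2 * N)"
        unfolding mult_2 by (rule orb_add[symmetric])
      then show ?thesis by (simp add: Q_def)
    qed
    finally show "2 / E\<^sup>2 * (cmod w)\<^sup>2 \<le> Q (x + real N * \<alpha>) (orb \<alpha> c x w N) - Q x w" .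
  qed
qed

section \<open>Real and complex cocycles\<close>

text \<open>
  The real and the imaginary part of a vector of \<open>complex ^ 2\<close> evolve independently under a real
  matrix, and each is an orbit in the plane.
\<close>

definition re_part :: "complex ^ 2 \<Rightarrow> complex" where "re_part W = Complex (Re (W $ 1)) (Re (W $ 2))"
definition im_part :: "complex ^ 2 \<Rightarrow> complex" where "im_part W = Complex (Im (W $ 1)) (Im (W $ 2))"
definition emb :: "complex \<Rightarrow> complex ^ 2" where "emb w = vector [of_real (Re w), of_real (Im w)]"
definition det2 :: "complex ^ 2 \<Rightarrow> complex ^ 2 \<Rightarrow> complex" where "det2 U V = U $ 1 * V $ 2 - U $ 2 * V $ 1"

lemma emb_nth [simp]: "emb w $ 1 = of_real (Re w)" "emb w $ 2 = of_real (Im w)"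
  by (simp_all add: emb_def)

lemma vec2_eq: "(U :: complex ^ 2) = V \<longleftrightarrow> U $ 1 = V $ 1 \<and> U $ 2 = V $ 2"
  by (simp add: vec_eq_iff forall_2)

lemma schroedinger_nth [simp]:
  "(schroedinger c x *v W) $ 1 = of_real (c x) * W $ 1 - W $ 2"
  "(schroedinger c x *v W) $ 2 = W $ 1"
  by (simp_all add: schroedinger_def matrix_vector_mult_def sum_2)

lemma re_part_emb [simp]: "re_part (emb w) = w" "im_part (emb w) = 0"
  by (simp_all add: re_part_def im_part_def complex_eq_iff)

lemma schroedinger_emb: "schroedinger c x *v emb w = emb (step (c x) w)"
  by (simp add: vec2_eq)

abbreviation citer :: "real \<Rightarrow> (real \<Rightarrow> real) \<Rightarrow> nat \<Rightarrow> real \<Rightarrow> complex ^ 2 ^ 2" where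
  "citer \<alpha> c \<equiv> cocycle_iter \<alpha> (schroedinger c)"

lemma citer_Suc_mult: "citer \<alpha> c (Suc n) x *v W = schroedinger c (x + real n * \<alpha>) *v (citer \<alpha> c n x *v W)"
  by (simp add: matrix_vector_mul_assoc)

lemma re_part_citer: "re_part (citer \<alpha> c n x *v W) = orb \<alpha> c x (re_part W) n"
proof (induction n)
  case (Suc n)
  have "re_part (citer \<alpha> c (Suc n) x *v W) = step (c (x + real n * \<alpha>)) (re_part (citer \<alpha> c n x *v W))"
    unfolding citer_Suc_mult by (simp add: re_part_def complex_eq_iff)
  with Suc show ?case by simp
qed simp

lemma im_part_citer: "im_part (citer \<alpha> c n x *v W) = orb \<alpha> c x (im_part W) n"
proof (induction n)
  case (Suc n)
  have "im_part (citer \<alpha> c (Suc n) x *v W) = step (c (x + real n * \<alpha>)) (im_part (citer \<alpha> c n x *v W))"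
    unfolding citer_Suc_mult by (simp add: im_part_def complex_eq_iff)
  with Suc show ?case by simp
qed simp

lemma citer_emb: "citer \<alpha> c n x *v emb w = emb (orb \<alpha> c x w n)"
proof (induction n)
  case (Suc n) then show ?case unfolding citer_Suc_mult by (simp add: schroedinger_emb)
qed simp

lemma norm_parts: "(norm (W :: complex ^ 2))\<^sup>2 = (cmod (re_part W))\<^sup>2 + (cmod (im_part W))\<^sup>2"
  by (simp add: norm_vec_def L2_set_def sum_2 re_part_def im_part_def cmod_power2)

lemma norm_emb [simp]: "norm (emb w) = cmod w"
proof -
  have "(norm (emb w))\<^sup>2 = (cmod w)\<^sup>2" by (simp add: norm_parts)
  then show ?thesis by (simp add: power2_eq_iff_nonneg)
qed

lemma norm_smult_vec: "norm (k *s (W :: complex ^ 2)) = cmod k * norm W"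
proof -
  have "(norm (k *s W))\<^sup>2 = (cmod k * norm W)\<^sup>2"
    by (simp add: norm_vec_def L2_set_def sum_2 norm_mult power_mult_distrib algebra_simps)
  then show ?thesis by (simp add: power2_eq_iff_nonneg)
qed

lemma det2_schroedinger: "det2 (schroedinger c x *v U) (schroedinger c x *v V) = det2 U V"
  by (simp add: det2_def algebra_simps)

lemma det2_citer: "det2 (citer \<alpha> c n x *v U) (citer \<alpha> c n x *v V) = det2 U V"
proof (induction n)
  case (Suc n) then show ?case unfolding citer_Suc_mult by (simp add: det2_schroedinger)
qed simp

lemma norm_det2_le: "cmod (det2 U V) \<le> 2 * norm U * norm V"
proof -
  have c: "cmod (W $ i) \<le> norm W" for W :: "complex ^ 2" and i by (rule Finite_Cartesian_Product.norm_nth_le)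
  have "cmod (det2 U V) \<le> cmod (U $ 1) * cmod (V $ 2) + cmod (U $ 2) * cmod (V $ 1)"
    unfolding det2_def using norm_triangle_ineq4[of "U $ 1 * V $ 2" "U $ 2 * V $ 1"] by (simp add: norm_mult)
  also have "\<dots> \<le> norm U * norm V + norm U * norm V"
    by (intro add_mono mult_mono c) auto
  finally show ?thesis by simp
qed

lemma det2_zero_imp:
  assumes "det2 U V = 0" "U \<noteq> 0" shows "V \<in> cline U"
proof -
  have "U $ 1 \<noteq> 0 \<or> U $ 2 \<noteq> 0" using assms(2) by (simp add: vec2_eq)
  then show ?thesis
  proof
    assume u: "U $ 1 \<noteq> 0"
    have "V = (V $ 1 / U $ 1) *s U" using assms(1) u by (simp add: vec2_eq det2_def field_simps)
    then show ?thesis unfolding cline_def by blast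
  next
    assume u: "U $ 2 \<noteq> 0"
    have "V = (V $ 2 / U $ 2) *s U" using assms(1) u by (simp add: vec2_eq det2_def field_simps)
    then show ?thesis unfolding cline_def by blast
  qed
qed

lemma invertible_schroedinger: "invertible (schroedinger c x)"
proof -
  define B :: "complex ^ 2 ^ 2" where "B = vector [vector [0, 1], vector [- 1, of_real (c x)]]"
  have "schroedinger c x ** B = mat 1" "B ** schroedinger c x = mat 1"
    by (auto simp: vec_eq_iff forall_2 matrix_matrix_mult_def sum_2 schroedinger_def B_def mat_def)
  then show ?thesis unfolding invertible_def by blast
qed

lemma invertible_citer: "invertible (citer \<alpha> c n x)"
proof (induction n)
  case 0 show ?case by (simp add: invertible_def)
next
  case (Suc n) then show ?case by (simp add: invertible_mult invertible_schroedinger)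
qed

lemma matrix_inv_apply: "invertible M \<Longrightarrow> matrix_inv M *v (M *v U) = U"
  and matrix_apply_inv: "invertible M \<Longrightarrow> M *v (matrix_inv M *v U) = U"
proof -
  assume "invertible M"
  then have "M ** matrix_inv M = mat 1 \<and> matrix_inv M ** M = mat 1"
    unfolding invertible_def matrix_inv_def by (rule someI_ex)
  then show "matrix_inv M *v (M *v U) = U" "M *v (matrix_inv M *v U) = U"
    by (simp_all add: matrix_vector_mul_assoc)
qed

lemma cocycle_iter_neg_apply:
  "cocycle_iter_neg \<alpha> (schroedinger c) n (x + real n * \<alpha>) *v (citer \<alpha> c n x *v U) = U"
  by (simp add: cocycle_iter_neg_def matrix_inv_apply invertible_citer)

section \<open>A spectral gap gives uniform hyperbolicity\<close>

lemma zsum_reflect: "zsum (\<lambda>n. f (- n)) = zsum f"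
  unfolding zsum_def by (rule sum.reindex_bij_witness[of _ uminus uminus]) auto

lemma gapped_reverse: "gapped \<alpha> c G \<Longrightarrow> gapped (- \<alpha>) c G"
  unfolding gapped_def
proof (intro allI impI)
  fix x and f :: "int \<Rightarrow> real"
  assume g: "\<forall>x f. fsp f \<longrightarrow> G * nn f \<le> nn (Top \<alpha> c x f)" and f: "fsp f"
  define h where "h n = f (- n)" for n
  have h: "fsp h"
  proof (rule fspI[of "uminus ` {n. f n \<noteq> 0}"])
    show "finite (uminus ` {n. f n \<noteq> 0})" using f by (simp add: fsp_def)
    fix n assume "n \<notin> uminus ` {n. f n \<noteq> 0}"
    then have "- n \<notin> {n. f n \<noteq> 0}" by (metis image_eqI minus_minus)
    then show "h n = 0" by (simp add: h_def)
  qed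
  have "ip h h = ip f f" unfolding ip_def h_def by (rule zsum_reflect)
  then have 1: "nn h = nn f" by (simp add: nn_def)
  have "Top (- \<alpha>) c x f = (\<lambda>n. Top \<alpha> c x h (- n))"
    by (simp add: fun_eq_iff Top_def h_def add.commute)
  then have "ip (Top (- \<alpha>) c x f) (Top (- \<alpha>) c x f) = ip (Top \<alpha> c x h) (Top \<alpha> c x h)"
    unfolding ip_def using zsum_reflect[of "\<lambda>n. Top \<alpha> c x h n * Top \<alpha> c x h n"] by simp
  then have "nn (Top (- \<alpha>) c x f) = nn (Top \<alpha> c x h)" by (simp add: nn_def)
  then show "G * nn f \<le> nn (Top (- \<alpha>) c x f)" using g h 1 by metis
qed

lemma stab_sect_exists:
  assumes "continuous_on UNIV c" "periodic1 c" "G > 0" "gapped \<alpha> c G"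
  obtains s k l where "sect \<alpha> c s k l" "\<And>x. stab \<alpha> c x (cis (s x))"
proof -
  have c: "continuous_on ({0..0} \<times> UNIV) (\<lambda>p::real \<times> real. c (snd p))"
    by (rule continuous_on_compose2[OF assms(1)]) (intro continuous_intros, auto)
  show ?thesis
  proof (rule stab_section_family[of 0 0 "\<lambda>_. c" G \<alpha>])
    fix s k l
    assume "\<And>\<tau>. \<tau> \<in> {0..0::real} \<Longrightarrow> sect \<alpha> c (s \<tau>) k l"
      "\<And>\<tau> x. \<tau> \<in> {0..0::real} \<Longrightarrow> stab \<alpha> c x (cis (s \<tau> x))"
    then show thesis using that[of "s 0" k l] by simp
  qed (use assms c in auto)
qed

lemma cline_smult: "k \<noteq> 0 \<Longrightarrow> cline (k *s W) = cline W"
proof -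
  assume k: "k \<noteq> 0"
  have "cline (a *s U) \<subseteq> cline U" for a U by (auto simp: cline_def vector_smult_assoc)
  from this[of k W] this[of "1 / k" "k *s W"] k show ?thesis by (simp add: vector_smult_assoc)
qed

lemma matrix_image_cline: "(\<lambda>w. M *v w) ` cline W = cline (M *v W)"
  by (auto simp: cline_def vector_scalar_commute image_iff)

lemma emb_scale: "emb (of_real a * w) = of_real a *s emb w"
  by (simp add: vec2_eq)

lemma emb_eq_0 [simp]: "emb w = 0 \<longleftrightarrow> w = 0"
  by (metis norm_emb norm_eq_zero)

lemma continuous_emb: "continuous_on A f \<Longrightarrow> continuous_on A (\<lambda>x. emb (f x))"
proof -
  assume f: "continuous_on A f"
  have "(\<lambda>x. emb (f x)) = (\<lambda>x. (\<chi> i. if i = 1 then of_real (Re (f x)) else of_real (Im (f x))))"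
    by (simp add: fun_eq_iff vec2_eq)
  moreover have "continuous_on A (\<lambda>x. (\<chi> i. if i = 1 then of_real (Re (f x)) else of_real (Im (f x))) :: complex ^ 2)"
  proof (rule continuous_on_vec_lambda)
    fix i :: 2
    show "continuous_on A (\<lambda>x. if i = 1 then of_real (Re (f x)) else of_real (Im (f x)) :: complex)"
      by (cases "i = 1") (simp_all, (intro continuous_intros f)+)
  qed
  ultimately show ?thesis by (simp only:)
qed

lemma continuous_map_cline:
  assumes "continuous_on UNIV f" "\<And>x. f x \<noteq> 0"
  shows "continuous_map euclideanreal CP1_topology (\<lambda>x. cline (f x))"
proof -
  have "continuous_map euclideanreal (top_of_set (UNIV - {0})) f"
    using assms by (auto simp: continuous_map_in_subtopology)
  from continuous_map_compose[OF this quotient_imp_continuous_map[OF quotient_map_cline]]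
  show ?thesis by (simp add: o_def)
qed

lemma step_parallel_stab:
  assumes G: "G > 0" "gapped \<alpha> c G" and s: "\<And>x. stab \<alpha> c x (cis (s x))"
  shows "\<exists>a. a \<noteq> 0 \<and> step (c x) (cis (s x)) = of_real a * cis (s (x + \<alpha>))"
proof -
  have "wedge (cis (s (x + \<alpha>))) (step (c x) (cis (s x))) = 0"
    using stab_parallel[OF G(2,1) s stab_step[OF s]] .
  then obtain a where a: "step (c x) (cis (s x)) = of_real a * cis (s (x + \<alpha>))"
    using wedge_0_imp[of "cis (s (x + \<alpha>))"] by auto
  have "step (c x) (cis (s x)) \<noteq> 0"
    using orb_eq_0[of \<alpha> c x "cis (s x)" 1] by simp
  then have "a \<noteq> 0" using a by auto
  then show ?thesis using a by blast
qed

text \<open>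
  The stable line field comes from the stable section, and the unstable one from the stable section of the
  reversed dynamics.
\<close>

lemma gapped_imp_uniformly_hyperbolic:
  assumes cont: "continuous_on UNIV c" and per: "periodic1 c" and G: "G > 0" "gapped \<alpha> c G"
  shows "uniformly_hyperbolic \<alpha> (schroedinger c)"
proof -
  obtain s k l where s: "sect \<alpha> c s k l" "\<And>x. stab \<alpha> c x (cis (s x))"
    using stab_sect_exists[OF cont per G] by metis
  have G': "gapped (- \<alpha>) c G" using gapped_reverse[OF G(2)] .
  obtain s' k' l' where s': "sect (- \<alpha>) c s' k' l'" "\<And>x. stab (- \<alpha>) c x (cis (s' x))"
    using stab_sect_exists[OF cont per G(1) G'] by metis
  define S where "S x = cline (emb (cis (s x)))" for x
  define U where "U x = cline (emb (swap (cis (s' (x - \<alpha>)))))" for x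
  define K where "K = 4 / G\<^sup>2"
  have K: "K > 0" using G by (simp add: K_def)
  define \<theta> where "\<theta> = sqrt (K / (1 + K))"
  have \<theta>: "0 < \<theta>" "\<theta> < 1" using K by (auto simp: \<theta>_def)
  define C where "C = sqrt (1 + K)"
  have C: "C > 0" using K by (simp add: C_def)
  have pw: "(1 / \<theta>) powi (- int n) = \<theta> ^ n" for n
    using \<theta> by (simp add: power_int_minus power_divide field_simps)
  have dec: "cmod (orb a c x w n) \<le> C * \<theta> ^ n * cmod w" if "gapped a c G" "stab a c x w" for a x w n
  proof -
    have "(cmod (orb a c x w n))\<^sup>2 \<le> (1 + K) * (K / (1 + K)) ^ n * (cmod w)\<^sup>2"
      unfolding K_def using stabD_decay(1)[OF that(1) G(1) that(2)] .
    also have "\<dots> = (C * \<theta> ^ n * cmod w)\<^sup>2"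
    proof -
      have "(\<theta> ^ n)\<^sup>2 = (K / (1 + K)) ^ n"
        using K by (simp add: \<theta>_def power_mult[symmetric] mult.commute[of n 2] power_mult)
      moreover have "C\<^sup>2 = 1 + K" using K by (simp add: C_def)
      ultimately show ?thesis by (simp only: power_mult_distrib)
    qed
    finally show ?thesis using C \<theta> by (simp add: power2_le_iff_abs_le abs_le_iff)
  qed
  have cs: "continuous_on UNIV s" "continuous_on UNIV s'" using s(1) s'(1) by (auto simp: sect_def)
  have csh: "continuous_on UNIV (\<lambda>x. s' (x - \<alpha>))"
    by (rule continuous_on_compose2[OF cs(2)]) (intro continuous_intros, auto)
  have cisk: "cis (a + of_int m * pi) = of_real (cos (of_int m * pi)) * cis a" "cos (of_int m * pi) \<noteq> 0" for a and m :: int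
  proof -
    have "sin (of_int m * pi) = 0" by (simp add: sin_zero_iff_int2)
    then show "cis (a + of_int m * pi) = of_real (cos (of_int m * pi)) * cis a" "cos (of_int m * pi) \<noteq> 0"
      using sin_cos_squared_add[of "of_int m * pi"] by (auto simp: complex_eq_iff cos_add sin_add)
  qed
  have swap_scale: "swap (of_real a * w) = of_real a * swap w" for a w by (simp add: complex_eq_iff)
  show ?thesis
    unfolding uniformly_hyperbolic_def
  proof (intro exI conjI allI impI ballI)
    show "periodic1 U" unfolding periodic1_def
    proof
      fix x
      have "s' (x + 1 - \<alpha>) = s' (x - \<alpha>) + of_int k' * pi"
        using s'(1)[unfolded sect_def] by (metis add.commute add_diff_eq)
      then have "emb (swap (cis (s' (x + 1 - \<alpha>)))) = of_real (cos (of_int k' * pi)) *s emb (swap (cis (s' (x - \<alpha>))))"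
        by (simp only: cisk(1) swap_scale emb_scale)
      then show "U (x + 1) = U x" unfolding U_def using cisk(2)[of k'] by (simp add: cline_smult)
    qed
    show "periodic1 S" unfolding periodic1_def
    proof
      fix x
      have "s (x + 1) = s x + of_int k * pi" using s(1) by (simp add: sect_def)
      then have "emb (cis (s (x + 1))) = of_real (cos (of_int k * pi)) *s emb (cis (s x))"
        by (simp only: cisk(1) emb_scale)
      then show "S (x + 1) = S x" unfolding S_def using cisk(2)[of k] by (simp add: cline_smult)
    qed
    show "continuous_map euclideanreal CP1_topology U" unfolding U_def
    proof (rule continuous_map_cline)
      have "continuous_on UNIV (\<lambda>x. swap (cis (s' (x - \<alpha>))))"
        unfolding swap_def Complex_eq using csh by (intro continuous_intros)
      then show "continuous_on UNIV (\<lambda>x. emb (swap (cis (s' (x - \<alpha>)))))" by (rule continuous_emb)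
      show "emb (swap (cis (s' (x - \<alpha>)))) \<noteq> 0" for x
        by (metis emb_eq_0 norm_cis norm_zero swap_simps(4) zero_neq_one)
    qed
    show "continuous_map euclideanreal CP1_topology S" unfolding S_def
    proof (rule continuous_map_cline)
      have "continuous_on UNIV (\<lambda>x. cis (s x))" using cs by (intro continuous_intros)
      then show "continuous_on UNIV (\<lambda>x. emb (cis (s x)))" by (rule continuous_emb)
    qed simp
    show "C > 0" by (rule C)
    show "1 / \<theta> > 1" using \<theta> by simp
    fix x
    show "(\<lambda>w. schroedinger c x *v w) ` U x = U (x + \<alpha>)"
    proof -
      obtain a where a: "a \<noteq> 0" "step (c x) (cis (s' x)) = of_real a * cis (s' (x - \<alpha>))"
        using step_parallel_stab[OF G(1) G' s'(2), of x] by auto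
      have "step (c x) (swap (cis (s' (x - \<alpha>)))) = of_real (1 / a) * swap (cis (s' x))"
      proof -
        have "cis (s' (x - \<alpha>)) = of_real (1 / a) * step (c x) (cis (s' x))" using a by simp
        then have "swap (cis (s' (x - \<alpha>))) = of_real (1 / a) * swap (step (c x) (cis (s' x)))"
          by (simp only: swap_scale)
        then have "step (c x) (swap (cis (s' (x - \<alpha>)))) = of_real (1 / a) * step (c x) (swap (step (c x) (cis (s' x))))"
          using step_lin[of "c x" "1 / a" "swap (step (c x) (cis (s' x)))" 0 0] by simp
        then show ?thesis by simp
      qed
      then have "schroedinger c x *v emb (swap (cis (s' (x - \<alpha>)))) = of_real (1 / a) *s emb (swap (cis (s' x)))"
        by (simp only: schroedinger_emb emb_scale)
      moreover have "of_real (1 / a) \<noteq> (0::complex)" using a(1) by simp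
      ultimately show ?thesis unfolding U_def matrix_image_cline by (simp add: cline_smult)
    qed
    show "(\<lambda>w. schroedinger c x *v w) ` S x = S (x + \<alpha>)"
    proof -
      obtain a where a: "a \<noteq> 0" "step (c x) (cis (s x)) = of_real a * cis (s (x + \<alpha>))"
        using step_parallel_stab[OF G s(2), of x] by auto
      then have "schroedinger c x *v emb (cis (s x)) = of_real a *s emb (cis (s (x + \<alpha>)))"
        by (simp only: schroedinger_emb emb_scale)
      moreover have "of_real a \<noteq> (0::complex)" using a(1) by simp
      ultimately show ?thesis unfolding S_def matrix_image_cline by (simp add: cline_smult)
    qed
    fix n :: nat assume "1 \<le> n"
    fix w :: "complex ^ 2"
    {
      assume w: "w \<in> U x" "norm w = 1"
      define z where "z = cis (s' (x - \<alpha>))"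
      obtain a where a: "w = a *s emb (swap z)" using w(1) by (auto simp: U_def cline_def z_def)
      have a1: "cmod a = 1" using w(2) by (simp add: a norm_smult_vec z_def)
      define y where "y = swap (orb (- \<alpha>) c (x - \<alpha>) z n)"
      have e: "x - \<alpha> + real n * (- \<alpha>) - (- \<alpha>) = x - real n * \<alpha>" by (simp add: algebra_simps)
      have "orb \<alpha> c (x - real n * \<alpha>) y n = swap z"
        using orb_reverse[of "- \<alpha>" c "x - \<alpha>" n z] unfolding e y_def by simp
      then have "citer \<alpha> c n (x - real n * \<alpha>) *v (a *s emb y) = w"
        by (simp add: vector_scalar_commute citer_emb a)
      then have "cocycle_iter_neg \<alpha> (schroedinger c) n x *v w = a *s emb y"
        using cocycle_iter_neg_apply[of \<alpha> c n "x - real n * \<alpha>" "a *s emb y"] by simp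
      then have "norm (cocycle_iter_neg \<alpha> (schroedinger c) n x *v w) = cmod (orb (- \<alpha>) c (x - \<alpha>) z n)"
        by (simp add: norm_smult_vec a1 y_def)
      also have "\<dots> \<le> C * \<theta> ^ n" using dec[OF G' s'(2), of "x - \<alpha>" n] by (simp add: z_def)
      finally show "norm (cocycle_iter_neg \<alpha> (schroedinger c) n x *v w) \<le> C * (1 / \<theta>) powi (- int n)"
        by (simp only: pw)
    next
      assume w: "w \<in> S x" "norm w = 1"
      obtain a where a: "w = a *s emb (cis (s x))" using w(1) by (auto simp: S_def cline_def)
      have a1: "cmod a = 1" using w(2) by (simp add: a norm_smult_vec)
      have "norm (citer \<alpha> c n x *v w) = cmod (orb \<alpha> c x (cis (s x)) n)"
        by (simp add: a vector_scalar_commute citer_emb norm_smult_vec a1)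
      also have "\<dots> \<le> C * \<theta> ^ n" using dec[OF G(2) s(2), of x n] by simp
      finally show "norm (citer \<alpha> c n x *v w) \<le> C * (1 / \<theta>) powi (- int n)"
        by (simp only: pw)
    }
  qed
qed

section \<open>Uniform hyperbolicity gives convexity\<close>

text \<open>
  A vector with bounded forward orbit is parallel to the stable line, since the determinant with a decaying vector
  tends to 0; a vector with bounded backward orbit is parallel to the unstable line. A vector on both lines
  decays in both directions, which is impossible for a nonzero one.
\<close>

lemma uniformly_hyperbolic_no_bounded_orbit:
  assumes uh: "uniformly_hyperbolic \<alpha> (schroedinger c)"
    and b: "\<And>n. cmod (orb \<alpha> c x w n) \<le> L" "\<And>n. cmod (orb (- \<alpha>) c (x - \<alpha>) (swap w) n) \<le> L"
  shows "w = 0"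
proof (rule ccontr)
  assume w: "w \<noteq> 0"
  obtain u s C \<kappa> where us: "continuous_map euclideanreal CP1_topology u" "continuous_map euclideanreal CP1_topology s"
      "\<And>x. (\<lambda>w. schroedinger c x *v w) ` u x = u (x + \<alpha>)"
      "C > 0" "\<kappa> > 1"
      and du: "\<And>x n w. n \<ge> 1 \<Longrightarrow> w \<in> u x \<Longrightarrow> norm w = 1 \<Longrightarrow> norm (cocycle_iter_neg \<alpha> (schroedinger c) n x *v w) \<le> C * \<kappa> powi (- int n)"
      and ds: "\<And>x n w. n \<ge> 1 \<Longrightarrow> w \<in> s x \<Longrightarrow> norm w = 1 \<Longrightarrow> norm (citer \<alpha> c n x *v w) \<le> C * \<kappa> powi (- int n)"
    using uh unfolding uniformly_hyperbolic_def by metis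
  have lines: "u y \<in> CP1" "s y \<in> CP1" for y
    using continuous_map_image_subset_topspace[OF us(1)] continuous_map_image_subset_topspace[OF us(2)]
    by (auto simp: topspace_CP1_topology)
  define \<theta> where "\<theta> = 1 / \<kappa>"
  have \<theta>: "0 < \<theta>" "\<theta> < 1" using us(5) by (auto simp: \<theta>_def)
  have pw: "\<kappa> powi (- int n) = \<theta> ^ n" for n
    using us(5) by (simp add: power_int_minus \<theta>_def power_divide field_simps)
  have unit: "\<exists>e\<in>A. norm e = 1 \<and> A = cline e" if "A \<in> CP1" for A
  proof -
    obtain a where a: "a \<noteq> 0" "A = cline a" using \<open>A \<in> CP1\<close> by (auto simp: CP1_def)
    define e where "e = (of_real (1 / norm a) :: complex) *s a"
    have e: "norm e = 1" "cline e = cline a"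
      unfolding e_def using a(1) by (simp_all add: norm_smult_vec norm_divide cline_smult)
    have "e \<in> cline e" unfolding cline_def using vector_smult_lid[of e] by (metis rangeI)
    then show ?thesis using e a(2) by auto
  qed
  have lin: "k *s e \<in> A" if "A \<in> CP1" "e \<in> A" for A k e
    using that by (auto simp: CP1_def cline_def vector_smult_assoc)
  define W where "W = emb w"
  have W: "W \<noteq> 0" using w by (simp add: W_def)
  have lim: "(\<lambda>n. 2 * L * (C * \<theta> ^ n)) \<longlonglongrightarrow> 2 * L * (C * 0)"
    using \<theta> by (intro tendsto_intros LIMSEQ_power_zero) auto
  have Ws: "W \<in> s x"
  proof -
    obtain e where e: "e \<in> s x" "norm e = 1" "s x = cline e" using unit[OF lines(2)] by blast
    have "cmod (det2 e W) \<le> 2 * L * (C * \<theta> ^ n)" if "n \<ge> 1" for n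
    proof -
      have "cmod (det2 e W) = cmod (det2 (citer \<alpha> c n x *v e) (citer \<alpha> c n x *v W))" by (simp add: det2_citer)
      also have "\<dots> \<le> 2 * norm (citer \<alpha> c n x *v e) * norm (citer \<alpha> c n x *v W)" by (rule norm_det2_le)
      also have "\<dots> \<le> 2 * (C * \<theta> ^ n) * L"
        using ds[OF that e(1,2)] b(1)[of n] us(4) \<theta> by (intro mult_mono) (auto simp: pw W_def citer_emb)
      finally show ?thesis by (simp add: mult_ac)
    qed
    then have "cmod (det2 e W) \<le> 2 * L * (C * 0)"
      by (intro LIMSEQ_le_const[OF lim]) blast
    then have "det2 e W = 0" by simp
    moreover have "e \<noteq> 0" using e(2) by auto
    ultimately show ?thesis using det2_zero_imp e(3) by blast
  qed
  have Wu: "W \<in> u x"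
  proof -
    obtain e where e: "e \<in> u x" "norm e = 1" "u x = cline e" using unit[OF lines(1)] by blast
    have "cmod (det2 e W) \<le> 2 * L * (C * \<theta> ^ n)" if "n \<ge> 1" for n
    proof -
      define y where "y = x - real n * \<alpha>"
      define M where "M = citer \<alpha> c n y"
      define e' where "e' = matrix_inv M *v e"
      define w' where "w' = swap (orb (- \<alpha>) c (x - \<alpha>) (swap w) n)"
      have eq: "x - \<alpha> + real n * (- \<alpha>) - (- \<alpha>) = y" by (simp add: y_def algebra_simps)
      have "orb \<alpha> c y w' n = w"
        using orb_reverse[of "- \<alpha>" c "x - \<alpha>" n "swap w"] unfolding eq w'_def by simp
      then have Mw: "M *v emb w' = W" by (simp add: M_def citer_emb W_def)
      have Me: "M *v e' = e" unfolding e'_def M_def by (rule matrix_apply_inv[OF invertible_citer])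
      have "cmod (det2 e W) = cmod (det2 e' (emb w'))" unfolding Mw[symmetric] Me[symmetric] M_def by (simp add: det2_citer)
      also have "\<dots> \<le> 2 * norm e' * norm (emb w')" by (rule norm_det2_le)
      also have "\<dots> \<le> 2 * (C * \<theta> ^ n) * L"
        using du[OF that e(1,2)] b(2)[of n] us(4) \<theta>
        by (intro mult_mono) (auto simp: pw e'_def M_def y_def w'_def cocycle_iter_neg_def)
      finally show ?thesis by (simp add: mult_ac)
    qed
    then have "cmod (det2 e W) \<le> 2 * L * (C * 0)"
      by (intro LIMSEQ_le_const[OF lim]) blast
    then have "det2 e W = 0" by simp
    moreover have "e \<noteq> 0" using e(2) by auto
    ultimately show ?thesis using det2_zero_imp e(3) by blast
  qed
  have uiter: "citer \<alpha> c n x *v W \<in> u (x + real n * \<alpha>)" for n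
  proof (induction n)
    case (Suc n)
    have "citer \<alpha> c (Suc n) x *v W \<in> (\<lambda>w. schroedinger c (x + real n * \<alpha>) *v w) ` u (x + real n * \<alpha>)"
      unfolding citer_Suc_mult using Suc by blast
    then show ?case unfolding us(3) by (simp add: algebra_simps)
  qed (use Wu in simp)
  have "norm W \<le> (C * \<theta> ^ n) * ((C * \<theta> ^ n) * norm W)" if n: "n \<ge> 1" for n
  proof -
    define V where "V = citer \<alpha> c n x *v W"
    have scaled: "norm (f Y) \<le> B * norm Y" if "\<And>e. e \<in> A \<Longrightarrow> norm e = 1 \<Longrightarrow> norm (f e) \<le> B"
      "A \<in> CP1" "Y \<in> A" "\<And>k e. f (k *s e) = k *s f e" for f :: "complex ^ 2 \<Rightarrow> complex ^ 2" and A B Y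
    proof (cases "Y = 0")
      case True then show ?thesis using that(4)[of 0 0] by simp
    next
      case False
      define e where "e = (of_real (1 / norm Y) :: complex) *s Y"
      have "norm e = 1" using False by (simp add: e_def norm_smult_vec norm_divide)
      then have "norm (f e) \<le> B" using that(1) lin[OF that(2,3)] by (simp add: e_def)
      moreover have "norm (f e) = norm (f Y) / norm Y" by (simp add: e_def that(4) norm_smult_vec norm_divide)
      ultimately show ?thesis using False by (simp add: divide_le_eq)
    qed
    have 1: "norm V \<le> (C * \<theta> ^ n) * norm W"
      unfolding V_def
      by (rule scaled[OF _ lines(2) Ws]) (use ds[OF n] in \<open>auto simp: pw vector_scalar_commute\<close>)
    have "norm (cocycle_iter_neg \<alpha> (schroedinger c) n (x + real n * \<alpha>) *v V) \<le> (C * \<theta> ^ n) * norm V"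
      unfolding V_def
      by (rule scaled[OF _ lines(1) uiter]) (use du[OF n] in \<open>auto simp: pw vector_scalar_commute\<close>)
    then have "norm W \<le> (C * \<theta> ^ n) * norm V" unfolding V_def by (simp only: cocycle_iter_neg_apply)
    also have "\<dots> \<le> (C * \<theta> ^ n) * ((C * \<theta> ^ n) * norm W)" using 1 us(4) \<theta> by (intro mult_left_mono) auto
    finally show ?thesis .
  qed
  moreover have "(\<lambda>n. (C * \<theta> ^ n) * ((C * \<theta> ^ n) * norm W)) \<longlonglongrightarrow> (C * 0) * ((C * 0) * norm W)"
    using \<theta> by (intro tendsto_intros LIMSEQ_power_zero) auto
  ultimately have "norm W \<le> (C * 0) * ((C * 0) * norm W)"
    by (intro LIMSEQ_le_const) auto
  then show False using W by simp
qed

lemma orb_backward: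
  "m \<le> n \<Longrightarrow> orb (- \<alpha>) c (x + real n * \<alpha> - \<alpha>) (swap (orb \<alpha> c x w n)) m = swap (orb \<alpha> c x w (n - m))"
proof -
  assume m: "m \<le> n"
  have e: "x + real (n - m) * \<alpha> + real m * \<alpha> - \<alpha> = x + real n * \<alpha> - \<alpha>" using m by (simp add: of_nat_diff algebra_simps)
  have "orb \<alpha> c x w n = orb \<alpha> c (x + real (n - m) * \<alpha>) (orb \<alpha> c x w (n - m)) m"
    using orb_add[of \<alpha> c x w "n - m" m] m by simp
  then show ?thesis using orb_reverse[of \<alpha> c "x + real (n - m) * \<alpha>" m "orb \<alpha> c x w (n - m)"] unfolding e by simp
qed

text \<open>
  By compactness every orbit doubles its norm within a bounded time \<open>M\<close>, forwards or backwards. Starting from the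
  middle of a long window and doubling repeatedly one must reach an end of the window, so the norm at the
  middle is much smaller than at one of the ends.
\<close>

lemma no_bounded_orbit_imp_hyp:
  assumes cont: "continuous_on UNIV c" and per: "periodic1 c"
    and nb: "\<And>x w L. (\<And>n. cmod (orb \<alpha> c x w n) \<le> L) \<Longrightarrow> (\<And>n. cmod (orb (- \<alpha>) c (x - \<alpha>) (swap w) n) \<le> L) \<Longrightarrow> w = 0"
  shows "\<exists>N. hyp \<alpha> c N"
proof -
  have "\<exists>M. \<forall>x\<in>{0..1}. \<forall>w. cmod w = 1 \<longrightarrow>
      (\<exists>n\<le>M. 2 \<le> cmod (orb \<alpha> c x w n) \<or> 2 \<le> cmod (orb (- \<alpha>) c (x - \<alpha>) (swap w) n))"
  proof (rule ccontr)
    assume "\<not> ?thesis"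
    then have neg: "\<exists>x\<in>{0..1}. \<exists>w. cmod w = 1 \<and>
      (\<forall>n\<le>M. \<not> 2 \<le> cmod (orb \<alpha> c x w n) \<and> \<not> 2 \<le> cmod (orb (- \<alpha>) c (x - \<alpha>) (swap w) n))" for M
      by meson
    have "\<forall>M. \<exists>q. q \<in> {0..1} \<times> sphere 0 1 \<and>
       (\<forall>n\<le>M. cmod (orb \<alpha> c (fst q) (snd q) n) < 2 \<and> cmod (orb (- \<alpha>) c (fst q - \<alpha>) (swap (snd q)) n) < 2)"
    proof
      fix M
      obtain x w where "x \<in> {0..1}" "cmod w = 1"
        "\<forall>n\<le>M. \<not> 2 \<le> cmod (orb \<alpha> c x w n) \<and> \<not> 2 \<le> cmod (orb (- \<alpha>) c (x - \<alpha>) (swap w) n)"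
        using neg[of M] by blast
      then show "\<exists>q. q \<in> {0..1} \<times> sphere 0 1 \<and>
       (\<forall>n\<le>M. cmod (orb \<alpha> c (fst q) (snd q) n) < 2 \<and> cmod (orb (- \<alpha>) c (fst q - \<alpha>) (swap (snd q)) n) < 2)"
        by (intro exI[of _ "(x, w)"]) (simp add: not_le)
    qed
    then obtain q where q: "\<And>M. q M \<in> {0..1} \<times> sphere 0 1"
      "\<And>M n. n \<le> M \<Longrightarrow> cmod (orb \<alpha> c (fst (q M)) (snd (q M)) n) < 2"
      "\<And>M n. n \<le> M \<Longrightarrow> cmod (orb (- \<alpha>) c (fst (q M) - \<alpha>) (swap (snd (q M))) n) < 2"
      by metis
    have "compact ({0..1} \<times> sphere 0 1 :: (real \<times> complex) set)" by (intro compact_Times) auto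
    then obtain l \<rho> where l: "l \<in> {0..1} \<times> sphere 0 1" "strict_mono \<rho>" "(q \<circ> \<rho>) \<longlonglongrightarrow> l"
      using q(1) unfolding compact_def by meson
    have le: "\<forall>\<^sub>F j in sequentially. n \<le> \<rho> j" for n
      using seq_suble[OF l(2)] by (meson eventually_sequentiallyI order_trans)
    have lim: "cmod (F l) \<le> 2" if F: "continuous_on UNIV F" "\<And>M. n \<le> M \<Longrightarrow> cmod (F (q M)) < 2"
      for F :: "real \<times> complex \<Rightarrow> complex" and n
    proof -
      have "isCont F l" using F(1) continuous_on_eq_continuous_at[OF open_UNIV] by blast
      from isCont_tendsto_compose[OF this l(3)] have "(\<lambda>j. cmod (F (q (\<rho> j)))) \<longlonglongrightarrow> cmod (F l)"
        by (intro tendsto_norm) (simp add: o_def)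
      then show ?thesis
        by (rule tendsto_upperbound) (use le[of n] F(2) in \<open>auto elim!: eventually_mono intro: less_imp_le\<close>)
    qed
    have "snd l = 0"
    proof (rule nb)
      fix n
      show "cmod (orb \<alpha> c (fst l) (snd l) n) \<le> 2"
        using lim[of "\<lambda>q. orb \<alpha> c (fst q + 0) (snd q) n" n] q(2) orb_continuous[OF cont, of "\<lambda>w. w" \<alpha> 0 n]
        by (simp add: continuous_intros)
      have "continuous_on UNIV swap" unfolding swap_def Complex_eq by (intro continuous_intros)
      then show "cmod (orb (- \<alpha>) c (fst l - \<alpha>) (swap (snd l)) n) \<le> 2"
        using lim[of "\<lambda>q. orb (- \<alpha>) c (fst q + (- \<alpha>)) (swap (snd q)) n" n] q(3) orb_continuous[OF cont, of swap "- \<alpha>" "- \<alpha>" n]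
        by simp
    qed
    then show False using l(1) by auto
  qed
  then obtain M where M0: "\<And>x w. x \<in> {0..1} \<Longrightarrow> cmod w = 1 \<Longrightarrow>
      (\<exists>n\<le>M. 2 \<le> cmod (orb \<alpha> c x w n) \<or> 2 \<le> cmod (orb (- \<alpha>) c (x - \<alpha>) (swap w) n))" by blast
  have M1: "\<exists>n\<le>M. 2 * cmod w \<le> cmod (orb \<alpha> c x w n) \<or> 2 * cmod w \<le> cmod (orb (- \<alpha>) c (x - \<alpha>) (swap w) n)" for x w
  proof (cases "w = 0")
    case False
    define u where "u = of_real (1 / cmod w) * w"
    have u: "cmod u = 1" "w = of_real (cmod w) * u" using False by (auto simp: u_def norm_mult norm_divide)
    have fr: "frac x \<in> {0..1}" using frac_lt_1[of x] by simp
    obtain n where n: "n \<le> M" "2 \<le> cmod (orb \<alpha> c (frac x) u n) \<or> 2 \<le> cmod (orb (- \<alpha>) c (frac x - \<alpha>) (swap u) n)"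
      using M0[OF fr u(1)] by blast
    have e: "frac x + of_int \<lfloor>x\<rfloor> = x" "frac x - \<alpha> + of_int \<lfloor>x\<rfloor> = x - \<alpha>" by (simp_all add: frac_def)
    have "orb \<alpha> c (frac x) u n = orb \<alpha> c x u n" "orb (- \<alpha>) c (frac x - \<alpha>) (swap u) n = orb (- \<alpha>) c (x - \<alpha>) (swap u) n"
      using orb_periodic_int[OF per, of \<alpha> "frac x" "\<lfloor>x\<rfloor>" u n] orb_periodic_int[OF per, of "- \<alpha>" "frac x - \<alpha>" "\<lfloor>x\<rfloor>" "swap u" n]
      unfolding e by simp_all
    moreover have "orb \<alpha> c x w n = of_real (cmod w) * orb \<alpha> c x u n"
      by (subst u(2)) (rule orb_scale)
    moreover have "swap w = of_real (cmod w) * swap u" 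
      by (subst u(2)) (simp add: complex_eq_iff)
    then have "orb (- \<alpha>) c (x - \<alpha>) (swap w) n = of_real (cmod w) * orb (- \<alpha>) c (x - \<alpha>) (swap u) n"
      by (simp only: orb_scale)
    ultimately have "2 * cmod w \<le> cmod (orb \<alpha> c x w n) \<or> 2 * cmod w \<le> cmod (orb (- \<alpha>) c (x - \<alpha>) (swap w) n)"
      using n(2) mult_left_mono[of 2 "cmod (orb \<alpha> c x u n)" "cmod w"]
        mult_left_mono[of 2 "cmod (orb (- \<alpha>) c (x - \<alpha>) (swap u) n)" "cmod w"]
      by (auto simp: norm_mult mult.commute[of 2])
    then show ?thesis using n(1) by blast
  qed auto
  obtain K where K: "\<And>x. \<bar>c x\<bar> \<le> K" using periodic1_bounded[OF cont per] by blast
  define B where "B = K + 1"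
  have cB: "\<bar>c x\<bar> + 1 \<le> B" for x using K[of x] by (simp add: B_def)
  have B1: "1 \<le> B" using cB[of 0] by linarith
  obtain j where j: "2 * B ^ M < 2 ^ j" using real_arch_pow[of 2 "2 * B ^ M"] by auto
  define N where "N = j * M"
  have "hyp \<alpha> c N"
    unfolding hyp_def
  proof (intro allI)
    fix x w
    define b where "b n = cmod (orb \<alpha> c x w n)" for n
    have dbl: "\<exists>n'\<le>2 * N. n - M \<le> n' \<and> n' \<le> n + M \<and> 2 * b n \<le> b n'" if "M \<le> n" "n + M \<le> 2 * N" for n
    proof -
      obtain m where m: "m \<le> M" "2 * cmod (orb \<alpha> c x w n) \<le> cmod (orb \<alpha> c (x + real n * \<alpha>) (orb \<alpha> c x w n) m)
         \<or> 2 * cmod (orb \<alpha> c x w n) \<le> cmod (orb (- \<alpha>) c (x + real n * \<alpha> - \<alpha>) (swap (orb \<alpha> c x w n)) m)"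
        using M1 by blast
      from m(2) show ?thesis
      proof
        assume "2 * cmod (orb \<alpha> c x w n) \<le> cmod (orb \<alpha> c (x + real n * \<alpha>) (orb \<alpha> c x w n) m)"
        then have "2 * b n \<le> b (n + m)" by (simp add: b_def orb_add)
        then show ?thesis using m(1) that by (intro exI[of _ "n + m"]) auto
      next
        assume "2 * cmod (orb \<alpha> c x w n) \<le> cmod (orb (- \<alpha>) c (x + real n * \<alpha> - \<alpha>) (swap (orb \<alpha> c x w n)) m)"
        then have "2 * b n \<le> b (n - m)" using m(1) that by (simp add: b_def orb_backward)
        then show ?thesis using m(1) that by (intro exI[of _ "n - m"]) auto
      qed
    qed
    \<comment> \<open>After \<open>i\<close> doublings the position is still \<open>(j - i) * M\<close> away from both ends.\<close>
    have chain: "i \<le> j \<Longrightarrow> \<exists>n'. (j - i) * M \<le> n' \<and> n' + (j - i) * M \<le> 2 * N \<and> 2 ^ i * b N \<le> b n'" for i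
    proof (induction i)
      case 0 then show ?case by (intro exI[of _ N]) (simp add: N_def)
    next
      case (Suc i)
      then obtain n where n: "(j - i) * M \<le> n" "n + (j - i) * M \<le> 2 * N" "2 ^ i * b N \<le> b n" by auto
      have ji: "j - i = Suc (j - Suc i)" using Suc.prems by simp
      have s: "(j - i) * M = M + (j - Suc i) * M" unfolding ji by simp
      obtain n' where n': "n' \<le> 2 * N" "n - M \<le> n'" "n' \<le> n + M" "2 * b n \<le> b n'"
        using dbl[of n] n s by auto
      have "2 ^ Suc i * b N \<le> b n'" using n(3) n'(4) by simp
      then show ?case using n n' s by (intro exI[of _ n']) auto
    qed
    obtain n1 where n1: "n1 \<le> 2 * N" "2 ^ j * b N \<le> b n1" using chain[of j] by auto
    have "Max (b ` {..2 * N}) \<in> b ` {..2 * N}" by (rule Max_in) auto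
    then obtain m where m: "m \<le> 2 * N" "Max (b ` {..2 * N}) = b m" by (metis imageE atMost_iff)
    have bm: "b n \<le> b m" if "n \<le> 2 * N" for n unfolding m(2)[symmetric] using that by (intro Max_ge) auto
    have b0: "0 \<le> b n" for n by (simp add: b_def)
    define E where "E = max (b 0) (b (2 * N))"
    have E: "b 0 \<le> E" "b (2 * N) \<le> E" "0 \<le> E" using b0[of 0] by (auto simp: E_def)
    have "b m \<le> B ^ M * E"
    proof -
      consider "m < M" | "2 * N < m + M" | "M \<le> m" "m + M \<le> 2 * N" by linarith
      then show ?thesis
      proof cases
        case 1
        have "b m \<le> B ^ m * b 0" unfolding b_def using norm_orb_le[OF cB] by simp
        also have "\<dots> \<le> B ^ M * E" using 1 B1 E b0 by (intro mult_mono power_increasing) auto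
        finally show ?thesis .
      next
        case 2
        have "b m \<le> B ^ (2 * N - m) * cmod (orb \<alpha> c (x + real m * \<alpha>) (orb \<alpha> c x w m) (2 * N - m))"
          unfolding b_def by (rule norm_orb_ge[OF cB])
        also have "\<dots> = B ^ (2 * N - m) * b (2 * N)"
          using orb_add[of \<alpha> c x w m "2 * N - m"] m(1) by (simp add: b_def)
        also have "\<dots> \<le> B ^ M * E" using 2 B1 E b0 by (intro mult_mono power_increasing) auto
        finally show ?thesis .
      next
        case 3
        then obtain n' where "n' \<le> 2 * N" "2 * b m \<le> b n'" using dbl by blast
        then have "b m \<le> 0" using bm[of n'] b0[of m] by linarith
        moreover have "0 \<le> B ^ M * E" using B1 E by simp
        ultimately show ?thesis by linarith
      qed
    qed
    then have "2 ^ j * b N \<le> B ^ M * E" using n1 bm[OF n1(1)] by linarith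
    moreover have "2 * B ^ M * b N \<le> 2 ^ j * b N" using j b0[of N] by (intro mult_right_mono) auto
    ultimately have "B ^ M * (2 * b N) \<le> B ^ M * E" by simp
    then have "2 * b N \<le> E" using B1 by simp
    then have "(2 * b N)\<^sup>2 \<le> E\<^sup>2" using b0 by (intro power_mono) auto
    also have "E\<^sup>2 \<le> (b 0)\<^sup>2 + (b (2 * N))\<^sup>2" by (auto simp: E_def max_def)
    finally show "4 * (cmod (orb \<alpha> c x w N))\<^sup>2 \<le> (cmod (orb \<alpha> c x w (2 * N)))\<^sup>2 + (cmod w)\<^sup>2"
      by (simp add: b_def power_mult_distrib)
  qed
  then show ?thesis by blast
qed

lemma uniformly_hyperbolic_iff:
  assumes cont: "continuous_on UNIV c" and per: "periodic1 c"
  shows "uniformly_hyperbolic \<alpha> (schroedinger c) \<longleftrightarrow> (\<exists>N. hyp \<alpha> c N)"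
    and "uniformly_hyperbolic \<alpha> (schroedinger c) \<longleftrightarrow> (\<exists>G>0. gapped \<alpha> c G)"
proof -
  obtain M where M: "\<And>x. \<bar>c x\<bar> \<le> M" using periodic1_bounded[OF cont per] by blast
  have 1: "\<exists>N. hyp \<alpha> c N" if "uniformly_hyperbolic \<alpha> (schroedinger c)"
    using no_bounded_orbit_imp_hyp[OF cont per] uniformly_hyperbolic_no_bounded_orbit[OF that] by blast
  have 2: "\<exists>G>0. gapped \<alpha> c G" if "\<exists>N. hyp \<alpha> c N" using that hyp_imp_gapped M by blast
  have 3: "uniformly_hyperbolic \<alpha> (schroedinger c)" if "\<exists>G>0. gapped \<alpha> c G"
    using that gapped_imp_uniformly_hyperbolic[OF cont per] by blast
  show "uniformly_hyperbolic \<alpha> (schroedinger c) \<longleftrightarrow> (\<exists>N. hyp \<alpha> c N)"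
    "uniformly_hyperbolic \<alpha> (schroedinger c) \<longleftrightarrow> (\<exists>G>0. gapped \<alpha> c G)"
    using 1 2 3 by blast+
qed

section \<open>Winding is paid for by edge states\<close>

lemma between_connected:
  fixes f :: "real \<Rightarrow> real"
  assumes "continuous_on {u..w} f" "u \<le> w" "\<And>h. h \<in> {u..w} \<Longrightarrow> f h \<noteq> a" "\<And>h. h \<in> {u..w} \<Longrightarrow> f h \<noteq> b"
    and "min a b < f u" "f u < max a b"
  shows "min a b < f w \<and> f w < max a b"
proof -
  have con: "connected (f ` {u..w})" using assms(1) by (intro connected_continuous_image) auto
  have m: "f u \<in> f ` {u..w}" "f w \<in> f ` {u..w}" using assms(2) by auto
  have "min a b < f w"
  proof (rule ccontr)
    assume "\<not> ?thesis"
    then have "min a b \<in> f ` {u..w}" using assms(5) by (intro connectedD_interval[OF con m(2,1)]) auto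
    then show False using assms(3,4) by (metis imageE min_def)
  qed
  moreover have "f w < max a b"
  proof (rule ccontr)
    assume "\<not> ?thesis"
    then have "max a b \<in> f ` {u..w}" using assms(6) by (intro connectedD_interval[OF con m(1,2)]) auto
    then show False using assms(3,4) by (metis imageE max_def)
  qed
  ultimately show ?thesis by blast
qed

lemma floor_change:
  fixes a b :: real
  assumes "\<bar>b - a\<bar> < pi"
  shows "\<bar>\<lfloor>b / pi\<rfloor> - \<lfloor>a / pi\<rfloor>\<bar> \<le> 1"
    and "\<lfloor>b / pi\<rfloor> \<noteq> \<lfloor>a / pi\<rfloor> \<Longrightarrow> \<exists>m::int. min a b \<le> of_int m * pi \<and> of_int m * pi \<le> max a b"
proof -
  have "\<bar>b / pi - a / pi\<bar> < 1" using assms by (simp add: diff_divide_distrib[symmetric] abs_divide)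
  then show "\<bar>\<lfloor>b / pi\<rfloor> - \<lfloor>a / pi\<rfloor>\<bar> \<le> 1" by linarith
  assume ne: "\<lfloor>b / pi\<rfloor> \<noteq> \<lfloor>a / pi\<rfloor>"
  define m where "m = max \<lfloor>a / pi\<rfloor> \<lfloor>b / pi\<rfloor>"
  have "of_int m \<le> max (a / pi) (b / pi)" unfolding m_def by (auto simp: max_def) linarith+
  moreover have "min (a / pi) (b / pi) \<le> of_int m" using ne unfolding m_def by (auto simp: max_def min_def) linarith+
  ultimately show "\<exists>m::int. min a b \<le> of_int m * pi \<and> of_int m * pi \<le> max a b"
    by (intro exI[of _ m]) (auto simp: max_def min_def field_simps split: if_splits)
qed

text \<open>
  At the points \<open>x = i / S\<close> the angles \<open>s \<tau> x\<close> with \<open>\<tau> \<in> I\<close> sweep out an interval between the values at the two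
  ends of \<open>I\<close>. By the choice of \<open>S\<close> a shift of the phase by \<open>1 / S\<close> has less effect than a shift of the energy by
  \<open>g / 2\<close>, so the angle of the middle energy at the next point still lies in the interval swept out at \<open>x\<close>.
  Whenever it passes a multiple of \<open>pi\<close> on the way, some energy in \<open>I\<close> has a horizontal direction at \<open>x\<close>.
  Along the whole circle the angle changes by \<open>k * pi\<close>.
\<close>

lemma winding_le_crossings:
  fixes v :: "real \<Rightarrow> real"
  assumes irr: "\<alpha> \<notin> \<rat>" and lam: "lam > 0" and g: "g > 0"
    and lip: "\<And>x y. \<bar>v x - v y\<bar> \<le> V * \<bar>x - y\<bar>"
    and S: "S > 0" "2 * V < real S * g"
    and I: "I = {t - g / 2..t + g / 2}"
    and sc: "continuous_on (I \<times> UNIV) (\<lambda>p. s (fst p) (snd p))"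
    and se: "\<And>\<tau>. \<tau> \<in> I \<Longrightarrow> sect \<alpha> (\<lambda>x. lam * (\<tau> - v x)) (s \<tau>) k l"
  shows "\<bar>real_of_int k\<bar> \<le> card {i. i < S \<and> (\<exists>\<tau>\<in>I. sin (s \<tau> (real i / real S)) = 0)}"
proof -
  define a where "a = t - g / 2"
  define b where "b = t + g / 2"
  have tI: "t \<in> I" "a \<in> I" "b \<in> I" "a < t" "t < b" using g by (auto simp: I a_def b_def)
  have cx: "continuous_on I (\<lambda>\<tau>. s \<tau> x)" for x
  proof -
    have "continuous_on I (\<lambda>\<tau>. (\<tau>, x))" by (intro continuous_intros)
    moreover have "(\<lambda>\<tau>. (\<tau>, x)) ` I \<subseteq> I \<times> UNIV" by auto
    ultimately show ?thesis using continuous_on_compose2[OF sc] by fastforce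
  qed
  have st: "continuous_on UNIV (s t)" using se[OF tI(1)] by (simp add: sect_def)
  have ne: "s \<tau>1 x \<noteq> s \<tau>2 x + of_int m * pi" if "\<tau>1 \<in> I" "\<tau>2 \<in> I" "\<tau>1 < \<tau>2" for \<tau>1 \<tau>2 x m
    using that lam by (intro sections_never_meet[OF irr se se]) auto
  have inj: "inj_on (\<lambda>\<tau>. s \<tau> x) I" for x
    using ne[where m=0] by (intro linorder_inj_onI) auto
  have mid: "min (s a x) (s b x) < s t x \<and> s t x < max (s a x) (s b x)" for x
  proof -
    have "(s a x < s t x \<and> s t x < s b x) \<or> (s b x < s t x \<and> s t x < s a x)"
      using tI continuous_inj_imp_mono[of a t b "\<lambda>\<tau>. s \<tau> x"] cx[of x] inj[of x]
      by (simp add: I a_def b_def)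
    then show ?thesis by auto
  qed
  \<comment> \<open>Sections of different energies never meet modulo \<open>pi\<close>.\<close>
  have near: "\<bar>s \<tau> x - s t x\<bar> < pi" if "\<tau> \<in> I" for \<tau> x
  proof (rule ccontr)
    assume big: "\<not> ?thesis"
    define J where "J = {min t \<tau>..max t \<tau>}"
    have JI: "J \<subseteq> I" using that tI by (auto simp: J_def I min_def max_def split: if_splits)
    have con: "connected ((\<lambda>\<tau>. s \<tau> x) ` J)"
      using cx[of x] JI by (intro connected_continuous_image) (auto simp: J_def intro: continuous_on_subset)
    have m: "s t x \<in> (\<lambda>\<tau>. s \<tau> x) ` J" "s \<tau> x \<in> (\<lambda>\<tau>. s \<tau> x) ` J" by (auto simp: J_def)
    have "s t x + pi \<in> (\<lambda>\<tau>. s \<tau> x) ` J \<or> s t x - pi \<in> (\<lambda>\<tau>. s \<tau> x) ` J"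
      using big connectedD_interval[OF con m(1,2)] connectedD_interval[OF con m(2,1)]
      by (cases "s t x \<le> s \<tau> x") (auto simp: abs_if split: if_splits)
    then obtain \<sigma> where s': "\<sigma> \<in> J" "s \<sigma> x = s t x + pi \<or> s \<sigma> x = s t x - pi"
      by (elim disjE imageE) metis+
    have s: "\<sigma> \<in> I" "s \<sigma> x = s t x + pi \<or> s \<sigma> x = s t x - pi" using s' JI by blast+
    have "\<sigma> \<noteq> t" using s(2) by auto
    then show False
      using s ne[OF s(1) tI(1), of x 1] ne[OF s(1) tI(1), of x "-1"] ne[OF tI(1) s(1), of x 1] ne[OF tI(1) s(1), of x "-1"]
      by (cases "\<sigma> < t") auto
  qed
  define d where "d = 1 / real S"
  have d: "d > 0" using S by (simp add: d_def)
  \<comment> \<open>The phase shifted section belongs to a potential between those of the two end energies.\<close>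
  have shift: "sect \<alpha> (\<lambda>x. lam * (t - v (x + h))) (\<lambda>x. s t (x + h)) k l" for h
  proof -
    have "continuous_on UNIV (\<lambda>x. s t (x + h))"
      by (rule continuous_on_compose2[OF st]) (intro continuous_intros, auto)
    moreover have "s t (x + 1 + h) = s t (x + h) + of_int k * pi" for x
    proof -
      have "s t ((x + h) + 1) = s t (x + h) + of_int k * pi" using se[OF tI(1)] unfolding sect_def by blast
      moreover have "x + 1 + h = (x + h) + 1" by simp
      ultimately show ?thesis by (simp only:)
    qed
    moreover have "lift (lam * (t - v (x + h))) (s t (x + h)) = s t (x + \<alpha> + h) + of_int l * pi" for x
    proof -
      have "lift (lam * (t - v (x + h))) (s t (x + h)) = s t ((x + h) + \<alpha>) + of_int l * pi"
        using se[OF tI(1)] unfolding sect_def by blast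
      moreover have "x + \<alpha> + h = (x + h) + \<alpha>" by simp
      ultimately show ?thesis by (simp only:)
    qed
    ultimately show ?thesis by (simp add: sect_def)
  qed
  have avoid: "s t (x + h) \<noteq> s a x" "s t (x + h) \<noteq> s b x" if h: "h \<in> {0..d}" for x h
  proof -
    have vh: "\<bar>v (y + h) - v y\<bar> < g / 2" for y
    proof -
      have "\<bar>v (y + h) - v y\<bar> \<le> V * h" using lip[of "y + h" y] h by simp
      moreover have V0: "0 \<le> V" using lip[of 1 0] by simp
      moreover have "V * h \<le> V * d" using h V0 by (intro mult_left_mono) auto
      moreover have "V * d < g / 2" using S by (simp add: d_def field_simps)
      ultimately show ?thesis by linarith
    qed
    have l1: "lam * (a - v y) < lam * (t - v (y + h))" "lam * (t - v (y + h)) < lam * (b - v y)" for y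
    proof -
      have "a - v y < t - v (y + h)" "t - v (y + h) < b - v y"
        using vh[of y] unfolding abs_less_iff a_def b_def by linarith+
      then show "lam * (a - v y) < lam * (t - v (y + h))" "lam * (t - v (y + h)) < lam * (b - v y)"
        using lam by simp_all
    qed
    show "s t (x + h) \<noteq> s a x"
      using sections_never_meet[OF irr se[OF tI(2)] shift l1(1), of x 0] by simp
    show "s t (x + h) \<noteq> s b x"
      using sections_never_meet[OF irr shift se[OF tI(3)] l1(2), of x 0] by simp
  qed
  have step: "min (s a x) (s b x) < s t (x + d) \<and> s t (x + d) < max (s a x) (s b x)" for x
  proof (rule between_connected[where u=0 and w=d and f="\<lambda>h. s t (x + h)"])
    have "continuous_on UNIV (\<lambda>h. s t (x + h))"
      by (rule continuous_on_compose2[OF st]) (intro continuous_intros, auto)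
    then show "continuous_on {0..d} (\<lambda>h. s t (x + h))" by (rule continuous_on_subset) simp
    show "0 \<le> d" using d by simp
    show "s t (x + h) \<noteq> s a x" "s t (x + h) \<noteq> s b x" if "h \<in> {0..d}" for h
      using avoid[OF that] by blast+
    show "min (s a x) (s b x) < s t (x + 0)" "s t (x + 0) < max (s a x) (s b x)" using mid[of x] by simp_all
  qed
  define n where "n i = \<lfloor>s t (real i * d) / pi\<rfloor>" for i
  define X where "X = {i. i < S \<and> (\<exists>\<tau>\<in>I. sin (s \<tau> (real i / real S)) = 0)}"
  have fX: "finite X" by (simp add: X_def)
  have inc: "\<bar>n (Suc i) - n i\<bar> \<le> (if i \<in> X then 1 else 0)" if i: "i < S" for i
  proof -
    define x where "x = real i * d"
    have xs: "real (Suc i) * d = x + d" by (simp add: x_def algebra_simps)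
    have xi: "x = real i / real S" by (simp add: x_def d_def)
    have "\<bar>s t (x + d) - s t x\<bar> < pi"
      using step[of x] near[OF tI(2), of x] near[OF tI(3), of x] by (auto simp: min_def max_def abs_if split: if_splits)
    note fl = floor_change[OF this]
    show ?thesis
    proof (cases "n (Suc i) = n i")
      case False
      then have "\<lfloor>s t (x + d) / pi\<rfloor> \<noteq> \<lfloor>s t x / pi\<rfloor>" unfolding n_def xs x_def[symmetric] .
      from fl(2)[OF this] obtain m :: int where m: "min (s t x) (s t (x + d)) \<le> of_int m * pi" "of_int m * pi \<le> max (s t x) (s t (x + d))"
        by blast
      have m': "min (s a x) (s b x) \<le> of_int m * pi" "of_int m * pi \<le> max (s a x) (s b x)"
        using m mid[of x] step[of x] by (auto simp: min_def max_def split: if_splits)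
      have con: "connected ((\<lambda>\<tau>. s \<tau> x) ` I)" using cx[of x] by (intro connected_continuous_image) (auto simp: I)
      have "of_int m * pi \<in> (\<lambda>\<tau>. s \<tau> x) ` I"
        using m' connectedD_interval[OF con, of "s a x" "s b x"] connectedD_interval[OF con, of "s b x" "s a x"] tI
        by (auto simp: min_def max_def split: if_splits)
      then obtain \<tau> where "\<tau> \<in> I" "s \<tau> x = of_int m * pi" by (metis imageE)
      then have "\<tau> \<in> I \<and> sin (s \<tau> (real i / real S)) = 0" unfolding xi[symmetric] by (auto simp: sin_zero_iff_int2)
      then have "i \<in> X" using i unfolding X_def by blast
      then show ?thesis using fl(1) unfolding n_def xs x_def[symmetric] by simp
    qed simp
  qed
  have tel: "j \<le> S \<Longrightarrow> \<bar>n j - n 0\<bar> \<le> int (card (X \<inter> {..<j}))" for j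
  proof (induction j)
    case (Suc j)
    have "X \<inter> {..<Suc j} = (if j \<in> X then insert j (X \<inter> {..<j}) else X \<inter> {..<j})" by (auto simp: less_Suc_eq)
    then have cd: "card (X \<inter> {..<Suc j}) = card (X \<inter> {..<j}) + (if j \<in> X then 1 else 0)" by simp
    have ih: "\<bar>n j - n 0\<bar> \<le> int (card (X \<inter> {..<j}))" using Suc by simp
    have dn: "\<bar>n (Suc j) - n j\<bar> \<le> (if j \<in> X then 1 else 0)" using inc[of j] Suc.prems by simp
    show ?case
    proof (cases "j \<in> X")
      case True
      then have "card (X \<inter> {..<Suc j}) = card (X \<inter> {..<j}) + 1" "\<bar>n (Suc j) - n j\<bar> \<le> 1"
        using cd dn by simp_all
      then show ?thesis using ih by linarith
    next
      case False
      then have "card (X \<inter> {..<Suc j}) = card (X \<inter> {..<j})" "\<bar>n (Suc j) - n j\<bar> \<le> 0"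
        using cd dn by simp_all
      then show ?thesis using ih by linarith
    qed
  qed simp
  have "real S * d = 1" using S by (simp add: d_def)
  then have "n S = \<lfloor>s t (0 + 1) / pi\<rfloor>" by (simp add: n_def)
  also have "s t (0 + 1) = s t 0 + of_int k * pi" using se[OF tI(1)] unfolding sect_def by blast
  also have "\<lfloor>(s t 0 + of_int k * pi) / pi\<rfloor> = n 0 + k" by (simp add: n_def add_divide_distrib)
  finally have "\<bar>k\<bar> \<le> int (card (X \<inter> {..<S}))" using tel[of S] by simp
  moreover have "X \<inter> {..<S} = X" by (auto simp: X_def)
  ultimately have "real_of_int \<bar>k\<bar> \<le> real_of_int (int (card X))" by (simp only: of_int_le_iff)
  then show ?thesis by (simp add: X_def)
qed

section \<open>Edge states are localised\<close>

text \<open>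
  The orbit is multiplied by a staircase \<open>ch\<close> that rises from 0 to 1 in equal steps at the sites of \<open>A\<close>. The operator
  applied to the product sees only the steps, each of height \<open>1 / card A\<close>, and the values of the orbit
  there, which are small by assumption; the far end \<open>N\<close> contributes a term that vanishes in the limit. The gap
  then bounds the mass beyond \<open>len\<close>.
\<close>

lemma cutoff_estimate:
  assumes gp: "gapped \<alpha> c G" and G: "G > 0" and st: "stab \<alpha> c x 1"
    and A: "finite A" "A \<subseteq> {1..<len}" "A \<noteq> {}"
  defines "p \<equiv> \<lambda>n. Im (orb \<alpha> c x 1 n)"
  assumes R: "(\<Sum>n\<in>A. (cmod (orb \<alpha> c x 1 n))\<^sup>2) \<le> R\<^sup>2 * (\<Sum>n. (p n)\<^sup>2)" and R0: "R \<ge> 0" and RG: "4 * R \<le> real (card A) * G"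
  shows "summable (\<lambda>n. (p n)\<^sup>2)" "3 / 4 * (\<Sum>n. (p n)\<^sup>2) \<le> (\<Sum>n\<in>{1..len}. (p n)\<^sup>2)"
proof -
  define w where "w n = orb \<alpha> c x 1 n" for n
  have im: "Im (w n) = p n" and re: "Re (w n) = p (Suc n)" for n by (simp_all add: w_def p_def)
  have rec: "p (Suc (Suc n)) = c (x + real n * \<alpha>) * p (Suc n) - p n" for n
    by (simp add: p_def)
  have p0: "p 0 = 0" by (simp add: p_def)
  have sw: "summable (\<lambda>n. (cmod (w n))\<^sup>2)" unfolding w_def by (rule stabD_decay(2)[OF gp G st])
  show sp: "summable (\<lambda>n. (p n)\<^sup>2)"
    by (rule summable_comparison_test'[OF sw, of 0]) (simp add: cmod_power2 im)
  have w0: "(\<lambda>n. cmod (w n)) \<longlonglongrightarrow> 0"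
    unfolding w_def using stab_tendsto_0[OF gp G st] by (rule tendsto_norm_zero)
  define E where "E = (\<Sum>n. (p n)\<^sup>2)"
  have E0: "0 \<le> E" unfolding E_def using sp by (intro suminf_nonneg) auto
  define b where "b = real (card A)"
  have b: "b > 0" using A by (simp add: b_def card_gt_0_iff)
  define ch where "ch n = real (card {a \<in> A. a < n}) / b" for n
  have ch1: "ch n \<le> 1" "0 \<le> ch n" for n
  proof -
    have "card {a \<in> A. a < n} \<le> card A" using A by (intro card_mono) auto
    then show "ch n \<le> 1" "0 \<le> ch n" using b by (simp_all add: ch_def b_def)
  qed
  have chbig: "ch n = 1" if "len \<le> n" for n
  proof -
    have "{a \<in> A. a < n} = A" using A that by auto
    then show ?thesis using b by (simp add: ch_def b_def)
  qed
  have ch0: "ch 1 = 0" "ch 0 = 0" 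
  proof -
    have "{a \<in> A. a < 1} = {}" "{a \<in> A. a < 0} = {}" using A by auto
    then show "ch 1 = 0" "ch 0 = 0" by (simp_all add: ch_def)
  qed
  have chS: "ch (Suc n) = ch n + (if n \<in> A then 1 / b else 0)" for n
  proof -
    have "{a \<in> A. a < Suc n} = (if n \<in> A then insert n {a \<in> A. a < n} else {a \<in> A. a < n})"
      by (auto simp: less_Suc_eq)
    then show ?thesis using A by (simp add: ch_def add_divide_distrib)
  qed
  define q where "q n = (if n \<in> A then 1 / b else 0)" for n :: nat
  have key: "G * sqrt (\<Sum>n\<in>{Suc len..<N}. (p n)\<^sup>2) \<le> 2 * (R * sqrt E / b) + 2 * cmod (w N)" if N: "len < N" for N
  proof -
    \<comment> \<open>The errors \<open>u1\<close> and \<open>u2\<close> come from the steps of the staircase, \<open>u3\<close> from the cut at \<open>N\<close>.\<close>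
    define f where "f m = (if 1 \<le> m \<and> m \<le> int N then ch (nat m) * p (nat m) else 0)" for m :: int
    define u1 where "u1 m = (if m \<ge> 0 then q (nat m) * p (Suc (nat m)) else 0)" for m :: int
    define u2 where "u2 m = (if m \<ge> 1 then q (nat m - 1) * p (nat m - 1) else 0)" for m :: int
    define u3 where "u3 m = (if m = int N then - p (Suc N) else if m = int N + 1 then p N else 0)" for m :: int
    have f0: "f m = 0" if "m \<notin> {1..int N}" for m using that by (auto simp: f_def)
    have f: "fsp f" by (rule fspI[of "{1..int N}"]) (auto simp: f0)
    have qN: "q N = 0" "q n = 0" if "n \<ge> len" for n using A N that by (auto simp: q_def)
    have chN: "ch N = 1" "ch (Suc N) = 1" using N by (auto intro!: chbig)
    have T: "Top \<alpha> c (x - \<alpha>) f m = (u1 m - u2 m) + u3 m" for m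
    proof -
      consider "m < 0" | "m = 0" | "m > int N" | "1 \<le> m" "m \<le> int N" by linarith
      then show ?thesis
      proof cases
        case 1 then show ?thesis by (simp add: Top_def f_def u1_def u2_def u3_def)
      next
        case 2
        have "0 \<notin> A" using A by auto
        then show ?thesis using 2 N ch0 by (simp add: Top_def f_def u1_def u2_def u3_def q_def)
      next
        case 3
        then have a: "nat m \<ge> len" "nat m - 1 \<ge> len" using N by auto
        show ?thesis
        proof (cases "m = int N + 1")
          case True
          then show ?thesis using a N chN qN(2)[OF a(1)] qN(2)[OF a(2)] by (simp add: Top_def f_def u1_def u2_def u3_def)
        next
          case False
          then show ?thesis using 3 a qN(2)[OF a(1)] qN(2)[OF a(2)] by (simp add: Top_def f_def u1_def u2_def u3_def)
        qed
      next
        case 4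
        define j where "j = nat (m - 1)"
        have j: "m = int j + 1" "Suc j \<le> N" using 4 by (auto simp: j_def)
        have nm: "nat m = Suc j" "nat (m - 1) = j" "nat (m + 1) = Suc (Suc j)" using j by auto
        have a1: "x - \<alpha> + real_of_int m * \<alpha> = x + real j * \<alpha>" using j by (simp add: algebra_simps)
        have a2: "f (m - 1) = ch j * p j" using j by (cases j) (auto simp: f_def p0 nat_add_distrib)
        have a4: "f m = ch (Suc j) * p (Suc j)" using 4 nm by (simp add: f_def)
        have a3: "f (m + 1) = ch (Suc (Suc j)) * p (Suc (Suc j)) + u3 m"
          using j N chN by (cases "Suc j = N") (auto simp: f_def u3_def nat_add_distrib Suc_le_eq)
        have b1: "u1 m = q (Suc j) * p (Suc (Suc j))" "u2 m = q j * p j" using 4 nm by (auto simp: u1_def u2_def)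
        have s1: "ch (Suc (Suc j)) = ch (Suc j) + q (Suc j)" "ch j = ch (Suc j) - q j" using chS by (auto simp: q_def)
        have r: "c (x + real j * \<alpha>) * p (Suc j) = p (Suc (Suc j)) + p j" using rec[of j] by simp
        have "Top \<alpha> c (x - \<alpha>) f m = ch (Suc (Suc j)) * p (Suc (Suc j)) + u3 m + ch j * p j - ch (Suc j) * (c (x + real j * \<alpha>) * p (Suc j))"
          unfolding Top_def a1 a2 a3 a4 by simp
        also have "\<dots> = (u1 m - u2 m) + u3 m" unfolding r b1 s1 by (simp add: algebra_simps)
        finally show ?thesis .
      qed
    qed
    have fu: "fsp u1" "fsp u2" "fsp u3"
    proof -
      have "q (nat m) = 0" if "m \<notin> int ` A" "m \<ge> 0" for m using that by (auto simp: q_def image_iff)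
      then show "fsp u1" by (intro fspI[of "int ` A"]) (auto simp: u1_def A(1))
      have "q (nat m - 1) = 0" if "m \<notin> (\<lambda>n. int n + 1) ` A" "m \<ge> 1" for m
      proof -
        have "m = int (nat m - 1) + 1" using that by simp
        then have "nat m - 1 \<notin> A" using that(1) by blast
        then show ?thesis by (simp add: q_def)
      qed
      then show "fsp u2" by (intro fspI[of "(\<lambda>n. int n + 1) ` A"]) (auto simp: u2_def A(1))
      show "fsp u3" by (rule fspI[of "{int N, int N + 1}"]) (auto simp: u3_def)
    qed
    have RE: "(\<Sum>n\<in>A. (p (Suc n))\<^sup>2) + (\<Sum>n\<in>A. (p n)\<^sup>2) \<le> R\<^sup>2 * E"
      using R by (simp add: w_def[symmetric] E_def cmod_power2 im re sum.distrib)
    have sums0: "0 \<le> (\<Sum>n\<in>A. (p (Suc n))\<^sup>2)" "0 \<le> (\<Sum>n\<in>A. (p n)\<^sup>2)" by (auto intro: sum_nonneg)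
    have n1: "nn u1 \<le> R * sqrt E / b"
    proof -
      have "(nn u1)\<^sup>2 = (\<Sum>m\<in>int ` A. (u1 m)\<^sup>2)"
        unfolding nn_zsum by (rule zsum_eq) (use A(1) in \<open>auto simp: u1_def q_def image_iff\<close>)
      also have "\<dots> = (\<Sum>n\<in>A. (p (Suc n))\<^sup>2 / b\<^sup>2)"
        by (subst sum.reindex) (auto simp: u1_def q_def power_mult_distrib power_divide intro!: sum.cong)
      also have "\<dots> = (\<Sum>n\<in>A. (p (Suc n))\<^sup>2) / b\<^sup>2" by (simp add: sum_divide_distrib)
      also have "\<dots> \<le> (R * sqrt E / b)\<^sup>2"
        using RE sums0 E0 by (simp add: power_divide power_mult_distrib divide_right_mono)
      finally show ?thesis using R0 E0 b by (simp add: power2_le_iff_abs_le abs_le_iff)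
    qed
    have n2: "nn u2 \<le> R * sqrt E / b"
    proof -
      have "(nn u2)\<^sup>2 = (\<Sum>m\<in>(\<lambda>n. int n + 1) ` A. (u2 m)\<^sup>2)"
        unfolding nn_zsum
      proof (rule zsum_eq)
        fix m assume m: "m \<notin> (\<lambda>n. int n + 1) ` A"
        show "(u2 m)\<^sup>2 = 0"
        proof (cases "m \<ge> 1")
          case True
          then have "m = int (nat m - 1) + 1" by simp
          then have "nat m - 1 \<notin> A" using m by blast
          then show ?thesis by (simp add: u2_def q_def)
        qed (simp add: u2_def)
      qed (use A(1) in simp)
      also have "\<dots> = (\<Sum>n\<in>A. (p n)\<^sup>2 / b\<^sup>2)"
        by (subst sum.reindex) (auto simp: u2_def q_def power_mult_distrib power_divide nat_add_distrib inj_on_def intro!: sum.cong)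
      also have "\<dots> = (\<Sum>n\<in>A. (p n)\<^sup>2) / b\<^sup>2" by (simp add: sum_divide_distrib)
      also have "\<dots> \<le> (R * sqrt E / b)\<^sup>2"
        using RE sums0 E0 by (simp add: power_divide power_mult_distrib divide_right_mono)
      finally show ?thesis using R0 E0 b by (simp add: power2_le_iff_abs_le abs_le_iff)
    qed
    have n3: "nn u3 = cmod (w N)"
    proof -
      have "nn u3 = L2_set u3 {int N, int N + 1}" by (rule nn_L2) (auto simp: u3_def)
      also have "\<dots> = cmod (w N)" by (simp add: L2_set_def u3_def cmod_def im re)
      finally show ?thesis .
    qed
    have "G * nn f \<le> nn (\<lambda>m. (u1 m - u2 m) + u3 m)"
      using gappedD[OF gp f, of "x - \<alpha>"] by (simp add: T[abs_def])
    also have "\<dots> \<le> nn (\<lambda>m. u1 m - u2 m) + nn u3" using fu by (intro nn_triangle) auto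
    also have "nn (\<lambda>m. u1 m - u2 m) \<le> nn u1 + nn u2" using fu by (intro nn_diff_le)
    finally have 1: "G * nn f \<le> 2 * (R * sqrt E / b) + 2 * cmod (w N)" using n1 n2 n3 norm_ge_zero[of "w N"] by linarith
    have "(\<Sum>n\<in>{Suc len..<N}. (p n)\<^sup>2) = (\<Sum>m\<in>int ` {Suc len..<N}. (f m)\<^sup>2)"
      by (subst sum.reindex) (auto simp: f_def chbig intro!: sum.cong)
    also have "\<dots> \<le> (\<Sum>m\<in>{1..int N}. (f m)\<^sup>2)" by (rule sum_mono2) auto
    also have "\<dots> = (nn f)\<^sup>2" unfolding nn_zsum by (rule zsum_eq[symmetric]) (auto simp: f0)
    finally have "sqrt (\<Sum>n\<in>{Suc len..<N}. (p n)\<^sup>2) \<le> nn f" by (intro real_le_lsqrt) (auto intro: sum_nonneg)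
    then have "G * sqrt (\<Sum>n\<in>{Suc len..<N}. (p n)\<^sup>2) \<le> G * nn f" using G by (intro mult_left_mono) auto
    with 1 show ?thesis by linarith
  qed
  define P where "P = (\<Sum>n\<in>{1..len}. (p n)\<^sup>2)"
  have split: "(\<Sum>n<N. (p n)\<^sup>2) = P + (\<Sum>n\<in>{Suc len..<N}. (p n)\<^sup>2)" if "len < N" for N
  proof -
    have sets: "{..<N} = ({0} \<union> {1..len}) \<union> {Suc len..<N}" using that by auto
    have "(\<Sum>n<N. (p n)\<^sup>2) = (\<Sum>n\<in>{0} \<union> {1..len}. (p n)\<^sup>2) + (\<Sum>n\<in>{Suc len..<N}. (p n)\<^sup>2)"
      unfolding sets by (rule sum.union_disjoint) auto
    then show ?thesis by (simp add: P_def p0)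
  qed
  have l1: "(\<lambda>N. \<Sum>n<N. (p n)\<^sup>2) \<longlonglongrightarrow> E" unfolding E_def by (rule summable_LIMSEQ[OF sp])
  have l2: "(\<lambda>N. G * sqrt ((\<Sum>n<N. (p n)\<^sup>2) - P)) \<longlonglongrightarrow> G * sqrt (E - P)" by (intro tendsto_intros l1)
  have l3: "(\<lambda>N. 2 * (R * sqrt E / b) + 2 * cmod (w N)) \<longlonglongrightarrow> 2 * (R * sqrt E / b) + 2 * 0" by (intro tendsto_intros w0)
  have "G * sqrt (E - P) \<le> 2 * (R * sqrt E / b) + 2 * 0"
  proof (rule tendsto_le[OF _ l3 l2])
    show "\<forall>\<^sub>F N in sequentially. G * sqrt ((\<Sum>n<N. (p n)\<^sup>2) - P) \<le> 2 * (R * sqrt E / b) + 2 * cmod (w N)"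
      using key split by (intro eventually_sequentiallyI[of "Suc len"]) (auto simp: Suc_le_eq)
  qed simp
  also have "\<dots> \<le> G * (sqrt E / 2)"
  proof -
    have "(4 * R) * sqrt E \<le> (b * G) * sqrt E" using RG E0 by (intro mult_right_mono) (auto simp: b_def)
    then show ?thesis using b by (simp add: field_simps)
  qed
  finally have h: "sqrt (E - P) \<le> sqrt E / 2" using G by simp
  have PE: "P \<le> E" unfolding P_def E_def by (rule sum_le_suminf[OF sp]) auto
  have "(sqrt (E - P))\<^sup>2 \<le> (sqrt E / 2)\<^sup>2" using h PE by (intro power_mono) auto
  then have "E - P \<le> E / 4" using PE E0 by (simp add: power_divide)
  then show "3 / 4 * (\<Sum>n. (p n)\<^sup>2) \<le> (\<Sum>n\<in>{1..len}. (p n)\<^sup>2)" unfolding E_def[symmetric] P_def[symmetric] by simp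
qed

text \<open>
  Eigenfunctions of one self-adjoint half line operator for different eigenvalues; the telescoping quantity is
  the wedge product.
\<close>

lemma edge_states_orthogonal:
  assumes c: "\<And>y. c' y = c y + d" and d: "d \<noteq> 0"
    and g: "gapped \<alpha> c G" "gapped \<alpha> c' G" "G > 0" and st: "stab \<alpha> c x 1" "stab \<alpha> c' x 1"
  shows "(\<lambda>n. Im (orb \<alpha> c x 1 n) * Im (orb \<alpha> c' x 1 n)) sums 0"
proof -
  define w where "w n = orb \<alpha> c x 1 n" for n
  define w' where "w' n = orb \<alpha> c' x 1 n" for n
  have rec: "wedge (w (Suc n)) (w' (Suc n)) = wedge (w n) (w' n) - d * (Im (w (Suc n)) * Im (w' (Suc n)))" for n
    by (simp add: wedge_def w_def w'_def c algebra_simps)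
  have i0: "Im (w 0) * Im (w' 0) = 0" by (simp add: w_def w'_def)
  have tel: "d * (\<Sum>n<Suc N. Im (w n) * Im (w' n)) = - wedge (w N) (w' N)" for N
  proof (induction N)
    case 0 then show ?case using i0 by (simp add: wedge_def w_def w'_def)
  next
    case (Suc N)
    then show ?case using rec[of N] by (simp add: algebra_simps)
  qed
  have t: "(\<lambda>n. cmod (w n) * cmod (w' n)) \<longlonglongrightarrow> 0 * 0"
    unfolding w_def w'_def by (intro tendsto_mult tendsto_norm_zero stab_tendsto_0[OF g(1,3) st(1)] stab_tendsto_0[OF g(2,3) st(2)])
  have "(\<lambda>N. wedge (w N) (w' N)) \<longlonglongrightarrow> 0"
    by (rule Lim_null_comparison[where g="\<lambda>n. cmod (w n) * cmod (w' n)"]) (use t abs_wedge_le in auto)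
  then have "(\<lambda>N. - wedge (w N) (w' N) / d) \<longlonglongrightarrow> - 0 / d" by (intro tendsto_intros d)
  moreover have "- wedge (w N) (w' N) / d = (\<Sum>n<Suc N. Im (w n) * Im (w' n))" for N
    using tel[of N] d by (simp add: field_simps)
  ultimately have "(\<lambda>N. \<Sum>n<Suc N. Im (w n) * Im (w' n)) \<longlonglongrightarrow> 0" by simp
  then have "(\<lambda>N. \<Sum>n<N. Im (w n) * Im (w' n)) \<longlonglongrightarrow> 0" by (rule LIMSEQ_imp_Suc)
  then show ?thesis by (simp add: sums_def w_def w'_def)
qed

text \<open>
  Bessel's inequality for the unit vector at site \<open>n\<close>, in terms of the coefficients of its projection.
\<close>

lemma bessel:
  fixes f :: "'a \<Rightarrow> nat \<Rightarrow> real"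
  assumes T: "finite T" and E: "\<And>i. i \<in> T \<Longrightarrow> (\<lambda>n. (f i n)\<^sup>2) sums E i" "\<And>i. i \<in> T \<Longrightarrow> E i > 0"
    and o: "\<And>i j. i \<in> T \<Longrightarrow> j \<in> T \<Longrightarrow> i \<noteq> j \<Longrightarrow> (\<lambda>n. f i n * f j n) sums 0"
  shows "(\<Sum>i\<in>T. (f i n)\<^sup>2 / E i) \<le> 1"
proof -
  define a where "a i = f i n / E i" for i
  define h where "h k = (\<Sum>i\<in>T. a i * f i k)" for k
  have "(\<lambda>k. \<Sum>i\<in>T. \<Sum>j\<in>T. a i * a j * (f i k * f j k)) sums (\<Sum>i\<in>T. \<Sum>j\<in>T. a i * a j * (if i = j then E i else 0))"
    using E(1) o by (intro sums_sum sums_mult) (auto simp: power2_eq_square)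
  moreover have "(\<Sum>i\<in>T. \<Sum>j\<in>T. a i * a j * (f i k * f j k)) = (h k)\<^sup>2" for k
    by (simp add: h_def power2_eq_square sum_product mult_ac)
  moreover have "(\<Sum>j\<in>T. a i * a j * (if i = j then E i else 0)) = (f i n)\<^sup>2 / E i" if "i \<in> T" for i
  proof -
    have "(\<Sum>j\<in>T. a i * a j * (if i = j then E i else 0)) = (\<Sum>j\<in>T. if i = j then a i * a i * E i else 0)"
      by (rule sum.cong) auto
    also have "\<dots> = a i * a i * E i" using T that by simp
    finally show ?thesis using E(2)[OF that] by (simp add: a_def power2_eq_square)
  qed
  ultimately have S: "(\<lambda>k. (h k)\<^sup>2) sums (\<Sum>i\<in>T. (f i n)\<^sup>2 / E i)" by simp
  have hn: "h n = (\<Sum>i\<in>T. (f i n)\<^sup>2 / E i)" by (simp add: h_def a_def power2_eq_square)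
  have "(\<Sum>k\<in>{n}. (h k)\<^sup>2) \<le> (\<Sum>k. (h k)\<^sup>2)"
    using S by (intro sum_le_suminf) (auto simp: sums_iff)
  then have "(h n)\<^sup>2 \<le> h n" using S by (simp add: sums_iff hn)
  then have "\<not> 1 < h n" using mult_strict_right_mono[of 1 "h n" "h n"] by (auto simp: power2_eq_square)
  then show ?thesis by (simp add: hn)
qed

section \<open>Expanding blocks\<close>

text \<open>
  In the basis of an expanded vector \<open>v\<close> and a transverse one, the coordinates of \<open>w\<close> at time \<open>k\<close> are bounded by the final
  norm of \<open>w\<close> and by its initial norm, respectively. A vector cannot be large in the middle of an
  expanding block without being large at one of the ends.
\<close>

lemma expanding_block:
  assumes B: "\<And>y. \<bar>c y\<bar> + 1 \<le> B" and v: "cmod v = 1" "\<Lambda> \<le> cmod (orb \<alpha> c y v n)" "\<Lambda> > 0" and k: "k \<le> n"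
  shows "cmod (orb \<alpha> c y w k) * \<Lambda> \<le> B ^ k * cmod (orb \<alpha> c y w n) + B ^ (n - k) * cmod w"
proof -
  define vn where "vn = orb \<alpha> c y v n"
  have vn: "0 < cmod vn" using v(2,3) unfolding vn_def by linarith
  have "v \<noteq> 0" using v(1) by auto
  then obtain r where rn: "cmod (orb \<alpha> c y r n) = 1" and vr: "wedge v r = cmod vn"
    unfolding vn_def using transverse_orbit by blast
  let ?w = "orb \<alpha> c y w k" and ?v = "orb \<alpha> c y v k" and ?r = "orb \<alpha> c y r k"
  have plucker: "of_real (wedge ?v ?r) * ?w = of_real (wedge ?w ?r) * ?v + of_real (wedge ?v ?w) * ?r"
    by (simp add: complex_eq_iff wedge_def algebra_simps)
  have "cmod vn * cmod ?w = cmod (of_real (wedge ?v ?r) * ?w)" using vr vn by (simp add: norm_mult)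
  also have "\<dots> \<le> \<bar>wedge ?w ?r\<bar> * cmod ?v + \<bar>wedge ?v ?w\<bar> * cmod ?r"
    unfolding plucker by (rule order_trans[OF norm_triangle_ineq]) (simp add: norm_mult)
  also have "wedge ?w ?r = wedge (orb \<alpha> c y w n) (orb \<alpha> c y r n)" by simp
  also have "\<bar>wedge (orb \<alpha> c y w n) (orb \<alpha> c y r n)\<bar> * cmod ?v \<le> cmod (orb \<alpha> c y w n) * B ^ k"
    using abs_wedge_le[of "orb \<alpha> c y w n" "orb \<alpha> c y r n"] norm_orb_le[OF B, where w=v and n=k] rn v(1)
    by (intro mult_mono) auto
  also have "wedge ?v ?w = wedge v w" by simp
  also have "\<bar>wedge v w\<bar> * cmod ?r \<le> cmod w * B ^ (n - k)"
  proof (rule mult_mono)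
    show "\<bar>wedge v w\<bar> \<le> cmod w" using abs_wedge_le[of v w] v(1) by simp
    have "cmod ?r \<le> B ^ (n - k) * cmod (orb \<alpha> c (y + real k * \<alpha>) ?r (n - k))" by (rule norm_orb_ge[OF B])
    also have "orb \<alpha> c (y + real k * \<alpha>) ?r (n - k) = orb \<alpha> c y r n" using orb_add[of \<alpha> c y r k "n - k"] k by simp
    finally show "cmod ?r \<le> B ^ (n - k)" using rn by simp
  qed auto
  finally have "cmod vn * cmod ?w \<le> cmod (orb \<alpha> c y w n) * B ^ k + cmod w * B ^ (n - k)" by simp
  moreover have "\<Lambda> * cmod ?w \<le> cmod vn * cmod ?w" using v(2) by (intro mult_right_mono) (auto simp: vn_def)
  ultimately show ?thesis by (simp add: mult.commute)
qed

section \<open>Localisation of edge states by Diophantine recurrence\<close>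

text \<open>
  Modulo the error of the approximation the first \<open>q\<close> points of an orbit are the multiples of \<open>1 / q\<close> in another
  order.
\<close>

lemma orbit_net:
  fixes P q :: int
  assumes cop: "coprime P q" and q: "q > 0" and ap: "\<bar>\<alpha> - of_int P / of_int q\<bar> \<le> 1 / (of_int q)\<^sup>2"
  shows "\<exists>j<nat q. \<exists>m::int. \<bar>y + real j * \<alpha> - z - of_int m\<bar> \<le> 2 / of_int q"
proof -
  define i where "i = \<lfloor>of_int q * (z - y)\<rfloor>"
  obtain u v where uv: "u * P + v * q = 1" using bezout_int[of P q] cop by (auto simp: coprime_iff_gcd_eq_1)
  define j where "j = (i * u) mod q"
  have j: "0 \<le> j" "j < q" using q by (auto simp: j_def)
  define d where "d = (i * u) div q"
  have jd: "j = i * u - d * q" by (simp add: j_def d_def minus_div_mult_eq_mod)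
  define m where "m = - i * v - d * P"
  have jP: "j * P = i + m * q"
  proof -
    have "j * P = i * (u * P) - d * q * P" by (simp add: jd algebra_simps)
    also have "u * P = 1 - v * q" using uv by simp
    finally show ?thesis by (simp add: m_def algebra_simps)
  qed
  have qr: "(0::real) < of_int q" using q by simp
  have jPr: "of_int j * (of_int P / of_int q) = of_int i / of_int q + (of_int m :: real)"
  proof -
    have "(of_int (j * P) :: real) = of_int (i + m * q)" by (simp only: jP)
    then show ?thesis using qr by (simp add: field_simps)
  qed
  have 1: "\<bar>z - y - of_int i / of_int q\<bar> \<le> 1 / of_int q"
  proof -
    have "of_int i \<le> of_int q * (z - y)" "of_int q * (z - y) < of_int i + 1" unfolding i_def by linarith+
    then have "of_int i / of_int q \<le> z - y" "z - y < (of_int i + 1) / of_int q"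
      using qr by (simp_all add: pos_divide_le_eq pos_less_divide_eq mult.commute)
    then show ?thesis by (simp add: add_divide_distrib)
  qed
  have 2: "\<bar>of_int j * (\<alpha> - of_int P / of_int q)\<bar> \<le> 1 / of_int q"
  proof -
    have "\<bar>of_int j * (\<alpha> - of_int P / of_int q)\<bar> \<le> of_int q * (1 / (of_int q)\<^sup>2)"
      unfolding abs_mult using j ap by (intro mult_mono) auto
    then show ?thesis using qr by (simp add: power2_eq_square)
  qed
  have "y + of_int j * \<alpha> - z - of_int m = of_int j * (\<alpha> - of_int P / of_int q) - (z - y - of_int i / of_int q)"
    using jPr by (simp add: algebra_simps)
  then have "\<bar>y + of_int j * \<alpha> - z - of_int m\<bar> \<le> 1 / of_int q + 1 / of_int q"
    by (simp only:) (rule order_trans[OF abs_triangle_ineq4 add_mono[OF 2 1]])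
  then have "\<bar>y + of_int j * \<alpha> - z - of_int m\<bar> \<le> 2 / of_int q" by simp
  moreover have "real (nat j) = of_int j" "nat j < nat q" using j by auto
  ultimately show ?thesis by metis
qed

lemma orb_perturb:
  assumes B: "\<And>y. \<bar>c y\<bar> + 1 \<le> B" "\<And>y. \<bar>c' y\<bar> + 1 \<le> B"
    and e: "\<And>j. \<bar>c (y + real j * \<alpha>) - c' (z + real j * \<alpha>)\<bar> \<le> \<eta>"
  shows "B * cmod (orb \<alpha> c y w n - orb \<alpha> c' z w n) \<le> real n * B ^ n * \<eta> * cmod w"
proof (induction n)
  case (Suc n)
  have B1: "1 \<le> B" using B(1)[of 0] by linarith
  have \<eta>: "0 \<le> \<eta>" using e[of 0] by linarith
  let ?u = "orb \<alpha> c y w n" and ?u' = "orb \<alpha> c' z w n"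
  let ?c = "c (y + real n * \<alpha>)" and ?c' = "c' (z + real n * \<alpha>)"
  have "step ?c ?u - step ?c' ?u' = step ?c (?u - ?u') + of_real ((?c - ?c') * Re ?u')"
    by (simp add: complex_eq_iff algebra_simps)
  then have "cmod (step ?c ?u - step ?c' ?u') \<le> cmod (step ?c (?u - ?u')) + \<bar>(?c - ?c') * Re ?u'\<bar>"
    using norm_triangle_ineq[of "step ?c (?u - ?u')" "of_real ((?c - ?c') * Re ?u')"]
    by (simp only: norm_of_real)
  also have "cmod (step ?c (?u - ?u')) \<le> B * cmod (?u - ?u')"
    using norm_step_le[of ?c "?u - ?u'"] B(1)[of "y + real n * \<alpha>"] by (meson mult_right_mono norm_ge_zero order_trans)
  also have "\<bar>(?c - ?c') * Re ?u'\<bar> \<le> \<eta> * (B ^ n * cmod w)"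
    unfolding abs_mult using e[of n] \<eta> order_trans[OF abs_Re_le_cmod norm_orb_le[OF B(2), where w=w and n=n]]
    by (intro mult_mono) auto
  finally have "B * cmod (orb \<alpha> c y w (Suc n) - orb \<alpha> c' z w (Suc n)) \<le> B * (B * cmod (?u - ?u') + \<eta> * (B ^ n * cmod w))"
    using B1 by simp
  also have "\<dots> \<le> B * (real n * B ^ n * \<eta> * cmod w + \<eta> * (B ^ n * cmod w))"
    using Suc B1 by (intro mult_left_mono add_right_mono) auto
  finally show ?case by (simp add: algebra_simps)
qed simp

locale schr =
  fixes \<alpha> :: real and v :: "real \<Rightarrow> real" and V lam :: real
  assumes irr: "\<alpha> \<notin> \<rat>" and per: "periodic1 v"
    and lip: "\<And>x y. \<bar>v x - v y\<bar> \<le> V * \<bar>x - y\<bar>"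
    and rng: "\<And>x. 0 \<le> v x \<and> v x \<le> 1"
    and lam2: "lam \<ge> 2"
begin

definition pot :: "real \<Rightarrow> real \<Rightarrow> real" where "pot \<tau> x = lam * (\<tau> - v x)"

lemma V0: "0 \<le> V" using lip[of 1 0] by simp

lemma contv: "continuous_on A v"
proof -
  have "V-lipschitz_on A v" using lip V0 by (intro lipschitz_onI) (auto simp: dist_real_def)
  then show ?thesis by (rule lipschitz_on_continuous_on)
qed

lemma pot_periodic: "periodic1 (pot \<tau>)" using per by (simp add: periodic1_def pot_def)

lemma pot_cont: "continuous_on A (pot \<tau>)" unfolding pot_def by (intro continuous_intros contv)

lemma pot_bound: "\<bar>\<tau> - t\<bar> \<le> g \<Longrightarrow> t \<in> {0..1} \<Longrightarrow> lam * g \<le> 2 \<Longrightarrow> \<bar>pot \<tau> y\<bar> + 1 \<le> lam + 3"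
proof -
  assume a: "\<bar>\<tau> - t\<bar> \<le> g" "t \<in> {0..1}" "lam * g \<le> 2"
  have "\<bar>\<tau> - v y\<bar> \<le> 1 + g" using a(1,2) rng[of y] by auto
  then have "\<bar>pot \<tau> y\<bar> \<le> lam * (1 + g)" using lam2 by (simp add: pot_def abs_mult)
  then show ?thesis using a(3) by (simp add: algebra_simps)
qed

lemma gapped_pot_shift:
  assumes "gapped \<alpha> (pot t) G" shows "gapped \<alpha> (pot \<tau>) (G - lam * \<bar>\<tau> - t\<bar>)"
proof (rule gapped_perturb[OF assms])
  fix x have "pot \<tau> x - pot t x = lam * (\<tau> - t)" by (simp add: pot_def algebra_simps)
  then show "\<bar>pot \<tau> x - pot t x\<bar> \<le> lam * \<bar>\<tau> - t\<bar>" using lam2 by (simp add: abs_mult)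
qed

text \<open>
  Sum Bessel's inequality over the first \<open>len\<close> sites.
\<close>

lemma edge_state_count:
  assumes T: "finite T" and st: "\<And>\<tau>. \<tau> \<in> T \<Longrightarrow> stab \<alpha> (pot \<tau>) x 1"
    and g: "\<And>\<tau>. \<tau> \<in> T \<Longrightarrow> gapped \<alpha> (pot \<tau>) G" "G > 0"
    and loc: "\<And>\<tau>. \<tau> \<in> T \<Longrightarrow> 3 / 4 * (\<Sum>n. (Im (orb \<alpha> (pot \<tau>) x 1 n))\<^sup>2) \<le> (\<Sum>n\<in>{1..len}. (Im (orb \<alpha> (pot \<tau>) x 1 n))\<^sup>2)"
  shows "card T \<le> 2 * len"
proof -
  define f where "f \<tau> n = Im (orb \<alpha> (pot \<tau>) x 1 n)" for \<tau> n
  define E where "E \<tau> = (\<Sum>n. (f \<tau> n)\<^sup>2)" for \<tau>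
  have sm: "summable (\<lambda>n. (f \<tau> n)\<^sup>2)" if "\<tau> \<in> T" for \<tau>
    by (rule summable_comparison_test'[OF stabD_decay(2)[OF g(1)[OF that] g(2) st[OF that]], of 0])
      (simp add: cmod_power2 f_def)
  have sE: "(\<lambda>n. (f \<tau> n)\<^sup>2) sums E \<tau>" if "\<tau> \<in> T" for \<tau>
    unfolding E_def using sm[OF that] by (rule summable_sums)
  have Epos: "E \<tau> > 0" if "\<tau> \<in> T" for \<tau>
  proof -
    have "(f \<tau> 1)\<^sup>2 \<le> E \<tau>"
      unfolding E_def using sum_le_suminf[OF sm[OF that], of "{1}"] by simp
    then show ?thesis by (simp add: f_def)
  qed
  have o: "(\<lambda>n. f \<tau> n * f \<sigma> n) sums 0" if "\<tau> \<in> T" "\<sigma> \<in> T" "\<tau> \<noteq> \<sigma>" for \<tau> \<sigma>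
    unfolding f_def
    by (rule edge_states_orthogonal[where d="lam * (\<sigma> - \<tau>)"])
      (use that g st lam2 in \<open>auto simp: pot_def algebra_simps\<close>)
  have "3 / 4 * real (card T) = (\<Sum>\<tau>\<in>T. 3 / 4)" by simp
  also have "\<dots> \<le> (\<Sum>\<tau>\<in>T. \<Sum>n\<in>{1..len}. (f \<tau> n)\<^sup>2 / E \<tau>)"
  proof (rule sum_mono)
    fix \<tau> assume t: "\<tau> \<in> T"
    have "3 / 4 * E \<tau> \<le> (\<Sum>n\<in>{1..len}. (f \<tau> n)\<^sup>2)" using loc[OF t] unfolding E_def f_def .
    then have "3 / 4 \<le> (\<Sum>n\<in>{1..len}. (f \<tau> n)\<^sup>2) / E \<tau>" using Epos[OF t] by (simp add: le_divide_eq)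
    then show "3 / 4 \<le> (\<Sum>n\<in>{1..len}. (f \<tau> n)\<^sup>2 / E \<tau>)" by (simp only: sum_divide_distrib)
  qed
  also have "\<dots> = (\<Sum>n\<in>{1..len}. \<Sum>\<tau>\<in>T. (f \<tau> n)\<^sup>2 / E \<tau>)" by (rule sum.swap)
  also have "\<dots> \<le> (\<Sum>n\<in>{1..len}. 1)" by (intro sum_mono bessel[OF T sE Epos o])
  finally show ?thesis by simp
qed

text \<open>
  One expanding block is taken from each of the windows \<open>{1 + 2 * q * i..<1 + 2 * q * (i + 1)}\<close> with \<open>i < b\<close>, and
  the cut is made at their middles. There the squared norm is small relative to the two ends of the block; the ends of
  different blocks are disjoint, so the total is small relative to the whole mass.
\<close>

lemma edge_state_localised:
  assumes gp: "gapped \<alpha> (pot \<tau>) G" and G: "G > 0" and st: "stab \<alpha> (pot \<tau>) x 1"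
    and B: "\<And>y. \<bar>pot \<tau> y\<bar> + 1 \<le> B" and \<Lambda>: "\<Lambda> > 0"
    and good: "\<And>y. \<exists>j<q. \<exists>w. cmod w = 1 \<and> \<Lambda> \<le> cmod (orb \<alpha> (pot \<tau>) (y + real j * \<alpha>) w n)"
    and nq: "n < q" and b: "b > 0" and bG: "12 * (B ^ (n - n div 2) / \<Lambda>) \<le> real b * G"
  shows "3 / 4 * (\<Sum>n. (Im (orb \<alpha> (pot \<tau>) x 1 n))\<^sup>2) \<le> (\<Sum>n\<in>{1..1 + 2 * q * b}. (Im (orb \<alpha> (pot \<tau>) x 1 n))\<^sup>2)"
proof -
  define w where "w n = orb \<alpha> (pot \<tau>) x 1 n" for n
  define k where "k = n div 2"
  define \<rho> where "\<rho> = B ^ (n - k) / \<Lambda>"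
  have B1: "1 \<le> B" using B[of 0] by linarith
  have \<rho>0: "\<rho> > 0" using B1 \<Lambda> by (simp add: \<rho>_def)
  have k: "k \<le> n" "k \<le> n - k" by (auto simp: k_def)
  have "\<forall>i. \<exists>j<q. \<exists>u. cmod u = 1 \<and> \<Lambda> \<le> cmod (orb \<alpha> (pot \<tau>) ((x + real (1 + 2 * q * i) * \<alpha>) + real j * \<alpha>) u n)"
    using good by blast
  then obtain j where j: "\<And>i. j i < q"
    "\<And>i. \<exists>u. cmod u = 1 \<and> \<Lambda> \<le> cmod (orb \<alpha> (pot \<tau>) ((x + real (1 + 2 * q * i) * \<alpha>) + real (j i) * \<alpha>) u n)"
    by metis
  define s where "s i = 1 + 2 * q * i + j i" for i
  have s_less: "s i + q < s i' + j i + 1" if "i < i'" for i i'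
  proof -
    have "Suc i \<le> i'" using that by simp
    then have "2 * q * Suc i \<le> 2 * q * i'" by (rule mult_le_mono2)
    then show ?thesis using j(1)[of i] j(1)[of i'] nq by (simp add: s_def)
  qed
  have sinj: "s i < s i'" if "i < i'" for i i' using s_less[OF that] j(1)[of i] by linarith
  have inj: "inj_on (\<lambda>i. s i + e) X" for e X
    using sinj by (intro linorder_inj_onI) (auto simp: less_imp_neq)
  have est: "(cmod (w (s i + k)))\<^sup>2 \<le> 2 * \<rho>\<^sup>2 * ((cmod (w (s i)))\<^sup>2 + (cmod (w (s i + n)))\<^sup>2)" for i
  proof -
    obtain u where u: "cmod u = 1" "\<Lambda> \<le> cmod (orb \<alpha> (pot \<tau>) ((x + real (1 + 2 * q * i) * \<alpha>) + real (j i) * \<alpha>) u n)"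
      using j(2) by blast
    have y: "(x + real (1 + 2 * q * i) * \<alpha>) + real (j i) * \<alpha> = x + real (s i) * \<alpha>" by (simp add: s_def algebra_simps)
    have "cmod (orb \<alpha> (pot \<tau>) (x + real (s i) * \<alpha>) (w (s i)) k) * \<Lambda>
       \<le> B ^ k * cmod (orb \<alpha> (pot \<tau>) (x + real (s i) * \<alpha>) (w (s i)) n) + B ^ (n - k) * cmod (w (s i))"
      using u(2) unfolding y by (intro expanding_block[OF B u(1) _ \<Lambda> k(1)]) 
    then have "cmod (w (s i + k)) * \<Lambda> \<le> B ^ k * cmod (w (s i + n)) + B ^ (n - k) * cmod (w (s i))"
      by (simp add: w_def orb_add)
    also have "B ^ k * cmod (w (s i + n)) \<le> B ^ (n - k) * cmod (w (s i + n))"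
      using B1 k by (intro mult_right_mono power_increasing) auto
    finally have "cmod (w (s i + k)) \<le> \<rho> * (cmod (w (s i)) + cmod (w (s i + n)))"
      using \<Lambda> by (simp add: \<rho>_def field_simps)
    then have "(cmod (w (s i + k)))\<^sup>2 \<le> (\<rho> * (cmod (w (s i)) + cmod (w (s i + n))))\<^sup>2" by (intro power_mono) auto
    also have "\<dots> \<le> \<rho>\<^sup>2 * (2 * ((cmod (w (s i)))\<^sup>2 + (cmod (w (s i + n)))\<^sup>2))"
      unfolding power_mult_distrib
    proof (rule mult_left_mono)
      show "(cmod (w (s i)) + cmod (w (s i + n)))\<^sup>2 \<le> 2 * ((cmod (w (s i)))\<^sup>2 + (cmod (w (s i + n)))\<^sup>2)"
        using zero_le_power2[of "cmod (w (s i)) - cmod (w (s i + n))"] by (simp add: power2_sum power2_diff)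
    qed simp
    finally show ?thesis by (simp add: algebra_simps)
  qed
  define p where "p n = Im (w n)" for n
  have re: "Re (w n) = p (Suc n)" for n by (simp add: p_def w_def)
  have sp: "summable (\<lambda>n. (p n)\<^sup>2)"
    by (rule summable_comparison_test'[OF stabD_decay(2)[OF gp G st], of 0]) (simp add: cmod_power2 p_def w_def)
  define E where "E = (\<Sum>n. (p n)\<^sup>2)"
  have E0: "0 \<le> E" unfolding E_def using sp by (intro suminf_nonneg) auto
  have sumE: "(\<Sum>i<b. (cmod (w (s i + e)))\<^sup>2) \<le> 2 * E" for e
  proof -
    have 1: "(\<Sum>i<b. (p (s i + e'))\<^sup>2) \<le> E" for e'
    proof -
      have "(\<Sum>i<b. (p (s i + e'))\<^sup>2) = (\<Sum>n\<in>(\<lambda>i. s i + e') ` {..<b}. (p n)\<^sup>2)"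
        by (subst sum.reindex[OF inj]) simp
      also have "\<dots> \<le> E" unfolding E_def using sp by (intro sum_le_suminf) auto
      finally show ?thesis .
    qed
    have "(\<Sum>i<b. (cmod (w (s i + e)))\<^sup>2) = (\<Sum>i<b. (p (s i + Suc e))\<^sup>2) + (\<Sum>i<b. (p (s i + e))\<^sup>2)"
      by (simp add: cmod_power2 re p_def[symmetric] sum.distrib)
    then show ?thesis using 1[of "Suc e"] 1[of e] by linarith
  qed
  define A where "A = (\<lambda>i. s i + k) ` {..<b}"
  have cA: "card A = b" unfolding A_def by (simp add: card_image[OF inj])
  have "(\<Sum>n\<in>A. (cmod (w n))\<^sup>2) = (\<Sum>i<b. (cmod (w (s i + k)))\<^sup>2)"
    unfolding A_def by (subst sum.reindex[OF inj]) simp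
  also have "\<dots> \<le> (\<Sum>i<b. 2 * \<rho>\<^sup>2 * ((cmod (w (s i)))\<^sup>2 + (cmod (w (s i + n)))\<^sup>2))"
    by (intro sum_mono est)
  also have "\<dots> = 2 * \<rho>\<^sup>2 * ((\<Sum>i<b. (cmod (w (s i + 0)))\<^sup>2) + (\<Sum>i<b. (cmod (w (s i + n)))\<^sup>2))"
    by (simp only: sum_distrib_left[symmetric] sum.distrib add_0_right)
  also have "\<dots> \<le> 2 * \<rho>\<^sup>2 * (2 * E + 2 * E)" by (intro mult_left_mono add_mono sumE) auto
  also have "\<dots> \<le> (3 * \<rho>)\<^sup>2 * E" using E0 by (simp add: power_mult_distrib algebra_simps)
  finally have R: "(\<Sum>n\<in>A. (cmod (w n))\<^sup>2) \<le> (3 * \<rho>)\<^sup>2 * E" .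
  have A: "finite A" "A \<subseteq> {1..<1 + 2 * q * b}" "A \<noteq> {}"
  proof -
    show "A \<subseteq> {1..<1 + 2 * q * b}"
    proof
      fix a assume "a \<in> A"
      then obtain i where i: "i < b" "a = s i + k" by (auto simp: A_def)
      have "2 * q * Suc i \<le> 2 * q * b" using i by (intro mult_le_mono2) simp
      then show "a \<in> {1..<1 + 2 * q * b}" using i j(1)[of i] k nq by (simp add: s_def)
    qed
  qed (use b in \<open>auto simp: A_def\<close>)
  show ?thesis
    by (rule cutoff_estimate(2)[OF gp G st A, where R="3 * \<rho>"])
      (use R \<rho>0 bG in \<open>simp_all add: cA w_def p_def E_def \<rho>_def k_def\<close>)
qed

end

section \<open>Counting gaps of one size\<close>

lemma label_fibre_card: "card {\<lceil>y\<rceil>..\<lfloor>y + 2\<rfloor>} \<le> 3" for y :: real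
  by simp linarith

context schr
begin

lemma label_family:
  assumes g: "g > 0" and gp: "gapped \<alpha> (pot t) (lam * g)"
  obtains s k l where "continuous_on ({t - g / 2..t + g / 2} \<times> UNIV) (\<lambda>p. s (fst p) (snd p))"
    "\<And>\<tau>. \<tau> \<in> {t - g / 2..t + g / 2} \<Longrightarrow> sect \<alpha> (pot \<tau>) (s \<tau>) k l"
    "\<And>\<tau> x. \<tau> \<in> {t - g / 2..t + g / 2} \<Longrightarrow> stab \<alpha> (pot \<tau>) x (cis (s \<tau> x))"
proof (rule stab_section_family[of "t - g / 2" "t + g / 2" pot "lam * g / 2" \<alpha>])
  show "continuous_on ({t - g / 2..t + g / 2} \<times> UNIV) (\<lambda>p. pot (fst p) (snd p))"
    unfolding pot_def
    by (intro continuous_intros continuous_on_compose2[OF contv[of UNIV]]) auto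
  show "gapped \<alpha> (pot \<tau>) (lam * g / 2)" if "\<tau> \<in> {t - g / 2..t + g / 2}" for \<tau>
  proof (rule gapped_mono[OF gapped_pot_shift[OF gp]])
    have "\<bar>\<tau> - t\<bar> \<le> g / 2" using that by (intro abs_leI) auto
    then have "lam * \<bar>\<tau> - t\<bar> \<le> lam * (g / 2)" using lam2 by (intro mult_left_mono) auto
    then show "lam * g / 2 \<le> lam * g - lam * \<bar>\<tau> - t\<bar>" by (simp add: field_simps)
  qed
qed (use g lam2 pot_periodic in auto)

lemma gap_half:
  assumes gp: "gapped \<alpha> (pot t) (lam * g)" and t: "\<tau> \<in> {t - g / 2..t + g / 2}"
  shows "gapped \<alpha> (pot \<tau>) (lam * g / 2)"
proof (rule gapped_mono[OF gapped_pot_shift[OF gp]])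
  have "\<bar>\<tau> - t\<bar> \<le> g / 2" using t by (intro abs_leI) auto
  then have "lam * \<bar>\<tau> - t\<bar> \<le> lam * (g / 2)" using lam2 by (intro mult_left_mono) auto
  then show "lam * g / 2 \<le> lam * g - lam * \<bar>\<tau> - t\<bar>" by (simp add: field_simps)
qed

text \<open>
  Labels are counted by the value of \<open>k\<close>. Those with \<open>\<bar>k\<bar> \<le> K\<close> number at most \<open>3 * (2 * K + 1)\<close>. Each
  of the others produces more than \<open>K\<close> pairs of a sample point and an edge state there; since edge states of
  different labels have different energies, a sample point carries at most \<open>2 * len\<close> of them. The energies of one label
  lie within \<open>2 * g\<close> of the two ends of their range, because an energy further inside is surrounded by hyperbolic
  energies up to distance \<open>2 * g\<close> and would have a gap of size \<open>lam * (2 * g)\<close>.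
\<close>

lemma gap_cover:
  assumes g: "g > 0"
    and U: "\<And>t. t \<in> U \<Longrightarrow> t \<in> {0..1} \<and> gapped \<alpha> (pot t) (lam * g) \<and> \<not> gapped \<alpha> (pot t) (lam * (2 * g))"
    and S: "S > 0" "2 * V < real S * g" and K: "K > 0"
    and loc: "\<And>t \<tau> x. t \<in> U \<Longrightarrow> \<tau> \<in> {t - g / 2..t + g / 2} \<Longrightarrow> stab \<alpha> (pot \<tau>) x 1 \<Longrightarrow>
       3 / 4 * (\<Sum>n. (Im (orb \<alpha> (pot \<tau>) x 1 n))\<^sup>2) \<le> (\<Sum>n\<in>{1..len}. (Im (orb \<alpha> (pot \<tau>) x 1 n))\<^sup>2)"
  shows "\<exists>C. C \<in> sets lborel \<and> U \<subseteq> C \<and> emeasure lborel C \<le> ennreal (4 * g * (3 * (2 * real K + 1) + 2 * real S * real len / real K))"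
proof -
  define I where "I t = {t - g / 2..t + g / 2}" for t
  have Gpos: "lam * g / 2 > 0" using lam2 g by simp
  define R where "R t s k l \<longleftrightarrow> (t \<in> U \<longrightarrow> continuous_on (I t \<times> UNIV) (\<lambda>p. s (fst p) (snd p))
     \<and> (\<forall>\<tau>\<in>I t. sect \<alpha> (pot \<tau>) (s \<tau>) k l) \<and> (\<forall>\<tau>\<in>I t. \<forall>x. stab \<alpha> (pot \<tau>) x (cis (s \<tau> x))))" for t s k l
  have "\<exists>s k l. R t s k l" for t
  proof (cases "t \<in> U")
    case True
    then have gp: "gapped \<alpha> (pot t) (lam * g)" using U by blast
    show ?thesis
    proof (rule label_family[OF g gp])
      fix s k l
      assume "continuous_on ({t - g / 2..t + g / 2} \<times> UNIV) (\<lambda>p. s (fst p) (snd p))"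
        "\<And>\<tau>. \<tau> \<in> {t - g / 2..t + g / 2} \<Longrightarrow> sect \<alpha> (pot \<tau>) (s \<tau>) k l"
        "\<And>\<tau> x. \<tau> \<in> {t - g / 2..t + g / 2} \<Longrightarrow> stab \<alpha> (pot \<tau>) x (cis (s \<tau> x))"
      then have "R t s k l" unfolding R_def I_def by blast
      then show ?thesis by blast
    qed
  qed (simp add: R_def)
  then obtain fs fk fl where fR: "\<And>t. R t (fs t) (fk t) (fl t)" by metis
  have fc: "\<And>t. t \<in> U \<Longrightarrow> continuous_on (I t \<times> UNIV) (\<lambda>p. fs t (fst p) (snd p))"
    and fse: "\<And>t \<tau>. t \<in> U \<Longrightarrow> \<tau> \<in> I t \<Longrightarrow> sect \<alpha> (pot \<tau>) (fs t \<tau>) (fk t) (fl t)"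
    and fst': "\<And>t \<tau> x. t \<in> U \<Longrightarrow> \<tau> \<in> I t \<Longrightarrow> stab \<alpha> (pot \<tau>) x (cis (fs t \<tau> x))"
    using fR unfolding R_def by blast+
  have tI: "t \<in> I t" for t using g by (simp add: I_def)
  have gI: "gapped \<alpha> (pot \<tau>) (lam * g / 2)" if "t \<in> U" "\<tau> \<in> I t" for t \<tau>
    using gap_half U that by (auto simp: I_def)
  define lab where "lab t = (fk t, fl t)" for t
  have lab_uniq: "lab t = lab t'" if "t \<in> U" "t' \<in> U" "\<tau> \<in> I t" "\<tau> \<in> I t'" for t t' \<tau>
    using stab_sect_label_unique[OF Gpos gI[OF that(1,3)] fse[OF that(1,3)] fst'[OF that(1,3)] fse[OF that(2,4)] fst'[OF that(2,4)]]
    by (simp add: lab_def)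
  have between: "\<exists>G>0. gapped \<alpha> (pot e) G" if "t \<in> U" "t' \<in> U" "lab t = lab t'" "t \<le> e" "e \<le> t'" for t t' e
  proof -
    consider "e = t" | "e = t'" | "t < e" "e < t'" using \<open>t \<le> e\<close> \<open>e \<le> t'\<close> by fastforce
    then show ?thesis
    proof cases
      case 1
      then show ?thesis using gI[OF that(1) tI] Gpos by blast
    next
      case 2
      then show ?thesis using gI[OF that(2) tI] Gpos by blast
    next
      case 3
      have "sect \<alpha> (pot t') (fs t' t') (fk t) (fl t)" using fse[OF that(2) tI] that(3) by (simp add: lab_def)
      then show ?thesis
        using 3 lam2 by (intro gapped_between_sections[OF irr fse[OF that(1) tI] _ _ _ pot_cont pot_periodic]) (auto simp: pot_def)
    qed
  qed
  define X where "X t = {i. i < S \<and> (\<exists>\<tau>\<in>I t. sin (fs t \<tau> (real i / real S)) = 0)}" for t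
  have XS: "X t \<subseteq> {..<S}" for t by (auto simp: X_def)
  have fX: "finite (X t)" for t by (rule finite_subset[OF XS]) simp
  have lam0: "lam > 0" using lam2 by simp
  have wind: "\<bar>real_of_int (fk t)\<bar> \<le> card (X t)" if "t \<in> U" for t
    unfolding X_def
    by (rule winding_le_crossings[OF irr lam0 g lip S I_def fc[OF that]])
      (use fse[OF that] in \<open>simp add: pot_def[abs_def]\<close>)
  define L where "L = lab ` U"
  define Fib where "Fib k = {\<lceil>- 1/2 - of_int k * \<alpha>\<rceil>..\<lfloor>- 1/2 - of_int k * \<alpha> + 2\<rfloor>}" for k :: int
  have Lfib: "snd \<kappa> \<in> Fib (fst \<kappa>)" if "\<kappa> \<in> L" for \<kappa>
  proof -
    obtain t where t: "t \<in> U" "\<kappa> = lab t" using \<open>\<kappa> \<in> L\<close> by (auto simp: L_def)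
    have "- 1/2 \<le> of_int (fk t) * \<alpha> + of_int (fl t) \<and> of_int (fk t) * \<alpha> + of_int (fl t) \<le> 3/2"
      by (rule label_range[OF fse[OF t(1) tI]])
    then show ?thesis by (auto simp: Fib_def t(2) lab_def le_floor_iff ceiling_le_iff)
  qed
  have Lk: "\<bar>fst \<kappa>\<bar> \<le> int S" if "\<kappa> \<in> L" for \<kappa>
  proof -
    obtain t where t: "t \<in> U" "\<kappa> = lab t" using \<open>\<kappa> \<in> L\<close> by (auto simp: L_def)
    have "card (X t) \<le> card {..<S}" using XS by (intro card_mono) auto
    then have "\<bar>real_of_int (fk t)\<bar> \<le> real S" using wind[OF t(1)] by simp
    then have "real_of_int \<bar>fk t\<bar> \<le> real_of_int (int S)" by simp
    then have "\<bar>fk t\<bar> \<le> int S" by (simp only: of_int_le_iff)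
    then show ?thesis by (simp add: t(2) lab_def)
  qed
  have "L \<subseteq> Sigma {- int S..int S} Fib"
  proof
    fix \<kappa> assume k: "\<kappa> \<in> L"
    show "\<kappa> \<in> Sigma {- int S..int S} Fib" using Lk[OF k] Lfib[OF k] by (cases \<kappa>) auto
  qed
  moreover have "finite (Sigma {- int S..int S} Fib)" by (intro finite_SigmaI) (auto simp: Fib_def)
  ultimately have fL: "finite L" by (rule finite_subset)
  have "\<forall>\<kappa>\<in>L. \<exists>t\<in>U. lab t = \<kappa>" by (auto simp: L_def)
  then obtain r where r: "\<And>\<kappa>. \<kappa> \<in> L \<Longrightarrow> r \<kappa> \<in> U" "\<And>\<kappa>. \<kappa> \<in> L \<Longrightarrow> lab (r \<kappa>) = \<kappa>" by metis
  \<comment> \<open>The labels whose representative energy has an edge state at the point \<open>i / S\<close> for a nearby energy.\<close>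
  define Y where "Y i = {\<kappa> \<in> L. i \<in> X (r \<kappa>)}" for i
  have Ycard: "card (Y i) \<le> 2 * len" for i
  proof -
    have "\<forall>\<kappa>\<in>Y i. \<exists>\<tau>\<in>I (r \<kappa>). sin (fs (r \<kappa>) \<tau> (real i / real S)) = 0" by (auto simp: Y_def X_def)
    then obtain tt where tt: "\<And>\<kappa>. \<kappa> \<in> Y i \<Longrightarrow> tt \<kappa> \<in> I (r \<kappa>)" "\<And>\<kappa>. \<kappa> \<in> Y i \<Longrightarrow> sin (fs (r \<kappa>) (tt \<kappa>) (real i / real S)) = 0"
      by metis
    have YL: "\<kappa> \<in> L" if "\<kappa> \<in> Y i" for \<kappa> using that by (simp add: Y_def)
    have "inj_on tt (Y i)"
    proof (rule inj_onI)
      fix \<kappa> \<kappa>' assume k: "\<kappa> \<in> Y i" "\<kappa>' \<in> Y i" "tt \<kappa> = tt \<kappa>'"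
      have "lab (r \<kappa>) = lab (r \<kappa>')"
        using lab_uniq[OF r(1)[OF YL[OF k(1)]] r(1)[OF YL[OF k(2)]] tt(1)[OF k(1)]] tt(1)[OF k(2)] k(3) by simp
      then show "\<kappa> = \<kappa>'" using r(2) YL k by metis
    qed
    then have "card (Y i) = card (tt ` Y i)" by (rule card_image[symmetric])
    also have "\<dots> \<le> 2 * len"
    proof (rule edge_state_count[where x="real i / real S" and G="lam * g / 2", OF _ _ _ Gpos])
      show "finite (tt ` Y i)" using fL by (simp add: Y_def)
      fix \<tau> assume "\<tau> \<in> tt ` Y i"
      then obtain \<kappa> where k: "\<kappa> \<in> Y i" "\<tau> = tt \<kappa>" by blast
      note rU = r(1)[OF YL[OF k(1)]]
      have t: "\<tau> \<in> I (r \<kappa>)" using tt(1)[OF k(1)] k(2) by simp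
      show "gapped \<alpha> (pot \<tau>) (lam * g / 2)" by (rule gI[OF rU t])
      let ?s = "fs (r \<kappa>) \<tau> (real i / real S)"
      have s0: "sin ?s = 0" using tt(2)[OF k(1)] k(2) by simp
      then have c0: "cos ?s \<noteq> 0" using sin_cos_squared_add[of ?s] by auto
      have "cis ?s = of_real (cos ?s)" using s0 by (simp add: complex_eq_iff)
      then have "of_real (1 / cos ?s) * cis ?s = 1" using c0 by simp
      then show st1: "stab \<alpha> (pot \<tau>) (real i / real S) 1"
        using stab_scale[OF fst'[OF rU t], of "real i / real S" "1 / cos ?s"] by metis
      show "3 / 4 * (\<Sum>n. (Im (orb \<alpha> (pot \<tau>) (real i / real S) 1 n))\<^sup>2) \<le> (\<Sum>n\<in>{1..len}. (Im (orb \<alpha> (pot \<tau>) (real i / real S) 1 n))\<^sup>2)"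
        by (rule loc[OF rU _ st1]) (use t in \<open>simp add: I_def\<close>)
    qed
    finally show ?thesis .
  qed
  have double: "(\<Sum>\<kappa>\<in>L. card (X (r \<kappa>))) \<le> S * (2 * len)"
  proof -
    have "(\<Sum>\<kappa>\<in>L. card (X (r \<kappa>))) = (\<Sum>\<kappa>\<in>L. \<Sum>i<S. if i \<in> X (r \<kappa>) then 1 else 0)"
    proof (rule sum.cong)
      fix \<kappa>
      have "{..<S} \<inter> X (r \<kappa>) = X (r \<kappa>)" using XS by blast
      then show "card (X (r \<kappa>)) = (\<Sum>i<S. if i \<in> X (r \<kappa>) then 1 else 0)"
        by (simp add: sum.If_cases)
    qed simp
    also have "\<dots> = (\<Sum>i<S. \<Sum>\<kappa>\<in>L. if i \<in> X (r \<kappa>) then 1 else 0)" by (rule sum.swap)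
    also have "\<dots> = (\<Sum>i<S. card (Y i))"
    proof (rule sum.cong)
      fix i
      have "L \<inter> {\<kappa>. i \<in> X (r \<kappa>)} = Y i" by (auto simp: Y_def)
      then show "(\<Sum>\<kappa>\<in>L. if i \<in> X (r \<kappa>) then 1 else 0) = card (Y i)" using fL by (simp add: sum.If_cases)
    qed simp
    also have "\<dots> \<le> (\<Sum>i<S. 2 * len)" by (intro sum_mono Ycard)
    finally show ?thesis by simp
  qed
  define Lb where "Lb = {\<kappa> \<in> L. int K < \<bar>fst \<kappa>\<bar>}"
  define Ls where "Ls = {\<kappa> \<in> L. \<bar>fst \<kappa>\<bar> \<le> int K}"
  have big: "real (card Lb) \<le> 2 * real S * real len / real K"
  proof -
    have "card Lb * K = (\<Sum>\<kappa>\<in>Lb. K)" by simp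
    also have "\<dots> \<le> (\<Sum>\<kappa>\<in>Lb. card (X (r \<kappa>)))"
    proof (rule sum_mono)
      fix \<kappa> assume k: "\<kappa> \<in> Lb"
      then have kL: "\<kappa> \<in> L" "int K < \<bar>fst \<kappa>\<bar>" by (auto simp: Lb_def)
      have "fk (r \<kappa>) = fst \<kappa>" using arg_cong[OF r(2)[OF kL(1)], of fst] by (simp add: lab_def)
      then have "real_of_int \<bar>fst \<kappa>\<bar> \<le> real (card (X (r \<kappa>)))" using wind[OF r(1)[OF kL(1)]] by simp
      moreover have "real_of_int (int K) < real_of_int \<bar>fst \<kappa>\<bar>" using kL(2) by (simp only: of_int_less_iff)
      ultimately show "K \<le> card (X (r \<kappa>))" by simp
    qed
    also have "\<dots> \<le> (\<Sum>\<kappa>\<in>L. card (X (r \<kappa>)))" using fL by (intro sum_mono2) (auto simp: Lb_def)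
    also note double
    finally have "real (card Lb * K) \<le> real (S * (2 * len))" by (simp only: of_nat_le_iff)
    then show ?thesis using K by (simp add: le_divide_eq)
  qed
  have small: "real (card Ls) \<le> 3 * (2 * real K + 1)"
  proof -
    have "Ls \<subseteq> Sigma {- int K..int K} Fib"
    proof
      fix \<kappa> assume k: "\<kappa> \<in> Ls"
      then show "\<kappa> \<in> Sigma {- int K..int K} Fib" using Lfib[of \<kappa>] by (cases \<kappa>) (auto simp: Ls_def)
    qed
    then have "card Ls \<le> card (Sigma {- int K..int K} Fib)" by (intro card_mono finite_SigmaI) (auto simp: Fib_def)
    also have "\<dots> = (\<Sum>k\<in>{- int K..int K}. card (Fib k))" by (rule card_SigmaI) (auto simp: Fib_def)
    also have "\<dots> \<le> (\<Sum>k\<in>{- int K..int K}. 3)" unfolding Fib_def by (intro sum_mono label_fibre_card)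
    also have "\<dots> = 3 * (2 * K + 1)" by simp
    finally have "real (card Ls) \<le> real (3 * (2 * K + 1))" by (simp only: of_nat_le_iff)
    then show ?thesis by simp
  qed
  have cL: "real (card L) \<le> 3 * (2 * real K + 1) + 2 * real S * real len / real K"
  proof -
    have "L = Ls \<union> Lb" by (auto simp: Ls_def Lb_def)
    then have "card L \<le> card Ls + card Lb" using card_Un_le by metis
    then show ?thesis using big small by linarith
  qed
  define Uk where "Uk \<kappa> = {t \<in> U. lab t = \<kappa>}" for \<kappa>
  \<comment> \<open>The two intervals at the ends of the range of the label.\<close>
  define C where "C \<kappa> = {Inf (Uk \<kappa>)..Inf (Uk \<kappa>) + 2 * g} \<union> {Sup (Uk \<kappa>) - 2 * g..Sup (Uk \<kappa>)}" for \<kappa>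
  have UC: "t \<in> C (lab t)" if t: "t \<in> U" for t
  proof (rule ccontr)
    assume not: "t \<notin> C (lab t)"
    define W where "W = Uk (lab t)"
    have tW: "t \<in> W" using t by (simp add: W_def Uk_def)
    have bd: "bdd_below W" "bdd_above W"
      using U by (auto simp: W_def Uk_def intro!: bdd_belowI[of _ 0] bdd_aboveI[of _ 1])
    have "Inf W \<le> t" "t \<le> Sup W" using tW bd by (auto intro: cInf_lower cSup_upper)
    then have "Inf W < t - 2 * g" "t + 2 * g < Sup W" using not by (auto simp: C_def W_def)
    then obtain t1 t2 where t12: "t1 \<in> W" "t1 < t - 2 * g" "t2 \<in> W" "t + 2 * g < t2"
      using cInf_less_iff[of W "t - 2 * g"] less_cSup_iff[of W "t + 2 * g"] tW bd by auto
    have "gapped \<alpha> (pot t) (lam * (2 * g))"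
    proof (rule gapped_dist)
      show "\<bar>pot t y\<bar> \<le> lam * (\<bar>t\<bar> + 1)" for y
      proof -
        have "\<bar>t - v y\<bar> \<le> \<bar>t\<bar> + 1" using rng[of y] by linarith
        then show ?thesis using lam2 by (simp add: pot_def abs_mult mult_left_mono)
      qed
      show "0 \<le> lam * (2 * g)" using lam2 g by simp
      fix s assume s: "\<bar>s\<bar> \<le> lam * (2 * g)"
      have "\<bar>s / lam\<bar> \<le> 2 * g" using s lam2 by (simp add: divide_le_eq mult.commute abs_divide)
      then have "t1 \<le> t + s / lam" "t + s / lam \<le> t2" using t12(2,4) abs_le_D1[of "s / lam" "2 * g"] abs_le_D2[of "s / lam" "2 * g"] by linarith+
      then have "\<exists>G>0. gapped \<alpha> (pot (t + s / lam)) G"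
        using between[of t1 t2 "t + s / lam"] t12 by (auto simp: W_def Uk_def)
      moreover have "pot (t + s / lam) = (\<lambda>x. pot t x + s)" using lam2 by (simp add: pot_def fun_eq_iff field_simps)
      ultimately show "\<exists>G>0. gapped \<alpha> (\<lambda>x. pot t x + s) G" by simp
    qed
    then show False using U[OF t] by blast
  qed
  have Cs: "C \<kappa> \<in> sets lborel" for \<kappa> by (simp add: C_def)
  have Cm: "emeasure lborel (C \<kappa>) \<le> ennreal (4 * g)" for \<kappa>
  proof -
    have "emeasure lborel (C \<kappa>) \<le> emeasure lborel {Inf (Uk \<kappa>)..Inf (Uk \<kappa>) + 2 * g} + emeasure lborel {Sup (Uk \<kappa>) - 2 * g..Sup (Uk \<kappa>)}"
      unfolding C_def by (rule emeasure_subadditive) auto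
    also have "\<dots> = ennreal (2 * g) + ennreal (2 * g)" using g by simp
    also have "\<dots> = ennreal (4 * g)" using g by (subst ennreal_plus[symmetric]) auto
    finally show ?thesis .
  qed
  show ?thesis
  proof (intro exI[of _ "\<Union>\<kappa>\<in>L. C \<kappa>"] conjI)
    show "(\<Union>\<kappa>\<in>L. C \<kappa>) \<in> sets lborel" using fL Cs by (intro sets.finite_UN) auto
    show "U \<subseteq> (\<Union>\<kappa>\<in>L. C \<kappa>)" using UC by (auto simp: L_def)
    have "emeasure lborel (\<Union>\<kappa>\<in>L. C \<kappa>) \<le> (\<Sum>\<kappa>\<in>L. emeasure lborel (C \<kappa>))"
      using fL Cs by (intro emeasure_subadditive_finite) auto
    also have "\<dots> \<le> (\<Sum>\<kappa>\<in>L. ennreal (4 * g))" by (intro sum_mono Cm)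
    also have "\<dots> = ennreal (real (card L) * (4 * g))" using g by (simp add: ennreal_mult ennreal_of_nat_eq_real_of_nat)
    also have "\<dots> \<le> ennreal (4 * g * (3 * (2 * real K + 1) + 2 * real S * real len / real K))"
      using mult_left_mono[OF cL, of "4 * g"] g by (intro ennreal_leI) (simp add: mult.commute)
    finally show "emeasure lborel (\<Union>\<kappa>\<in>L. C \<kappa>) \<le> ennreal (4 * g * (3 * (2 * real K + 1) + 2 * real S * real len / real K))" .
  qed
qed

end

section \<open>Gaps narrower than the fourth power of a denominator\<close>

text \<open>
  The length \<open>n\<close> of an expanding block is chosen so that \<open>lam ^ n\<close> is roughly \<open>q ^ 12\<close>.
\<close>

lemma block_length:
  fixes lam Q :: real
  assumes lam: "lam \<ge> 2" and Q: "Q \<ge> 1"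
  obtains n where "lam powr real n \<le> Q ^ 12" "Q ^ 12 < lam powr (real n + 1)" "real n \<le> 12 * log 2 Q"
proof -
  define n where "n = nat \<lfloor>log lam (Q ^ 12)\<rfloor>"
  have Q12: "Q ^ 12 \<ge> 1" using Q by simp
  have l0: "0 \<le> log lam (Q ^ 12)" using lam Q12 by (subst zero_le_log_cancel_iff) auto
  have n: "real n \<le> log lam (Q ^ 12)" "log lam (Q ^ 12) < real n + 1"
    using l0 by (auto simp: n_def)
  have l2: "log lam (Q ^ 12) \<le> log 2 (Q ^ 12)"
  proof -
    have "ln (Q ^ 12) / ln lam \<le> ln (Q ^ 12) / ln 2"
      using lam Q12 by (intro divide_left_mono) auto
    then show ?thesis by (simp only: log_def)
  qed
  show ?thesis
  proof
    show "lam powr real n \<le> Q ^ 12" using n(1) lam Q12 by (subst (asm) le_log_iff) auto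
    show "Q ^ 12 < lam powr (real n + 1)" using n(2) lam Q12 by (subst (asm) log_less_iff) auto
    show "real n \<le> 12 * log 2 Q" using n(1) l2 Q by (simp add: log_nat_power)
  qed
qed

text \<open>
  The exponent \<open>12\<close> leaves room for both requirements with the rates \<open>47 / 48\<close> and \<open>49 / 48\<close>: in the first
  inequality \<open>lam powr (real n / 24)\<close> is at most the square root of \<open>Q\<close>, so the perturbation of the block
  over a distance of order \<open>1 / Q\<close> is harmless; in the second one the growth over half of the block, divided by the
  expansion over the whole block, is at most \<open>lam\<close> divided by a power of \<open>Q\<close> with exponent \<open>12 * (15 / 32)\<close>,
  which is larger than 5.
\<close>

lemma block_arith:
  fixes lam Q :: real
  assumes lam: "lam \<ge> 2" "lam + 3 \<le> lam powr (49 / 48)" and Q: "Q \<ge> 1"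
    and n: "lam powr real n \<le> Q ^ 12" "Q ^ 12 < lam powr (real n + 1)"
  shows "(lam + 3) ^ n \<le> lam powr (47 / 48 * real n) * sqrt Q"
    and "(lam + 3) ^ (n - n div 2) * Q ^ 5 \<le> lam * lam powr (47 / 48 * real n)"
proof -
  have pw: "(lam + 3) ^ k \<le> lam powr (49 / 48 * real k)" for k
  proof -
    have "(lam + 3) ^ k \<le> (lam powr (49 / 48)) ^ k" using lam by (intro power_mono) auto
    also have "\<dots> = lam powr (49 / 48 * real k)" using lam by (simp add: powr_realpow[symmetric] powr_powr)
    finally show ?thesis .
  qed
  have Q12: "(Q ^ 12) powr r = Q powr (12 * r)" for r
  proof -
    have "Q ^ 12 = Q powr 12" using Q by simp
    then show ?thesis by (simp only: powr_powr)
  qed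
  have "lam powr (49 / 48 * real n) = lam powr (47 / 48 * real n) * (lam powr real n) powr (1 / 24)"
    by (simp add: powr_powr powr_add[symmetric] field_simps)
  also have "\<dots> \<le> lam powr (47 / 48 * real n) * (Q ^ 12) powr (1 / 24)"
    using n(1) by (intro mult_left_mono powr_mono2) auto
  also have "(Q ^ 12) powr (1 / 24) = sqrt Q" using Q by (simp add: Q12 powr_half_sqrt)
  finally show "(lam + 3) ^ n \<le> lam powr (47 / 48 * real n) * sqrt Q" using pw[of n] by linarith
  have "real (n - n div 2) \<le> (real n + 1) / 2" by (simp add: of_nat_diff)
  then have 1: "lam powr (49 / 48 * real (n - n div 2)) \<le> lam powr (49 / 96 * (real n + 1))"
    using lam by (intro powr_mono) auto
  have "Q ^ 5 = Q powr 5" using Q by simp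
  also have "\<dots> \<le> Q powr (12 * (15 / 32))" using Q by (intro powr_mono) auto
  also have "\<dots> = (Q ^ 12) powr (15 / 32)" by (simp only: Q12)
  also have "\<dots> \<le> (lam powr (real n + 1)) powr (15 / 32)" using n(2) Q by (intro powr_mono2) auto
  also have "\<dots> = lam powr (45 / 96 * (real n + 1))" by (simp add: powr_powr mult.commute)
  finally have 2: "Q ^ 5 \<le> lam powr (45 / 96 * (real n + 1))" .
  have "(lam + 3) ^ (n - n div 2) * Q ^ 5 \<le> lam powr (49 / 96 * (real n + 1)) * lam powr (45 / 96 * (real n + 1))"
    using order_trans[OF pw 1] 2 Q by (intro mult_mono) auto
  also have "\<dots> = lam powr (47 / 48 * (real n + 1))"
    unfolding powr_add[symmetric] by (rule arg_cong[where f="\<lambda>x. lam powr x"]) linarith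
  also have "\<dots> \<le> lam powr (1 + 47 / 48 * real n)" using lam by (intro powr_mono) auto
  also have "\<dots> = lam * lam powr (47 / 48 * real n)" using lam by (simp add: powr_add)
  finally show "(lam + 3) ^ (n - n div 2) * Q ^ 5 \<le> lam * lam powr (47 / 48 * real n)" .
qed

context schr
begin

text \<open>
  A consequence of a large Lyapunov exponent that involves single orbits only.
\<close>

definition expanding :: "real \<Rightarrow> bool" where
  "expanding t \<longleftrightarrow> (\<forall>n. \<exists>x w. cmod w = 1 \<and> lam powr (47 / 48 * real n) \<le> cmod (orb \<alpha> (pot t) x w n))"

text \<open>
  The expanding block exists at some phase and for the energy \<open>t\<close>. Within each window of \<open>q\<close> sites the orbit comes
  within \<open>2 / q\<close> of that phase, and neither this shift nor the change of energy costs more than half of the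
  expansion.
\<close>

lemma expanding_recurs:
  assumes lamb: "lam + 3 \<le> lam powr (49 / 48)"
    and q: "q > 0" "coprime P (int q)" "\<bar>\<alpha> - of_int P / real q\<bar> \<le> 1 / (real q)\<^sup>2"
    and n: "lam powr real n \<le> real q ^ 12" "real q ^ 12 < lam powr (real n + 1)" "2 * real n * (2 * V + 1) \<le> sqrt (real q)"
    and g: "0 < g" "g \<le> 1 / real q" "lam * g \<le> 2"
    and t: "t \<in> {0..1}" "expanding t" and \<tau>: "\<bar>\<tau> - t\<bar> \<le> g / 2"
  shows "\<exists>j<q. \<exists>w. cmod w = 1 \<and> lam powr (47 / 48 * real n) / 2 \<le> cmod (orb \<alpha> (pot \<tau>) (y + real j * \<alpha>) w n)"
proof -
  obtain z w where zw: "cmod w = 1" "lam powr (47 / 48 * real n) \<le> cmod (orb \<alpha> (pot t) z w n)"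
    using t(2) unfolding expanding_def by blast
  obtain j m where j: "j < nat (int q)" "\<bar>y + real j * \<alpha> - z - of_int m\<bar> \<le> 2 / of_int (int q)"
    using orbit_net[of P "int q" \<alpha> y z] q by auto
  have qr: "real q \<ge> 1" using q by simp
  define B where "B = lam + 3"
  have B0: "B > 0" using lam2 by (simp add: B_def)
  define \<eta> where "\<eta> = lam * ((2 * V + 1) / real q)"
  have e: "\<bar>pot \<tau> ((y + real j * \<alpha>) + real i * \<alpha>) - pot t (z + real i * \<alpha>)\<bar> \<le> \<eta>" for i
  proof -
    have "v (z + real i * \<alpha>) = v (z + real i * \<alpha> + of_int m)" using periodic1_add_int[OF per] by simp
    then have "\<bar>v ((y + real j * \<alpha>) + real i * \<alpha>) - v (z + real i * \<alpha>)\<bar>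
      \<le> V * \<bar>((y + real j * \<alpha>) + real i * \<alpha>) - (z + real i * \<alpha> + of_int m)\<bar>"
      by (simp only:) (rule lip)
    also have "\<dots> \<le> V * (2 / real q)" using j(2) V0 by (intro mult_left_mono) (auto simp: algebra_simps)
    finally have "\<bar>(\<tau> - t) - (v ((y + real j * \<alpha>) + real i * \<alpha>) - v (z + real i * \<alpha>))\<bar> \<le> g / 2 + V * (2 / real q)"
      by (rule order_trans[OF abs_triangle_ineq4 add_mono[OF \<tau>]])
    also have "\<dots> \<le> 1 / real q + V * (2 / real q)" using g by simp
    also have "\<dots> = (2 * V + 1) / real q" by (simp add: add_divide_distrib)
    finally have "\<bar>lam * ((\<tau> - t) - (v ((y + real j * \<alpha>) + real i * \<alpha>) - v (z + real i * \<alpha>)))\<bar> \<le> \<eta>"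
      unfolding \<eta>_def abs_mult using lam2 by (intro mult_mono) auto
    then show ?thesis by (simp add: pot_def algebra_simps)
  qed
  have b1: "\<bar>pot \<tau> y\<bar> + 1 \<le> B" "\<bar>pot t y\<bar> + 1 \<le> B" for y
    unfolding B_def using \<tau> g by (intro pot_bound[OF _ t(1) g(3)]; simp)+
  let ?d = "cmod (orb \<alpha> (pot \<tau>) (y + real j * \<alpha>) w n - orb \<alpha> (pot t) z w n)"
  have "B * ?d \<le> real n * B ^ n * \<eta> * cmod w" by (rule orb_perturb) (rule b1 e)+
  also have "\<dots> \<le> B * (real n * B ^ n * ((2 * V + 1) / real q))"
  proof -
    have "\<eta> \<le> B * ((2 * V + 1) / real q)" unfolding \<eta>_def B_def using V0 lam2 by (intro mult_right_mono) auto
    then have "real n * B ^ n * \<eta> \<le> real n * B ^ n * (B * ((2 * V + 1) / real q))"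
      using B0 by (intro mult_left_mono) auto
    then show ?thesis using zw(1) by (simp add: algebra_simps)
  qed
  finally have "?d \<le> real n * B ^ n * ((2 * V + 1) / real q)" by (rule mult_left_le_imp_le[OF _ B0])
  also have "\<dots> \<le> real n * (lam powr (47 / 48 * real n) * sqrt (real q)) * ((2 * V + 1) / real q)"
    unfolding B_def using block_arith(1)[OF lam2 lamb qr n(1,2)] V0 by (intro mult_right_mono mult_left_mono) auto
  also have "\<dots> = (2 * real n * (2 * V + 1)) * (lam powr (47 / 48 * real n) * sqrt (real q) / (2 * real q))"
    using qr by (simp add: field_simps)
  also have "\<dots> \<le> sqrt (real q) * (lam powr (47 / 48 * real n) * sqrt (real q) / (2 * real q))"
    by (intro mult_right_mono n(3)) auto
  also have "\<dots> = lam powr (47 / 48 * real n) / 2 * (sqrt (real q) * sqrt (real q) / real q)"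
    using qr by (simp add: field_simps)
  also have "\<dots> = lam powr (47 / 48 * real n) / 2" using qr by simp
  finally have d: "?d \<le> lam powr (47 / 48 * real n) / 2" .
  have "lam powr (47 / 48 * real n) / 2 \<le> cmod (orb \<alpha> (pot t) z w n) - ?d" using d zw(2) by linarith
  also have "\<dots> \<le> cmod (orb \<alpha> (pot \<tau>) (y + real j * \<alpha>) w n)"
    using norm_triangle_ineq3[of "orb \<alpha> (pot \<tau>) (y + real j * \<alpha>) w n" "orb \<alpha> (pot t) z w n"] by linarith
  finally show ?thesis using zw(1) j(1) by auto
qed

text \<open>
  The localisation length \<open>len\<close> is of order \<open>1 / (g * q ^ 3)\<close> and the number \<open>S\<close> of sample points of order \<open>1 / g\<close>. With
  \<open>K\<close> of order \<open>1 / (g * q)\<close> the two contributions in \<open>gap_cover\<close> are of order \<open>1 / q\<close> and \<open>1 / q ^ 2\<close>.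
\<close>

lemma scale_cover:
  assumes lamb: "lam + 3 \<le> lam powr (49 / 48)"
    and q: "q > 0" "coprime P (int q)" "\<bar>\<alpha> - of_int P / real q\<bar> \<le> 1 / (real q)\<^sup>2"
    and big: "24 * (2 * V + 1) * log 2 (real q) \<le> sqrt (real q)" "12 * log 2 (real q) < real q"
    and g: "0 < g" "g \<le> 1 / real q ^ 4" "lam * g \<le> 2"
    and U: "\<And>t. t \<in> U \<Longrightarrow> t \<in> {0..1} \<and> gapped \<alpha> (pot t) (lam * g) \<and> \<not> gapped \<alpha> (pot t) (lam * (2 * g)) \<and> expanding t"
  shows "\<exists>C. C \<in> sets lborel \<and> U \<subseteq> C \<and> emeasure lborel C \<le> ennreal ((852 + 1584 * V) / real q)"
proof -
  define Q where "Q = real q"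
  have Q1: "Q \<ge> 1" using q by (simp add: Q_def)
  have Qm: "1 / Q ^ 4 \<le> 1 / Q" using Q1 power_increasing[of 1 4 Q] by (intro divide_left_mono) auto
  have gQ: "g \<le> 1 / Q" "g \<le> 1" using order_trans[OF g(2)[folded Q_def] Qm] order_trans[OF _ divide_le_eq_1_pos[THEN iffD2, OF _ Q1]] Q1 by auto
  obtain n where n: "lam powr real n \<le> Q ^ 12" "Q ^ 12 < lam powr (real n + 1)" "real n \<le> 12 * log 2 Q"
    using block_length[OF lam2 Q1] by blast
  have n2: "2 * real n * (2 * V + 1) \<le> sqrt Q"
  proof -
    have "2 * real n * (2 * V + 1) \<le> 2 * (12 * log 2 Q) * (2 * V + 1)" using n(3) V0 by (intro mult_right_mono) auto
    also have "\<dots> = 24 * (2 * V + 1) * log 2 Q" by simp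
    finally show ?thesis using big(1) unfolding Q_def by linarith
  qed
  have nq: "n < q" using n(3) big(2) unfolding Q_def by linarith
  define b where "b = nat \<lceil>48 / (Q ^ 5 * g)\<rceil>"
  have x0: "48 / (Q ^ 5 * g) > 0" using Q1 g by simp
  then have b0: "b > 0" by (simp add: b_def)
  have b1: "48 / (Q ^ 5 * g) \<le> real b" "real b \<le> 48 / (Q ^ 5 * g) + 1" unfolding b_def using x0 by linarith+
  define Y where "Y = lam powr (47 / 48 * real n)"
  have Y0: "Y > 0" using lam2 by (simp add: Y_def)
  have bG: "12 * ((lam + 3) ^ (n - n div 2) / (Y / 2)) \<le> real b * (lam * g / 2)"
  proof -
    have "(lam + 3) ^ (n - n div 2) \<le> lam * Y / Q ^ 5"
      using block_arith(2)[OF lam2 lamb Q1 n(1,2)] Q1 by (simp add: Y_def pos_le_divide_eq)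
    then have "12 * ((lam + 3) ^ (n - n div 2) / (Y / 2)) \<le> 12 * ((lam * Y / Q ^ 5) / (Y / 2))"
      using Y0 by (intro mult_left_mono divide_right_mono) auto
    also have "\<dots> = (48 / (Q ^ 5 * g)) * (lam * g / 2)" using Y0 g Q1 by (simp add: field_simps)
    also have "\<dots> \<le> real b * (lam * g / 2)" using b1 g lam2 by (intro mult_right_mono) auto
    finally show ?thesis .
  qed
  define len where "len = 1 + 2 * q * b"
  define S where "S = nat (\<lfloor>2 * V / g\<rfloor> + 1)"
  define K where "K = nat \<lceil>1 / (Q * g)\<rceil>"
  have v0: "0 \<le> 2 * V / g" using V0 g by simp
  have S: "S > 0" "2 * V / g < real S" "real S \<le> 2 * V / g + 1"
    unfolding S_def using v0 by (auto simp: nat_add_distrib) linarith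
  have k0: "0 < 1 / (Q * g)" using Q1 g by simp
  have K: "K > 0" "1 / (Q * g) \<le> real K" "real K \<le> 1 / (Q * g) + 1" unfolding K_def using k0 by linarith+
  have "\<exists>C. C \<in> sets lborel \<and> U \<subseteq> C \<and> emeasure lborel C \<le> ennreal (4 * g * (3 * (2 * real K + 1) + 2 * real S * real len / real K))"
  proof (rule gap_cover[OF g(1) _ S(1) _ K(1)])
    show "2 * V < real S * g" using S(2) g by (simp add: pos_divide_less_eq)
    fix t \<tau> x assume t: "t \<in> U" "\<tau> \<in> {t - g / 2..t + g / 2}" and st: "stab \<alpha> (pot \<tau>) x 1"
    have tt: "t \<in> {0..1}" "gapped \<alpha> (pot t) (lam * g)" "expanding t" using U[OF t(1)] by blast+
    have \<tau>: "\<bar>\<tau> - t\<bar> \<le> g / 2" using t(2) by (intro abs_leI) auto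
    show "3 / 4 * (\<Sum>n. (Im (orb \<alpha> (pot \<tau>) x 1 n))\<^sup>2) \<le> (\<Sum>n\<in>{1..len}. (Im (orb \<alpha> (pot \<tau>) x 1 n))\<^sup>2)"
      unfolding len_def
    proof (rule edge_state_localised[OF gap_half[OF tt(2) t(2)] _ st _ _ _ nq b0 bG])
      show "lam * g / 2 > 0" using lam2 g by simp
      show "\<bar>pot \<tau> y\<bar> + 1 \<le> lam + 3" for y using \<tau> g by (intro pot_bound[OF _ tt(1) g(3)]) linarith
      show "Y / 2 > 0" using Y0 by simp
      show "\<exists>j<q. \<exists>w. cmod w = 1 \<and> Y / 2 \<le> cmod (orb \<alpha> (pot \<tau>) (y + real j * \<alpha>) w n)" for y
        unfolding Y_def
        by (rule expanding_recurs[OF lamb q n(1,2)[unfolded Q_def] n2[unfolded Q_def] g(1) gQ(1)[unfolded Q_def] g(3) tt(1,3) \<tau>])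
    qed
  qed (use U in blast)
  moreover have "4 * g * (3 * (2 * real K + 1) + 2 * real S * real len / real K) \<le> (852 + 1584 * V) / Q"
  proof -
    have one: "1 \<le> 1 / (Q * g)" using gQ(1) g Q1 by (simp add: field_simps)
    have "3 * (2 * k + 1) \<le> 15 * x" if "k \<le> x + 1" "1 \<le> x" for x k :: real
      using that by (simp add: algebra_simps)
    from this[OF K(3) one] have "3 * (2 * real K + 1) \<le> 15 * (1 / (Q * g))" .
    then have A: "4 * g * (3 * (2 * real K + 1)) \<le> 4 * g * (15 * (1 / (Q * g)))" using g by (intro mult_left_mono) auto
    have S': "real S \<le> (2 * V + 1) / g" using S(3) gQ(2) g by (simp add: field_simps)
    have len: "real len \<le> 99 / (Q ^ 3 * g)"
    proof -
      have "real len = 1 + 2 * Q * real b" by (simp add: len_def Q_def)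
      also have "\<dots> \<le> 1 + 2 * Q * (48 / (Q ^ 5 * g) + 1)" using b1(2) Q1 by (intro add_left_mono mult_left_mono) auto
      also have "\<dots> = (1 + 2 * Q) + 96 / (Q ^ 4 * g)" using Q1 g by (simp add: field_simps power_eq_if)
      also have "\<dots> \<le> 3 / (Q ^ 3 * g) + 96 / (Q ^ 3 * g)"
      proof (rule add_mono)
        have "1 + 2 * Q \<le> 3 * Q" using Q1 by simp
        also have "\<dots> \<le> 3 / (Q ^ 3 * g)"
          using g(2) g(1) Q1 by (simp add: Q_def[symmetric] field_simps power_eq_if)
        finally show "1 + 2 * Q \<le> 3 / (Q ^ 3 * g)" .
        have "Q ^ 3 * g \<le> Q ^ 4 * g" using Q1 g by (intro mult_right_mono power_increasing) auto
        then show "96 / (Q ^ 4 * g) \<le> 96 / (Q ^ 3 * g)" using Q1 g by (intro divide_left_mono) auto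
      qed
      also have "\<dots> = 99 / (Q ^ 3 * g)" by (simp add: add_divide_distrib[symmetric])
      finally show ?thesis .
    qed
    have Kinv: "1 / real K \<le> Q * g" using K(1,2) Q1 g by (simp add: field_simps)
    have "4 * g * (2 * real S * real len / real K) = 8 * g * (real S * real len * (1 / real K))" by simp
    also have "\<dots> \<le> 8 * g * ((2 * V + 1) / g * (99 / (Q ^ 3 * g)) * (Q * g))"
      using S' len Kinv g V0 Q1 by (intro mult_left_mono mult_mono) auto
    also have "\<dots> = 792 * (2 * V + 1) / Q ^ 2" using Q1 g by (simp add: field_simps power_eq_if)
    also have "\<dots> \<le> 792 * (2 * V + 1) / Q"
      using Q1 V0 power_increasing[of 1 2 Q] by (intro divide_left_mono) auto
    finally have Bq: "4 * g * (2 * real S * real len / real K) \<le> 792 * (2 * V + 1) / Q" .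
    have "4 * g * (15 * (1 / (Q * g))) = 60 / Q" using g Q1 by (simp add: field_simps)
    then have "4 * g * (3 * (2 * real K + 1) + 2 * real S * real len / real K) \<le> 60 / Q + 792 * (2 * V + 1) / Q"
      using A Bq by (simp only: distrib_left)
    also have "\<dots> = (852 + 1584 * V) / Q" by (simp add: add_divide_distrib[symmetric] algebra_simps)
    finally show ?thesis .
  qed
  ultimately show ?thesis unfolding Q_def by (meson ennreal_leI order_trans)
qed

end

section \<open>Subadditivity and operator norms\<close>

lemma fekete:
  fixes a :: "nat \<Rightarrow> real"
  assumes sub: "\<And>m n. a (m + n) \<le> a m + a n" and nn: "\<And>n. 0 \<le> a n"
  shows "\<exists>L. (\<lambda>n. a n / real n) \<longlonglongrightarrow> L \<and> (\<forall>n\<ge>1. L \<le> a n / real n)"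
proof -
  define L where "L = (INF n\<in>{1..}. a n / real n)"
  have bdd: "bdd_below ((\<lambda>n. a n / real n) ` {1..})" using nn by (intro bdd_belowI[of _ 0]) auto
  have low: "L \<le> a n / real n" if "n \<ge> 1" for n unfolding L_def using that by (intro cINF_lower[OF bdd]) simp
  have mult: "a (k * m + r) \<le> real k * a m + a r" for k m r
  proof (induction k)
    case (Suc k)
    have "a (Suc k * m + r) = a (m + (k * m + r))" by (simp add: algebra_simps)
    also have "\<dots> \<le> a m + a (k * m + r)" by (rule sub)
    finally show ?case using Suc by (simp add: algebra_simps)
  qed simp
  have "(\<lambda>n. a n / real n) \<longlonglongrightarrow> L"
  proof (rule order_tendstoI)
    fix y assume y: "y < L"
    show "\<forall>\<^sub>F n in sequentially. y < a n / real n"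
      using eventually_ge_at_top[of 1] by eventually_elim (use y low in force)
  next
    fix y assume "L < y"
    then have "\<exists>m\<in>{1..}. a m / real m < y"
      unfolding L_def using cINF_less_iff[OF _ bdd, of y] by auto
    then obtain m where m: "m \<ge> 1" "a m / real m < y" by auto
    define M where "M = (\<Sum>r<m. a r)"
    have "(\<lambda>n. M / real n) \<longlonglongrightarrow> 0" by (rule lim_const_over_n)
    then have "\<forall>\<^sub>F n in sequentially. M / real n < y - a m / real m"
      by (rule order_tendstoD(2)) (use m in simp)
    then show "\<forall>\<^sub>F n in sequentially. a n / real n < y"
      using eventually_ge_at_top[of 1]
    proof eventually_elim
      fix n :: nat assume n: "M / real n < y - a m / real m" "1 \<le> n"
      have "a n \<le> real (n div m) * a m + a (n mod m)" using mult[of "n div m" m "n mod m"] by simp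
      also have "a (n mod m) \<le> M" unfolding M_def using m nn by (intro member_le_sum) auto
      also have "real (n div m) * a m \<le> real n / real m * a m"
      proof (rule mult_right_mono[OF _ nn])
        have "real (n div m * m) \<le> real n" by (simp only: of_nat_le_iff div_times_less_eq_dividend)
        then show "real (n div m) \<le> real n / real m" using m by (simp add: pos_le_divide_eq)
      qed
      finally have "a n \<le> real n * (a m / real m) + M" by simp
      then have "a n / real n \<le> a m / real m + M / real n" using n(2) by (simp add: field_simps)
      then show "a n / real n < y" using n(1) by linarith
    qed
  qed
  with low show ?thesis by blast
qed

lemma periodic_integral_shift:
  fixes f :: "real \<Rightarrow> real"
  assumes f: "continuous_on UNIV f" and p: "periodic1 f"
  shows "integral {0..1} (\<lambda>x. f (x + a)) = integral {0..1} f"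
proof -
  define r where "r = frac a"
  have r: "0 \<le> r" "r \<le> 1" unfolding r_def using frac_lt_1[of a] by auto
  have c: "continuous_on A f" for A by (rule continuous_on_subset[OF f]) simp
  have i: "f integrable_on {a..b}" for a b by (intro integrable_continuous_real c)
  have "f (x + a) = f (x + r)" for x
    using periodic1_add_int[OF p, of "x + r" "\<lfloor>a\<rfloor>"] by (simp add: r_def frac_def)
  then have "integral {0..1} (\<lambda>x. f (x + a)) = integral {0..1} (f \<circ> (\<lambda>x. x + r))" by (simp add: o_def)
  also have "\<dots> = integral {r..1 + r} f" using integral_shift[of 0 r 1 f] c by simp
  also have "\<dots> = integral {r..1} f + integral {1..1 + r} f" using r i by (intro Henstock_Kurzweil_Integration.integral_combine[symmetric]) auto
  also have "integral {1..1 + r} f = integral {0..r} (f \<circ> (\<lambda>x. x + 1))"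
    using integral_shift[of 0 1 r f] c by (simp add: add.commute)
  also have "f \<circ> (\<lambda>x. x + 1) = f" using p by (auto simp: periodic1_def)
  also have "integral {r..1} f + integral {0..r} f = integral {0..1} f"
    using r i Henstock_Kurzweil_Integration.integral_combine[of 0 r 1 f] by simp
  finally show ?thesis .
qed

lemma norm_mult_opnorm: "norm (M *v W) \<le> opnorm M * norm W"
  unfolding opnorm_def by (rule onorm) simp

lemma opnorm_nonneg: "0 \<le> opnorm M"
  unfolding opnorm_def by (rule onorm_pos_le) simp

lemma opnorm_mult: "opnorm (A ** B) \<le> opnorm A * opnorm B"
proof -
  have "(\<lambda>w. (A ** B) *v w) = (\<lambda>w. A *v w) \<circ> (\<lambda>w. B *v w)" by (simp add: fun_eq_iff matrix_vector_mul_assoc)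
  then show ?thesis unfolding opnorm_def by (simp only:) (intro onorm_compose, auto)
qed

lemma opnorm_le_basis: "opnorm M \<le> norm (M *v emb 1) + norm (M *v emb \<i>)"
  unfolding opnorm_def
proof (rule onorm_le)
  fix W :: "complex ^ 2"
  have "W = W $ 1 *s emb 1 + W $ 2 *s emb \<i>" by (simp add: vec2_eq)
  then have "M *v W = W $ 1 *s (M *v emb 1) + W $ 2 *s (M *v emb \<i>)"
    by (metis matrix_vector_right_distrib vector_scalar_commute)
  then have "norm (M *v W) \<le> cmod (W $ 1) * norm (M *v emb 1) + cmod (W $ 2) * norm (M *v emb \<i>)"
    using norm_triangle_ineq by (metis norm_smult_vec)
  also have "\<dots> \<le> norm W * norm (M *v emb 1) + norm W * norm (M *v emb \<i>)"
    by (intro add_mono mult_right_mono Finite_Cartesian_Product.norm_nth_le) auto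
  finally show "norm (M *v W) \<le> (norm (M *v emb 1) + norm (M *v emb \<i>)) * norm W" by (simp add: algebra_simps)
qed

lemma opnorm_diff: "\<bar>opnorm M - opnorm M'\<bar> \<le> norm (M *v emb 1 - M' *v emb 1) + norm (M *v emb \<i> - M' *v emb \<i>)"
proof -
  have 1: "opnorm A - opnorm B \<le> opnorm (A - B)" for A B
  proof -
    have "(\<lambda>w. A *v w) = (\<lambda>w. B *v w + (A - B) *v w)" by (simp add: matrix_vector_mult_diff_rdistrib)
    then have "opnorm A \<le> opnorm B + opnorm (A - B)"
      unfolding opnorm_def by (metis matrix_vector_mul_bounded_linear onorm_triangle)
    then show ?thesis by simp
  qed
  have 2: "opnorm (A - B) \<le> norm (A *v emb 1 - B *v emb 1) + norm (A *v emb \<i> - B *v emb \<i>)" for A B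
    using opnorm_le_basis[of "A - B"] by (simp add: matrix_vector_mult_diff_rdistrib)
  show ?thesis using 1[of M M'] 1[of M' M] 2[of M M'] 2[of M' M]
    by (simp add: abs_le_iff norm_minus_commute)
qed

lemma continuous_opnorm:
  assumes "continuous_on S (\<lambda>p. F p *v emb 1)" "continuous_on S (\<lambda>p. F p *v emb \<i>)"
  shows "continuous_on S (\<lambda>p. opnorm (F p))"
  unfolding continuous_on_def
proof
  fix p assume p: "p \<in> S"
  have 1: "((\<lambda>q. norm (F q *v emb 1 - F p *v emb 1) + norm (F q *v emb \<i> - F p *v emb \<i>)) \<longlongrightarrow> 0) (at p within S)"
    using assms p unfolding continuous_on_def
    by (intro tendsto_add_zero tendsto_norm_zero LIM_zero) auto
  have "((\<lambda>q. opnorm (F q) - opnorm (F p)) \<longlongrightarrow> 0) (at p within S)"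
    by (rule Lim_null_comparison[OF _ 1]) (auto simp: opnorm_diff)
  then show "((\<lambda>q. opnorm (F q)) \<longlongrightarrow> opnorm (F p)) (at p within S)" by (rule LIM_zero_cancel)
qed

text \<open>
  The determinant is 1, in the form of the invariant wedge product.
\<close>

lemma opnorm_citer_ge_1: "1 \<le> opnorm (citer \<alpha> c n x)"
proof -
  let ?M = "citer \<alpha> c n x"
  have b: "cmod (orb \<alpha> c x w n) \<le> opnorm ?M * cmod w" for w
    using norm_mult_opnorm[of ?M "emb w"] by (simp add: citer_emb)
  have "1 = \<bar>wedge (orb \<alpha> c x 1 n) (orb \<alpha> c x \<i> n)\<bar>" by (simp add: wedge_def[of 1])
  also have "\<dots> \<le> opnorm ?M * opnorm ?M"
    using b[of 1] b[of \<i>] opnorm_nonneg by (intro order_trans[OF abs_wedge_le] mult_mono) auto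
  finally show ?thesis using opnorm_nonneg[of ?M] by (meson less_le_not_le linorder_not_le mult_left_le order_trans)
qed

lemma citer_add: "citer \<alpha> c (m + n) x = citer \<alpha> c n (x + real m * \<alpha>) ** citer \<alpha> c m x"
proof (induction n)
  case (Suc n)
  then show ?case by (simp add: matrix_mul_assoc algebra_simps)
qed simp

lemma citer_periodic: "periodic1 c \<Longrightarrow> citer \<alpha> c n (x + 1) = citer \<alpha> c n x"
proof (induction n)
  case (Suc n)
  have "c (x + 1 + real n * \<alpha>) = c ((x + real n * \<alpha>) + 1)" by (simp add: algebra_simps)
  also have "\<dots> = c (x + real n * \<alpha>)" using Suc.prems by (simp add: periodic1_def)
  finally show ?case using Suc by (simp add: schroedinger_def)
qed simp

lemma opnorm_citer_le:
  assumes B: "\<And>x. \<bar>c x\<bar> + 1 \<le> B"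
  shows "opnorm (citer \<alpha> c n x) \<le> B ^ n"
  unfolding opnorm_def
proof (rule onorm_le)
  fix W
  let ?W = "citer \<alpha> c n x *v W"
  have B1: "1 \<le> B" using B[of 0] by linarith
  have "(norm ?W)\<^sup>2 = (cmod (orb \<alpha> c x (re_part W) n))\<^sup>2 + (cmod (orb \<alpha> c x (im_part W) n))\<^sup>2"
    by (simp only: norm_parts re_part_citer im_part_citer)
  also have "\<dots> \<le> (B ^ n * cmod (re_part W))\<^sup>2 + (B ^ n * cmod (im_part W))\<^sup>2"
    by (intro add_mono power_mono norm_orb_le[OF B]) auto
  also have "\<dots> = (B ^ n * norm W)\<^sup>2" by (simp add: power_mult_distrib norm_parts algebra_simps)
  finally show "norm ?W \<le> B ^ n * norm W" by (rule power2_le_imp_le) (use B1 in auto)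
qed

lemma opnorm_citer_attained:
  assumes R: "0 \<le> R" "R < opnorm (citer \<alpha> c n x)"
  shows "\<exists>w. cmod w = 1 \<and> R \<le> cmod (orb \<alpha> c x w n)"
proof -
  have "\<exists>W. R * norm W < norm (citer \<alpha> c n x *v W)"
  proof (rule ccontr)
    assume "\<not> ?thesis"
    then have "opnorm (citer \<alpha> c n x) \<le> R" unfolding opnorm_def by (intro onorm_le) (simp add: not_less)
    then show False using R by simp
  qed
  then obtain W where W: "R * norm W < norm (citer \<alpha> c n x *v W)" by blast
  have "\<exists>u. R * cmod u < cmod (orb \<alpha> c x u n)"
  proof (rule ccontr)
    assume "\<not> ?thesis"
    then have b: "cmod (orb \<alpha> c x u n) \<le> R * cmod u" for u by (simp add: not_less)
    have "(norm (citer \<alpha> c n x *v W))\<^sup>2 = (cmod (orb \<alpha> c x (re_part W) n))\<^sup>2 + (cmod (orb \<alpha> c x (im_part W) n))\<^sup>2"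
      by (simp only: norm_parts re_part_citer im_part_citer)
    also have "\<dots> \<le> (R * cmod (re_part W))\<^sup>2 + (R * cmod (im_part W))\<^sup>2" by (intro add_mono power_mono b) auto
    also have "\<dots> = (R * norm W)\<^sup>2" by (simp add: power_mult_distrib norm_parts algebra_simps)
    finally have "norm (citer \<alpha> c n x *v W) \<le> R * norm W" by (rule power2_le_imp_le) (use R in auto)
    then show False using W by simp
  qed
  then obtain u where u: "R * cmod u < cmod (orb \<alpha> c x u n)" by blast
  then have u0: "u \<noteq> 0" by auto
  define w where "w = of_real (1 / cmod u) * u"
  have "cmod w = 1" using u0 by (simp add: w_def norm_divide)
  moreover have "cmod (orb \<alpha> c x w n) = cmod (orb \<alpha> c x u n) / cmod u"
    unfolding w_def orb_scale by (simp add: norm_mult norm_divide)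
  ultimately show ?thesis using u u0 by (intro exI[of _ w]) (auto simp: le_divide_eq)
qed

section \<open>Logarithmic means of polynomials\<close>

lemma xlnx_continuous: "continuous_on UNIV (\<lambda>x::real. x * ln \<bar>x\<bar>)"
  unfolding continuous_on_def
proof
  fix a :: real
  show "((\<lambda>x. x * ln \<bar>x\<bar>) \<longlongrightarrow> a * ln \<bar>a\<bar>) (at a within UNIV)"
  proof (cases "a = 0")
    case False
    then show ?thesis by (intro tendsto_intros) auto
  next
    case True
    have "((\<lambda>x::real. 2 * sqrt \<bar>x\<bar> + \<bar>x\<bar> * \<bar>x\<bar>) \<longlongrightarrow> 2 * sqrt \<bar>0\<bar> + \<bar>0\<bar> * \<bar>0\<bar>) (at 0)" by (intro tendsto_intros)
    then have z: "((\<lambda>x::real. 2 * sqrt \<bar>x\<bar> + \<bar>x\<bar> * \<bar>x\<bar>) \<longlongrightarrow> 0) (at 0)" by simp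
    have "norm (x * ln \<bar>x\<bar>) \<le> 2 * sqrt \<bar>x\<bar> + \<bar>x\<bar> * \<bar>x\<bar>" for x :: real
    proof (cases "x = 0")
      case x: False
      define s where "s = sqrt \<bar>x\<bar>"
      have s: "s > 0" "\<bar>x\<bar> = s * s" using x by (auto simp: s_def)
      have "ln (s * s) = 2 * ln s" using s by (simp add: ln_mult)
      moreover have "- ln s \<le> 1 / s - 1" using ln_add_one_self_le_self2[of "1 / s - 1"] s by (simp add: ln_div)
      moreover have "ln s \<le> s * s / 2"
      proof -
        have "ln s \<le> s - 1" using ln_le_minus_one[OF s(1)] .
        also have "\<dots> \<le> s * s / 2" using zero_le_power2[of "s - 1"] by (simp add: power2_eq_square algebra_simps)
        finally show ?thesis .
      qed
      moreover have "0 < 1 / s" "0 < s * s" using s by simp_all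
      ultimately have "\<bar>2 * ln s\<bar> \<le> 2 * (1 / s) + s * s" by (intro abs_leI; linarith)
      then have "\<bar>ln \<bar>x\<bar>\<bar> \<le> 2 / s + s * s" using s \<open>ln (s * s) = 2 * ln s\<close> by simp
      then have "\<bar>x\<bar> * \<bar>ln \<bar>x\<bar>\<bar> \<le> \<bar>x\<bar> * (2 / s + s * s)" by (intro mult_left_mono) auto
      also have "\<dots> = 2 * s + \<bar>x\<bar> * \<bar>x\<bar>" using s by (simp add: field_simps)
      finally show ?thesis by (simp add: abs_mult s_def)
    qed simp
    then have "((\<lambda>x::real. x * ln \<bar>x\<bar>) \<longlongrightarrow> 0) (at 0)" by (intro Lim_null_comparison[OF _ z]) auto
    then show ?thesis using True by simp
  qed
qed

text \<open>
  The antiderivative is \<open>(t - r) * ln \<bar>t - r\<bar> - t\<close>, continuous across the singularity; with the convention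
  \<open>ln 0 = 0\<close> the integrand is a total function.
\<close>

lemma log_distance_integral:
  fixes r :: real
  shows "\<exists>I. ((\<lambda>t. ln \<bar>t - r\<bar>) has_integral I) {0..1} \<and> - 2 \<le> I"
proof -
  define F where "F t = (t - r) * ln \<bar>t - r\<bar> - t" for t
  have c: "continuous_on {0..1} F"
    unfolding F_def by (intro continuous_intros continuous_on_compose2[OF xlnx_continuous]) auto
  have d: "(F has_vector_derivative ln \<bar>t - r\<bar>) (at t)" if "t \<in> {0<..<1} - {r}" for t
  proof -
    consider "t > r" | "t < r" using \<open>t \<in> _\<close> by fastforce
    then have "(F has_real_derivative ln \<bar>t - r\<bar>) (at t)"
    proof cases
      case 1
      have "((\<lambda>t. (t - r) * ln (t - r) - t) has_real_derivative ln (t - r)) (at t)"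
        using 1 by (auto intro!: derivative_eq_intros)
      moreover have "\<forall>\<^sub>F s in nhds t. F s = (s - r) * ln (s - r) - s"
        using 1 by (intro eventually_mono[OF eventually_nhds_in_open[of "{r<..}"]]) (auto simp: F_def)
      ultimately show ?thesis using 1 by (subst DERIV_cong_ev[OF refl _ refl]) auto
    next
      case 2
      have "((\<lambda>t. - ((r - t) * ln (r - t)) - t) has_real_derivative ln (r - t)) (at t)"
        using 2 by (auto intro!: derivative_eq_intros)
      moreover have "\<forall>\<^sub>F s in nhds t. F s = - ((r - s) * ln (r - s)) - s"
        using 2 by (intro eventually_mono[OF eventually_nhds_in_open[of "{..<r}"]]) (auto simp: F_def, simp add: algebra_simps)
      ultimately show ?thesis using 2 by (subst DERIV_cong_ev[OF refl _ refl]) auto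
    qed
    then show ?thesis by (simp add: has_real_derivative_iff_has_vector_derivative)
  qed
  have "((\<lambda>t. ln \<bar>t - r\<bar>) has_integral (F 1 - F 0)) {0..1}"
    by (rule fundamental_theorem_of_calculus_interior_strong[of "{r}"]) (use c d in auto)
  moreover have "- 2 \<le> F 1 - F 0"
  proof -
    define h where "h x = x * ln x" for x :: real
    have low: "x - 1 \<le> h x" if "x \<ge> 0" for x
    proof (cases "x = 0")
      case False
      then have "- ln x \<le> 1 / x - 1" using ln_add_one_self_le_self2[of "1 / x - 1"] that by (simp add: ln_div)
      then have "x * (- ln x) \<le> x * (1 / x - 1)" using that by (intro mult_left_mono) auto
      then show ?thesis using False that by (simp add: h_def algebra_simps)
    qed (simp add: h_def)
    have inc: "- 1 \<le> h (1 + x) - h x" if "x \<ge> 0" for x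
    proof (cases "x = 0")
      case False
      have "x * ln x \<le> (1 + x) * ln (1 + x)"
      proof -
        have "x * ln x \<le> x * ln (1 + x)" using that False by (intro mult_left_mono) auto
        also have "\<dots> \<le> (1 + x) * ln (1 + x)" using that by (intro mult_right_mono) auto
        finally show ?thesis .
      qed
      then show ?thesis by (simp add: h_def)
    qed (simp add: h_def)
    have e: "F 1 - F 0 = (1 - r) * ln \<bar>1 - r\<bar> + r * ln \<bar>r\<bar> - 1" by (simp add: F_def)
    consider "r < 0" | "0 \<le> r" "r \<le> 1" | "r > 1" by linarith
    then show ?thesis
    proof cases
      case 1 then show ?thesis using inc[of "- r"] by (simp add: e h_def)
    next
      case 2 then show ?thesis using low[of r] low[of "1 - r"] by (simp add: e h_def)
    next
      case 3 then show ?thesis using inc[of "r - 1"] by (simp add: e h_def algebra_simps abs_if)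
    qed
  qed
  ultimately show ?thesis by blast
qed

text \<open>
  Jensen's formula in an elementary form: over the complex numbers the polynomial is a product of linear factors, and
  replacing every root by its real part only decreases the modulus at real arguments.
\<close>

lemma log_poly_integral:
  fixes p :: "complex poly" and u :: "real \<Rightarrow> real"
  assumes p: "degree p \<le> n" "coeff p n = of_real (lam ^ n)" and lam: "lam > 0"
    and u: "u integrable_on {0..1}" "\<And>t. t \<in> {0..1} \<Longrightarrow> poly p (of_real t) \<noteq> 0 \<Longrightarrow> ln (cmod (poly p (of_real t))) \<le> u t"
  shows "real n * (ln lam - 2) \<le> integral {0..1} u"
proof -
  have p0: "p \<noteq> 0" using p lam by auto
  have dp: "degree p = n" using p lam by (metis coeff_0 le_antisym le_degree of_real_eq_0_iff power_not_zero less_irrefl)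
  obtain A where A: "size A = n" "p = smult (lead_coeff p) (\<Prod>x\<in>#A. [:- x, 1:])"
    using alg_closed_imp_factorization[OF p0] dp by auto
  have lc: "lead_coeff p = of_real (lam ^ n)" using p dp by simp
  have I: "\<exists>I. ((\<lambda>t. \<Sum>z\<in>#A. ln \<bar>t - Re z\<bar>) has_integral I) {0..1} \<and> - 2 * real (size A) \<le> I" for A :: "complex multiset"
  proof (induction A)
    case empty show ?case by (intro exI[of _ 0]) simp
  next
    case (add z A)
    then obtain I where I: "((\<lambda>t. \<Sum>z\<in>#A. ln \<bar>t - Re z\<bar>) has_integral I) {0..1}" "- 2 * real (size A) \<le> I" by blast
    obtain J where J: "((\<lambda>t. ln \<bar>t - Re z\<bar>) has_integral J) {0..1}" "- 2 \<le> J" using log_distance_integral by blast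
    show ?case using has_integral_add[OF J(1) I(1)] I(2) J(2) by (intro exI[of _ "J + I"]) auto
  qed
  have low: "(\<Sum>z\<in>#A. ln \<bar>t - Re z\<bar>) \<le> ln (cmod (poly (\<Prod>x\<in>#A. [:- x, 1:]) (of_real t)))
      \<and> poly (\<Prod>x\<in>#A. [:- x, 1:]) (of_real t) \<noteq> 0"
    if "t \<notin> Re ` set_mset A" for A :: "complex multiset" and t :: real
    using that
  proof (induction A)
    case (add z A)
    have tz: "t - Re z \<noteq> 0" using add.prems by auto
    have le: "\<bar>t - Re z\<bar> \<le> cmod (of_real t - z)" using abs_Re_le_cmod[of "of_real t - z"] by simp
    then have nz: "cmod (of_real t - z) > 0" using tz by linarith
    have "ln \<bar>t - Re z\<bar> \<le> ln (cmod (of_real t - z))" using le tz by (intro ln_mono) auto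
    moreover have pe: "poly (\<Prod>x\<in>#add_mset z A. [:- x, 1:]) (of_real t) = (of_real t - z) * poly (\<Prod>x\<in>#A. [:- x, 1:]) (of_real t)"
      by (simp only: image_mset_add_mset prod_mset.add_mset poly_mult) simp
    ultimately show ?case
      unfolding pe using add nz by (simp add: norm_mult ln_mult del: ln_le_cancel_iff)
  qed simp
  obtain I where I: "((\<lambda>t. \<Sum>z\<in>#A. ln \<bar>t - Re z\<bar>) has_integral I) {0..1}" "- 2 * real n \<le> I" using I[of A] A(1) by auto
  define h where "h t = real n * ln lam + (\<Sum>z\<in>#A. ln \<bar>t - Re z\<bar>)" for t
  have h: "(h has_integral (real n * ln lam + I)) {0..1}"
    unfolding h_def using has_integral_add[OF has_integral_const_real[of "real n * ln lam" 0 1] I(1)] by simp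
  define u' where "u' t = (if t \<in> Re ` set_mset A then h t else u t)" for t
  have u': "(u' has_integral integral {0..1} u) {0..1}"
    by (rule has_integral_spike_finite[of "Re ` set_mset A" _ _ u])
      (use u(1) in \<open>auto simp: u'_def intro: integrable_integral\<close>)
  have "real n * ln lam + I \<le> integral {0..1} u"
  proof (rule has_integral_le[OF h u'])
    fix t :: real assume t: "t \<in> {0..1}"
    show "h t \<le> u' t"
    proof (cases "t \<in> Re ` set_mset A")
      case False
      define q where "q = poly (\<Prod>x\<in>#A. [:- x, 1:]) (of_real t)"
      have q: "(\<Sum>z\<in>#A. ln \<bar>t - Re z\<bar>) \<le> ln (cmod q)" "q \<noteq> 0" using low[OF False] by (auto simp: q_def)
      have "poly p (of_real t) = of_real (lam ^ n) * q"
        by (subst A(2)) (simp only: poly_smult q_def lc)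
      then have pq: "cmod (poly p (of_real t)) = lam ^ n * cmod q" using lam by (simp add: norm_mult norm_power)
      then have "ln (cmod (poly p (of_real t))) = real n * ln lam + ln (cmod q)"
        using lam q(2) by (simp add: ln_mult ln_realpow)
      moreover have "poly p (of_real t) \<noteq> 0" using pq lam q(2) by auto
      ultimately have "h t \<le> u t" using u(2)[OF t] q(1) by (simp add: h_def)
      then show ?thesis using False by (simp add: u'_def)
    qed (simp add: u'_def)
  qed
  then show ?thesis using I(2) by (simp add: algebra_simps)
qed

section \<open>Large Lyapunov exponents\<close>

lemma continuous_on_comp: "continuous_on UNIV f \<Longrightarrow> continuous_on A g \<Longrightarrow> continuous_on A (\<lambda>x. f (g x))"
  by (rule continuous_on_compose2) auto

locale family =
  fixes v :: "real \<Rightarrow> real" and lam :: real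
  assumes per: "periodic1 v" and cont: "continuous_on UNIV v"
    and rng: "\<And>x. 0 \<le> v x \<and> v x \<le> 1"
    and lam2: "lam \<ge> 2"
begin

text \<open>
  The potential is written in the expanded form that occurs in \<open>Delta\<close>.
\<close>

definition cpot :: "real \<Rightarrow> real \<Rightarrow> real" where "cpot t x = lam * t - lam * v x"

definition logint :: "nat \<Rightarrow> real \<Rightarrow> real \<Rightarrow> real" where
  "logint n \<alpha> t = integral {0..1} (\<lambda>x. ln (opnorm (citer \<alpha> (cpot t) n x)))"

definition lyap :: "real \<Rightarrow> real \<Rightarrow> real" where
  "lyap \<alpha> t = lyapunov \<alpha> (schroedinger (cpot t))"

lemma cpot_periodic: "periodic1 (cpot t)" using per by (simp add: periodic1_def cpot_def)

lemma orb_joint_cont: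
  "continuous_on UNIV (\<lambda>p. orb (fst (fst p)) (cpot (snd (fst p))) (snd p) w n)"
proof (induction n)
  case (Suc n)
  let ?w = "\<lambda>p :: (real \<times> real) \<times> real. orb (fst (fst p)) (cpot (snd (fst p))) (snd p) w n"
  let ?c = "\<lambda>p :: (real \<times> real) \<times> real. cpot (snd (fst p)) (snd p + real n * fst (fst p))"
  have "continuous_on UNIV ?c"
    unfolding cpot_def by (intro continuous_intros continuous_on_compose2[OF cont]) auto
  then have "continuous_on UNIV (\<lambda>p. of_real (?c p * Re (?w p)) + \<i> * ?w p)"
    by (intro continuous_intros Suc)
  moreover have "step c w = of_real (c * Re w) + \<i> * w" for c w by (simp add: complex_eq_iff)
  ultimately show ?case by simp
qed simp

lemma ln_opnorm_joint_cont:
  "continuous_on A (\<lambda>p. ln (opnorm (citer (fst (fst p)) (cpot (snd (fst p))) n (snd p))))"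
proof -
  have "continuous_on UNIV (\<lambda>p. opnorm (citer (fst (fst p)) (cpot (snd (fst p))) n (snd p)))"
    by (rule continuous_opnorm) (simp_all add: citer_emb continuous_emb orb_joint_cont)
  then have "continuous_on UNIV (\<lambda>p. ln (opnorm (citer (fst (fst p)) (cpot (snd (fst p))) n (snd p))))"
  proof (rule continuous_on_ln, intro ballI)
    fix p :: "(real \<times> real) \<times> real"
    show "opnorm (citer (fst (fst p)) (cpot (snd (fst p))) n (snd p)) \<noteq> 0"
      using opnorm_citer_ge_1[of "fst (fst p)" "cpot (snd (fst p))" n "snd p"] by linarith
  qed
  then show ?thesis by (rule continuous_on_subset) simp
qed

lemma ln_opnorm_cont: "continuous_on A (\<lambda>x. ln (opnorm (citer \<alpha> (cpot t) n x)))"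
proof -
  have "continuous_on A (\<lambda>x::real. ((\<alpha>, t), x))" by (intro continuous_intros)
  from continuous_on_comp[OF ln_opnorm_joint_cont this] show ?thesis by simp
qed

lemma ln_opnorm_cont_tx: "continuous_on A (\<lambda>p. ln (opnorm (citer \<alpha> (cpot (fst p)) n (snd p))))"
proof -
  have "continuous_on A (\<lambda>p :: real \<times> real. ((\<alpha>, fst p), snd p))" by (intro continuous_intros)
  from continuous_on_comp[OF ln_opnorm_joint_cont this] show ?thesis by simp
qed

lemma logint_cont: "continuous_on UNIV (\<lambda>q. logint n (fst q) (snd q))"
proof -
  have "continuous_on (UNIV \<times> cbox 0 1) (\<lambda>(q :: real \<times> real, x). ln (opnorm (citer (fst q) (cpot (snd q)) n x)))"
    using ln_opnorm_joint_cont[of "UNIV \<times> cbox 0 1" n] by (simp add: case_prod_unfold)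
  from integral_continuous_on_param[OF this] show ?thesis by (simp add: logint_def)
qed

lemma logint_cont_t: "continuous_on A (logint n \<alpha>)"
proof -
  have "continuous_on A (\<lambda>t::real. (\<alpha>, t))" by (intro continuous_intros)
  from continuous_on_comp[OF logint_cont this] show ?thesis by simp
qed

lemma logint_nonneg: "0 \<le> logint n \<alpha> t"
  unfolding logint_def
  by (intro integral_nonneg integrable_continuous_real ln_opnorm_cont) (simp add: opnorm_citer_ge_1)

lemma logint_subadd: "logint (m + n) \<alpha> t \<le> logint m \<alpha> t + logint n \<alpha> t"
proof -
  let ?f = "\<lambda>n x. ln (opnorm (citer \<alpha> (cpot t) n x))"
  have i: "?f n integrable_on {0..1}" for n by (intro integrable_continuous_real ln_opnorm_cont)
  have ish: "(\<lambda>x. ?f n (x + real m * \<alpha>)) integrable_on {0..1}"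
    by (intro integrable_continuous_real continuous_on_compose2[OF ln_opnorm_cont[of UNIV]] continuous_intros) auto
  have p: "periodic1 (?f n)" using cpot_periodic by (simp add: periodic1_def[of "?f n"] citer_periodic)
  have "logint (m + n) \<alpha> t \<le> integral {0..1} (\<lambda>x. ?f m x + ?f n (x + real m * \<alpha>))"
    unfolding logint_def
  proof (rule integral_le[OF i integrable_add[OF i ish]])
    fix x
    have pos: "0 < opnorm (citer \<alpha> (cpot t) k y)" for k y using opnorm_citer_ge_1[of \<alpha> "cpot t" k y] by linarith
    have "?f (m + n) x \<le> ln (opnorm (citer \<alpha> (cpot t) n (x + real m * \<alpha>)) * opnorm (citer \<alpha> (cpot t) m x))"
      unfolding citer_add using opnorm_mult pos[of "m + n" x] by (intro ln_mono) (auto simp: citer_add)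
    then show "?f (m + n) x \<le> ?f m x + ?f n (x + real m * \<alpha>)" by (simp add: ln_mult_pos[OF pos pos])
  qed
  also have "\<dots> = integral {0..1} (?f m) + integral {0..1} (\<lambda>x. ?f n (x + real m * \<alpha>))"
    by (rule integral_add[OF i ish])
  also have "integral {0..1} (\<lambda>x. ?f n (x + real m * \<alpha>)) = integral {0..1} (?f n)"
    by (rule periodic_integral_shift[OF ln_opnorm_cont p])
  finally show ?thesis by (simp add: logint_def)
qed

lemma lyap_lim: "(\<lambda>n. logint n \<alpha> t / real n) \<longlonglongrightarrow> lyap \<alpha> t"
  and lyap_le: "n \<ge> 1 \<Longrightarrow> lyap \<alpha> t \<le> logint n \<alpha> t / real n"
proof -
  obtain L where L: "(\<lambda>n. logint n \<alpha> t / real n) \<longlonglongrightarrow> L" "\<forall>n\<ge>1. L \<le> logint n \<alpha> t / real n"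
    using fekete[of "\<lambda>n. logint n \<alpha> t", OF logint_subadd logint_nonneg] by blast
  have "lyap \<alpha> t = L" unfolding lyap_def lyapunov_def using limI[OF L(1)] by (simp add: logint_def)
  with L show "(\<lambda>n. logint n \<alpha> t / real n) \<longlonglongrightarrow> lyap \<alpha> t"
    "n \<ge> 1 \<Longrightarrow> lyap \<alpha> t \<le> logint n \<alpha> t / real n" by auto
qed

lemma lyap_measurable: "(\<lambda>q. lyap (fst q) (snd q)) \<in> borel_measurable borel"
proof -
  have "(\<lambda>q. lim (\<lambda>n. logint n (fst q) (snd q) / real n)) \<in> borel_measurable borel"
    by (intro borel_measurable_lim_metric borel_measurable_divide borel_measurable_continuous_onI logint_cont) simp
  moreover have "lim (\<lambda>n. logint n (fst q) (snd q) / real n) = lyap (fst q) (snd q)" for q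
    by (rule limI[OF lyap_lim])
  ultimately show ?thesis by simp
qed

lemma lyap_measurable_t: "lyap \<alpha> \<in> borel_measurable borel"
  using measurable_compose[OF _ lyap_measurable, of "\<lambda>t. (\<alpha>, t)"] by simp

text \<open>
  By subadditivity the exponent is a lower bound at every finite time, so at each time some phase attains the
  average.
\<close>

lemma lyap_growth:
  assumes "0 \<le> r" "r < lyap \<alpha> t"
  shows "\<exists>x w. cmod w = 1 \<and> exp (r * real n) \<le> cmod (orb \<alpha> (cpot t) x w n)"
proof (cases "n = 0")
  case False
  let ?f = "\<lambda>x. ln (opnorm (citer \<alpha> (cpot t) n x))"
  have "r < logint n \<alpha> t / real n" using lyap_le[of n \<alpha> t] False assms by simp
  then have big: "r * real n < logint n \<alpha> t" using False by (simp add: less_divide_eq)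
  have "\<exists>x. r * real n < ?f x"
  proof (rule ccontr)
    assume "\<not> ?thesis"
    then have "logint n \<alpha> t \<le> integral {0..1} (\<lambda>x::real. r * real n)"
      unfolding logint_def by (intro integral_le integrable_continuous_real ln_opnorm_cont) (auto simp: not_less)
    then show False using big by simp
  qed
  then obtain x where x: "r * real n < ?f x" by blast
  have "exp (r * real n) < exp (?f x)" using x by simp
  also have "\<dots> = opnorm (citer \<alpha> (cpot t) n x)" using opnorm_citer_ge_1[of \<alpha> "cpot t" n x] by simp
  finally show ?thesis using opnorm_citer_attained[of "exp (r * real n)"] by force
qed (intro exI[of _ 0] exI[of _ 1], simp)

lemma poly_orb:
  "\<exists>P Q. degree P \<le> n \<and> degree Q \<le> n \<and> coeff P n = complex_of_real (lam ^ n) \<and>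
     (\<forall>t. poly P (of_real t) = of_real (Re (orb \<alpha> (cpot t) x 1 n)) \<and> poly Q (complex_of_real t) = of_real (Im (orb \<alpha> (cpot t) x 1 n)))"
proof (induction n)
  case 0
  show ?case by (intro exI[of _ 1] exI[of _ 0]) simp
next
  case (Suc n)
  then obtain P Q where PQ: "degree P \<le> n" "degree Q \<le> n" "coeff P n = complex_of_real (lam ^ n)"
    "\<And>t. poly P (of_real t) = of_real (Re (orb \<alpha> (cpot t) x 1 n))" "\<And>t. poly Q (complex_of_real t) = of_real (Im (orb \<alpha> (cpot t) x 1 n))"
    by blast
  define a where "a = - complex_of_real (lam * v (x + real n * \<alpha>))"
  define P' where "P' = [:a, of_real lam:] * P - Q"
  have P': "P' = smult a P + pCons 0 (smult (of_real lam) P) - Q" by (simp add: P'_def)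
  have "coeff P (Suc n) = 0" "coeff Q (Suc n) = 0" using PQ by (auto intro: coeff_eq_0)
  then have "coeff P' (Suc n) = of_real (lam ^ Suc n)" using PQ(3) by (simp add: P')
  moreover have "degree P' \<le> Suc n"
  proof (rule degree_le, intro allI impI)
    fix i assume "Suc n < i"
    have "coeff P j = 0" "coeff Q j = 0" if "n < j" for j using PQ(1,2) that by (auto intro: coeff_eq_0)
    then show "coeff P' i = 0" using \<open>Suc n < i\<close> by (cases i) (auto simp: P')
  qed
  moreover have "poly P' (of_real t) = of_real (Re (orb \<alpha> (cpot t) x 1 (Suc n)))" for t
    by (simp add: P' PQ(4,5) a_def cpot_def algebra_simps)
  ultimately show ?case using PQ by (intro exI[of _ P'] exI[of _ P]) auto
qed

lemma logint_mean: "real n * (ln lam - 2) \<le> integral {0..1} (logint n \<alpha>)"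
proof -
  let ?f = "\<lambda>t x. ln (opnorm (citer \<alpha> (cpot t) n x))"
  have c: "continuous_on (cbox (0, 0) (1, 1)) (\<lambda>(t, x). ?f t x)"
    using ln_opnorm_cont_tx[of "cbox (0, 0) (1, 1)" \<alpha> n] by (simp add: case_prod_unfold)
  have ct: "continuous_on A (\<lambda>t. ?f t x)" for A x
  proof -
    have "continuous_on A (\<lambda>t::real. (t, x))" by (intro continuous_intros)
    from continuous_on_comp[OF ln_opnorm_cont_tx this] show ?thesis by simp
  qed
  have swap: "integral {0..1} (logint n \<alpha>) = integral {0..1} (\<lambda>x. integral {0..1} (\<lambda>t. ?f t x))"
    using integral_swap_continuous[OF c] by (simp add: logint_def[abs_def])
  have "integral {0..1} (\<lambda>x::real. real n * (ln lam - 2)) \<le> integral {0..1} (\<lambda>x. integral {0..1} (\<lambda>t. ?f t x))"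
  proof (rule integral_le)
    have "continuous_on (UNIV \<times> cbox 0 1) (\<lambda>p :: real \<times> real. (snd p, fst p))" by (intro continuous_intros)
    from continuous_on_comp[OF ln_opnorm_cont_tx this, of \<alpha> n]
    have "continuous_on (UNIV \<times> cbox 0 1) (\<lambda>(x, t). ?f t x)" by (simp add: case_prod_unfold)
    from integral_continuous_on_param[OF this]
    show "(\<lambda>x. integral {0..1} (\<lambda>t. ?f t x)) integrable_on {0..1}"
      by (intro integrable_continuous_real) (auto intro: continuous_on_subset)
    fix x
    obtain P where P: "degree P \<le> n" "coeff P n = complex_of_real (lam ^ n)"
      "\<And>t. poly P (of_real t) = of_real (Re (orb \<alpha> (cpot t) x 1 n))" using poly_orb[of n \<alpha> x] by blast
    show "real n * (ln lam - 2) \<le> integral {0..1} (\<lambda>t. ?f t x)"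
    proof (rule log_poly_integral[OF P(1,2)])
      show "lam > 0" using lam2 by simp
      show "(\<lambda>t. ?f t x) integrable_on {0..1}" by (intro integrable_continuous_real ct)
      fix t :: real assume nz: "poly P (of_real t) \<noteq> 0"
      have "cmod (poly P (of_real t)) \<le> cmod (orb \<alpha> (cpot t) x 1 n)" by (simp add: P(3) abs_Re_le_cmod)
      also have "\<dots> \<le> opnorm (citer \<alpha> (cpot t) n x)"
        using norm_mult_opnorm[of "citer \<alpha> (cpot t) n x" "emb 1"] by (simp add: citer_emb)
      finally show "ln (cmod (poly P (of_real t))) \<le> ?f t x" using nz by (intro ln_mono) auto
    qed
  qed (rule integrable_const_ivl)
  then show ?thesis by (simp add: swap)
qed

lemma logint_upper:
  assumes t: "t \<in> {0..1}" shows "logint n \<alpha> t \<le> real n * ln (lam + 1)"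
proof -
  have B: "\<bar>cpot t x\<bar> + 1 \<le> lam + 1" for x
  proof -
    have "\<bar>t - v x\<bar> \<le> 1" using t rng[of x] by auto
    then have "lam * \<bar>t - v x\<bar> \<le> lam * 1" using lam2 by (intro mult_left_mono) auto
    moreover have "cpot t x = lam * (t - v x)" by (simp add: cpot_def algebra_simps)
    ultimately show ?thesis using lam2 by (simp add: abs_mult)
  qed
  have "logint n \<alpha> t \<le> integral {0..1} (\<lambda>x::real. real n * ln (lam + 1))"
    unfolding logint_def
  proof (intro integral_le integrable_continuous_real ln_opnorm_cont)
    fix x
    have "ln (opnorm (citer \<alpha> (cpot t) n x)) \<le> ln ((lam + 1) ^ n)"
      using opnorm_citer_ge_1[of \<alpha> "cpot t" n x] by (intro ln_mono opnorm_citer_le B) auto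
    then show "ln (opnorm (citer \<alpha> (cpot t) n x)) \<le> real n * ln (lam + 1)" using lam2 by (simp add: ln_realpow)
  qed simp
  then show ?thesis by simp
qed

text \<open>
  Markov's inequality for the nonnegative function \<open>ln (lam + 1) - lyap \<alpha> t\<close>, whose mean is at most
  \<open>ln (lam + 1) - ln lam + 2 \<le> 3\<close>.
\<close>

lemma lyap_exceptional_small:
  assumes e: "\<epsilon> > 0"
  shows "measure lborel {t \<in> {0..1}. lyap \<alpha> t \<le> (1 - \<epsilon>) * ln lam} \<le> 3 / (\<epsilon> * ln lam)"
proof -
  define D where "D = {t \<in> {0..1}. lyap \<alpha> t \<le> (1 - \<epsilon>) * ln lam}"
  have "{t. lyap \<alpha> t \<le> (1 - \<epsilon>) * ln lam} \<in> sets borel"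
    using borel_measurable_le[OF lyap_measurable_t borel_measurable_const, of \<alpha> "(1 - \<epsilon>) * ln lam"] by simp
  moreover have "D = {0..1} \<inter> {t. lyap \<alpha> t \<le> (1 - \<epsilon>) * ln lam}" by (auto simp: D_def)
  ultimately have Dm: "D \<in> sets borel" by simp
  have Df: "emeasure lborel D < \<infinity>"
  proof -
    have "emeasure lborel D \<le> emeasure lborel {0..1::real}" by (intro emeasure_mono) (auto simp: D_def)
    also have "\<dots> < \<infinity>" by simp
    finally show ?thesis .
  qed
  have l0: "ln lam > 0" using lam2 by simp
  define s where "s n t = indicator {0..1} t * (logint n \<alpha> t / real n)" for n and t :: real
  define w where "w t = indicator {0..1} t * ln (lam + 1)" for t :: real
  define f where "f t = indicator {0..1} t * lyap \<alpha> t" for t :: real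
  have up: "logint n \<alpha> t / real n \<le> ln (lam + 1)" if "t \<in> {0..1}" for n t
    using logint_upper[OF that, of n \<alpha>] lam2 by (cases "n = 0") (auto simp: divide_le_eq mult.commute)
  have lw: "lyap \<alpha> t \<le> ln (lam + 1)" if "t \<in> {0..1}" for t
    using lyap_le[of 1 \<alpha> t] up[OF that, of 1] by simp
  have iw: "integrable lborel w" unfolding w_def by (intro integrable_mult_left) simp
  have fm: "f \<in> borel_measurable lborel"
    using lyap_measurable_t[of \<alpha>] unfolding f_def by (intro borel_measurable_times) auto
  have sm: "s n \<in> borel_measurable lborel" for n
    unfolding s_def
    using borel_measurable_continuous_onI[OF logint_cont_t[of UNIV n \<alpha>]]
    by (intro borel_measurable_times borel_measurable_divide) auto
  have bd: "norm (s n t) \<le> w t" for n t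
    using up[of t n] logint_nonneg[of n \<alpha> t] by (auto simp: s_def w_def indicator_def)
  have lim: "(\<lambda>n. s n t) \<longlonglongrightarrow> f t" for t
    unfolding s_def f_def by (intro tendsto_intros lyap_lim)
  have fi: "integrable lborel f" and conv: "(\<lambda>n. \<integral>t. s n t \<partial>lborel) \<longlonglongrightarrow> (\<integral>t. f t \<partial>lborel)"
    using integrable_dominated_convergence[where s=s, OF fm sm iw] integral_dominated_convergence[where s=s, OF fm sm iw] lim bd
    by auto
  have "ln lam - 2 \<le> (\<integral>t. s n t \<partial>lborel)" if "n \<ge> 1" for n
  proof -
    have c: "continuous_on {0..1} (\<lambda>t. logint n \<alpha> t / real n)" using that by (intro continuous_intros logint_cont_t) auto
    have "set_integrable lborel {0..1} (\<lambda>t. logint n \<alpha> t / real n)" by (rule borel_integrable_atLeastAtMost'[OF c])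
    from set_borel_integral_eq_integral(2)[OF this]
    have "(\<integral>t. s n t \<partial>lborel) = integral {0..1} (\<lambda>t. logint n \<alpha> t / real n)"
      by (simp add: set_lebesgue_integral_def s_def)
    also have "\<dots> = integral {0..1} (logint n \<alpha>) / real n" by simp
    also have "\<dots> \<ge> ln lam - 2" using logint_mean[of n \<alpha>] that by (simp add: le_divide_eq mult.commute)
    finally show ?thesis .
  qed
  then have mean: "ln lam - 2 \<le> (\<integral>t. f t \<partial>lborel)" by (intro LIMSEQ_le_const[OF conv]) auto
  have "(\<integral>t. \<epsilon> * ln lam * indicator D t \<partial>lborel) \<le> (\<integral>t. w t - f t \<partial>lborel)"
  proof (rule integral_mono)
    show "integrable lborel (\<lambda>t. \<epsilon> * ln lam * indicator D t)" using Dm Df by (intro integrable_mult_right) simp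
    show "integrable lborel (\<lambda>t. w t - f t)" by (rule Bochner_Integration.integrable_diff[OF iw fi])
    fix t
    have "ln lam \<le> ln (lam + 1)" using lam2 by simp
    then show "\<epsilon> * ln lam * indicator D t \<le> w t - f t"
      using lw[of t] by (auto simp: D_def w_def f_def indicator_def algebra_simps)
  qed
  also have "(\<integral>t. \<epsilon> * ln lam * indicator D t \<partial>lborel) = \<epsilon> * ln lam * measure lborel D" using Dm by simp
  also have "(\<integral>t. w t - f t \<partial>lborel) = ln (lam + 1) - (\<integral>t. f t \<partial>lborel)"
    using iw fi by (simp add: w_def)
  also have "\<dots> \<le> ln 2 + ln lam - (ln lam - 2)"
  proof -
    have "ln (lam + 1) \<le> ln (2 * lam)" using lam2 by simp
    then show ?thesis using mean lam2 by (simp add: ln_mult)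
  qed
  also have "\<dots> \<le> 3" using ln_2_less_1 by simp
  finally show ?thesis unfolding D_def[symmetric] using e l0 by (simp add: le_divide_eq mult.commute)
qed

end

section \<open>Continued fractions and Brjuno numbers\<close>

lemma cf_rem_irrational: "\<alpha> \<notin> \<rat> \<Longrightarrow> cf_rem \<alpha> n \<notin> \<rat>"
proof (induction n)
  case (Suc n)
  show ?case
  proof
    assume "cf_rem \<alpha> (Suc n) \<in> \<rat>"
    then have "1 / cf_rem \<alpha> (Suc n) + of_int \<lfloor>cf_rem \<alpha> n\<rfloor> \<in> \<rat>" by (intro Rats_add Rats_divide) auto
    then have "cf_rem \<alpha> n \<in> \<rat>" by (simp add: frac_def)
    with Suc show False by blast
  qed
qed simp

lemma cf_frac_bounds: "\<alpha> \<notin> \<rat> \<Longrightarrow> 0 < frac (cf_rem \<alpha> n) \<and> frac (cf_rem \<alpha> n) < 1"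
  using cf_rem_irrational[of \<alpha> n] Ints_subset_Rats by (auto simp: frac_gt_0_iff frac_lt_1)

lemma cf_coeff_pos: "\<alpha> \<notin> \<rat> \<Longrightarrow> 1 \<le> cf_coeff \<alpha> (Suc n)"
  using cf_frac_bounds[of \<alpha> n] by (simp add: cf_coeff_def le_floor_iff)

text \<open>
  The numerators of the convergents, with the same indexing as \<open>cf_denom\<close>.
\<close>

fun cf_numer :: "real \<Rightarrow> nat \<Rightarrow> int" where
  "cf_numer \<alpha> 0 = \<lfloor>\<alpha>\<rfloor>"
| "cf_numer \<alpha> (Suc 0) = cf_coeff \<alpha> 1 * \<lfloor>\<alpha>\<rfloor> + 1"
| "cf_numer \<alpha> (Suc (Suc n)) = cf_coeff \<alpha> (Suc (Suc n)) * cf_numer \<alpha> (Suc n) + cf_numer \<alpha> n"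

lemma cf_det: "cf_numer \<alpha> (Suc n) * cf_denom \<alpha> n - cf_numer \<alpha> n * cf_denom \<alpha> (Suc n) = (- 1) ^ n"
  by (induction n) (simp_all add: algebra_simps)

lemma cf_denom_pos:
  assumes "\<alpha> \<notin> \<rat>" shows "1 \<le> cf_denom \<alpha> n" "1 \<le> cf_denom \<alpha> (Suc n)"
proof -
  have "1 \<le> cf_denom \<alpha> n \<and> 1 \<le> cf_denom \<alpha> (Suc n)"
  proof (induction n)
    case 0 show ?case using cf_coeff_pos[OF assms, of 0] by simp
  next
    case (Suc n)
    have "1 * 1 \<le> cf_coeff \<alpha> (Suc (Suc n)) * cf_denom \<alpha> (Suc n)"
      using cf_coeff_pos[OF assms, of "Suc n"] Suc by (intro mult_mono) auto
    then show ?case using Suc by simp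
  qed
  then show "1 \<le> cf_denom \<alpha> n" "1 \<le> cf_denom \<alpha> (Suc n)" by auto
qed

lemma cf_error_step:
  assumes irr: "\<alpha> \<notin> \<rat>"
  shows "of_int (cf_denom \<alpha> (Suc n)) * \<alpha> - of_int (cf_numer \<alpha> (Suc n))
    = - frac (cf_rem \<alpha> (Suc n)) * (of_int (cf_denom \<alpha> n) * \<alpha> - of_int (cf_numer \<alpha> n))"
proof (induction n)
  case 0
  have f: "frac \<alpha> \<noteq> 0" using cf_frac_bounds[OF irr, of 0] by simp
  have "frac (1 / frac \<alpha>) * frac \<alpha> = 1 - of_int \<lfloor>1 / frac \<alpha>\<rfloor> * frac \<alpha>"
    using f by (simp add: frac_def[of "1 / frac \<alpha>"] left_diff_distrib)
  then show ?case by (simp add: cf_coeff_def frac_def[of \<alpha>] algebra_simps)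
next
  case (Suc n)
  define d where "d n = of_int (cf_denom \<alpha> n) * \<alpha> - of_int (cf_numer \<alpha> n)" for n
  define f where "f = frac (cf_rem \<alpha> (Suc n))"
  have f: "f \<noteq> 0" using cf_frac_bounds[OF irr, of "Suc n"] by (simp add: f_def)
  have IH: "d (Suc n) = - f * d n" using Suc by (simp add: d_def f_def)
  have "d (Suc (Suc n)) = of_int (cf_coeff \<alpha> (Suc (Suc n))) * d (Suc n) + d n"
    by (simp add: d_def algebra_simps)
  also have "d n = - (1 / f) * d (Suc n)" using f by (simp add: IH)
  also have "of_int (cf_coeff \<alpha> (Suc (Suc n))) * d (Suc n) + - (1 / f) * d (Suc n) = - frac (1 / f) * d (Suc n)"
  proof -
    have "cf_coeff \<alpha> (Suc (Suc n)) = \<lfloor>1 / f\<rfloor>" by (simp add: cf_coeff_def f_def)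
    then show ?thesis by (simp add: frac_def[of "1 / f"] algebra_simps)
  qed
  finally show ?case by (simp add: d_def f_def)
qed

lemma cf_error:
  assumes irr: "\<alpha> \<notin> \<rat>"
  shows "\<bar>of_int (cf_denom \<alpha> n) * \<alpha> - of_int (cf_numer \<alpha> n)\<bar> * of_int (cf_denom \<alpha> (Suc n)) \<le> 1"
proof -
  define q q' p p' where "q = real_of_int (cf_denom \<alpha> n)" and "q' = real_of_int (cf_denom \<alpha> (Suc n))"
    and "p = real_of_int (cf_numer \<alpha> n)" and "p' = real_of_int (cf_numer \<alpha> (Suc n))"
  define f where "f = frac (cf_rem \<alpha> (Suc n))"
  have pos: "0 < q" "0 < q'" "0 < f"
    using cf_denom_pos[OF irr, of n] cf_frac_bounds[OF irr, of "Suc n"] by (auto simp: q_def q'_def f_def)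
  have "of_int (cf_numer \<alpha> (Suc n) * cf_denom \<alpha> n - cf_numer \<alpha> n * cf_denom \<alpha> (Suc n)) = (of_int ((- 1) ^ n) :: real)"
    by (simp only: cf_det)
  then have d1: "p' * q - p * q' = (- 1) ^ n" by (simp add: p_def p'_def q_def q'_def)
  have d2: "q' * \<alpha> - p' = - f * (q * \<alpha> - p)"
    using cf_error_step[OF irr, of n] by (simp add: p_def p'_def q_def q'_def f_def)
  have "(q' + f * q) * (q * \<alpha> - p) = q' * (q * \<alpha> - p) - q * (- f * (q * \<alpha> - p))"
    by (simp add: algebra_simps)
  also have "\<dots> = q' * (q * \<alpha> - p) - q * (q' * \<alpha> - p')" by (simp only: d2)
  also have "\<dots> = p' * q - p * q'" by (simp add: algebra_simps)
  also note d1
  finally have "(q' + f * q) * (q * \<alpha> - p) = (- 1) ^ n" .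
  then have "\<bar>(q' + f * q) * (q * \<alpha> - p)\<bar> = 1" by (simp add: power_abs)
  then have "(q' + f * q) * \<bar>q * \<alpha> - p\<bar> = 1" using pos by (simp add: abs_mult)
  moreover have "q' * \<bar>q * \<alpha> - p\<bar> \<le> (q' + f * q) * \<bar>q * \<alpha> - p\<bar>" using pos by (intro mult_right_mono) auto
  ultimately show ?thesis by (simp add: q_def q'_def p_def mult.commute)
qed

text \<open>
  The denominators are indexed from the first convergent on, because the index 0 and the index 1 may
  both have denominator 1; from here on they increase strictly.
\<close>

definition cfQ :: "real \<Rightarrow> nat \<Rightarrow> nat" where "cfQ \<alpha> m = nat (cf_denom \<alpha> (Suc m))"

lemma of_nat_cfQ: "\<alpha> \<notin> \<rat> \<Longrightarrow> int (cfQ \<alpha> m) = cf_denom \<alpha> (Suc m)"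
  using cf_denom_pos[of \<alpha> m] by (simp add: cfQ_def)

lemma real_cfQ: "\<alpha> \<notin> \<rat> \<Longrightarrow> real (cfQ \<alpha> m) = real_of_int (cf_denom \<alpha> (Suc m))"
  using of_nat_cfQ[of \<alpha> m] by (metis of_int_of_nat_eq)

lemma cfQ_rec: "\<alpha> \<notin> \<rat> \<Longrightarrow> cfQ \<alpha> (Suc m) + cfQ \<alpha> m \<le> cfQ \<alpha> (Suc (Suc m))"
proof -
  assume irr: "\<alpha> \<notin> \<rat>"
  have "1 * cf_denom \<alpha> (Suc (Suc m)) \<le> cf_coeff \<alpha> (Suc (Suc (Suc m))) * cf_denom \<alpha> (Suc (Suc m))"
    using cf_coeff_pos[OF irr, of "Suc (Suc m)"] cf_denom_pos[OF irr, of "Suc m"] by (intro mult_right_mono) auto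
  then have "int (cfQ \<alpha> (Suc m) + cfQ \<alpha> m) \<le> int (cfQ \<alpha> (Suc (Suc m)))"
    by (simp add: of_nat_cfQ[OF irr])
  then show ?thesis by simp
qed

lemma cfQ_pos: "\<alpha> \<notin> \<rat> \<Longrightarrow> 0 < cfQ \<alpha> m"
  using cf_denom_pos[of \<alpha> m] by (simp add: cfQ_def)

lemma cfQ_Suc_less: "\<alpha> \<notin> \<rat> \<Longrightarrow> cfQ \<alpha> m < cfQ \<alpha> (Suc m)"
proof (cases m)
  case 0
  assume irr: "\<alpha> \<notin> \<rat>"
  have "1 * cf_denom \<alpha> (Suc 0) \<le> cf_coeff \<alpha> (Suc (Suc 0)) * cf_denom \<alpha> (Suc 0)"
    using cf_coeff_pos[OF irr, of "Suc 0"] cf_denom_pos[OF irr, of 0] by (intro mult_right_mono) auto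
  then have "int (cfQ \<alpha> 0) < int (cfQ \<alpha> 1)" by (simp add: of_nat_cfQ[OF irr])
  then show ?thesis using 0 by simp
next
  case (Suc k)
  assume "\<alpha> \<notin> \<rat>"
  then show ?thesis using cfQ_rec[of \<alpha> k] cfQ_pos[of \<alpha> k] Suc by simp
qed

lemma cfQ_mono: "\<alpha> \<notin> \<rat> \<Longrightarrow> strict_mono (cfQ \<alpha>)"
  using cfQ_Suc_less by (simp add: strict_mono_Suc_iff)

text \<open>
  The ratio \<open>36 / 25\<close> is a square below the golden ratio, convenient for taking square roots.
\<close>

lemma cfQ_growth: "\<alpha> \<notin> \<rat> \<Longrightarrow> (36 / 25) ^ m \<le> real (cfQ \<alpha> m)"
proof -
  assume irr: "\<alpha> \<notin> \<rat>"
  have "(36 / 25) ^ m \<le> real (cfQ \<alpha> m) \<and> (36 / 25) ^ Suc m \<le> real (cfQ \<alpha> (Suc m))"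
  proof (induction m)
    case 0 show ?case using cfQ_pos[OF irr, of 0] cfQ_Suc_less[OF irr, of 0] by simp
  next
    case (Suc m)
    have "(36 / 25 :: real) ^ Suc (Suc m) \<le> (36 / 25) ^ Suc m + (36 / 25) ^ m" by simp
    also have "\<dots> \<le> real (cfQ \<alpha> (Suc m) + cfQ \<alpha> m)" using Suc by simp
    also have "\<dots> \<le> real (cfQ \<alpha> (Suc (Suc m)))" using cfQ_rec[OF irr, of m] by (simp only: of_nat_le_iff)
    finally show ?case using Suc by simp
  qed
  then show ?thesis by blast
qed

lemma cfQ_approx:
  assumes irr: "\<alpha> \<notin> \<rat>"
  shows "coprime (cf_numer \<alpha> (Suc m)) (int (cfQ \<alpha> m))"
    and "\<bar>real (cfQ \<alpha> m) * \<alpha> - of_int (cf_numer \<alpha> (Suc m))\<bar> * real (cfQ \<alpha> (Suc m)) \<le> 1"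
    and "\<bar>\<alpha> - of_int (cf_numer \<alpha> (Suc m)) / real (cfQ \<alpha> m)\<bar> \<le> 1 / (real (cfQ \<alpha> m))\<^sup>2"
proof -
  show "coprime (cf_numer \<alpha> (Suc m)) (int (cfQ \<alpha> m))"
  proof (rule coprimeI)
    fix c assume c: "c dvd cf_numer \<alpha> (Suc m)" "c dvd int (cfQ \<alpha> m)"
    then have "c dvd cf_numer \<alpha> (Suc m) * cf_denom \<alpha> m - cf_numer \<alpha> m * cf_denom \<alpha> (Suc m)"
      by (intro dvd_diff dvd_mult2[OF c(1)] dvd_mult) (simp add: of_nat_cfQ[OF irr])
    then have "c dvd (- 1) ^ m" by (simp only: cf_det)
    then show "is_unit c" by (auto simp: minus_one_power_iff split: if_splits)
  qed
  show e: "\<bar>real (cfQ \<alpha> m) * \<alpha> - of_int (cf_numer \<alpha> (Suc m))\<bar> * real (cfQ \<alpha> (Suc m)) \<le> 1"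
    using cf_error[OF irr, of "Suc m"] by (simp add: real_cfQ[OF irr])
  let ?q = "real (cfQ \<alpha> m)" and ?p = "real_of_int (cf_numer \<alpha> (Suc m))"
  have q: "0 < ?q" using cfQ_pos[OF irr] by simp
  have "\<bar>?q * \<alpha> - ?p\<bar> * ?q \<le> \<bar>?q * \<alpha> - ?p\<bar> * real (cfQ \<alpha> (Suc m))"
    using cfQ_Suc_less[OF irr, of m] by (intro mult_left_mono) auto
  with e have "\<bar>?q * \<alpha> - ?p\<bar> * ?q \<le> 1" by linarith
  moreover have "\<alpha> - ?p / ?q = (?q * \<alpha> - ?p) / ?q" using q by (simp add: field_simps)
  ultimately show "\<bar>\<alpha> - ?p / ?q\<bar> \<le> 1 / ?q\<^sup>2"
    using q by (simp add: abs_divide power2_eq_square field_simps)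
qed

lemma brjuno_cfQ: "brjuno \<alpha> \<longleftrightarrow> \<alpha> \<notin> \<rat> \<and> summable (\<lambda>m. ln (real (cfQ \<alpha> (Suc m))) / real (cfQ \<alpha> m))"
  unfolding brjuno_def using real_cfQ by auto

text \<open>
  If convergents never approximate better than \<open>1 / q\<^sup>2\<close>, then the next denominator is at most the
  square of the current one, and the exponential growth of the denominators gives convergence.
\<close>

lemma brjuno_if_badly_approximable:
  assumes irr: "\<alpha> \<notin> \<rat>"
    and ev: "\<forall>\<^sub>F q in sequentially. \<forall>p::int. 1 / (real q)\<^sup>2 \<le> \<bar>real q * \<alpha> - of_int p\<bar>"
  shows "brjuno \<alpha>"
  unfolding brjuno_cfQ
proof (intro conjI irr)
  let ?Q = "\<lambda>m. real (cfQ \<alpha> m)"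
  have "filterlim (cfQ \<alpha>) sequentially sequentially" by (rule filterlim_subseq[OF cfQ_mono[OF irr]])
  from eventually_compose_filterlim[OF ev this]
  have "\<forall>\<^sub>F m in sequentially. norm (ln (?Q (Suc m)) / ?Q m) \<le> 4 * (5 / 6) ^ m"
  proof eventually_elim
    case (elim m)
    have q: "1 \<le> ?Q m" "1 \<le> ?Q (Suc m)" using cfQ_pos[OF irr, of m] cfQ_pos[OF irr, of "Suc m"] by linarith+
    define s where "s = sqrt (?Q m)"
    have s: "1 \<le> s" "?Q m = s * s" using q by (auto simp: s_def)
    have "1 / (?Q m)\<^sup>2 * ?Q (Suc m) \<le> 1"
      using cfQ_approx(2)[OF irr, of m] mult_right_mono[OF elim[rule_format, of "cf_numer \<alpha> (Suc m)"], of "?Q (Suc m)"] q by linarith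
    then have "?Q (Suc m) \<le> (?Q m)\<^sup>2" using q by (simp add: field_simps)
    then have "ln (?Q (Suc m)) \<le> ln (s ^ 4)" using q s by (intro ln_mono) (auto simp: power_eq_if algebra_simps)
    also have "\<dots> = 4 * ln s" using s by (simp add: ln_realpow)
    also have "\<dots> \<le> 4 * s" using s ln_bound[of s] by simp
    finally have "ln (?Q (Suc m)) / ?Q m \<le> 4 * s / ?Q m" using q by (intro divide_right_mono) auto
    also have "\<dots> = 4 * (1 / s)" using s by simp
    also have "1 / s \<le> (5 / 6) ^ m"
    proof -
      have "((6 / 5) ^ m)\<^sup>2 = (36 / 25 :: real) ^ m" by (simp add: power2_eq_square flip: power_mult_distrib)
      then have "((6 / 5) ^ m)\<^sup>2 \<le> s\<^sup>2" using cfQ_growth[OF irr, of m] s by (simp add: power2_eq_square)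
      then have "(6 / 5) ^ m \<le> s" by (rule power2_le_imp_le) (use s in simp)
      then have "1 / s \<le> 1 / (6 / 5) ^ m" by (intro frac_le) auto
      then show ?thesis by (simp add: power_divide)
    qed
    finally show ?case using q by simp
  qed
  then show "summable (\<lambda>m. ln (?Q (Suc m)) / ?Q m)"
    by (rule summable_comparison_test_ev) (intro summable_mult summable_geometric, simp)
qed

lemma near_rational:
  fixes p q :: int and \<alpha> :: real
  assumes \<alpha>: "\<alpha> \<in> {0..<1}" and q: "q \<ge> 1" and less: "\<bar>of_int q * \<alpha> - of_int p\<bar> < 1 / (of_int q)\<^sup>2"
  shows "0 \<le> p" "p \<le> q" "\<bar>\<alpha> - of_int p / of_int q\<bar> \<le> 1 / of_int q ^ 3"
proof -
  define x where "x = real_of_int q"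
  have x: "1 \<le> x" using q by (simp add: x_def)
  have "1 / x\<^sup>2 \<le> 1" using x by simp
  then have l1: "\<bar>x * \<alpha> - of_int p\<bar> < 1" using less by (simp add: x_def)
  have "0 \<le> x * \<alpha>" "x * \<alpha> < x * 1" using \<alpha> x by (auto intro: mult_strict_left_mono)
  then have "- 1 < real_of_int p" "real_of_int p < real_of_int q + 1" using l1 by (auto simp: x_def)
  then show "0 \<le> p" "p \<le> q" by linarith+
  have "\<alpha> - of_int p / x = (x * \<alpha> - of_int p) / x" using x by (simp add: field_simps)
  then have "\<bar>\<alpha> - of_int p / x\<bar> = \<bar>x * \<alpha> - of_int p\<bar> / x" using x by (simp add: abs_divide)
  also have "\<dots> \<le> (1 / x\<^sup>2) / x" using less x by (intro divide_right_mono) (auto simp: x_def)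
  also have "\<dots> = 1 / x ^ 3" by (simp add: power2_eq_square power3_eq_cube)
  finally show "\<bar>\<alpha> - of_int p / of_int q\<bar> \<le> 1 / of_int q ^ 3" by (simp add: x_def)
qed

text \<open>
  Borel-Cantelli: the \<open>\<alpha>\<close> within \<open>1 / q ^ 3\<close> of a fraction with denominator \<open>q\<close> have measure of order
  \<open>1 / q\<^sup>2\<close>.
\<close>

lemma AE_brjuno: "AE \<alpha> in lborel. \<alpha> \<in> {0..<1} \<longrightarrow> brjuno \<alpha>"
proof -
  define I where "I q p = {real p / real q - 1 / real q ^ 3..real p / real q + 1 / real q ^ 3}" for q p :: nat
  define A where "A n = (\<Union>p\<in>{..Suc n}. I (Suc n) p)" for n
  have Am: "A n \<in> sets lborel" for n unfolding A_def by (intro sets.finite_UN) (auto simp: I_def)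
  have bound: "emeasure lborel (A n) \<le> ennreal (4 * inverse ((real (Suc n))\<^sup>2))" for n
  proof -
    define x where "x = real (Suc n)"
    have x: "1 \<le> x" by (simp add: x_def)
    have "emeasure lborel (A n) \<le> ennreal (4 * inverse (x\<^sup>2))"
    proof -
      have "emeasure lborel (A n) \<le> (\<Sum>p\<in>{..Suc n}. emeasure lborel (I (Suc n) p))"
        unfolding A_def by (intro emeasure_subadditive_finite) (auto simp: I_def)
      also have "\<dots> = (\<Sum>p\<in>{..Suc n}. ennreal (2 / x ^ 3))" by (simp add: I_def x_def)
      also have "\<dots> = ennreal (\<Sum>p\<in>{..Suc n}. 2 / x ^ 3)" using x by (intro sum_ennreal) simp
      also have "(\<Sum>p\<in>{..Suc n}. 2 / x ^ 3) = (x + 1) * (2 / x ^ 3)" by (simp add: x_def)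
      also have "\<dots> \<le> (2 * x) * (2 / x ^ 3)" using x by (intro mult_right_mono) auto
      also have "\<dots> = 4 * inverse (x\<^sup>2)" using x by (simp add: power2_eq_square power3_eq_cube divide_inverse)
      finally show "emeasure lborel (A n) \<le> ennreal (4 * inverse (x\<^sup>2))" by (simp add: ennreal_leI)
    qed
    then show ?thesis by (simp only: x_def)
  qed
  have fin: "emeasure lborel (A n) < \<infinity>" for n by (rule le_less_trans[OF bound]) simp
  have mA: "measure lborel (A n) \<le> 4 * inverse ((real (Suc n))\<^sup>2)" for n
    unfolding measure_def by (rule enn2real_leI[OF _ bound]) simp
  have "summable (\<lambda>n. inverse ((real n)\<^sup>2))" using inverse_power_summable[of 2, where ?'a=real] by simp
  then have "summable (\<lambda>n. inverse ((real (Suc n))\<^sup>2))" 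
    by (simp only: summable_Suc_iff[of "\<lambda>n. inverse ((real n)\<^sup>2)"])
  then have "summable (\<lambda>n. 4 * inverse ((real (Suc n))\<^sup>2))" by (rule summable_mult)
  then have "summable (\<lambda>n. measure lborel (A n))"
    by (rule summable_comparison_test'[of _ 0]) (simp only: real_norm_def abs_of_nonneg[OF measure_nonneg] mA)
  from borel_cantelli_AE1[OF Am fin this]
  have "AE \<alpha> in lborel. \<forall>\<^sub>F n in sequentially. \<alpha> \<notin> A n" by simp
  moreover have "AE \<alpha> in lborel. \<alpha> \<notin> (\<rat> :: real set)"
    by (rule AE_I'[of \<rat>]) (auto intro: countable_imp_null_set_lborel countable_rat)
  ultimately show ?thesis
  proof eventually_elim
    case (elim \<alpha>)
    show ?case
    proof
      assume \<alpha>: "\<alpha> \<in> {0..<1}"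
      have "\<forall>\<^sub>F n in sequentially. \<forall>p::int. 1 / (real (Suc n))\<^sup>2 \<le> \<bar>real (Suc n) * \<alpha> - of_int p\<bar>"
        using elim(1)
      proof (rule eventually_mono, intro allI)
        fix n p assume nA: "\<alpha> \<notin> A n"
        let ?q = "real (Suc n)"
        show "1 / ?q\<^sup>2 \<le> \<bar>?q * \<alpha> - of_int p\<bar>"
        proof (rule ccontr)
          assume "\<not> ?thesis"
          then have less: "\<bar>?q * \<alpha> - of_int p\<bar> < 1 / ?q\<^sup>2" by simp
          have p: "0 \<le> p" "p \<le> int (Suc n)" and "\<bar>\<alpha> - of_int p / ?q\<bar> \<le> 1 / ?q ^ 3"
            using near_rational[OF \<alpha>, of "int (Suc n)" p] less by auto
          moreover have "real (nat p) = of_int p" using p by simp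
          ultimately have "\<alpha> \<in> I (Suc n) (nat p)" unfolding I_def by (simp only: abs_le_iff atLeastAtMost_iff) linarith
          moreover have "nat p \<in> {..Suc n}" using p by auto
          ultimately show False using nA by (auto simp: A_def)
        qed
      qed
      then have "\<forall>\<^sub>F q in sequentially. \<forall>p::int. 1 / (real q)\<^sup>2 \<le> \<bar>real q * \<alpha> - of_int p\<bar>"
        by (subst (asm) eventually_sequentially_Suc[of "\<lambda>q. \<forall>p::int. 1 / (real q)\<^sup>2 \<le> \<bar>real q * \<alpha> - of_int p\<bar>"])
      then show "brjuno \<alpha>" by (rule brjuno_if_badly_approximable[OF elim(2)])
    qed
  qed
qed

section \<open>Exceptional energies\<close>

lemma c1_periodic_lipschitz:
  fixes v :: "real \<Rightarrow> real"
  assumes c1: "v C1_differentiable_on UNIV" and p: "periodic1 v"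
  shows "\<exists>V. \<forall>x y. \<bar>v x - v y\<bar> \<le> V * \<bar>x - y\<bar>"
proof -
  obtain D where D: "\<And>x. (v has_vector_derivative D x) (at x)" "continuous_on UNIV D"
    using c1 by (auto simp: C1_differentiable_on_def)
  have "D (x + 1) = D x" for x
  proof -
    have "((v \<circ> (\<lambda>x. x + 1)) has_vector_derivative (1 *\<^sub>R D (x + 1))) (at x)"
      by (intro vector_diff_chain_at) (auto intro!: derivative_eq_intros D(1))
    moreover have "v \<circ> (\<lambda>x. x + 1) = v" using p by (auto simp: periodic1_def)
    ultimately show ?thesis using vector_derivative_unique_at[OF D(1)] by auto
  qed
  then obtain V where V: "\<And>x. \<bar>D x\<bar> \<le> V" using periodic1_bounded[OF D(2)] by (auto simp: periodic1_def)
  have d: "DERIV v x :> D x" for x using D(1) by (simp add: has_real_derivative_iff_has_vector_derivative)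
  have less: "\<bar>v x - v y\<bar> \<le> V * \<bar>x - y\<bar>" if yx: "y < x" for x y
  proof -
    obtain z where "v x - v y = (x - y) * D z" using MVT2[OF yx d] by blast
    then show ?thesis using V[of z] yx by (simp add: abs_mult mult_right_mono mult.commute[of V])
  qed
  have "\<bar>v x - v y\<bar> \<le> V * \<bar>x - y\<bar>" for x y
    using less[of x y] less[of y x] by (cases x y rule: linorder_cases) (auto simp: abs_minus_commute)
  then show ?thesis by blast
qed

context family
begin

lemma cpot_cont: "continuous_on A (cpot t)"
  unfolding cpot_def by (intro continuous_intros continuous_on_comp[OF cont])

lemma uniformly_hyperbolic_measurable:
  "{q. uniformly_hyperbolic (fst q) (schroedinger (cpot (snd q)))} \<in> sets borel"
proof -
  have "closed {q. hyp (fst q) (cpot (snd q)) N}" for N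
    unfolding hyp_def
  proof (intro closed_Collect_all closed_Collect_le)
    have c: "continuous_on UNIV (\<lambda>q. orb (fst q) (cpot (snd q)) x w n)" for x w n
    proof -
      have "continuous_on UNIV (\<lambda>q :: real \<times> real. (q, x))" by (intro continuous_intros)
      from continuous_on_comp[OF orb_joint_cont this] show ?thesis by simp
    qed
    show "continuous_on UNIV (\<lambda>q. 4 * (cmod (orb (fst q) (cpot (snd q)) x w N))\<^sup>2)" for x w
      by (intro continuous_intros c)
    show "continuous_on UNIV (\<lambda>q. (cmod (orb (fst q) (cpot (snd q)) x w (2 * N)))\<^sup>2 + (cmod w)\<^sup>2)" for x w
      by (intro continuous_intros c)
  qed
  then have "(\<Union>N. {q. hyp (fst q) (cpot (snd q)) N}) \<in> sets borel" by (intro sets.countable_UN) auto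
  moreover have "(\<Union>N. {q. hyp (fst q) (cpot (snd q)) N}) = {q. uniformly_hyperbolic (fst q) (schroedinger (cpot (snd q)))}"
    by (auto simp: uniformly_hyperbolic_iff(1)[OF cpot_cont cpot_periodic])
  ultimately show ?thesis by simp
qed

lemma Delta_eq:
  "Delta v \<epsilon> lam \<alpha> = {t. 0 < lyap \<alpha> t \<and> \<not> uniformly_hyperbolic \<alpha> (schroedinger (cpot t)) \<and> (1 - \<epsilon>) * ln lam < lyap \<alpha> t}"
  by (simp add: Delta_def nonuniformly_hyperbolic_def lyap_def cpot_def[abs_def] conj_assoc)

lemma Gamma_measurable: "Gamma_set v \<epsilon> lam \<in> sets borel"
proof -
  have "Gamma_set v \<epsilon> lam = {q. 0 < lyap (fst q) (snd q)} \<inter> {q. (1 - \<epsilon>) * ln lam < lyap (fst q) (snd q)}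
     - {q. uniformly_hyperbolic (fst q) (schroedinger (cpot (snd q)))}"
    by (auto simp: Gamma_set_def Delta_eq)
  moreover have "{q. c < lyap (fst q) (snd q)} \<in> sets borel" for c
    using borel_measurable_less[OF borel_measurable_const lyap_measurable, of c] by simp
  ultimately show ?thesis using uniformly_hyperbolic_measurable by auto
qed

lemma Delta_measurable: "Delta v \<epsilon> lam \<alpha> \<in> sets borel"
proof -
  have "Pair \<alpha> \<in> borel_measurable (borel :: real measure)" by simp
  from measurable_sets[OF this Gamma_measurable, of \<epsilon>]
  show ?thesis by (simp add: Gamma_set_def vimage_def)
qed

end

sublocale schr \<subseteq> fam: family v lam
  by unfold_locales (use per contv rng lam2 in auto)

context schr
begin

lemma pot_eq: "pot t = fam.cpot t"
  by (simp add: fun_eq_iff pot_def fam.cpot_def algebra_simps)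

lemma expanding_of_lyap:
  assumes "47 / 48 * ln lam < fam.lyap \<alpha> t" shows "expanding t"
  unfolding expanding_def
proof
  fix n
  have "lam powr (47 / 48 * real n) = exp (47 / 48 * ln lam * real n)" using lam2 by (simp add: powr_def mult_ac)
  then show "\<exists>x w. cmod w = 1 \<and> lam powr (47 / 48 * real n) \<le> cmod (orb \<alpha> (pot t) x w n)"
    using fam.lyap_growth[OF _ assms, of n] lam2 by (simp add: pot_eq)
qed

lemma gap_le:
  assumes t: "t \<in> range v" and gp: "gapped \<alpha> (pot t) (lam * g)" and g: "0 \<le> g"
  shows "lam * g \<le> 2"
proof -
  obtain x where x: "t = v x" using t by blast
  have "(lam * g)\<^sup>2 \<le> 2 + (pot t x)\<^sup>2" using lam2 g by (intro gapped_upper[OF gp]) simp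
  then have "(lam * g)\<^sup>2 \<le> 2\<^sup>2" by (simp add: pot_def x)
  then show ?thesis by (rule power2_le_imp_le) simp
qed

text \<open>
  Every uniformly hyperbolic energy is assigned the least \<open>j\<close> for which \<open>lam * 2 ^ (-j)\<close> is an admissible gap bound, and then
  the index \<open>m\<close> with \<open>Q m ^ 4 \<le> 2 ^ j < Q (m + 1) ^ 4\<close>. Since the potential vanishes at some phase, \<open>lam \<le> 2 * 2 ^ j\<close>,
  which forces \<open>m \<ge> M\<close>. For each \<open>m\<close> there are at most \<open>5 * log 2 (Q (m + 1))\<close> values of \<open>j\<close>.
\<close>

lemma uniformly_hyperbolic_cover:
  assumes lamb: "lam + 3 \<le> lam powr (49 / 48)" and ran: "range v = {0..1}"
    and sm: "summable (\<lambda>m. ln (real (cfQ \<alpha> (Suc m))) / real (cfQ \<alpha> m))"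
    and M: "M \<ge> 1" and lamM: "2 * real (cfQ \<alpha> M) ^ 4 \<le> lam"
    and big: "\<And>q. q \<ge> cfQ \<alpha> M \<Longrightarrow> 24 * (2 * V + 1) * log 2 (real q) \<le> sqrt (real q) \<and> 12 * log 2 (real q) < real q"
  shows "\<exists>C. C \<in> sets lborel \<and> {t \<in> {0..1}. expanding t \<and> (\<exists>G>0. gapped \<alpha> (pot t) G)} \<subseteq> C \<and>
    emeasure lborel C \<le> ennreal ((852 + 1584 * V) * (5 / ln 2) *
      (\<Sum>m. ln (real (cfQ \<alpha> (Suc (m + M)))) / real (cfQ \<alpha> (m + M))))"
proof -
  define Q where "Q = cfQ \<alpha>"
  have Qmono: "strict_mono Q" unfolding Q_def by (rule cfQ_mono[OF irr])
  have Qle: "Q a \<le> Q b" if "a \<le> b" for a b using strict_mono_less_eq[OF Qmono] that by simp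
  have Qid: "m \<le> Q m" for m by (rule seq_suble[OF Qmono])
  have Q0: "0 < Q m" for m unfolding Q_def by (rule cfQ_pos[OF irr])
  define g :: "nat \<Rightarrow> real" where "g j = (1 / 2) ^ j" for j
  have g0: "0 < g j" for j by (simp add: g_def)
  define U where "U j = {t \<in> {0..1}. expanding t \<and> gapped \<alpha> (pot t) (lam * g j) \<and> \<not> gapped \<alpha> (pot t) (lam * (2 * g j))}" for j
  have cover: "\<exists>C. C \<in> sets lborel \<and> U j \<subseteq> C \<and> emeasure lborel C \<le> ennreal ((852 + 1584 * V) / real (Q m))"
    if m: "m \<ge> M" and j: "Q m ^ 4 \<le> 2 ^ j" for m j
  proof (cases "U j = {}")
    case True
    then show ?thesis by (intro exI[of _ "{}"]) simp
  next
    case False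
    then obtain t where t: "t \<in> range v" "gapped \<alpha> (pot t) (lam * g j)" by (auto simp: U_def ran)
    show ?thesis
    proof (rule scale_cover[OF lamb Q0 cfQ_approx(1)[OF irr, of m, folded Q_def] cfQ_approx(3)[OF irr, of m, folded Q_def] _ _ g0])
      show "24 * (2 * V + 1) * log 2 (real (Q m)) \<le> sqrt (real (Q m))" "12 * log 2 (real (Q m)) < real (Q m)"
        using big[of "Q m"] Qle[OF m] by (auto simp: Q_def)
      show "lam * g j \<le> 2" using gap_le[OF t] g0[of j] by simp
      have "real (Q m ^ 4) \<le> real (2 ^ j)" using j by (simp only: of_nat_le_iff)
      then show "g j \<le> 1 / real (Q m) ^ 4" using Q0[of m] by (simp add: g_def power_divide divide_le_eq pos_le_divide_eq mult.commute field_simps)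
    qed (auto simp: U_def)
  qed
  define Cf where "Cf m j = (SOME C. C \<in> sets lborel \<and> U j \<subseteq> C \<and> emeasure lborel C \<le> ennreal ((852 + 1584 * V) / real (Q m)))" for m j
  have Cf: "Cf m j \<in> sets lborel \<and> U j \<subseteq> Cf m j \<and> emeasure lborel (Cf m j) \<le> ennreal ((852 + 1584 * V) / real (Q m))"
    if "m \<ge> M" "Q m ^ 4 \<le> 2 ^ j" for m j
    unfolding Cf_def by (rule someI_ex[OF cover[OF that]])
  \<comment> \<open>The scales that are handled by the denominator \<open>Q m\<close>.\<close>
  define J where "J m = {j :: nat. Q m ^ 4 \<le> 2 ^ j \<and> 2 ^ j < Q (Suc m) ^ 4}" for m
  have J: "finite (J m) \<and> real (card (J m)) \<le> 5 * log 2 (real (Q (Suc m)))" for m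
  proof -
    define y where "y = 4 * log 2 (real (Q (Suc m)))"
    have "Q m < Q (Suc m)" using strict_mono_less[OF Qmono] by simp
    then have Q2: "2 \<le> Q (Suc m)" using Q0[of m] by linarith
    then have l1: "1 \<le> log 2 (real (Q (Suc m)))" by (simp add: le_log_iff)
    have sub: "J m \<subseteq> {..<nat \<lceil>y\<rceil>}"
    proof
      fix j assume "j \<in> J m"
      then have "real (2 ^ j) < real (Q (Suc m) ^ 4)" by (simp only: of_nat_less_iff J_def mem_Collect_eq)
      then have "log 2 (2 ^ j) < log 2 (real (Q (Suc m)) ^ 4)" using Q0[of "Suc m"] by (subst log_less_cancel_iff) auto
      then have "real j < y" using Q0[of "Suc m"] by (simp add: log_nat_power y_def)
      then show "j \<in> {..<nat \<lceil>y\<rceil>}" by (simp, linarith)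
    qed
    then have "card (J m) \<le> nat \<lceil>y\<rceil>" using card_mono[OF _ sub] by simp
    then have "real (card (J m)) \<le> y + 1" using l1 unfolding y_def by linarith
    then show ?thesis using sub l1 by (auto simp: y_def intro: finite_subset)
  qed
  define W where "W m = (\<Union>j\<in>J m. Cf m j)" for m
  define b where "b m = ln (real (Q (Suc m))) / real (Q m)" for m
  have b0: "0 \<le> b m" for m using Q0[of "Suc m"] by (auto simp: b_def intro!: divide_nonneg_nonneg)
  have sb: "summable (\<lambda>m. b (m + M))" using sm by (subst summable_iff_shift) (simp add: b_def[abs_def] Q_def)
  define K where "K = (852 + 1584 * V) * (5 / ln 2)"
  have K0: "0 \<le> K" using V0 by (simp add: K_def)
  have Wm: "W m \<in> sets lborel" if "m \<ge> M" for m
    unfolding W_def using J[of m] Cf[OF that] by (intro sets.finite_UN) (auto simp: J_def)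
  have Wb: "emeasure lborel (W m) \<le> ennreal (K * b m)" if "m \<ge> M" for m
  proof -
    have c0: "0 \<le> (852 + 1584 * V) / real (Q m)" using V0 by simp
    have "emeasure lborel (W m) \<le> (\<Sum>j\<in>J m. emeasure lborel (Cf m j))"
      unfolding W_def using J[of m] Cf[OF that] by (intro emeasure_subadditive_finite) (auto simp: J_def)
    also have "\<dots> \<le> (\<Sum>j\<in>J m. ennreal ((852 + 1584 * V) / real (Q m)))"
      using Cf[OF that] by (intro sum_mono) (auto simp: J_def)
    also have "\<dots> = ennreal (\<Sum>j\<in>J m. (852 + 1584 * V) / real (Q m))" using c0 by (intro sum_ennreal) simp
    also have "\<dots> \<le> ennreal (K * b m)"
    proof (rule ennreal_leI)
      have "(\<Sum>j\<in>J m. (852 + 1584 * V) / real (Q m)) = real (card (J m)) * ((852 + 1584 * V) / real (Q m))" by simp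
      also have "\<dots> \<le> 5 * log 2 (real (Q (Suc m))) * ((852 + 1584 * V) / real (Q m))"
        using J[of m] c0 by (intro mult_right_mono) auto
      also have "\<dots> = K * b m" by (simp add: K_def b_def log_def)
      finally show "(\<Sum>j\<in>J m. (852 + 1584 * V) / real (Q m)) \<le> K * b m" .
    qed
    finally show ?thesis .
  qed
  show ?thesis
  proof (intro exI[of _ "\<Union>m. W (m + M)"] conjI)
    show "(\<Union>m. W (m + M)) \<in> sets lborel" using Wm by (intro sets.countable_UN) auto
    have "emeasure lborel (\<Union>m. W (m + M)) \<le> (\<Sum>m. emeasure lborel (W (m + M)))"
      using Wm by (intro emeasure_subadditive_countably) auto
    also have "\<dots> \<le> (\<Sum>m. ennreal (K * b (m + M)))" by (intro suminf_le Wb) auto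
    also have "\<dots> = ennreal (\<Sum>m. K * b (m + M))" using K0 b0 sb by (intro suminf_ennreal2 summable_mult) auto
    also have "(\<Sum>m. K * b (m + M)) = K * (\<Sum>m. b (m + M))" by (rule suminf_mult[OF sb])
    finally show "emeasure lborel (\<Union>m. W (m + M)) \<le> ennreal ((852 + 1584 * V) * (5 / ln 2) *
      (\<Sum>m. ln (real (cfQ \<alpha> (Suc (m + M)))) / real (cfQ \<alpha> (m + M))))"
      by (simp add: K_def b_def Q_def)
    show "{t \<in> {0..1}. expanding t \<and> (\<exists>G>0. gapped \<alpha> (pot t) G)} \<subseteq> (\<Union>m. W (m + M))"
    proof
      fix t assume "t \<in> {t \<in> {0..1}. expanding t \<and> (\<exists>G>0. gapped \<alpha> (pot t) G)}"
      then obtain G where t: "t \<in> {0..1}" "expanding t" and G: "G > 0" "gapped \<alpha> (pot t) G" by blast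
      have lam0: "lam > 0" using lam2 by simp
      obtain j0 where "(1 / 2 :: real) ^ j0 < G / lam" using real_arch_pow_inv[of "G / lam" "1 / 2"] G lam0 by auto
      then have "lam * g j0 \<le> G" using lam0 by (simp add: g_def less_divide_eq mult.commute)
      then have ex: "gapped \<alpha> (pot t) (lam * g j0)" by (rule gapped_mono[OF G(2)])
      define j where "j = (LEAST j. gapped \<alpha> (pot t) (lam * g j))"
      have gj: "gapped \<alpha> (pot t) (lam * g j)" unfolding j_def by (rule LeastI[where P="\<lambda>j. gapped \<alpha> (pot t) (lam * g j)", OF ex])
      have "lam * g j \<le> 2" by (rule gap_le[OF _ gj]) (use t ran g0[of j] in auto)
      then have "lam \<le> 2 * 2 ^ j" by (simp add: g_def power_divide divide_le_eq)
      then have "real (Q M ^ 4) \<le> real (2 ^ j)" using lamM by (simp add: Q_def)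
      then have jM: "Q M ^ 4 \<le> 2 ^ j" by (simp only: of_nat_le_iff)
      have "Q 0 < Q M" using M strict_mono_less[OF Qmono] by simp
      then have "2 \<le> Q M" using Q0[of 0] by linarith
      then have "2 ^ 4 \<le> Q M ^ 4" by (rule power_mono) simp
      then have j1: "j \<noteq> 0" using jM by (cases j) auto
      then have "g (j - 1) = 2 * g j" by (cases j) (auto simp: g_def)
      moreover have "\<not> gapped \<alpha> (pot t) (lam * g (j - 1))"
        using not_less_Least[of "j - 1" "\<lambda>j. gapped \<alpha> (pot t) (lam * g j)"] j1 by (simp add: j_def)
      ultimately have tU: "t \<in> U j" using t gj by (simp add: U_def)
      have ex2: "\<exists>m. M \<le> m \<and> 2 ^ j < Q (Suc m) ^ 4"
      proof (intro exI conjI)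
        show "M \<le> max M (2 ^ j)" by simp
        have "2 ^ j < Suc (max M (2 ^ j))" by simp
        also have "\<dots> \<le> Q (Suc (max M (2 ^ j)))" by (rule Qid)
        also have "\<dots> \<le> Q (Suc (max M (2 ^ j))) ^ 4" by (rule self_le_power) (use Q0[of "Suc (max M (2 ^ j))"] in auto)
        finally show "2 ^ j < Q (Suc (max M (2 ^ j))) ^ 4" .
      qed
      define m where "m = (LEAST m. M \<le> m \<and> 2 ^ j < Q (Suc m) ^ 4)"
      have m: "M \<le> m" "2 ^ j < Q (Suc m) ^ 4" using LeastI_ex[OF ex2] by (auto simp: m_def)
      have "Q m ^ 4 \<le> 2 ^ j"
      proof (cases "m = M")
        case False
        then have "M \<le> m - 1" "Suc (m - 1) = m" using m(1) by auto
        then show ?thesis using not_less_Least[of "m - 1" "\<lambda>m. M \<le> m \<and> 2 ^ j < Q (Suc m) ^ 4"] False m(1)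
          by (auto simp: m_def[symmetric] not_less)
      qed (use jM in simp)
      then have "j \<in> J m" "t \<in> Cf m j" using m tU Cf[OF m(1), of j] by (auto simp: J_def)
      then have "t \<in> W ((m - M) + M)" using m(1) by (auto simp: W_def)
      then show "t \<in> (\<Union>m. W (m + M))" by blast
    qed
  qed
qed

end

text \<open>
  First \<open>M\<close> is chosen so large that the tail of the Brjuno series is small, then \<open>lam\<close> so large that the tail
  from \<open>M\<close> on is the relevant one.
\<close>

lemma bad_energies_vanish:
  fixes v :: "real \<Rightarrow> real"
  assumes per: "periodic1 v" and lip: "\<And>x y. \<bar>v x - v y\<bar> \<le> V * \<bar>x - y\<bar>" and ran: "range v = {0..1}"
    and e: "\<epsilon> > 0" and br: "brjuno \<alpha>"
  shows "((\<lambda>lam. measure lborel ({0..1} - Delta v \<epsilon> lam \<alpha>)) \<longlongrightarrow> 0) at_top"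
proof (rule tendstoI)
  fix d :: real assume d: "d > 0"
  have irr: "\<alpha> \<notin> \<rat>" and sm: "summable (\<lambda>m. ln (real (cfQ \<alpha> (Suc m))) / real (cfQ \<alpha> m))"
    using br by (auto simp: brjuno_cfQ)
  have rng: "0 \<le> v x \<and> v x \<le> 1" for x using ran by auto
  have V0: "0 \<le> V" using lip[of 1 0] by simp
  define K where "K = (852 + 1584 * V) * (5 / ln 2)"
  define tail where "tail M = (\<Sum>m. ln (real (cfQ \<alpha> (Suc (m + M)))) / real (cfQ \<alpha> (m + M)))" for M
  have K0: "0 \<le> K" using V0 by (simp add: K_def)
  \<comment> \<open>The expanding blocks need an exponent above \<open>47 / 48 * ln lam\<close>, whatever the given \<open>\<epsilon>\<close> is.\<close>
  define \<delta> where "\<delta> = min \<epsilon> (1 / 48)"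
  have \<delta>: "0 < \<delta>" "\<delta> \<le> \<epsilon>" "\<delta> \<le> 1 / 48" using e by (auto simp: \<delta>_def)
  have "(\<lambda>M. K * tail M) \<longlonglongrightarrow> K * 0"
    unfolding tail_def by (intro tendsto_intros suminf_exist_split2[OF sm, simplified])
  then have evT: "\<forall>\<^sub>F M in sequentially. K * tail M < d / 2" using d by (intro order_tendstoD(2)) auto
  define c where "c = 24 * (2 * V + 1)"
  have "c > 0" using V0 by (simp add: c_def)
  then have "\<forall>\<^sub>F x::real in at_top. c * log 2 x \<le> sqrt x" "\<forall>\<^sub>F x::real in at_top. 12 * log 2 x < x" by real_asymp+
  then have "\<forall>\<^sub>F x::real in at_top. c * log 2 x \<le> sqrt x \<and> 12 * log 2 x < x" by (rule eventually_conj)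
  then obtain X where X: "\<And>x::real. X \<le> x \<Longrightarrow> c * log 2 x \<le> sqrt x \<and> 12 * log 2 x < x"
    unfolding eventually_at_top_linorder by blast
  obtain M0 where M0: "\<And>M. M \<ge> M0 \<Longrightarrow> K * tail M < d / 2" using evT unfolding eventually_sequentially by blast
  define M where "M = max (max 1 M0) (nat \<lceil>X\<rceil>)"
  have M: "1 \<le> M" "K * tail M < d / 2" "X \<le> real M"
    using M0[of M] by (auto simp: M_def) (linarith | meson le_max_iff_disj)+
  have "M \<le> cfQ \<alpha> M" by (rule seq_suble[OF cfQ_mono[OF irr]])
  then have big: "24 * (2 * V + 1) * log 2 (real q) \<le> sqrt (real q) \<and> 12 * log 2 (real q) < real q"
    if "q \<ge> cfQ \<alpha> M" for q
    using X[of "real q"] M(3) that unfolding c_def by (meson le_trans of_nat_mono order_trans)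
  have "((\<lambda>lam::real. 3 / (\<delta> * ln lam)) \<longlongrightarrow> 0) at_top" using \<delta>(1) by real_asymp
  then have ev1: "\<forall>\<^sub>F lam in at_top. 3 / (\<delta> * ln lam) < d / 2" using d by (intro order_tendstoD(2)) auto
  have ev2: "\<forall>\<^sub>F lam::real in at_top. lam + 3 \<le> lam powr (49 / 48)" by real_asymp
  show "\<forall>\<^sub>F lam in at_top. dist (measure lborel ({0..1} - Delta v \<epsilon> lam \<alpha>)) 0 < d"
    using ev1 ev2 eventually_ge_at_top[of 2] eventually_ge_at_top[of "2 * real (cfQ \<alpha> M) ^ 4"]
  proof eventually_elim
    case (elim lam)
    interpret schr \<alpha> v V lam by unfold_locales (use irr per lip rng elim in auto)
    obtain C where C: "C \<in> sets lborel" "{t \<in> {0..1}. expanding t \<and> (\<exists>G>0. gapped \<alpha> (pot t) G)} \<subseteq> C"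
      "emeasure lborel C \<le> ennreal (K * tail M)"
      using uniformly_hyperbolic_cover[OF elim(2) ran sm M(1) elim(4) big] unfolding K_def tail_def by blast
    have Cf: "C \<in> fmeasurable lborel"
      using C(1) le_less_trans[OF C(3) ennreal_less_top] by (intro fmeasurableI) auto
    have tail0: "0 \<le> K * tail M"
      unfolding tail_def using K0 sm cfQ_pos[OF irr]
      by (intro mult_nonneg_nonneg suminf_nonneg) (auto simp: summable_iff_shift[of "\<lambda>m. ln (real (cfQ \<alpha> (Suc m))) / real (cfQ \<alpha> m)"] Suc_leI)
    have mC: "measure lborel C \<le> K * tail M" unfolding measure_def by (rule enn2real_leI[OF tail0 C(3)])
    define D where "D = {t \<in> {0..1}. fam.lyap \<alpha> t \<le> (1 - \<delta>) * ln lam}"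
    have mD: "measure lborel D \<le> 3 / (\<delta> * ln lam)" unfolding D_def by (rule fam.lyap_exceptional_small[OF \<delta>(1)])
    have Dm: "D \<in> sets lborel"
    proof -
      have "{t. fam.lyap \<alpha> t \<le> (1 - \<delta>) * ln lam} \<in> sets borel"
        using borel_measurable_le[OF fam.lyap_measurable_t borel_measurable_const, of \<alpha> "(1 - \<delta>) * ln lam"] by simp
      moreover have "D = {0..1} \<inter> {t. fam.lyap \<alpha> t \<le> (1 - \<delta>) * ln lam}" by (auto simp: D_def)
      ultimately show ?thesis by simp
    qed
    have "emeasure lborel D \<le> emeasure lborel {0..1::real}" by (intro emeasure_mono) (auto simp: D_def)
    also have "\<dots> < \<infinity>" by simp
    finally have Df: "D \<in> fmeasurable lborel" using Dm by (intro fmeasurableI) auto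
    have lnl: "0 < ln lam" using elim by simp
    have sub: "{0..1} - Delta v \<epsilon> lam \<alpha> \<subseteq> D \<union> C"
    proof
      fix t assume t: "t \<in> {0..1} - Delta v \<epsilon> lam \<alpha>"
      show "t \<in> D \<union> C"
      proof (cases "t \<in> D")
        case False
        then have L: "(1 - \<delta>) * ln lam < fam.lyap \<alpha> t" using t by (auto simp: D_def)
        have "(1 - \<epsilon>) * ln lam \<le> (1 - \<delta>) * ln lam" "47 / 48 * ln lam \<le> (1 - \<delta>) * ln lam"
          using \<delta> lnl by (auto intro!: mult_right_mono)
        then have L1: "(1 - \<epsilon>) * ln lam < fam.lyap \<alpha> t" "47 / 48 * ln lam < fam.lyap \<alpha> t" using L by linarith+
        then have "0 < fam.lyap \<alpha> t" using lnl by linarith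
        then have "uniformly_hyperbolic \<alpha> (schroedinger (pot t))"
          using t L1 by (auto simp: fam.Delta_eq pot_eq)
        then have "\<exists>G>0. gapped \<alpha> (pot t) G" by (simp add: uniformly_hyperbolic_iff(2)[OF pot_cont pot_periodic])
        then show ?thesis using C(2) t expanding_of_lyap[OF L1(2)] by auto
      qed simp
    qed
    have "measure lborel ({0..1} - Delta v \<epsilon> lam \<alpha>) \<le> measure lborel (D \<union> C)"
      using fam.Delta_measurable[of \<epsilon> \<alpha>] Cf Df by (intro measure_mono_fmeasurable[OF sub] fmeasurable.Un) auto
    also have "\<dots> \<le> measure lborel D + measure lborel C" using Dm C(1) by (intro measure_Un_le)
    also have "\<dots> < d" using mD mC elim(1) M(2) by linarith
    finally show ?case by simp
  qed
qed

section \<open>Passage to the limit\<close>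

lemma measure_slice:
  assumes m: "B \<in> sets (borel :: real measure)"
  shows "measure lborel ({0..1} \<inter> B) = 1 - measure lborel ({0..1} - B)"
proof -
  have "measure lborel ({0..1} - ({0..1} - B)) = measure lborel {0..1::real} - measure lborel ({0..1} - B)"
    using m by (intro measure_Diff) (auto simp: emeasure_lborel_Icc_eq)
  moreover have "{0..1} - ({0..1} - B) = {0..1} \<inter> B" by auto
  ultimately show ?thesis by simp
qed

theorem mainTheorem6:
  fixes v :: "real \<Rightarrow> real" and \<epsilon> :: real
  assumes "periodic1 v"
    and "v C1_differentiable_on UNIV"
    and "range v = {0..1}"
    and "finite {x \<in> {0..<1}. deriv v x = 0}"
    and "\<exists>F. finite F \<and> (\<forall>t \<in> {0..1} - F. inj_on (deriv v) {x \<in> {0..<1}. v x = t})"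
    and "\<epsilon> > 0"
  shows "(\<forall>\<alpha>. brjuno \<alpha> \<longrightarrow>
            ((\<lambda>lam. measure lebesgue ({0..1} \<inter> Delta v \<epsilon> lam \<alpha>)) \<longlongrightarrow> 1) at_top)
       \<and> ((\<lambda>lam. measure lebesgue (({0..<1} \<times> {0..1}) \<inter> Gamma_set v \<epsilon> lam)) \<longlongrightarrow> 1) at_top"
proof -
  obtain V where lip: "\<And>x y. \<bar>v x - v y\<bar> \<le> V * \<bar>x - y\<bar>"
    using c1_periodic_lipschitz[OF assms(2,1)] by blast
  have rng: "0 \<le> v x \<and> v x \<le> 1" for x using assms(3) by auto
  have cont: "continuous_on UNIV v" using C1_differentiable_imp_continuous_on[OF assms(2)] .
  have fam: "family v lam" if "lam \<ge> 2" for lam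
    by unfold_locales (use assms(1) cont rng that in auto)
  have D: "Delta v \<epsilon> lam \<alpha> \<in> sets borel" if "lam \<ge> 2" for lam \<alpha>
    by (rule family.Delta_measurable[OF fam[OF that]])
  have lim: "((\<lambda>lam. measure lborel ({0..1} \<inter> Delta v \<epsilon> lam \<alpha>)) \<longlongrightarrow> 1) at_top" if "brjuno \<alpha>" for \<alpha>
  proof -
    have "((\<lambda>lam. 1 - measure lborel ({0..1} - Delta v \<epsilon> lam \<alpha>)) \<longlongrightarrow> 1 - 0) at_top"
      by (intro tendsto_intros bad_energies_vanish[OF assms(1) lip assms(3,6) that])
    then have "((\<lambda>lam. 1 - measure lborel ({0..1} - Delta v \<epsilon> lam \<alpha>)) \<longlongrightarrow> 1) at_top" by simp
    moreover have "\<forall>\<^sub>F lam in at_top. 1 - measure lborel ({0..1} - Delta v \<epsilon> lam \<alpha>) = measure lborel ({0..1} \<inter> Delta v \<epsilon> lam \<alpha>)"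
      using eventually_ge_at_top[of 2] by eventually_elim (simp only: measure_slice D)
    ultimately show ?thesis by (rule Lim_transform_eventually)
  qed
  have 1: "((\<lambda>lam. measure lebesgue ({0..1} \<inter> Delta v \<epsilon> lam \<alpha>)) \<longlongrightarrow> 1) at_top" if "brjuno \<alpha>" for \<alpha>
  proof (rule Lim_transform_eventually[OF lim[OF that]])
    show "\<forall>\<^sub>F lam in at_top. measure lborel ({0..1} \<inter> Delta v \<epsilon> lam \<alpha>) = measure lebesgue ({0..1} \<inter> Delta v \<epsilon> lam \<alpha>)"
      using eventually_ge_at_top[of 2]
    proof eventually_elim
      case (elim lam)
      then have "{0..1} \<inter> Delta v \<epsilon> lam \<alpha> \<in> sets lborel" using D by simp
      then show ?case by (rule measure_completion[symmetric])
    qed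
  qed
  define E where "E lam = ({0..<1} \<times> {0..1}) \<inter> Gamma_set v \<epsilon> lam" for lam
  \<comment> \<open>The case distinction makes the functions measurable for all \<open>lam\<close>, as dominated convergence requires.\<close>
  define h where "h lam \<alpha> = (if lam \<ge> 2 then indicator {0..<1} \<alpha> * measure lborel ({0..1} \<inter> Delta v \<epsilon> lam \<alpha>) else 0)"
    for lam \<alpha> :: real
  have Em: "E lam \<in> sets borel" if "lam \<ge> 2" for lam
    unfolding E_def using family.Gamma_measurable[OF fam[OF that]]
    by (intro sets.Int) (auto simp: borel_prod[symmetric])
  have slice: "emeasure lborel (Pair \<alpha> -` E lam) = ennreal (h lam \<alpha>)" if "lam \<ge> 2" for lam \<alpha>
  proof (cases "\<alpha> \<in> {0..<1}")
    case True
    then have "Pair \<alpha> -` E lam = {0..1} \<inter> Delta v \<epsilon> lam \<alpha>" by (auto simp: E_def Gamma_set_def)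
    moreover have "emeasure lborel ({0..1} \<inter> Delta v \<epsilon> lam \<alpha>) < \<infinity>"
      using emeasure_mono[of "{0..1} \<inter> Delta v \<epsilon> lam \<alpha>" "{0..1}" lborel] by (auto intro: le_less_trans)
    ultimately show ?thesis using True that by (simp add: h_def emeasure_eq_ennreal_measure less_top)
  next
    case False
    then have "Pair \<alpha> -` E lam = {}" by (auto simp: E_def)
    then show ?thesis using False by (simp add: h_def)
  qed
  have hm: "h lam \<in> borel_measurable lborel" for lam
  proof (cases "lam \<ge> 2")
    case True
    have "E lam \<in> sets (lborel \<Otimes>\<^sub>M lborel)" unfolding lborel_prod sets_lborel by (rule Em[OF True])
    from lborel.measurable_emeasure_Pair[OF this]
    have "(\<lambda>\<alpha>. enn2real (ennreal (h lam \<alpha>))) \<in> borel_measurable lborel" using slice[OF True] by simp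
    moreover have "0 \<le> h lam \<alpha>" for \<alpha> by (simp add: h_def)
    ultimately show ?thesis by simp
  qed (simp add: h_def[abs_def])
  have mE: "measure lebesgue (E lam) = (\<integral>\<alpha>. h lam \<alpha> \<partial>lborel)" if "lam \<ge> 2" for lam
  proof -
    have "E lam \<in> sets (lborel \<Otimes>\<^sub>M lborel)" unfolding lborel_prod sets_lborel by (rule Em[OF that])
    from lborel.emeasure_pair_measure_alt[OF this]
    have "emeasure lborel (E lam) = (\<integral>\<^sup>+\<alpha>. ennreal (h lam \<alpha>) \<partial>lborel)" by (simp add: lborel_prod slice[OF that])
    moreover have "(\<integral>\<alpha>. h lam \<alpha> \<partial>lborel) = enn2real (\<integral>\<^sup>+\<alpha>. ennreal (h lam \<alpha>) \<partial>lborel)"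
      by (intro integral_eq_nn_integral hm AE_I2) (simp add: h_def)
    ultimately show ?thesis using Em[OF that] by (simp add: measure_def)
  qed
  have ae: "AE \<alpha> in lborel. ((\<lambda>lam. h lam \<alpha>) \<longlongrightarrow> indicator {0..<1} \<alpha>) at_top"
    using AE_brjuno
  proof eventually_elim
    case (elim \<alpha>)
    show ?case
    proof (cases "\<alpha> \<in> {0..<1}")
      case True
      have "((\<lambda>lam. measure lborel ({0..1} \<inter> Delta v \<epsilon> lam \<alpha>)) \<longlongrightarrow> indicator {0..<1} \<alpha>) at_top"
        using lim elim True by simp
      moreover have "\<forall>\<^sub>F lam in at_top. measure lborel ({0..1} \<inter> Delta v \<epsilon> lam \<alpha>) = h lam \<alpha>"
        using eventually_ge_at_top[of 2] by eventually_elim (use True in \<open>simp add: h_def\<close>)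
      ultimately show ?thesis by (rule Lim_transform_eventually)
    next
      case False
      then have "h lam \<alpha> = 0" for lam by (simp add: h_def)
      then show ?thesis using False by simp
    qed
  qed
  have bd: "\<forall>\<^sub>F lam in at_top. AE \<alpha> in lborel. norm (h lam \<alpha>) \<le> indicator {0..<1} \<alpha>"
  proof (intro always_eventually allI AE_I2)
    fix lam \<alpha> :: real
    have "measure lborel ({0..1} \<inter> Delta v \<epsilon> lam \<alpha>) \<le> 1" if "lam \<ge> 2"
      using measure_slice[OF D[OF that]] by simp
    then show "norm (h lam \<alpha>) \<le> indicator {0..<1} \<alpha>" by (auto simp: h_def indicator_def)
  qed
  have im: "(indicator {0..<1} :: real \<Rightarrow> real) \<in> borel_measurable lborel" "integrable lborel (indicator {0..<1} :: real \<Rightarrow> real)"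
    by auto
  have "((\<lambda>lam. \<integral>\<alpha>. h lam \<alpha> \<partial>lborel) \<longlongrightarrow> 1) at_top"
    using integral_dominated_convergence_at_top[OF im(1) hm im(2) ae bd] by simp
  moreover have "\<forall>\<^sub>F lam in at_top. (\<integral>\<alpha>. h lam \<alpha> \<partial>lborel) = measure lebesgue (E lam)"
    using eventually_ge_at_top[of 2] by eventually_elim (simp only: mE)
  ultimately have 2: "((\<lambda>lam. measure lebesgue (E lam)) \<longlongrightarrow> 1) at_top" by (rule Lim_transform_eventually)
  show ?thesis using 1 2 unfolding E_def by blast
qed

end
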